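(* Let $A$, $B$, $C$ be separable commutative unital $C^*$-algebras, and let $\phi_A:C\to A$ and $\phi_B:C\to B$ be injective unital $*$-homomorphisms (so that $A,B\supseteq C$). Then the amalgamated free product $A\star_C B$ is residually finite-dimensional.
   Context: For unital $*$-homomorphisms $\phi_A:C\to A$, $\phi_B:C\to B$ of unital $C^*$-algebras, the amalgamated free product $A\star_C B$ is the unital $C^*$-algebra equipped with unital $*$-homomorphisms $\varphi_A:A\to A\star_C B$, $\varphi_B:B\to A\star_C B$ with $\varphi_A\circ\phi_A=\varphi_B\circ\phi_B$, which is universal: for every $C^*$-algebra $D$ and $*$-homomorphisms $\tilde\varphi_A:A\to D$, $\tilde\varphi_B:B\to D$ with $\tilde\varphi_A\circ\phi_A=\tilde\varphi_B\circ\phi_B$ there is a unique $*$-homomorphism $\Phi:A\star_C B\to D$ with $\Phi\circ\varphi_A=\tilde\varphi_A$, $\Phi\circ\varphi_B=\tilde\varphi_B$. A $C^*$-algebra $\mathcal A$ is residually finite-dimensional (RFD) if it is separable and for every $a\in\mathcal A$ one has $\|a\|=\sup\|\pi(a)\|$, the supremum over all finite-dimensional $*$-representations $\pi$ of $\mathcal A$ (equivalently, $\mathcal A$ embeds into a direct product of matrix algebras). *)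

theory Defs
  imports Complex_Main "HOL-Library.Countable_Set" "Jordan_Normal_Form.Schur_Decomposition"
begin

record 'a cstar_alg =
  ca_carrier :: "'a set"
  ca_zero :: 'a
  ca_one :: 'a
  ca_add :: "'a \<Rightarrow> 'a \<Rightarrow> 'a"
  ca_mult :: "'a \<Rightarrow> 'a \<Rightarrow> 'a"
  ca_smult :: "complex \<Rightarrow> 'a \<Rightarrow> 'a"
  ca_star :: "'a \<Rightarrow> 'a"
  ca_norm :: "'a \<Rightarrow> real"

definition ca_diff :: "'a cstar_alg \<Rightarrow> 'a \<Rightarrow> 'a \<Rightarrow> 'a" where
  "ca_diff A x y = ca_add A x (ca_smult A (-1) y)"

definition cstar_alg :: "'a cstar_alg \<Rightarrow> bool" where
  "cstar_alg A \<longleftrightarrow>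
    (let S = ca_carrier A; z = ca_zero A; add = ca_add A; mult = ca_mult A;
         sm = ca_smult A; st = ca_star A; nrm = ca_norm A in
     \<comment> \<open>closure\<close>
     z \<in> S \<and>
     (\<forall>x\<in>S. \<forall>y\<in>S. add x y \<in> S \<and> mult x y \<in> S) \<and>
     (\<forall>c. \<forall>x\<in>S. sm c x \<in> S) \<and>
     (\<forall>x\<in>S. st x \<in> S) \<and>
     \<comment> \<open>complex vector space\<close>
     (\<forall>x\<in>S. \<forall>y\<in>S. \<forall>w\<in>S. add (add x y) w = add x (add y w)) \<and>
     (\<forall>x\<in>S. \<forall>y\<in>S. add x y = add y x) \<and>
     (\<forall>x\<in>S. add z x = x) \<and>
     (\<forall>x\<in>S. \<exists>y\<in>S. add x y = z) \<and>
     (\<forall>c. \<forall>x\<in>S. \<forall>y\<in>S. sm c (add x y) = add (sm c x) (sm c y)) \<and>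
     (\<forall>c d. \<forall>x\<in>S. sm (c + d) x = add (sm c x) (sm d x)) \<and>
     (\<forall>c d. \<forall>x\<in>S. sm (c * d) x = sm c (sm d x)) \<and>
     (\<forall>x\<in>S. sm 1 x = x) \<and>
     \<comment> \<open>associative algebra\<close>
     (\<forall>x\<in>S. \<forall>y\<in>S. \<forall>w\<in>S. mult (mult x y) w = mult x (mult y w)) \<and>
     (\<forall>x\<in>S. \<forall>y\<in>S. \<forall>w\<in>S. mult x (add y w) = add (mult x y) (mult x w)) \<and>
     (\<forall>x\<in>S. \<forall>y\<in>S. \<forall>w\<in>S. mult (add x y) w = add (mult x w) (mult y w)) \<and>
     (\<forall>c. \<forall>x\<in>S. \<forall>y\<in>S. sm c (mult x y) = mult (sm c x) y \<and> sm c (mult x y) = mult x (sm c y)) \<and>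
     \<comment> \<open>involution\<close>
     (\<forall>x\<in>S. st (st x) = x) \<and>
     (\<forall>x\<in>S. \<forall>y\<in>S. st (add x y) = add (st x) (st y)) \<and>
     (\<forall>c. \<forall>x\<in>S. st (sm c x) = sm (cnj c) (st x)) \<and>
     (\<forall>x\<in>S. \<forall>y\<in>S. st (mult x y) = mult (st y) (st x)) \<and>
     \<comment> \<open>submultiplicative norm\<close>
     (\<forall>x\<in>S. nrm x = 0 \<longleftrightarrow> x = z) \<and>
     (\<forall>x\<in>S. \<forall>y\<in>S. nrm (add x y) \<le> nrm x + nrm y) \<and>
     (\<forall>c. \<forall>x\<in>S. nrm (sm c x) = cmod c * nrm x) \<and>
     (\<forall>x\<in>S. \<forall>y\<in>S. nrm (mult x y) \<le> nrm x * nrm y) \<and>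
     \<comment> \<open>completeness\<close>
     (\<forall>f::nat \<Rightarrow> 'a. (\<forall>n. f n \<in> S) \<longrightarrow>
        (\<forall>e>0. \<exists>N. \<forall>m\<ge>N. \<forall>n\<ge>N. nrm (ca_diff A (f m) (f n)) < e) \<longrightarrow>
        (\<exists>x\<in>S. \<forall>e>0. \<exists>N. \<forall>n\<ge>N. nrm (ca_diff A (f n) x) < e)) \<and>
     \<comment> \<open>C*-identity\<close>
     (\<forall>x\<in>S. nrm (mult (st x) x) = (nrm x)\<^sup>2))"

definition unital_cstar_alg :: "'a cstar_alg \<Rightarrow> bool" where
  "unital_cstar_alg A \<longleftrightarrow> cstar_alg A \<and> ca_one A \<in> ca_carrier A \<and>
     (\<forall>x\<in>ca_carrier A. ca_mult A (ca_one A) x = x \<and> ca_mult A x (ca_one A) = x)"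

definition ca_commutative :: "'a cstar_alg \<Rightarrow> bool" where
  "ca_commutative A \<longleftrightarrow> (\<forall>x\<in>ca_carrier A. \<forall>y\<in>ca_carrier A. ca_mult A x y = ca_mult A y x)"

definition ca_separable :: "'a cstar_alg \<Rightarrow> bool" where
  "ca_separable A \<longleftrightarrow> (\<exists>D. D \<subseteq> ca_carrier A \<and> countable D \<and>
     (\<forall>x\<in>ca_carrier A. \<forall>e>0. \<exists>d\<in>D. ca_norm A (ca_diff A x d) < e))"

definition star_hom :: "'a cstar_alg \<Rightarrow> 'b cstar_alg \<Rightarrow> ('a \<Rightarrow> 'b) \<Rightarrow> bool" where
  "star_hom A B f \<longleftrightarrow>
     (\<forall>x\<in>ca_carrier A. f x \<in> ca_carrier B) \<and>
     (\<forall>x\<in>ca_carrier A. \<forall>y\<in>ca_carrier A. f (ca_add A x y) = ca_add B (f x) (f y)) \<and>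
     (\<forall>c. \<forall>x\<in>ca_carrier A. f (ca_smult A c x) = ca_smult B c (f x)) \<and>
     (\<forall>x\<in>ca_carrier A. \<forall>y\<in>ca_carrier A. f (ca_mult A x y) = ca_mult B (f x) (f y)) \<and>
     (\<forall>x\<in>ca_carrier A. f (ca_star A x) = ca_star B (f x))"

definition unital_star_hom :: "'a cstar_alg \<Rightarrow> 'b cstar_alg \<Rightarrow> ('a \<Rightarrow> 'b) \<Rightarrow> bool" where
  "unital_star_hom A B f \<longleftrightarrow> star_hom A B f \<and> f (ca_one A) = ca_one B"

definition is_amalg_free_product ::
  "'a cstar_alg \<Rightarrow> 'b cstar_alg \<Rightarrow> 'c cstar_alg \<Rightarrow> ('c \<Rightarrow> 'a) \<Rightarrow> ('c \<Rightarrow> 'b) \<Rightarrow>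
   'p cstar_alg \<Rightarrow> ('a \<Rightarrow> 'p) \<Rightarrow> ('b \<Rightarrow> 'p) \<Rightarrow> bool" where
  "is_amalg_free_product A B C phiA phiB P psiA psiB \<longleftrightarrow>
     unital_cstar_alg P \<and> unital_star_hom A P psiA \<and> unital_star_hom B P psiB \<and>
     (\<forall>c\<in>ca_carrier C. psiA (phiA c) = psiB (phiB c)) \<and>
     (\<forall>(D::'p cstar_alg) fA fB. cstar_alg D \<longrightarrow> star_hom A D fA \<longrightarrow> star_hom B D fB \<longrightarrow>
        (\<forall>c\<in>ca_carrier C. fA (phiA c) = fB (phiB c)) \<longrightarrow>
        (\<exists>\<Phi>. star_hom P D \<Phi> \<and>
              (\<forall>a\<in>ca_carrier A. \<Phi> (psiA a) = fA a) \<and>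
              (\<forall>b\<in>ca_carrier B. \<Phi> (psiB b) = fB b) \<and>
              (\<forall>\<Psi>. star_hom P D \<Psi> \<and>
                    (\<forall>a\<in>ca_carrier A. \<Psi> (psiA a) = fA a) \<and>
                    (\<forall>b\<in>ca_carrier B. \<Psi> (psiB b) = fB b) \<longrightarrow>
                    (\<forall>x\<in>ca_carrier P. \<Psi> x = \<Phi> x))))"

definition vec_norm2 :: "complex vec \<Rightarrow> real" where
  "vec_norm2 v = sqrt (\<Sum>i<dim_vec v. (cmod (v $ i))\<^sup>2)"

definition mat_opnorm :: "complex mat \<Rightarrow> real" where
  "mat_opnorm M = Sup {vec_norm2 (M *\<^sub>v v) | v. v \<in> carrier_vec (dim_col M) \<and> vec_norm2 v \<le> 1}"

definition fd_rep :: "'a cstar_alg \<Rightarrow> nat \<Rightarrow> ('a \<Rightarrow> complex mat) \<Rightarrow> bool" where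
  "fd_rep A n \<pi> \<longleftrightarrow>
     (\<forall>x\<in>ca_carrier A. \<pi> x \<in> carrier_mat n n) \<and>
     (\<forall>x\<in>ca_carrier A. \<forall>y\<in>ca_carrier A. \<pi> (ca_add A x y) = \<pi> x + \<pi> y) \<and>
     (\<forall>c. \<forall>x\<in>ca_carrier A. \<pi> (ca_smult A c x) = c \<cdot>\<^sub>m \<pi> x) \<and>
     (\<forall>x\<in>ca_carrier A. \<forall>y\<in>ca_carrier A. \<pi> (ca_mult A x y) = \<pi> x * \<pi> y) \<and>
     (\<forall>x\<in>ca_carrier A. \<pi> (ca_star A x) = mat_adjoint (\<pi> x))"

definition RFD :: "'a cstar_alg \<Rightarrow> bool" where
  "RFD A \<longleftrightarrow> ca_separable A \<and>
     (\<forall>a\<in>ca_carrier A. ca_norm A a = Sup {mat_opnorm (\<pi> a) | \<pi> n. fd_rep A n \<pi>})"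

end

(* Since A and B are commutative and generate P, the image of C is central in P.  For x in P there
   is a state f of P with f(x*x) close to |x|^2 and f(cy) = f(c) f(y) for central c; it comes from a
   maximal proper cone of self-adjoint elements that is stable under positive central factors.
   In particular f restricts to a character of C.  For finitely many v_k in P the compressions
   a |-> f(v_k* a v_l) to A are approximated by finite combinations of characters of A that extend
   this character of C; such a combination is given by a diagonal representation of A and vectors
   xi_k.  The same holds for B, with C acting by the same scalars, and the two families of vectors
   can be given the same Gram matrix, so that a unitary identifies them.  The universal property
   turns the resulting pair of representations into a finite-dimensional representation of P which
   is close to the GNS representation of f on the v_k. *)
theory Submission
  imports Defs "HOL-Analysis.L2_Norm"
begin

section \<open>Positive elements of a \<open>C\<^sup>*\<close>-algebra\<close>

text \<open>The obstacle is that the representations of A and B must agree on C exactly, while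
  finitely many characters can only approximate a compression. Multiplicativity of \<open>f\<close>
  on the centre resolves this: every character used takes the value of \<open>f\<close> at c for c
  in C, so C acts by equal scalars on both sides, and conjugating one side by a unitary cannot
  disturb the agreement. That unitary requires literally equal Gram matrices. Hence only the
  coefficients of elements of A and B are approximated and inner products stay exact: a compression
  is cut by squares that sum to 1, and on each piece a single character replaces the algebra. The
  pieces come from products of binomial weights, as in Bernstein's proof of the Weierstrass theorem;
  they act as a fine partition of the joint spectrum, and their small variance makes each element
  almost constant on a piece. The universal property speaks only of algebras on the type
  \<open>'p\<close> of P. Matrix algebras are therefore copied into \<open>'p\<close>, and the fact
  that P is generated by the two images is read off from uniqueness, applied to closed subalgebras
  of P.\<close>

class cstar = real_normed_algebra + banach + monoid_mult +
  fixes scaleC :: "complex \<Rightarrow> 'a \<Rightarrow> 'a" (infixr "*\<^sub>C" 75)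
    and star :: "'a \<Rightarrow> 'a"
  assumes scaleC_add_right: "c *\<^sub>C (x + y) = c *\<^sub>C x + c *\<^sub>C y"
    and scaleC_add_left: "(c + d) *\<^sub>C x = c *\<^sub>C x + d *\<^sub>C x"
    and scaleC_scaleC: "c *\<^sub>C d *\<^sub>C x = (c * d) *\<^sub>C x"
    and scaleR_scaleC: "r *\<^sub>R x = complex_of_real r *\<^sub>C x"
    and mult_scaleC_left: "(c *\<^sub>C x) * y = c *\<^sub>C (x * y)"
    and mult_scaleC_right: "x * (c *\<^sub>C y) = c *\<^sub>C (x * y)"
    and star_star [simp]: "star (star x) = x"
    and star_add: "star (x + y) = star x + star y"
    and star_scaleC: "star (c *\<^sub>C x) = cnj c *\<^sub>C star x"
    and star_mult: "star (x * y) = star y * star x"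
    and norm_star_mult_self: "norm (star x * x) = (norm x)\<^sup>2"

section \<open>Elementary rules for scalars, involution and norm\<close>

lemma scaleC_zero_left [simp]: "0 *\<^sub>C x = (0::'a::cstar)"
  using scaleC_add_left[of 0 0 x] by simp

lemma scaleC_one [simp]: "1 *\<^sub>C x = (x::'a::cstar)"
  using scaleR_scaleC[of 1 x] by simp

lemma scaleC_minus_left: "(- c) *\<^sub>C x = - (c *\<^sub>C (x::'a::cstar))"
  using scaleC_add_left[of c "- c" x] by (simp add: eq_neg_iff_add_eq_0 add.commute)

lemma scaleC_zero_right [simp]: "c *\<^sub>C 0 = (0::'a::cstar)"
  using scaleC_add_right[of c "0::'a" 0] by simp

lemma scaleC_minus_right: "c *\<^sub>C (- x) = - (c *\<^sub>C (x::'a::cstar))"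
  using scaleC_add_right[of c x "- x"] by (simp add: eq_neg_iff_add_eq_0 add.commute)

lemma scaleC_diff_right: "c *\<^sub>C (x - y) = c *\<^sub>C x - c *\<^sub>C (y::'a::cstar)"
  using scaleC_add_right[of c x "- y"] by (simp add: scaleC_minus_right)

lemma star_zero [simp]: "star 0 = (0::'a::cstar)"
  using star_scaleC[of 0 "0::'a"] by simp

lemma star_minus: "star (- x) = - star (x::'a::cstar)"
  using star_add[of x "- x"] by (simp add: eq_neg_iff_add_eq_0 add.commute)

lemma star_diff: "star (x - y) = star x - star (y::'a::cstar)"
  using star_add[of x "- y"] by (simp add: star_minus)

lemma star_scaleR: "star (r *\<^sub>R x) = r *\<^sub>R star (x::'a::cstar)"
  by (simp add: scaleR_scaleC star_scaleC)

lemma star_one [simp]: "star 1 = (1::'a::cstar)"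
  by (metis mult.left_neutral mult.right_neutral star_mult star_star)

lemma norm_star [simp]: "norm (star x) = norm (x::'a::cstar)"
proof -
  have le: "norm y \<le> norm (star y)" for y :: 'a
  proof (cases "norm y = 0")
    case False
    have "norm y * norm y \<le> norm (star y) * norm y"
      using norm_star_mult_self[of y] norm_mult_ineq[of "star y" y] by (simp add: power2_eq_square)
    with False show ?thesis by simp
  qed auto
  from le[of x] le[of "star x"] show ?thesis by simp
qed

text \<open>The C*-identity makes the norm of 1 idempotent, hence 0 or 1. The value 0 belongs to the
  zero algebra, which the class admits: its unit comes from \<open>monoid_mult\<close>, not from a
  class that fixes the norm of 1.\<close>

lemma norm_one_le: "norm (1::'a::cstar) \<le> 1"
proof (rule ccontr)
  assume "\<not> norm (1::'a) \<le> 1"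
  moreover have "norm (1::'a) = norm (1::'a) * norm (1::'a)"
    using norm_star_mult_self[of "1::'a"] by (simp add: power2_eq_square)
  ultimately show False by simp
qed

lemma tendsto_star:
  fixes f :: "nat \<Rightarrow> 'a::cstar"
  assumes "f \<longlonglongrightarrow> l" shows "(\<lambda>n. star (f n)) \<longlonglongrightarrow> star l"
proof -
  have "(\<lambda>n. norm (f n - l)) \<longlonglongrightarrow> 0" using assms by (simp add: LIM_zero tendsto_norm_zero)
  then have "(\<lambda>n. norm (star (f n) - star l)) \<longlonglongrightarrow> 0"
    by (simp flip: star_diff)
  then show ?thesis by (simp add: LIM_zero_iff tendsto_norm_zero_iff)
qed

text \<open>Increments of \<open>y\<close> telescope below those of a bounded increasing real
  sequence \<open>t\<close>. Both the square root iteration and the geometric series for inverses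
  are compared with their scalar versions in this way.\<close>

lemma convergent_of_dominated_increments:
  fixes y :: "nat \<Rightarrow> 'a::banach"
  assumes inc: "\<And>n. norm (y (Suc n) - y n) \<le> t (Suc n) - t n" and bd: "\<And>n. t n \<le> B"
  shows "convergent y"
proof -
  have mono: "incseq t" using inc by (intro incseq_SucI) (smt (verit) norm_ge_zero)
  then have "convergent t"
    using bd by (metis convergentI incseq_convergent)
  then have ct: "Cauchy t" by (rule convergent_Cauchy)
  have d: "norm (y (n + k) - y n) \<le> t (n + k) - t n" for n k
  proof (induction k)
    case (Suc k)
    have "norm (y (n + Suc k) - y n) \<le> norm (y (Suc (n + k)) - y (n + k)) + norm (y (n + k) - y n)"
      using norm_triangle_ineq[of "y (Suc (n + k)) - y (n + k)" "y (n + k) - y n"] by simp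
    then show ?case using Suc inc[of "n + k"] by simp
  qed simp
  have "Cauchy y"
  proof (rule CauchyI')
    fix e :: real assume "0 < e"
    then obtain M where M: "\<And>m n. m \<ge> M \<Longrightarrow> n \<ge> M \<Longrightarrow> norm (t m - t n) < e"
      using CauchyD[OF ct] by blast
    show "\<exists>M. \<forall>m\<ge>M. \<forall>n>m. dist (y m) (y n) < e"
    proof (intro exI allI impI)
      fix m n assume "m \<ge> M" "n > m"
      then obtain k where "n = m + k" using less_imp_add_positive by blast
      then have "norm (y m - y n) \<le> t n - t m" using d[of m k] by (simp add: norm_minus_commute)
      also have "\<dots> < e" using M[of n m] \<open>m \<ge> M\<close> \<open>n > m\<close> by auto
      finally show "dist (y m) (y n) < e" by (simp add: dist_norm)
    qed
  qed
  then show ?thesis by (simp add: Cauchy_convergent_iff)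
qed

definition sa :: "'a::cstar \<Rightarrow> bool" where "sa x \<longleftrightarrow> star x = x"

lemma sa_add: "sa x \<Longrightarrow> sa y \<Longrightarrow> sa (x + y)" by (simp add: sa_def star_add)
lemma sa_diff: "sa x \<Longrightarrow> sa y \<Longrightarrow> sa (x - y)" by (simp add: sa_def star_diff)
lemma sa_minus: "sa x \<Longrightarrow> sa (- x)" by (simp add: sa_def star_minus)
lemma sa_scaleR: "sa x \<Longrightarrow> sa (r *\<^sub>R x)" by (simp add: sa_def star_scaleR)
lemma sa_one [simp]: "sa 1" by (simp add: sa_def)
lemma sa_zero [simp]: "sa 0" by (simp add: sa_def)
lemma sa_mult: "sa x \<Longrightarrow> sa y \<Longrightarrow> x * y = y * x \<Longrightarrow> sa (x * y)" by (simp add: sa_def star_mult)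
lemma sa_star_mult: "sa (star x * x)" by (simp add: sa_def star_mult)
lemmas sa_intros = sa_add sa_diff sa_minus sa_scaleR sa_one sa_zero sa_star_mult

lemma norm_sa_square: "sa k \<Longrightarrow> norm (k * k) = (norm k)\<^sup>2"
  using norm_star_mult_self[of k] by (simp add: sa_def)

lemma tendsto_commute:
  fixes y :: "nat \<Rightarrow> 'a::cstar"
  assumes "y \<longlonglongrightarrow> l" "\<And>n. z * y n = y n * z" shows "z * l = l * z"
proof -
  have "(\<lambda>n. z * y n) \<longlonglongrightarrow> z * l" "(\<lambda>n. y n * z) \<longlonglongrightarrow> l * z"
    using assms(1) by (auto intro: tendsto_mult_left tendsto_mult_right)
  then show ?thesis using assms(2) LIMSEQ_unique by auto
qed

text \<open>The limit \<open>l\<close> of the iteration \<open>y \<mapsto> (d + y\<^sup>2)/2\<close>, which is dominated by the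
  corresponding real iteration with \<open>d = 1\<close>, satisfies \<open>(1 - l)\<^sup>2 = 1 - d\<close>.\<close>
lemma sqrt_near_one:
  fixes h :: "'a::cstar"
  assumes h: "sa h" and nh: "norm (1 - h) \<le> 1"
  obtains k where "sa k" "k * k = h" "norm (1 - k) \<le> 1" "\<And>z. z * h = h * z \<Longrightarrow> z * k = k * z"
proof -
  define d where "d = 1 - h"
  define y where "y = rec_nat 0 (\<lambda>_ y. (1/2) *\<^sub>R (d + y * y))"
  define t where "t = rec_nat (0::real) (\<lambda>_ t. (1 + t * t) / 2)"
  have y0: "y 0 = 0" and yS: "\<And>n. y (Suc n) = (1/2) *\<^sub>R (d + y n * y n)" by (simp_all add: y_def)
  have t0: "t 0 = 0" and tS: "\<And>n. t (Suc n) = (1 + t n * t n) / 2" by (simp_all add: t_def)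
  have nd: "norm d \<le> 1" using nh by (simp add: d_def)
  have tb: "0 \<le> t n \<and> t n \<le> 1" for n
    by (induction n) (auto simp: t0 tS mult_le_one)
  have yt: "norm (y n) \<le> t n" for n
  proof (induction n)
    case (Suc n)
    have "norm (d + y n * y n) \<le> 1 + t n * t n"
      by (rule order_trans[OF norm_triangle_ineq add_mono[OF nd]])
         (rule order_trans[OF norm_mult_ineq mult_mono], use Suc tb in auto)
    then show ?case by (simp add: yS tS)
  qed (simp add: y0 t0)
  \<comment> \<open>The difference of squares is split as a (a - b) + (a - b) b, valid for
    noncommuting a and b, and each factor is bounded by its real counterpart.\<close>
  have inc: "norm (y (Suc n) - y n) \<le> t (Suc n) - t n" for n
  proof (induction n)
    case 0 show ?case using nd by (simp add: y0 t0 yS tS)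
  next
    case (Suc n)
    let ?a = "y (Suc n)" and ?b = "y n"
    have "norm (?a * ?a - ?b * ?b) = norm (?a * (?a - ?b) + (?a - ?b) * ?b)" by (simp add: algebra_simps)
    also have "\<dots> \<le> norm ?a * norm (?a - ?b) + norm (?a - ?b) * norm ?b"
      by (rule order_trans[OF norm_triangle_ineq add_mono[OF norm_mult_ineq norm_mult_ineq]])
    also have "\<dots> \<le> t (Suc n) * (t (Suc n) - t n) + (t (Suc n) - t n) * t n"
      using order_trans[OF norm_ge_zero Suc]
      using Suc yt[of n] yt[of "Suc n"] tb[of n] tb[of "Suc n"]
      by (intro add_mono mult_mono) (auto intro: order_trans[OF norm_ge_zero])
    finally have *: "norm (?a * ?a - ?b * ?b) \<le> t (Suc n) * t (Suc n) - t n * t n"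
      by (simp add: algebra_simps)
    have "y (Suc (Suc n)) - y (Suc n) = (1/2) *\<^sub>R (?a * ?a - ?b * ?b)"
      by (subst (1 2) yS) (simp add: algebra_simps)
    moreover have "t (Suc (Suc n)) - t (Suc n) = (t (Suc n) * t (Suc n) - t n * t n) / 2"
      by (subst (1 2) tS) (simp add: field_simps)
    ultimately show ?case using * by simp
  qed
  from convergent_of_dominated_increments[of y t 1, OF inc] tb obtain l where l: "y \<longlonglongrightarrow> l"
    by (auto simp: convergent_def)
  have "(\<lambda>n. y (Suc n)) \<longlonglongrightarrow> (1/2) *\<^sub>R (d + l * l)"
    unfolding yS by (intro tendsto_intros l)
  then have eq: "l = (1/2) *\<^sub>R (d + l * l)"
    using LIMSEQ_unique LIMSEQ_Suc[OF l] by blast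
  have "l + l = 2 *\<^sub>R l" by (simp add: scaleR_2)
  also have "\<dots> = d + l * l" by (subst eq) simp
  finally have eq2: "l + l = d + l * l" .
  have ysa: "star (y n) = y n" for n
    by (induction n) (use h in \<open>auto simp: y0 yS star_scaleR star_add star_mult d_def star_diff sa_def\<close>)
  have "star l = l"
    using LIMSEQ_unique[OF tendsto_star[OF l]] l by (simp add: ysa)
  then have sal: "sa (1 - l)" by (simp add: sa_def star_diff)
  have sq: "(1 - l) * (1 - l) = h"
    using eq2 by (simp add: algebra_simps d_def)
  have "norm l \<le> 1"
    using LIMSEQ_le_const2[OF tendsto_norm[OF l]] yt tb by (meson order_trans)
  then have nl: "norm (1 - (1 - l)) \<le> 1" by simp
  \<comment> \<open>The root is a limit of polynomials in \<open>h\<close>, so it commutes with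
    whatever commutes with \<open>h\<close>. This clause does the work of functional calculus in all
    later uses of roots.\<close>
  have comm: "z * (1 - l) = (1 - l) * z" if z: "z * h = h * z" for z
  proof -
    have zd: "z * d = d * z" using z by (simp add: d_def algebra_simps)
    have "z * y n = y n * z" for n
    proof (induction n)
      case (Suc n)
      have "z * (y n * y n) = (y n * y n) * z" by (metis Suc mult.assoc)
      then show ?case by (simp add: yS zd algebra_simps)
    qed (simp add: y0)
    from tendsto_commute[OF l this] show ?thesis by (simp add: algebra_simps)
  qed
  show ?thesis by (rule that[OF sal sq nl comm])
qed

text \<open>Positivity is encoded algebraically, by a self-adjoint root. That sums are positive
  (\<open>pos_add\<close>) and that every \<open>star y * y\<close> is positive
  (\<open>pos_star_mult\<close>) then become theorems.\<close>

definition pos :: "'a::cstar \<Rightarrow> bool" where "pos h \<longleftrightarrow> (\<exists>k. sa k \<and> h = k * k)"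

lemma pos_sa: "pos h \<Longrightarrow> sa h" by (auto simp: pos_def intro: sa_mult)

text \<open>\<open>sqrt_near_one\<close> applied to \<open>h\<close> divided by \<open>c\<close>.
  The bound on the root is recorded because, by \<open>posI_norm\<close>, it certifies that the root
  is positive itself.\<close>

lemma sqrt_scaled:
  fixes h :: "'a::cstar"
  assumes h: "sa h" and c: "c \<ge> 0" and nh: "norm (c *\<^sub>R 1 - h) \<le> c"
  obtains k where "sa k" "k * k = h" "\<And>z. z * h = h * z \<Longrightarrow> z * k = k * z" "norm (sqrt c *\<^sub>R 1 - k) \<le> sqrt c"
proof (cases "c = 0")
  case True
  with nh have "h = 0" by simp
  with True show ?thesis by (intro that[of 0]) auto
next
  case False
  with c have c: "c > 0" by simp
  have "1 - (1/c) *\<^sub>R h = (1/c) *\<^sub>R (c *\<^sub>R 1 - h)" using c by (simp add: algebra_simps)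
  then have "norm (1 - (1/c) *\<^sub>R h) = (1/c) * norm (c *\<^sub>R 1 - h)" using c by (metis abs_of_pos norm_scaleR zero_less_divide_1_iff)
  also have "\<dots> \<le> (1/c) * c" using nh c by (intro mult_left_mono) auto
  finally have "norm (1 - (1/c) *\<^sub>R h) \<le> 1" using c by simp
  from sqrt_near_one[OF sa_scaleR[OF h] this] obtain k where
    k: "sa k" "k * k = (1/c) *\<^sub>R h" "norm (1 - k) \<le> 1" and kz: "\<And>z. z * (1/c) *\<^sub>R h = (1/c) *\<^sub>R h * z \<Longrightarrow> z * k = k * z"
    by blast
  have "norm (sqrt c *\<^sub>R 1 - sqrt c *\<^sub>R k) \<le> sqrt c"
    using k(3) c by (simp flip: scaleR_diff_right)
  moreover have "sqrt c *\<^sub>R k * sqrt c *\<^sub>R k = h" using k(2) c by simp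
  moreover have "z * sqrt c *\<^sub>R k = sqrt c *\<^sub>R k * z" if "z * h = h * z" for z
    using kz[of z] that by simp
  ultimately show ?thesis
    by (intro that[OF sa_scaleR[OF k(1), of "sqrt c"]])
qed

lemma posI_norm: "sa h \<Longrightarrow> c \<ge> 0 \<Longrightarrow> norm (c *\<^sub>R 1 - h) \<le> c \<Longrightarrow> pos h"
  by (rule sqrt_scaled) (auto simp: pos_def)

lemma scaleC_ii_ii: "\<i> *\<^sub>C \<i> *\<^sub>C x = - (x::'a::cstar)"
  by (simp add: scaleC_scaleC scaleC_minus_left)

text \<open>The element \<open>u = k + il\<close> is a multiple of a unitary and \<open>k = (u + u\<^sup>*)/2\<close>.\<close>
lemma norm_le_of_commuting_squares:
  fixes k l :: "'a::cstar"
  assumes k: "sa k" and l: "sa l" and kl: "k * l = l * k" and s: "k * k + l * l = s *\<^sub>R 1" and s0: "s \<ge> 0"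
  shows "(norm k)\<^sup>2 \<le> s"
proof -
  define u where "u = k + \<i> *\<^sub>C l"
  have st: "star u = k - \<i> *\<^sub>C l"
    using k l by (simp add: u_def star_add star_scaleC sa_def scaleC_minus_left)
  have "star u * u = s *\<^sub>R 1"
    unfolding st unfolding u_def s[symmetric]
    by (simp add: algebra_simps mult_scaleC_left mult_scaleC_right scaleC_add_right scaleC_diff_right scaleC_ii_ii kl)
  then have "(norm u)\<^sup>2 = norm (s *\<^sub>R (1::'a))" by (metis norm_star_mult_self)
  also have "\<dots> \<le> s" using s0 norm_one_le[where 'a='a] by (simp add: mult_left_le)
  finally have nu: "(norm u)\<^sup>2 \<le> s" .
  have "k = (1/2) *\<^sub>R (u + star u)" unfolding st unfolding u_def by (simp flip: scaleR_2)
  then have "norm k = (1/2) * norm (u + star u)" by (metis abs_of_nonneg norm_scaleR zero_le_divide_1_iff zero_le_numeral)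
  then have "norm k \<le> (norm u + norm (star u)) / 2" using norm_triangle_ineq[of u "star u"] by simp
  then have "norm k \<le> norm u" by simp
  then show ?thesis using nu by (meson norm_ge_zero order_trans power_mono)
qed

text \<open>Converse of \<open>posI_norm\<close>. With h = k k and \<open>l\<close> a root of c - h,
  the roots \<open>k\<close> and \<open>l\<close> commute and their squares add up to c;
  \<open>norm_le_of_commuting_squares\<close> bounds the square of the norm of \<open>l\<close>,
  which is the norm of c - h.\<close>

lemma pos_norm_diff:
  fixes h :: "'a::cstar"
  assumes "pos h" "norm h \<le> c" shows "norm (c *\<^sub>R 1 - h) \<le> c"
proof -
  obtain k where k: "sa k" "h = k * k" using assms by (auto simp: pos_def)
  have c: "c \<ge> 0" using assms(2) norm_ge_zero order_trans by metis
  have sah: "sa h" using assms pos_sa by blast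
  have "norm (c *\<^sub>R 1 - (c *\<^sub>R 1 - h)) \<le> c" using assms by simp
  with sqrt_scaled[of "c *\<^sub>R 1 - h" c] sah c obtain l where
    l: "sa l" "l * l = c *\<^sub>R 1 - h" "\<And>z. z * (c *\<^sub>R 1 - h) = (c *\<^sub>R 1 - h) * z \<Longrightarrow> z * l = l * z"
    by (metis sa_diff sa_one sa_scaleR)
  have "k * l = l * k" by (rule l(3)) (simp add: k algebra_simps)
  then have "(norm l)\<^sup>2 \<le> c"
    using norm_le_of_commuting_squares[of l k c] k l(1,2) c by simp
  then show ?thesis using norm_sa_square[OF l(1)] l(2) by simp
qed

lemma pos_sqrt:
  fixes h :: "'a::cstar"
  assumes "pos h"
  obtains k where "sa k" "pos k" "k * k = h" "\<And>z. z * h = h * z \<Longrightarrow> z * k = k * z"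
proof -
  obtain k where k: "sa k" "k * k = h" "\<And>z. z * h = h * z \<Longrightarrow> z * k = k * z"
      "norm (sqrt (norm h) *\<^sub>R 1 - k) \<le> sqrt (norm h)"
    using sqrt_scaled[OF pos_sa[OF assms] norm_ge_zero pos_norm_diff[OF assms order_refl]] by metis
  have "pos k" by (rule posI_norm[OF k(1) _ k(4)]) simp
  from that[OF k(1) this k(2,3)] show ?thesis .
qed

text \<open>By \<open>posI_norm\<close> and \<open>pos_norm_diff\<close>, positivity of
  \<open>h\<close> amounts to h lying in a ball of radius c around c for a suitable c. Such a
  description is stable under sums by the triangle inequality.\<close>

lemma pos_add:
  fixes h :: "'a::cstar"
  assumes "pos h" "pos k" shows "pos (h + k)"
proof (rule posI_norm)
  show "sa (h + k)" using assms pos_sa sa_add by blast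
  have "norm ((norm h + norm k) *\<^sub>R 1 - (h + k)) = norm ((norm h *\<^sub>R 1 - h) + (norm k *\<^sub>R 1 - k))"
    by (simp add: algebra_simps)
  also have "\<dots> \<le> norm h + norm k"
    by (rule order_trans[OF norm_triangle_ineq]) (simp add: add_mono assms pos_norm_diff)
  finally show "norm ((norm h + norm k) *\<^sub>R 1 - (h + k)) \<le> norm h + norm k" .
qed simp

lemma pos_square: "sa k \<Longrightarrow> pos (k * k)" by (auto simp: pos_def)

lemma pos_scaleR: "r \<ge> 0 \<Longrightarrow> pos h \<Longrightarrow> pos (r *\<^sub>R h)"
proof -
  assume r: "r \<ge> 0" and "pos h"
  then obtain k where k: "sa k" "h = k * k" by (auto simp: pos_def)
  then have "r *\<^sub>R h = (sqrt r *\<^sub>R k) * (sqrt r *\<^sub>R k)" using r by simp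
  then show ?thesis using k(1) pos_square[OF sa_scaleR] by metis
qed

lemma pos_one [simp]: "pos 1" using pos_square[of 1] by simp
lemma pos_zero [simp]: "pos 0" using pos_square[of 0] by simp

lemma pos_norm_minus:
  fixes y :: "'a::cstar"
  assumes "sa y" "norm y \<le> c" shows "pos (c *\<^sub>R 1 - y)"
proof -
  have "c \<ge> 0" using assms(2) norm_ge_zero order_trans by metis
  then show ?thesis using assms by (intro posI_norm[of _ c]) (auto intro!: sa_intros)
qed

text \<open>The roots of x and of s - x commute, and their squares sum to s, so the bound for
  commuting squares applies again.\<close>

lemma norm_le_of_pos:
  fixes x :: "'a::cstar"
  assumes "pos x" "pos (s *\<^sub>R 1 - x)" "s \<ge> 0" shows "norm x \<le> s"
proof -
  obtain k where k: "sa k" "x = k * k" using assms by (auto simp: pos_def)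
  obtain l where l: "sa l" "l * l = s *\<^sub>R 1 - x" "\<And>z. z * (s *\<^sub>R 1 - x) = (s *\<^sub>R 1 - x) * z \<Longrightarrow> z * l = l * z"
    using pos_sqrt[OF assms(2)] by blast
  have "k * l = l * k" by (rule l(3)) (simp add: k algebra_simps)
  then have "(norm k)\<^sup>2 \<le> s"
    using norm_le_of_commuting_squares[of k l s] k l(1,2) assms by simp
  then show ?thesis using norm_sa_square[OF k(1)] k by simp
qed

lemma norm_mono_pos:
  fixes x :: "'a::cstar"
  assumes "pos x" "pos (y - x)" shows "norm x \<le> norm y"
proof (rule norm_le_of_pos[OF assms(1)])
  have "sa y" using sa_add[OF pos_sa[OF assms(2)] pos_sa[OF assms(1)]] by simp
  from pos_add[OF pos_norm_minus[OF this order_refl] assms(2)]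
  show "pos (norm y *\<^sub>R 1 - x)" by simp
qed simp

definition re_part :: "'a::cstar \<Rightarrow> 'a" where "re_part y = (1/2) *\<^sub>R (y + star y)"
definition im_part :: "'a::cstar \<Rightarrow> 'a" where "im_part y = (1/2) *\<^sub>R (\<i> *\<^sub>C (star y - y))"

lemma sa_re_part: "sa (re_part y)" by (simp add: re_part_def sa_def star_scaleR star_add add.commute)

lemma sa_im_part: "sa (im_part y)"
  by (simp add: im_part_def sa_def star_scaleR star_scaleC star_diff scaleC_minus_left scaleC_diff_right)

lemma re_im_decomp: "y = re_part y + \<i> *\<^sub>C im_part y"
proof -
  have *: "\<i> *\<^sub>C (r *\<^sub>R z) = r *\<^sub>R (\<i> *\<^sub>C z)" for r and z :: 'a
    by (simp add: scaleR_scaleC scaleC_scaleC mult.commute)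
  have "y = (1/2) *\<^sub>R (y + y)" by simp
  then show ?thesis
    by (simp add: re_part_def im_part_def * scaleC_ii_ii algebra_simps)
qed

lemma re_im_star: "star y = re_part y - \<i> *\<^sub>C im_part y"
  by (subst re_im_decomp[of y])
     (use sa_re_part[of y] sa_im_part[of y] in \<open>simp add: star_add star_scaleC sa_def scaleC_minus_left\<close>)

text \<open>With \<open>M = \<parallel>w\<parallel>\<^sup>2\<close>, \<open>a = - w\<^sup>* w\<close> and \<open>\<gamma>\<^sup>2 = M - w w\<^sup>*\<close> the element \<open>\<gamma> w\<close>
  satisfies \<open>(\<gamma> w)\<^sup>* (\<gamma> w) = - (M a + a\<^sup>2)\<close>, whence \<open>2 M\<^sup>2 \<le> \<parallel>\<gamma> w\<parallel>\<^sup>2 \<le> M\<^sup>2\<close>.\<close>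
lemma zero_of_neg_star_mult:
  fixes w :: "'a::cstar"
  assumes a: "pos (- (star w * w))" shows "w = 0"
proof -
  define a where "a = - (star w * w)"
  define M where "M = (norm w)\<^sup>2"
  have M0: "M \<ge> 0" by (simp add: M_def)
  have pa: "pos a" using assms by (simp add: a_def)
  have na: "norm a = M" by (simp add: a_def M_def norm_star_mult_self)
  define u v where "u = re_part w" and "v = im_part w"
  have uv: "w = u + \<i> *\<^sub>C v" "star w = u - \<i> *\<^sub>C v" "sa u" "sa v"
    using re_im_decomp re_im_star sa_re_part sa_im_part by (auto simp: u_def v_def)
  \<comment> \<open>The mixed terms in u and v cancel in this sum, leaving 2 u^2 + 2 v^2. As
    \<open>star w * w\<close> is assumed negative, \<open>w * star w\<close> becomes a sum of
    positive elements.\<close>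
  have "star w * w + w * star w = (u * u + u * u) + (v * v + v * v)"
    unfolding uv(2) unfolding uv(1) by (simp add: algebra_simps mult_scaleC_left mult_scaleC_right scaleC_add_right scaleC_diff_right scaleC_ii_ii)
  then have b: "w * star w = a + ((u * u + u * u) + (v * v + v * v))"
    by (simp add: a_def algebra_simps)
  have pb: "pos (w * star w)" unfolding b using pa uv by (intro pos_add pos_square)
  have nb: "norm (w * star w) = M" using norm_star_mult_self[of "star w"] by (simp add: M_def)
  have pM: "pos (M *\<^sub>R 1 - w * star w)" by (rule pos_norm_minus) (use pb nb pos_sa in auto)
  then obtain g where g: "sa g" "g * g = M *\<^sub>R 1 - w * star w" by (metis pos_def)
  have ng: "(norm g)\<^sup>2 \<le> M"
    using norm_sa_square[OF g(1)] pos_norm_diff[OF pb, of M] nb g(2) by simp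
  have "star (g * w) * (g * w) = star w * (g * g) * w" using g(1) by (simp add: star_mult sa_def mult.assoc)
  also have "\<dots> = M *\<^sub>R (star w * w) - (star w * w) * (star w * w)"
    unfolding g(2) by (simp add: algebra_simps)
  finally have "star (g * w) * (g * w) = - (M *\<^sub>R a + a * a)" by (simp add: a_def)
  then have "norm (M *\<^sub>R a + a * a) = (norm (g * w))\<^sup>2"
    by (metis norm_minus_cancel norm_star_mult_self)
  also have "\<dots> \<le> (norm g * norm w)\<^sup>2" by (simp add: norm_mult_ineq power_mono)
  also have "\<dots> \<le> M * M" unfolding power_mult_distrib M_def[symmetric] using ng M0 by (rule mult_right_mono)
  finally have up: "norm (M *\<^sub>R a + a * a) \<le> M * M" .
  obtain al where al: "sa al" "al * al = a" using pa by (metis pos_def)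
  have "pos (M *\<^sub>R 1 - a)" by (rule pos_norm_minus) (use pa na pos_sa in auto)
  then obtain be where be: "sa be" "be * be = M *\<^sub>R 1 - a" "\<And>z. z * (M *\<^sub>R 1 - a) = (M *\<^sub>R 1 - a) * z \<Longrightarrow> z * be = be * z"
    using pos_sqrt by blast
  have c: "al * be = be * al" by (rule be(3)) (simp add: al(2)[symmetric] algebra_simps)
  \<comment> \<open>This square equals M a - a^2. Hence 2 a^2 lies below M a + a^2, whose norm is at
    most M^2, although 2 a^2 has norm 2 M^2; this forces M = 0.\<close>
  have "(al * be) * (al * be) = al * al * (be * be)" by (metis c mult.assoc)
  also have "\<dots> = (M *\<^sub>R a + a * a) - (a * a + a * a)" by (simp add: al(2) be(2) algebra_simps)
  finally have "pos ((M *\<^sub>R a + a * a) - (a * a + a * a))"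
    using pos_square[OF sa_mult[OF al(1) be(1) c]] by simp
  moreover have saa: "pos (a * a)" using pa pos_sa pos_square by blast
  ultimately have "norm (a * a + a * a) \<le> M * M"
    using norm_mono_pos[of "a * a + a * a" "M *\<^sub>R a + a * a"] pos_add up by fastforce
  moreover have "norm (a * a + a * a) = 2 * (M * M)"
  proof -
    have "a * a + a * a = 2 *\<^sub>R (a * a)" by (simp add: scaleR_2)
    then show ?thesis using norm_sa_square[OF pos_sa[OF pa]] na by (simp add: power2_eq_square)
  qed
  ultimately have "M = 0" using mult_nonneg_nonneg[OF M0 M0] by auto
  then show ?thesis by (simp add: M_def)
qed

text \<open>Let h be \<open>star y * y\<close>, r the positive root of h^2 (the absolute value of h)
  and n = r - h, twice the negative part. Then h n = - r n, so \<open>star (y * n) * (y * n)\<close>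
  is the negative of a square and y n = 0. This gives h n = 0, then r n = 0, then n^2 = 0, and h =
  r.\<close>

theorem pos_star_mult:
  fixes y :: "'a::cstar"
  shows "pos (star y * y)"
proof -
  define h where "h = star y * y"
  have sh: "sa h" by (simp add: h_def sa_star_mult)
  obtain r where r: "sa r" "pos r" "r * r = h * h" and rz: "\<And>z. z * (h * h) = h * h * z \<Longrightarrow> z * r = r * z"
    using pos_sqrt[OF pos_square[OF sh]] by blast
  have hr: "h * r = r * h" by (rule rz) (simp add: mult.assoc)
  obtain q where q: "sa q" "q * q = r" and qz: "\<And>z. z * r = r * z \<Longrightarrow> z * q = q * z"
    using pos_sqrt[OF r(2)] by blast
  have hq: "h * q = q * h" by (rule qz[OF hr])
  define n where "n = r - h"
  have sn: "sa n" by (simp add: n_def sa_diff r sh)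
  have rq: "r * q = q * r" by (simp add: q(2)[symmetric] mult.assoc)
  have nq: "n * q = q * n" by (simp add: n_def algebra_simps hq rq)
  have hn: "h * n = - (r * n)" by (simp add: n_def algebra_simps r(3) hr)
  have "star (y * n) * (y * n) = n * (h * n)"
    using sn by (simp add: star_mult sa_def h_def mult.assoc)
  also have "\<dots> = - (q * n * (q * n))" by (simp add: hn q(2)[symmetric]) (metis nq mult.assoc)
  finally have "pos (- (star (y * n) * (y * n)))"
    using pos_square[OF sa_mult[OF q(1) sn nq[symmetric]]] by simp
  then have "y * n = 0" by (rule zero_of_neg_star_mult)
  then have hn0: "h * n = 0" by (simp add: h_def mult.assoc)
  with hn have "r * n = 0" by simp
  with hn0 have "n * n = 0" by (simp add: n_def left_diff_distrib)
  then have "n = 0" using norm_sa_square[OF sn] by simp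
  then show ?thesis using r(2) by (simp add: n_def h_def)
qed

text \<open>The equation is an algebraic certificate for norm at most 1. Homomorphisms preserve it,
  which is how their contractivity is obtained later.\<close>

lemma norm_le_one_of_sum:
  fixes x :: "'a::cstar"
  assumes "star x * x + star k * k = 1" shows "norm x \<le> 1"
proof -
  have "1 *\<^sub>R 1 - star x * x = star k * k" using assms by (simp add: algebra_simps)
  then have "norm (star x * x) \<le> 1"
    by (intro norm_le_of_pos) (auto simp: pos_star_mult)
  then show ?thesis by (simp add: norm_star_mult_self power_le_one_iff abs_square_le_1)
qed

section \<open>States multiplicative on central elements\<close>

text \<open>With c the norm of s plus e, the element d = 1 - (s + e) / c has norm at most q = 1 - e
  / c < 1. The partial sums of the powers of d are dominated by the scalar geometric series, whose
  sum is c / e; its limit inverts (s + e) / c and commutes with everything that commutes with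
  s.\<close>

lemma inverse_of_pos_shift:
  fixes s :: "'a::cstar"
  assumes s: "pos s" and e: "e > 0"
  obtains r where "(s + e *\<^sub>R 1) * r = 1" "sa r" "\<And>z. z * s = s * z \<Longrightarrow> z * r = r * z"
proof -
  define c where "c = norm s + e"
  have c: "c > 0" using e norm_ge_zero[of s] unfolding c_def by linarith
  define q where "q = norm s / c"
  have q: "0 \<le> q" "1 - q = e / c" using c by (auto simp: q_def c_def field_simps)
  define d where "d = 1 - (1/c) *\<^sub>R (s + e *\<^sub>R 1)"
  have "c *\<^sub>R d = norm s *\<^sub>R 1 - s"
    using c by (simp add: d_def scaleR_diff_right) (simp add: c_def scaleR_add_left)
  moreover have "d = (1/c) *\<^sub>R (c *\<^sub>R d)" using c by simp
  ultimately have "d = (1/c) *\<^sub>R (norm s *\<^sub>R 1 - s)" by simp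
  then have nd: "norm d \<le> q" using pos_norm_diff[OF s order_refl] c by (simp add: q_def divide_right_mono)
  define y where "y = rec_nat 0 (\<lambda>_ y. 1 + d * y)"
  define t where "t = rec_nat (0::real) (\<lambda>_ t. 1 + q * t)"
  have y0: "y 0 = 0" and yS: "\<And>n. y (Suc n) = 1 + d * y n" by (simp_all add: y_def)
  have t0: "t 0 = 0" and tS: "\<And>n. t (Suc n) = 1 + q * t n" by (simp_all add: t_def)
  have tb: "t n \<le> c / e" for n
  proof (induction n)
    case (Suc n)
    then have "q * t n \<le> q * (c / e)" using q by (intro mult_left_mono)
    also have "q * (c / e) = norm s / e" using c by (simp add: q_def)
    also have "\<dots> = c / e - 1" using e by (simp add: c_def field_simps)
    finally show ?case by (simp add: tS)
  qed (use c e in \<open>simp add: t0\<close>)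
  have inc: "norm (y (Suc n) - y n) \<le> t (Suc n) - t n" for n
  proof (induction n)
    case 0 show ?case using norm_one_le[where 'a='a] by (simp add: y0 t0 yS tS)
  next
    case (Suc n)
    have "y (Suc (Suc n)) - y (Suc n) = d * (y (Suc n) - y n)"
      by (subst (1 2) yS) (simp add: algebra_simps)
    then have "norm (y (Suc (Suc n)) - y (Suc n)) \<le> norm d * norm (y (Suc n) - y n)"
      by (simp add: norm_mult_ineq)
    also have "\<dots> \<le> q * (t (Suc n) - t n)" using nd Suc q by (intro mult_mono) auto
    also have "\<dots> = t (Suc (Suc n)) - t (Suc n)" by (simp add: tS algebra_simps)
    finally show ?case .
  qed
  from convergent_of_dominated_increments[of y t, OF inc tb] obtain l where l: "y \<longlonglongrightarrow> l"
    by (auto simp: convergent_def)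
  have "(\<lambda>n. y (Suc n)) \<longlonglongrightarrow> 1 + d * l"
    unfolding yS by (intro tendsto_intros l)
  then have "l = 1 + d * l"
    using LIMSEQ_unique LIMSEQ_Suc[OF l] by blast
  then have "(1 - d) * l = 1" by (simp add: algebra_simps)
  then have inv: "(s + e *\<^sub>R 1) * ((1/c) *\<^sub>R l) = 1" by (simp add: d_def)
  have comm: "z * y n = y n * z" if z: "z * s = s * z" for n z
  proof -
    have zd: "z * d = d * z" using z by (simp add: d_def algebra_simps)
    show ?thesis
    proof (induction n)
      case (Suc n)
      have "z * (d * y n) = d * y n * z" by (metis Suc zd mult.assoc)
      then show ?case by (simp add: yS algebra_simps)
    qed (simp add: y0)
  qed
  have sd: "star d = d" using pos_sa[OF s] by (simp add: d_def star_diff star_scaleR star_add sa_def)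
  have "star (y n) = y n" for n
  proof (induction n)
    case (Suc n)
    have "d * s = s * d" by (simp add: d_def algebra_simps)
    then have "d * y n = y n * d" by (rule comm)
    then show ?case using Suc sd by (simp add: yS star_add star_mult)
  qed (simp add: y0)
  then have "sa l" using LIMSEQ_unique[OF tendsto_star[OF l]] l by (simp add: sa_def)
  then have sar: "sa ((1/c) *\<^sub>R l)" by (rule sa_scaleR)
  have "z * ((1/c) *\<^sub>R l) = (1/c) *\<^sub>R l * z" if z: "z * s = s * z" for z
    using tendsto_commute[OF l comm[OF z]] by simp
  from that[OF inv sar this] show ?thesis .
qed

section \<open>Central elements and cones stable under positive central factors\<close>

definition central :: "'a::cstar \<Rightarrow> bool" where "central c \<longleftrightarrow> (\<forall>z. z * c = c * z)"

lemma central_mult: "central c \<Longrightarrow> central d \<Longrightarrow> central (c * d)"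
  unfolding central_def by (metis mult.assoc)
lemma central_add: "central c \<Longrightarrow> central d \<Longrightarrow> central (c + d)"
  by (simp add: central_def algebra_simps)
lemma central_diff: "central c \<Longrightarrow> central d \<Longrightarrow> central (c - d)"
  by (simp add: central_def algebra_simps)
lemma central_scaleR: "central c \<Longrightarrow> central (r *\<^sub>R c)"
  by (simp add: central_def)
lemma central_scaleC: "central c \<Longrightarrow> central (r *\<^sub>C c)"
  by (simp add: central_def mult_scaleC_left mult_scaleC_right)
lemma central_star: "central c \<Longrightarrow> central (star c)"
  unfolding central_def by (metis star_mult star_star)
lemma central_one: "central 1"
  by (simp add: central_def)

definition pos_central :: "'a::cstar \<Rightarrow> bool" where "pos_central s \<longleftrightarrow> pos s \<and> central s"

lemma pos_central_sqrt:
  assumes "pos_central s" obtains k where "sa k" "central k" "k * k = s"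
proof -
  obtain k where k: "sa k" "k * k = s" and kz: "\<And>z. z * s = s * z \<Longrightarrow> z * k = k * z"
    using pos_sqrt assms pos_central_def by metis
  have "central k" unfolding central_def
    using kz assms unfolding pos_central_def central_def by blast
  with k show ?thesis using that by blast
qed

lemma pos_central_square: "sa c \<Longrightarrow> central c \<Longrightarrow> pos_central (c * c)"
  by (simp add: pos_central_def pos_square central_mult)

lemma pos_central_add: "pos_central s \<Longrightarrow> pos_central t \<Longrightarrow> pos_central (s + t)"
  by (simp add: pos_central_def pos_add central_add)

lemma pos_central_scaleR_one: "r \<ge> 0 \<Longrightarrow> pos_central (r *\<^sub>R 1)"
  by (simp add: pos_central_def pos_scaleR central_scaleR central_one)

text \<open>The last clause distinguishes these cones from the cone of all elements on which a given
  state is nonnegative: it is the source of multiplicativity of the extracted functional on the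
  centre.\<close>

definition mcone :: "'a::cstar set \<Rightarrow> bool" where
  "mcone M \<longleftrightarrow> (\<forall>m\<in>M. sa m) \<and> (\<forall>m\<in>M. \<forall>n\<in>M. m + n \<in> M) \<and> (\<forall>y. star y * y \<in> M) \<and>
     (\<forall>c m. sa c \<longrightarrow> central c \<longrightarrow> m \<in> M \<longrightarrow> c * c * m \<in> M)"

lemma mcone_sa: "mcone M \<Longrightarrow> m \<in> M \<Longrightarrow> sa m" by (simp add: mcone_def)
lemma mcone_add: "mcone M \<Longrightarrow> m \<in> M \<Longrightarrow> n \<in> M \<Longrightarrow> m + n \<in> M" by (simp add: mcone_def)
lemma mcone_pos: "mcone M \<Longrightarrow> pos p \<Longrightarrow> p \<in> M" unfolding mcone_def pos_def sa_def by metis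
lemma mcone_mult: "mcone M \<Longrightarrow> pos_central s \<Longrightarrow> m \<in> M \<Longrightarrow> s * m \<in> M"
  by (metis mcone_def pos_central_sqrt)
lemma mcone_scaleR: "mcone M \<Longrightarrow> r \<ge> 0 \<Longrightarrow> m \<in> M \<Longrightarrow> r *\<^sub>R m \<in> M"
  using mcone_mult[OF _ pos_central_scaleR_one] by fastforce

lemma sa_central_mult: "sa x \<Longrightarrow> sa y \<Longrightarrow> central x \<Longrightarrow> sa (x * y)"
  by (intro sa_mult) (auto simp: central_def)

lemma pos_central_sa: "pos_central s \<Longrightarrow> sa s" by (simp add: pos_central_def pos_sa)

text \<open>Multiplication is available only by central squares, so the cone obtained by adjoining u
  consists of sums with one term s u, s positive central. Roots of s keep the form under
  multiplication by \<open>c * c\<close>.\<close>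

lemma mcone_extend:
  assumes M: "mcone M" and u: "sa u"
  shows "mcone {m + s * u |m s. m \<in> M \<and> pos_central s}" (is "mcone ?N")
    and "M \<subseteq> {m + s * u |m s. m \<in> M \<and> pos_central s}" and "u \<in> {m + s * u |m s. m \<in> M \<and> pos_central s}"
proof -
  have z: "pos_central 0" and o: "pos_central 1"
    using pos_central_scaleR_one[of 0] pos_central_scaleR_one[of 1] by auto
  show sub: "M \<subseteq> ?N"
  proof
    fix m assume "m \<in> M"
    then have "m = m + 0 * u \<and> m \<in> M \<and> pos_central (0::'a)" using z by simp
    then show "m \<in> ?N" by blast
  qed
  have "u = 0 + 1 * u \<and> 0 \<in> M \<and> pos_central (1::'a)" using o mcone_pos[OF M] by simp
  then show "u \<in> ?N" by blast
  show "mcone ?N" unfolding mcone_def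
  proof (intro conjI ballI allI impI)
    fix n assume "n \<in> ?N" then obtain m s where n: "n = m + s * u" "m \<in> M" "pos_central s" by blast
    then show "sa n" using mcone_sa[OF M] u pos_central_sa[of s]
      by (auto intro!: sa_add sa_central_mult simp: pos_central_def)
  next
    fix n n' assume "n \<in> ?N" "n' \<in> ?N"
    then obtain m s m' s' where "n = m + s * u" "m \<in> M" "pos_central s" "n' = m' + s' * u" "m' \<in> M" "pos_central s'"
      by blast
    then have "n + n' = (m + m') + (s + s') * u \<and> m + m' \<in> M \<and> pos_central (s + s')"
      by (simp add: algebra_simps mcone_add[OF M] pos_central_add)
    then show "n + n' \<in> ?N" by blast
  next
    fix y :: 'a show "star y * y \<in> ?N" using sub M unfolding mcone_def by blast
  next
    fix c n :: 'a assume c: "sa c" "central c" and "n \<in> ?N"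
    then obtain m s where n: "n = m + s * u" "m \<in> M" "pos_central s" by blast
    obtain k where k: "sa k" "central k" "k * k = s" using pos_central_sqrt[OF n(3)] .
    have "sa (c * k)" "central (c * k)" using c k sa_central_mult central_mult by blast+
    then have "pos_central ((c * k) * (c * k))" by (rule pos_central_square)
    moreover have "(c * k) * (c * k) = c * c * s" using k c unfolding central_def by (metis mult.assoc)
    ultimately have "c * c * n = c * c * m + (c * c * s) * u \<and> c * c * m \<in> M \<and> pos_central (c * c * s)"
      using n M c by (simp add: algebra_simps mcone_def)
    then show "c * c * n \<in> ?N" by blast
  qed
qed

text \<open>If \<open>s (-u) = 1 + m\<close>, multiply by \<open>r = (s + e)\<inverse>\<close> for small \<open>e\<close>:
  \<open>-u = r m + r (1 - e u)\<close>.\<close>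
lemma mcone_extend_proper:
  fixes u :: "'a::cstar"
  assumes L: "mcone L" and u: "sa u" and m: "m \<in> L" and s: "pos_central s" and eq: "m + s * u = - 1"
  shows "- u \<in> L"
proof -
  \<comment> \<open>Small enough for e u to have norm at most 1, so that 1 - e u is positive; the
    added 1 covers u = 0.\<close>
  define e where "e = 1 / (norm u + 1)"
  have nu: "norm u + 1 > 0" by (simp add: add_nonneg_pos)
  then have e: "e > 0" by (simp add: e_def)
  obtain r where r: "(s + e *\<^sub>R 1) * r = 1" "sa r" and rz: "\<And>z. z * s = s * z \<Longrightarrow> z * r = r * z"
    using inverse_of_pos_shift[of s e] s e pos_central_def by metis
  have cr: "central r" unfolding central_def using rz s unfolding pos_central_def central_def by blast
  have r': "r * (s + e *\<^sub>R 1) = 1" using r(1) cr by (simp add: central_def)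
  obtain k where k: "sa k" "central k" "k * k = s" using pos_central_sqrt[OF s] .
  have kr: "(r * k) * (r * k) = r * s * r" using k cr unfolding central_def by (metis mult.assoc)
  \<comment> \<open>Positivity of the inverse r: since r (s + e) r = r, it is a sum of the square of
    r k, with k a central root of s, and e times the square of r.\<close>
  have "r = r * (s + e *\<^sub>R 1) * r" by (simp add: r')
  also have "\<dots> = (r * k) * (r * k) + e *\<^sub>R (r * r)" unfolding kr by (simp add: algebra_simps)
  finally have "r = (r * k) * (r * k) + e *\<^sub>R (r * r)" .
  moreover have "pos ((r * k) * (r * k) + e *\<^sub>R (r * r))"
    using k(1) r(2) cr e by (intro pos_add pos_square pos_scaleR sa_central_mult) auto
  ultimately have pr: "pos_central r" using cr by (simp add: pos_central_def)
  have "norm (e *\<^sub>R u) \<le> 1" using e nu by (simp add: e_def)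
  then have "pos (1 *\<^sub>R 1 - e *\<^sub>R u)" by (intro pos_norm_minus sa_scaleR u)
  then have "1 - e *\<^sub>R u \<in> L" using mcone_pos[OF L] by simp
  then have "r * m + r * (1 - e *\<^sub>R u) \<in> L"
    using mcone_add[OF L] mcone_mult[OF L pr] m by blast
  moreover have "r * m + r * (1 - e *\<^sub>R u) = - u"
  proof -
    have "m = - 1 - s * u" using eq by (simp add: algebra_simps)
    have "r * m + r * (1 - e *\<^sub>R u) = - (r * (s + e *\<^sub>R 1) * u)" by (subst \<open>m = _\<close>) (simp add: algebra_simps)
    then show ?thesis by (simp add: r')
  qed
  ultimately show ?thesis by simp
qed

text \<open>Zorn's lemma above L with u adjoined. If a maximal proper cone M contained neither y nor
  -y, adjoining y would produce -1, and \<open>mcone_extend_proper\<close> would then put -y into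
  M.\<close>

lemma exists_total_mcone:
  fixes u :: "'a::cstar"
  assumes L: "mcone L" and u: "sa u" and un: "- u \<notin> L"
  obtains M where "mcone M" "L \<subseteq> M" "u \<in> M" "- 1 \<notin> M" "\<And>y. sa y \<Longrightarrow> y \<in> M \<or> - y \<in> M"
proof -
  define L' where "L' = {m + s * u |m s. m \<in> L \<and> pos_central s}"
  note ext = mcone_extend[OF L u, folded L'_def]
  have n1: "- 1 \<notin> L'" using mcone_extend_proper[OF L u] un unfolding L'_def by fastforce
  define A where "A = {M. mcone M \<and> L' \<subseteq> M \<and> - 1 \<notin> M}"
  have "\<exists>M\<in>A. \<forall>X\<in>A. M \<subseteq> X \<longrightarrow> X = M"
  proof (rule subset_Zorn_nonempty)
    show "A \<noteq> {}" using ext(1) n1 by (auto simp: A_def)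
    fix \<C> assume ne: "\<C> \<noteq> {}" and ch: "subset.chain A \<C>"
    then have CA: "\<And>X. X \<in> \<C> \<Longrightarrow> mcone X \<and> L' \<subseteq> X \<and> - 1 \<notin> X"
      and tot: "\<And>X Y. X \<in> \<C> \<Longrightarrow> Y \<in> \<C> \<Longrightarrow> X \<subseteq> Y \<or> Y \<subseteq> X"
      by (auto simp: subset.chain_def A_def)
    have "mcone (\<Union>\<C>)" unfolding mcone_def
    proof (intro conjI ballI allI impI)
      fix m assume "m \<in> \<Union>\<C>" then show "sa m" using CA mcone_sa by blast
    next
      fix m n assume "m \<in> \<Union>\<C>" "n \<in> \<Union>\<C>"
      then obtain X Y where XY: "X \<in> \<C>" "m \<in> X" "Y \<in> \<C>" "n \<in> Y" by blast
      from tot[OF XY(1,3)] show "m + n \<in> \<Union>\<C>"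
      proof
        assume "X \<subseteq> Y" then have "m + n \<in> Y" using XY CA mcone_add by blast
        then show ?thesis using XY by blast
      next
        assume "Y \<subseteq> X" then have "m + n \<in> X" using XY CA mcone_add by blast
        then show ?thesis using XY by blast
      qed
    next
      fix y :: 'a show "star y * y \<in> \<Union>\<C>" using ne CA unfolding mcone_def by blast
    next
      fix c m :: 'a assume "sa c" "central c" "m \<in> \<Union>\<C>"
      then show "c * c * m \<in> \<Union>\<C>" using CA unfolding mcone_def by blast
    qed
    moreover have "L' \<subseteq> \<Union>\<C>" "- 1 \<notin> \<Union>\<C>" using CA ne by fast+
    ultimately show "\<Union>\<C> \<in> A" by (simp add: A_def)
  qed
  then obtain M where MA: "M \<in> A" and mx0: "\<forall>X\<in>A. M \<subseteq> X \<longrightarrow> X = M" by (rule bexE)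
  from MA have M: "mcone M" "L' \<subseteq> M" "- 1 \<notin> M" by (simp_all add: A_def)
  have mx: "X = M" if "mcone X" "L' \<subseteq> X" "- 1 \<notin> X" "M \<subseteq> X" for X
    using mx0[rule_format, of X] that by (simp add: A_def)
  have "y \<in> M \<or> - y \<in> M" if y: "sa y" for y
  proof (rule ccontr)
    assume a: "\<not> (y \<in> M \<or> - y \<in> M)"
    define E where "E = {m + s * y |m s. m \<in> M \<and> pos_central s}"
    note ey = mcone_extend[OF M(1) y, folded E_def]
    have "E \<noteq> M" using ey(3) a by blast
    moreover have "L' \<subseteq> E" using M(2) ey(2) by (rule subset_trans)
    ultimately have "- 1 \<in> E" using mx[OF ey(1)] ey(2) by blast
    then obtain m s where "- 1 = m + s * y" and ms: "m \<in> M" "pos_central s"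
      unfolding E_def by blast
    then have ms: "m \<in> M" "pos_central s" "m + s * y = - 1" by simp_all
    from mcone_extend_proper[OF M(1) y ms] a show False by blast
  qed
  with that[of M] M ext show ?thesis by blast
qed

locale total_mcone =
  fixes M :: "'a::cstar set"
  assumes mc: "mcone M" and proper: "- 1 \<notin> M" and total: "\<And>y. sa y \<Longrightarrow> y \<in> M \<or> - y \<in> M"
begin

text \<open>The value of y as a Dedekind cut modulo M. M is not assumed to be closed, so the
  comparisons of y with t hold only up to every positive e.\<close>

definition val :: "'a \<Rightarrow> real \<Rightarrow> bool" where
  "val y t \<longleftrightarrow> (\<forall>e>0. y - (t - e) *\<^sub>R 1 \<in> M \<and> (t + e) *\<^sub>R 1 - y \<in> M)"

lemma scaleR_one_mem: "r \<ge> 0 \<Longrightarrow> r *\<^sub>R 1 \<in> M"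
  by (intro mcone_pos[OF mc] pos_scaleR) auto

lemma neg_scaleR_one_not_mem:
  assumes "r < 0" shows "r *\<^sub>R 1 \<notin> M"
proof
  assume "r *\<^sub>R 1 \<in> M"
  from mcone_scaleR[OF mc _ this, of "- 1 / r"] assms have "- 1 \<in> M" by (simp add: divide_nonneg_neg)
  with proper show False by simp
qed

lemma norm_minus_mem: "sa y \<Longrightarrow> norm y *\<^sub>R 1 - y \<in> M"
  by (intro mcone_pos[OF mc] pos_norm_minus) auto

text \<open>The value is the supremum of all s with y - s in M. It is bounded by the norm of y
  because no negative scalar lies in M; totality of M yields the comparison from above.\<close>

lemma val_exists:
  assumes y: "sa y" shows "\<exists>t. val y t"
proof -
  define T where "T = {s. y - s *\<^sub>R 1 \<in> M}"
  have "- norm y \<in> T" using norm_minus_mem[OF sa_minus[OF y]] by (simp add: T_def add.commute)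
  then have ne: "T \<noteq> {}" by blast
  have bd: "s \<le> norm y" if "s \<in> T" for s
  proof (rule ccontr)
    assume "\<not> s \<le> norm y"
    then have "(norm y - s) *\<^sub>R 1 \<notin> M" by (intro neg_scaleR_one_not_mem) simp
    moreover have "(norm y *\<^sub>R 1 - y) + (y - s *\<^sub>R 1) \<in> M"
      using that by (intro mcone_add[OF mc] norm_minus_mem[OF y]) (simp add: T_def)
    ultimately show False by (simp add: scaleR_diff_left)
  qed
  then have ba: "bdd_above T" by (auto simp: bdd_above_def)
  have "val y (Sup T)" unfolding val_def
  proof (intro allI impI conjI)
    fix e :: real assume e: "e > 0"
    then obtain s where s: "s \<in> T" "Sup T - e < s" using less_cSup_iff[OF ne ba, of "Sup T - e"] by auto
    have "(y - s *\<^sub>R 1) + (s - (Sup T - e)) *\<^sub>R 1 \<in> M"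
      using s by (intro mcone_add[OF mc] scaleR_one_mem) (auto simp: T_def)
    then show "y - (Sup T - e) *\<^sub>R 1 \<in> M" by (simp add: algebra_simps)
    show "(Sup T + e) *\<^sub>R 1 - y \<in> M"
    proof (rule ccontr)
      assume a: "(Sup T + e) *\<^sub>R 1 - y \<notin> M"
      have "sa ((Sup T + e) *\<^sub>R 1 - y)" using y by (intro sa_intros)
      from total[OF this] a have "Sup T + e \<in> T" by (simp add: T_def)
      from cSup_upper[OF this ba] e show False by simp
    qed
  qed
  then show ?thesis by blast
qed

lemma val_unique_le:
  assumes "val y t" "val y s" shows "s \<le> t"
proof (rule ccontr)
  assume "\<not> s \<le> t"
  \<comment> \<open>Adding the two comparisons puts the scalar t - s + 2 e = - e, a negative one,
    into M.\<close>
  define e where "e = (s - t) / 3"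
  have e: "e > 0" using \<open>\<not> s \<le> t\<close> by (simp add: e_def)
  have "((t + e) *\<^sub>R 1 - y) + (y - (s - e) *\<^sub>R 1) \<in> M"
    using assms e by (intro mcone_add[OF mc]) (auto simp: val_def)
  also have "((t + e) *\<^sub>R 1 - y) + (y - (s - e) *\<^sub>R 1) = ((t + e) - (s - e)) *\<^sub>R 1"
    by (simp only: scaleR_diff_left scaleR_add_left) (simp add: algebra_simps)
  finally have "((t + e) - (s - e)) *\<^sub>R 1 \<in> M" .
  moreover have "(t + e) - (s - e) < 0" using \<open>\<not> s \<le> t\<close> by (simp add: e_def field_simps)
  ultimately show False using neg_scaleR_one_not_mem by blast
qed

definition g :: "'a \<Rightarrow> real" where "g y = (SOME t. val y t)"

lemma val_g: "sa y \<Longrightarrow> val y (g y)"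
  unfolding g_def by (rule someI_ex) (rule val_exists)

lemma g_eqI: "sa y \<Longrightarrow> val y t \<Longrightarrow> g y = t"
  using val_unique_le[of y t "g y"] val_unique_le[of y "g y" t] val_g by (auto intro: antisym)

lemma g_one: "g 1 = 1"
  by (rule g_eqI) (auto simp: val_def scaleR_one_mem algebra_simps)

lemma g_nonneg:
  assumes "m \<in> M" shows "g m \<ge> 0"
proof (rule ccontr)
  assume a: "\<not> g m \<ge> 0"
  have "val m (g m)" using val_g mcone_sa[OF mc assms] by blast
  then have "(g m + (- g m / 2)) *\<^sub>R 1 - m \<in> M" using a unfolding val_def by (metis divide_pos_pos neg_0_less_iff_less not_le zero_less_numeral)
  then have "((g m + (- g m / 2)) *\<^sub>R 1 - m) + m \<in> M" using assms mcone_add[OF mc] by blast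
  then have "(g m / 2) *\<^sub>R 1 \<in> M" by (simp add: field_simps)
  with neg_scaleR_one_not_mem[of "g m / 2"] a show False by simp
qed

lemma val_add:
  assumes "val y t" "val z s" shows "val (y + z) (t + s)"
  unfolding val_def
proof (intro allI impI conjI)
  fix e :: real assume "e > 0"
  then have e: "e / 2 > 0" by simp
  have "(y - (t - e/2) *\<^sub>R 1) + (z - (s - e/2) *\<^sub>R 1) \<in> M"
    using assms e unfolding val_def by (intro mcone_add[OF mc]) blast+
  also have "(y - (t - e/2) *\<^sub>R 1) + (z - (s - e/2) *\<^sub>R 1) = y + z - ((t - e/2) + (s - e/2)) *\<^sub>R 1"
    unfolding scaleR_add_left by simp
  finally show "y + z - (t + s - e) *\<^sub>R 1 \<in> M" by (simp add: algebra_simps)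
  have "((t + e/2) *\<^sub>R 1 - y) + ((s + e/2) *\<^sub>R 1 - z) \<in> M"
    using assms e unfolding val_def by (intro mcone_add[OF mc]) blast+
  also have "((t + e/2) *\<^sub>R 1 - y) + ((s + e/2) *\<^sub>R 1 - z) = ((t + e/2) + (s + e/2)) *\<^sub>R 1 - (y + z)"
    unfolding scaleR_add_left by simp
  finally show "(t + s + e) *\<^sub>R 1 - (y + z) \<in> M" by (simp add: algebra_simps)
qed

lemma val_minus: "val y t \<Longrightarrow> val (- y) (- t)"
  unfolding val_def by (simp add: algebra_simps)

text \<open>Both comparisons for y - t are multiplied by s. The error becomes d s, and d is chosen
  such that d s is below e; stability of M under positive central factors enters here.\<close>

lemma val_mult:
  assumes s: "pos_central s" and y: "val y t" and sy: "sa y"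
  shows "val (s * (y - t *\<^sub>R 1)) 0"
  unfolding val_def
proof (intro allI impI conjI)
  fix e :: real assume e: "e > 0"
  define d where "d = e / (norm s + 1)"
  have n: "norm s + 1 > 0" by (simp add: add_nonneg_pos)
  have d: "d > 0" using e n by (simp add: d_def)
  have "norm (d *\<^sub>R s) \<le> e" using e n d by (simp add: d_def field_simps)
  then have p: "e *\<^sub>R 1 - d *\<^sub>R s \<in> M"
    using pos_central_sa[OF s] by (intro mcone_pos[OF mc] pos_norm_minus sa_scaleR)
  have "s * (y - (t - d) *\<^sub>R 1) + (e *\<^sub>R 1 - d *\<^sub>R s) \<in> M"
    using y d unfolding val_def by (intro mcone_add[OF mc] mcone_mult[OF mc s] p) blast
  then show "s * (y - t *\<^sub>R 1) - (0 - e) *\<^sub>R 1 \<in> M" by (simp add: algebra_simps)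
  have "s * ((t + d) *\<^sub>R 1 - y) + (e *\<^sub>R 1 - d *\<^sub>R s) \<in> M"
    using y d unfolding val_def by (intro mcone_add[OF mc] mcone_mult[OF mc s] p) blast
  then show "(0 + e) *\<^sub>R 1 - s * (y - t *\<^sub>R 1) \<in> M" by (simp add: algebra_simps)
qed

lemma g_add: "sa y \<Longrightarrow> sa z \<Longrightarrow> g (y + z) = g y + g z"
  by (intro g_eqI val_add val_g sa_add)

lemma g_minus: "sa y \<Longrightarrow> g (- y) = - g y"
  by (intro g_eqI val_minus val_g sa_minus)

lemma g_diff: "sa y \<Longrightarrow> sa z \<Longrightarrow> g (y - z) = g y - g z"
  using g_add[of y "- z"] g_minus[of z] sa_minus[of z] by simp

lemma g_scaleR_one: "g (r *\<^sub>R 1) = r"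
  by (rule g_eqI) (auto simp: val_def scaleR_one_mem simp flip: scaleR_diff_left intro: sa_scaleR)

text \<open>\<open>val_mult\<close> says that g vanishes at s (y - g y), whence g (s y) = g (g y s).
  Pulling out the scalar g y is the same argument with a scalar in place of s, followed by a sign
  change if g y is negative.\<close>

lemma g_mult_pos_central:
  assumes s: "pos_central s" and y: "sa y" shows "g (s * y) = g s * g y"
proof -
  have "g (s * (y - g y *\<^sub>R 1)) = 0"
  proof (rule g_eqI)
    show "sa (s * (y - g y *\<^sub>R 1))" using s y pos_central_sa[OF s] pos_central_def
      by (intro sa_central_mult sa_intros) auto
    show "val (s * (y - g y *\<^sub>R 1)) 0" by (rule val_mult[OF s val_g[OF y] y])
  qed
  moreover have sy: "sa (s * y)" using s y pos_central_sa[OF s] pos_central_def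
      by (intro sa_central_mult sa_intros) auto
  have "s * (y - g y *\<^sub>R 1) = s * y - g y *\<^sub>R s" by (simp add: algebra_simps)
  ultimately have 1: "g (s * y) = g (g y *\<^sub>R s)"
    using g_diff[OF sy sa_scaleR[OF pos_central_sa[OF s]], of "g y"] by simp
  have sr: "g (r *\<^sub>R s) = r * g s" if r: "r \<ge> 0" for r
  proof -
    have "g ((r *\<^sub>R 1) * (s - g s *\<^sub>R 1)) = 0"
      using val_mult[OF pos_central_scaleR_one[OF r] val_g[OF pos_central_sa[OF s]] pos_central_sa[OF s]]
      by (intro g_eqI) (auto intro!: sa_intros pos_central_sa[OF s])
    moreover have "(r *\<^sub>R 1) * (s - g s *\<^sub>R 1) = r *\<^sub>R s - (r * g s) *\<^sub>R 1" by (simp add: algebra_simps)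
    ultimately show ?thesis
      using g_diff[OF sa_scaleR[OF pos_central_sa[OF s], of r] sa_scaleR[OF sa_one, of "r * g s"]] g_scaleR_one by simp
  qed
  show ?thesis
  proof (cases "g y \<ge> 0")
    case True then show ?thesis using 1 sr by simp
  next
    case False
    then have "g (- ((- g y) *\<^sub>R s)) = - ((- g y) * g s)"
      using g_minus[OF sa_scaleR[OF pos_central_sa[OF s], of "- g y"]] sr[of "- g y"] by simp
    then show ?thesis using 1 by simp
  qed
qed

text \<open>Polarisation: 4 c = (c + 1)^2 - (c - 1)^2 is a difference of positive central
  elements.\<close>

lemma g_mult_central:
  assumes c: "sa c" "central c" and y: "sa y" shows "g (c * y) = g c * g y"
proof -
  let ?p = "(c + 1) * (c + 1)" and ?m = "(c - 1) * (c - 1)"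
  have pc: "pos_central ?p" "pos_central ?m"
    using c by (auto intro!: pos_central_square sa_intros central_add central_diff central_one)
  have four: "?p * z - ?m * z = 4 *\<^sub>R (c * z)" for z
  proof -
    have "4 *\<^sub>R (c * z) = (c * z + c * z) + (c * z + c * z)"
    proof -
      have "4 *\<^sub>R (c * z) = 2 *\<^sub>R (2 *\<^sub>R (c * z))" by simp
      then show ?thesis unfolding scaleR_2 .
    qed
    then show ?thesis by (simp add: algebra_simps)
  qed
  have 4: "g (4 *\<^sub>R z) = 4 * g z" if "sa z" for z
  proof -
    have "g ((4 *\<^sub>R 1) * z) = g (4 *\<^sub>R 1) * g z" by (rule g_mult_pos_central[OF pos_central_scaleR_one that]) simp
    then show ?thesis by (simp add: g_scaleR_one)
  qed
  have *: "4 * g (c * z) = (g ?p - g ?m) * g z" if z: "sa z" for z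
  proof -
    have "4 * g (c * z) = g (?p * z - ?m * z)"
      unfolding four using 4[of "c * z"] sa_central_mult[OF c(1) z c(2)] by simp
    also have "\<dots> = g (?p * z) - g (?m * z)"
      using sa_central_mult[OF pos_central_sa[OF pc(1)] z] sa_central_mult[OF pos_central_sa[OF pc(2)] z] pc
      by (intro g_diff) (auto simp: pos_central_def)
    also have "\<dots> = (g ?p - g ?m) * g z" unfolding g_mult_pos_central[OF pc(1) z] g_mult_pos_central[OF pc(2) z]
      by (rule left_diff_distrib[symmetric])
    finally show ?thesis .
  qed
  from *[OF sa_one] have "4 * g c = g ?p - g ?m" by (simp add: g_one)
  with *[OF y] have "4 * g (c * y) = (4 * g c) * g y" by (simp only:)
  then show ?thesis by simp
qed

section \<open>Complex extension of the real functional\<close>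

definition f :: "'a \<Rightarrow> complex" where "f y = Complex (g (re_part y)) (g (im_part y))"

lemma re_part_sa: "sa y \<Longrightarrow> re_part y = y" by (simp add: re_part_def sa_def flip: scaleR_2)
lemma im_part_sa: "sa y \<Longrightarrow> im_part y = 0" by (simp add: im_part_def sa_def)
lemma re_part_add: "re_part (x + y) = re_part x + re_part y" by (simp add: re_part_def star_add algebra_simps)
lemma im_part_add: "im_part (x + y) = im_part x + im_part y"
  by (simp add: im_part_def star_add scaleC_diff_right scaleC_add_right algebra_simps)

lemma sa_decomp_unique:
  assumes "sa a" "sa b" shows "re_part (a + \<i> *\<^sub>C b) = a" "im_part (a + \<i> *\<^sub>C b) = b"
proof -
  have s: "star (a + \<i> *\<^sub>C b) = a - \<i> *\<^sub>C b" using assms by (simp add: star_add star_scaleC sa_def scaleC_minus_left)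
  show "re_part (a + \<i> *\<^sub>C b) = a" unfolding re_part_def s by (simp flip: scaleR_2)
  have "\<i> *\<^sub>C (- (\<i> *\<^sub>C b) - \<i> *\<^sub>C b) = 2 *\<^sub>R b" by (simp add: scaleC_diff_right scaleC_minus_right scaleC_ii_ii scaleR_2)
  then show "im_part (a + \<i> *\<^sub>C b) = b" unfolding im_part_def s by simp
qed

lemma scaleC_Complex: "c *\<^sub>C (x::'b::cstar) = Re c *\<^sub>R x + \<i> *\<^sub>C (Im c *\<^sub>R x)"
  by (simp add: scaleR_scaleC scaleC_scaleC flip: scaleC_add_left) (metis complex_eq)

lemma central_mult_parts:
  assumes "central c"
  shows "re_part (c * y) = re_part c * re_part y - im_part c * im_part y"
    and "im_part (c * y) = re_part c * im_part y + im_part c * re_part y"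
proof -
  have cc: "central (re_part c)" "central (im_part c)"
    using assms by (auto simp: re_part_def im_part_def intro!: central_scaleR central_scaleC central_add central_diff central_star)
  have "c * y = (re_part c + \<i> *\<^sub>C im_part c) * (re_part y + \<i> *\<^sub>C im_part y)"
    by (simp flip: re_im_decomp)
  also have "\<dots> = (re_part c * re_part y - im_part c * im_part y) + \<i> *\<^sub>C (re_part c * im_part y + im_part c * re_part y)"
    by (simp add: algebra_simps mult_scaleC_left mult_scaleC_right scaleC_add_right scaleC_ii_ii)
  finally have *: "c * y = (re_part c * re_part y - im_part c * im_part y) + \<i> *\<^sub>C (re_part c * im_part y + im_part c * re_part y)" .
  have s: "sa (re_part c * re_part y - im_part c * im_part y)" "sa (re_part c * im_part y + im_part c * re_part y)"
    by (auto intro!: sa_diff sa_add sa_central_mult cc sa_re_part sa_im_part)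
  show "re_part (c * y) = re_part c * re_part y - im_part c * im_part y"
    and "im_part (c * y) = re_part c * im_part y + im_part c * re_part y"
    unfolding * using sa_decomp_unique[OF s] by auto
qed

lemma f_add: "f (x + y) = f x + f y"
  by (simp add: f_def re_part_add im_part_add g_add sa_re_part sa_im_part complex_eq_iff)

lemma f_mult_central:
  assumes "central c" shows "f (c * y) = f c * f y"
proof -
  have cc: "central (re_part c)" "central (im_part c)"
    using assms by (auto simp: re_part_def im_part_def intro!: central_scaleR central_scaleC central_add central_diff central_star)
  show ?thesis
    by (simp add: f_def central_mult_parts[OF assms] g_diff g_add g_mult_central cc sa_re_part sa_im_part
        sa_central_mult complex_eq_iff)
qed

lemma f_sa: "sa y \<Longrightarrow> f y = of_real (g y)"
  using g_scaleR_one[of 0] by (simp add: f_def re_part_sa im_part_sa complex_eq_iff)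

lemma f_scaleC: "f (c *\<^sub>C y) = c * f y"
proof -
  have "f (c *\<^sub>C 1) = c"
    by (simp add: f_def scaleC_Complex[of c 1] sa_decomp_unique sa_scaleR g_scaleR_one complex_eq_iff)
  then show ?thesis
    using f_mult_central[OF central_scaleC[OF central_one], of c y] by (simp add: mult_scaleC_left)
qed

end

text \<open>L is a parameter because there are two uses. With L the positive elements the result is
  a state of P; with a larger cone in a commutative algebra, where everything is central, it is a
  character adapted to a given functional. The hypothesis on u makes it possible to prescribe one
  further inequality.\<close>

theorem exists_central_state:
  fixes u :: "'a::cstar"
  assumes "mcone L" "sa u" "- u \<notin> L"
  obtains f :: "'a \<Rightarrow> complex"
  where "\<And>x y. f (x + y) = f x + f y" "\<And>c x. f (c *\<^sub>C x) = c * f x" "f 1 = 1"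
    "\<And>l. l \<in> L \<Longrightarrow> Im (f l) = 0 \<and> Re (f l) \<ge> 0" "Re (f u) \<ge> 0"
    "\<And>c y. central c \<Longrightarrow> f (c * y) = f c * f y"
proof -
  obtain M where M: "mcone M" "L \<subseteq> M" "u \<in> M" "- 1 \<notin> M" "\<And>y. sa y \<Longrightarrow> y \<in> M \<or> - y \<in> M"
    using exists_total_mcone[OF assms] by blast
  interpret total_mcone M using M by unfold_locales auto
  have p: "Im (f l) = 0 \<and> Re (f l) \<ge> 0" if "l \<in> M" for l
    using f_sa[OF mcone_sa[OF M(1) that]] g_nonneg[OF that] by simp
  show ?thesis
  proof (rule that[of f])
    show "f 1 = 1" using f_sa[of 1] g_one by simp
    show "Re (f u) \<ge> 0" using p M(3) by blast
  qed (use f_add f_scaleC f_mult_central p M(2) in blast)+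
qed

section \<open>Characters and partitions of a commutative algebra\<close>

text \<open>Cholesky factorisation by induction: the last row is divided by the root of the last
  diagonal entry d, and the induction hypothesis is applied to the Schur complement. If d = 0 the
  whole last row vanishes.\<close>

lemma psd_kernel_factor:
  fixes Q :: "nat \<Rightarrow> nat \<Rightarrow> complex"
  assumes "\<And>k l. k < n \<Longrightarrow> l < n \<Longrightarrow> Q l k = cnj (Q k l)"
    and "\<And>z. 0 \<le> Re (\<Sum>k<n. \<Sum>l<n. cnj (z k) * z l * Q k l)"
  shows "\<exists>S. \<forall>k<n. \<forall>l<n. Q k l = (\<Sum>m<n. cnj (S m k) * S m l)"
  using assms
proof (induction n arbitrary: Q)
  case 0 then show ?case by simp
next
  case (Suc n)
  note herm = Suc.prems(1) and psd = Suc.prems(2)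
  define d where "d = Re (Q n n)"
  have "Q n n = cnj (Q n n)" using herm[of n n] by simp
  then have dQ: "Q n n = of_real d" by (auto simp: d_def complex_eq_iff)
  have expand: "(\<Sum>k<Suc n. \<Sum>l<Suc n. cnj (z k) * z l * Q k l) =
      (\<Sum>k<n. \<Sum>l<n. cnj (z k) * z l * Q k l) + cnj (z n) * (\<Sum>l<n. Q n l * z l)
      + z n * cnj (\<Sum>l<n. Q n l * z l) + cnj (z n) * z n * of_real d" for z
  proof -
    have "(\<Sum>k<n. cnj (z k) * z n * Q k n) = z n * cnj (\<Sum>l<n. Q n l * z l)"
      unfolding cnj_sum sum_distrib_left
      by (rule sum.cong) (use herm[of _ n] herm[of n] in \<open>auto simp: mult_ac\<close>)
    moreover have "(\<Sum>l<n. cnj (z n) * z l * Q n l) = cnj (z n) * (\<Sum>l<n. Q n l * z l)"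
      unfolding sum_distrib_left by (rule sum.cong) (auto simp: mult_ac)
    ultimately show ?thesis by (simp add: sum.distrib dQ)
  qed
  have d0: "d \<ge> 0"
    using psd[of "\<lambda>k. if k = n then 1 else 0"] unfolding expand by (simp add: if_distrib cong: if_cong)
  have Qn0: "Q n k = 0" if "d = 0" "k < n" for k
  proof (rule ccontr)
    assume ne: "Q n k \<noteq> 0"
    define q where "q = Q n k"
    \<comment> \<open>The test vector with entry 1 at n and - r cnj q at k gives the form the value
      r |q|^2 (r Q k k - 2). This r makes r Q k k at most 1, so the value would be negative.\<close>
    define r where "r = 1 / (\<bar>Re (Q k k)\<bar> + 1)"
    have r: "r > 0" by (simp add: r_def)
    define z where "z = (\<lambda>i. if i = n then 1 else if i = k then - of_real r * cnj q else (0::complex))"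
    have zk: "z i = (if i = k then - of_real r * cnj q else 0)" if "i < n" for i
      using that by (auto simp: z_def)
    have b: "(\<Sum>l<n. Q n l * z l) = - of_real r * q * cnj q"
    proof -
      have "(\<Sum>l<n. Q n l * z l) = (\<Sum>l<n. if l = k then - of_real r * q * cnj q else 0)"
        by (rule sum.cong) (auto simp: zk q_def)
      then show ?thesis using \<open>k < n\<close> by simp
    qed
    have a: "(\<Sum>i<n. \<Sum>l<n. cnj (z i) * z l * Q i l) = of_real (r * r) * (q * cnj q) * Q k k"
    proof -
      have "(\<Sum>l<n. cnj (z i) * z l * Q i l) = cnj (z i) * (- of_real r * cnj q) * Q i k" for i
      proof -
        have "(\<Sum>l<n. cnj (z i) * z l * Q i l) = (\<Sum>l<n. if l = k then cnj (z i) * (- of_real r * cnj q) * Q i k else 0)"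
          by (rule sum.cong) (auto simp: zk)
        then show ?thesis using \<open>k < n\<close> by simp
      qed
      then have "(\<Sum>i<n. \<Sum>l<n. cnj (z i) * z l * Q i l) = (\<Sum>i<n. cnj (z i) * (- of_real r * cnj q) * Q i k)"
        by simp
      also have "\<dots> = (\<Sum>i<n. if i = k then of_real (r * r) * (q * cnj q) * Q k k else 0)"
        by (rule sum.cong) (auto simp: zk)
      finally show ?thesis using \<open>k < n\<close> by simp
    qed
    have qq: "q * cnj q = of_real ((cmod q)\<^sup>2)" by (rule complex_norm_square[symmetric])
    have "0 \<le> Re (of_real (r * r) * of_real ((cmod q)\<^sup>2) * Q k k) - 2 * r * (cmod q)\<^sup>2"
      using psd[of z] unfolding expand a b \<open>d = 0\<close> by (simp add: z_def mult.assoc qq)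
    then have "0 \<le> r * (cmod q)\<^sup>2 * (r * Re (Q k k) - 2)"
      by (simp add: algebra_simps)
    moreover have "r * Re (Q k k) \<le> 1"
      unfolding r_def using abs_ge_self[of "Re (Q k k)"] by (simp add: pos_divide_le_eq add_pos_nonneg)
    moreover have "0 < r * (cmod q)\<^sup>2" using r ne by (simp add: q_def)
    ultimately show False by (simp add: zero_le_mult_iff)
  qed
  \<comment> \<open>The Schur complement. Division by 0 yields 0, so for d = 0 it is just Q
    restricted to the indices below n.\<close>
  define Q' where "Q' k l = Q k l - cnj (Q n k) * Q n l / of_real d" for k l
  have "\<exists>S. \<forall>k<n. \<forall>l<n. Q' k l = (\<Sum>m<n. cnj (S m k) * S m l)"
  proof (rule Suc.IH)
    fix k l assume "k < n" "l < n"
    then show "Q' l k = cnj (Q' k l)" using herm[of k l] by (simp add: Q'_def)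
  next
    fix z :: "nat \<Rightarrow> complex"
    define b where "b = (\<Sum>l<n. Q n l * z l)"
    \<comment> \<open>The last coordinate that minimises the extended quadratic form when d is
      positive, by completing the square; the minimum is the value of the form of the Schur
      complement at z. It is 0 if d = 0.\<close>
    define z' where "z' = z(n := - b / of_real d)"
    have z'z: "z' k = z k" if "k < n" for k using that by (simp add: z'_def)
    have zn: "z' n = - b / of_real d" by (simp add: z'_def)
    have "(\<Sum>k<n. \<Sum>l<n. cnj (z k) * z l * Q' k l) =
        (\<Sum>k<n. \<Sum>l<n. cnj (z k) * z l * Q k l) - (\<Sum>k<n. \<Sum>l<n. cnj (Q n k * z k) * (Q n l * z l) / of_real d)"
      unfolding Q'_def by (simp add: right_diff_distrib sum_subtractf mult_ac)
    also have "(\<Sum>k<n. \<Sum>l<n. cnj (Q n k * z k) * (Q n l * z l) / of_real d) = cnj b * b / of_real d"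
      unfolding b_def cnj_sum sum_product by (simp add: sum_divide_distrib)
    also have "(\<Sum>k<n. \<Sum>l<n. cnj (z k) * z l * Q k l) - cnj b * b / of_real d
       = (\<Sum>k<Suc n. \<Sum>l<Suc n. cnj (z' k) * z' l * Q k l)"
      unfolding expand by (simp add: z'z zn flip: b_def)
    finally show "0 \<le> Re (\<Sum>k<n. \<Sum>l<n. cnj (z k) * z l * Q' k l)" using psd[of z'] by simp
  qed
  then obtain S where S: "\<And>k l. k < n \<Longrightarrow> l < n \<Longrightarrow> Q' k l = (\<Sum>m<n. cnj (S m k) * S m l)" by blast
  define T where "T m l = (if m = n then Q n l / of_real (sqrt d) else if l < n then S m l else 0)" for m l
  have sq: "cnj (Q n k / of_real (sqrt d)) * (Q n l / of_real (sqrt d)) = cnj (Q n k) * Q n l / of_real d" for k l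
  proof -
    have "complex_of_real (sqrt d) * complex_of_real (sqrt d) = of_real d"
      using d0 by (simp flip: of_real_mult)
    then show ?thesis by simp
  qed
  have T: "(\<Sum>m<Suc n. cnj (T m k) * T m l) = (\<Sum>m<n. if k < n \<and> l < n then cnj (S m k) * S m l else 0) + cnj (Q n k) * Q n l / of_real d" for k l
  proof -
    have "(\<Sum>m<n. cnj (T m k) * T m l) = (\<Sum>m<n. if k < n \<and> l < n then cnj (S m k) * S m l else 0)"
      by (rule sum.cong) (auto simp: T_def)
    then show ?thesis using sq by (simp add: T_def)
  qed
  have "Q k l = (\<Sum>m<Suc n. cnj (T m k) * T m l)" if kl: "k < Suc n" "l < Suc n" for k l
  proof (cases "k < n \<and> l < n")
    case True
    then show ?thesis unfolding T using S[of k l] by (simp add: Q'_def algebra_simps)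
  next
    case False
    then have "k = n \<or> l = n" using kl by auto
    then show ?thesis
    proof (cases "d = 0")
      case True
      then have "Q n i = 0" if "i < Suc n" for i using Qn0 that dQ by (cases "i = n") auto
      then show ?thesis unfolding T using False \<open>k = n \<or> l = n\<close> herm[of n k] kl by auto
    next
      case d: False
      then show ?thesis unfolding T using False \<open>k = n \<or> l = n\<close> herm[of n k] kl dQ by auto
    qed
  qed
  then show ?case by blast
qed

lemma norm_re_part_le: "norm (re_part y) \<le> norm (y::'a::cstar)"
  using norm_triangle_ineq[of y "star y"] by (simp add: re_part_def)

lemma norm_im_part_le: "norm (im_part y) \<le> norm (y::'a::cstar)"
proof -
  have "norm (c *\<^sub>C x) \<le> cmod c * norm x" for c and x :: 'a
  proof -
    have "star (c *\<^sub>C x) * (c *\<^sub>C x) = ((cmod c)\<^sup>2) *\<^sub>R (star x * x)"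
      by (simp add: star_scaleC mult_scaleC_left mult_scaleC_right scaleC_scaleC scaleR_scaleC)
         (metis complex_norm_square of_real_power)
    then have "(norm (c *\<^sub>C x))\<^sup>2 = (cmod c * norm x)\<^sup>2"
      using norm_star_mult_self[of "c *\<^sub>C x"] norm_star_mult_self[of x] by (simp add: power_mult_distrib)
    then show ?thesis by (rule power2_le_imp_le[OF eq_refl]) simp
  qed
  from this[of \<i> "star y - y"] norm_triangle_ineq4[of "star y" y] show ?thesis
    by (simp add: im_part_def)
qed

section \<open>Positive functionals and characters\<close>

definition linear_functional :: "('a::cstar \<Rightarrow> complex) \<Rightarrow> bool" where
  "linear_functional f \<longleftrightarrow> (\<forall>x y. f (x + y) = f x + f y) \<and> (\<forall>c x. f (c *\<^sub>C x) = c * f x)"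

lemma linear_functionalD:
  assumes "linear_functional f"
  shows "f (x + y) = f x + f y" "f (c *\<^sub>C x) = c * f x" "f 0 = 0" "f (- x) = - f x" "f (x - y) = f x - f y"
    "f (r *\<^sub>R x) = of_real r * f x" "f (\<Sum>p\<leftarrow>ps. h p) = (\<Sum>p\<leftarrow>ps. f (h p))"
proof -
  note l = assms[unfolded linear_functional_def]
  show add: "f (x + y) = f x + f y" for x y using l by blast
  show "f (c *\<^sub>C x) = c * f x" for c x using l by blast
  then show s: "f (r *\<^sub>R x) = of_real r * f x" for r x by (simp add: scaleR_scaleC)
  show z: "f 0 = 0" using add[of 0 0] by simp
  show m: "f (- x) = - f x" for x using s[of "-1" x] by simp
  show "f (x - y) = f x - f y" using add[of x "- y"] m[of y] by simp
  show "f (\<Sum>p\<leftarrow>ps. h p) = (\<Sum>p\<leftarrow>ps. f (h p))"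
    by (induction ps) (simp_all add: z add)
qed

definition pos_functional :: "('a::cstar \<Rightarrow> complex) \<Rightarrow> bool" where
  "pos_functional f \<longleftrightarrow> linear_functional f \<and> (\<forall>y. Im (f (star y * y)) = 0 \<and> 0 \<le> Re (f (star y * y)))"

lemma pos_functional_pos: "pos_functional f \<Longrightarrow> pos p \<Longrightarrow> Im (f p) = 0 \<and> 0 \<le> Re (f p)"
  unfolding pos_functional_def pos_def sa_def by metis

lemma pos_functional_sa:
  assumes f: "pos_functional f" and y: "sa y" shows "Im (f y) = 0"
proof -
  have l: "linear_functional f" using f by (simp add: pos_functional_def)
  have "Im (f (norm y *\<^sub>R 1 - y)) = 0" using pos_functional_pos[OF f pos_norm_minus[OF y order_refl]] by simp
  moreover have "Im (f 1) = 0" using pos_functional_pos[OF f pos_one] by simp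
  ultimately show ?thesis by (simp add: linear_functionalD[OF l])
qed

lemma pos_functional_star:
  assumes f: "pos_functional f" shows "f (star y) = cnj (f y)"
proof -
  have l: "linear_functional f" using f by (simp add: pos_functional_def)
  have "f (star y) = f (re_part y) - \<i> * f (im_part y)"
    unfolding re_im_star[of y] by (simp add: linear_functionalD[OF l])
  moreover have "f y = f (re_part y) + \<i> * f (im_part y)"
    by (subst re_im_decomp[of y]) (simp add: linear_functionalD[OF l])
  ultimately show ?thesis
    using pos_functional_sa[OF f sa_re_part[of y]] pos_functional_sa[OF f sa_im_part[of y]]
    by (simp add: complex_eq_iff)
qed

definition character :: "('a::cstar \<Rightarrow> complex) \<Rightarrow> bool" where
  "character x \<longleftrightarrow> linear_functional x \<and> x 1 = 1 \<and> (\<forall>a b. x (a * b) = x a * x b) \<and> (\<forall>a. x (star a) = cnj (x a))"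

text \<open>Think of f as a measure: some point x of its support satisfies x(z) \<le> mean of z + e.
  The cone L holds the elements y that are nonnegative for f, in the sense that f (star k k y) has
  nonnegative real part for all k. With t the mean of z plus e and u = t - z, the value of f at -u
  is - e f(1), so -u is outside L. The state obtained is a character since every element is
  central.\<close>

lemma exists_character:
  fixes f :: "'a::cstar \<Rightarrow> complex"
  assumes comm: "\<And>x y::'a. x * y = y * x" and f: "pos_functional f" and f1: "0 < Re (f 1)"
    and R: "\<forall>r\<in>R. \<forall>a. f (r * a) = ch r * f a" and z: "sa z" and e: "e > 0"
  obtains x where "character x" "\<forall>r\<in>R. x r = ch r"
    "Re (f 1) * Re (x z) \<le> Re (f z) + e * Re (f 1)"
proof -
  have l: "linear_functional f" using f by (simp add: pos_functional_def)
  note fl = linear_functionalD[OF l]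
  define t where "t = Re (f z) / Re (f 1) + e"
  define u where "u = t *\<^sub>R 1 - z"
  define L where "L = {y. sa y \<and> (\<forall>k. 0 \<le> Re (f (star k * k * y)))}"
  have cen: "central c" for c :: 'a by (simp add: central_def comm[of _ c])
  have L: "mcone L" unfolding mcone_def
  proof (intro conjI ballI allI impI)
    fix m assume "m \<in> L" then show "sa m" by (simp add: L_def)
  next
    fix m n assume "m \<in> L" "n \<in> L" then show "m + n \<in> L"
      by (simp add: L_def sa_add distrib_left fl)
  next
    fix y :: 'a
    have "0 \<le> Re (f (star k * k * (star y * y)))" for k
    proof -
      have "star k * k * (star y * y) = star (k * y) * (k * y)"
        unfolding star_mult by (metis comm mult.assoc)
      then show ?thesis using f by (simp add: pos_functional_def)
    qed
    then show "star y * y \<in> L" by (simp add: L_def sa_star_mult)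
  next
    fix c m :: 'a assume c: "sa c" and m: "m \<in> L"
    have "0 \<le> Re (f (star k * k * (c * c * m)))" for k
    proof -
      have "star k * k * (c * c * m) = star (k * c) * (k * c) * m"
        unfolding star_mult using c unfolding sa_def by (metis comm mult.assoc)
      then show ?thesis using m by (simp add: L_def)
    qed
    moreover have "sa (c * c * m)" using c m by (intro sa_central_mult cen) (auto simp: L_def)
    ultimately show "c * c * m \<in> L" by (simp add: L_def)
  qed
  have "Re (f (star 1 * 1 * (- u))) = - (e * Re (f 1))"
    using f1 by (simp add: u_def fl t_def field_simps)
  then have un: "- u \<notin> L" using e f1 unfolding L_def by (smt (verit) mem_Collect_eq mult_pos_pos)
  have "sa u" using z by (simp add: u_def sa_intros)
  from exists_central_state[OF L this un] obtain x where
    x: "\<And>a b. x (a + b) = x a + x b" "\<And>c a. x (c *\<^sub>C a) = c * x a" "x 1 = 1"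
    and xL: "\<And>l. l \<in> L \<Longrightarrow> Im (x l) = 0 \<and> Re (x l) \<ge> 0" and xu: "Re (x u) \<ge> 0"
    and xm: "\<And>c y. central c \<Longrightarrow> x (c * y) = x c * x y" by blast
  have lx: "linear_functional x" using x by (simp add: linear_functional_def)
  note xl = linear_functionalD[OF lx]
  have "star y * y \<in> L" for y using L by (simp add: mcone_def)
  then have px: "pos_functional x" using lx xL by (simp add: pos_functional_def)
  have ch: "character x"
    unfolding character_def using lx x(3) xm[OF cen] pos_functional_star[OF px] by blast
  \<comment> \<open>If f annihilates all multiples of w, then w and -w both lie in L and x must
    vanish at w. Applied to the real and imaginary parts of r - ch r, this shows that x extends
    \<open>ch\<close> on R.\<close>
  have null: "x w = 0" if w: "sa w" "\<And>a. f (w * a) = 0" for w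
  proof -
    have "f (star k * k * w) = 0" for k using w(2)[of "star k * k"] by (simp add: comm[of w])
    then have "w \<in> L" "- w \<in> L" using w(1) by (simp_all add: L_def sa_minus fl)
    then show ?thesis using xL[of w] xL[of "- w"] by (simp add: xl complex_eq_iff)
  qed
  have "x r = ch r" if r: "r \<in> R" for r
  proof -
    define w where "w = r - ch r *\<^sub>C 1"
    have w0: "f (w * a) = 0" for a using R r by (simp add: w_def left_diff_distrib fl mult_scaleC_left)
    have ws: "f (star w * a) = 0" for a
      using pos_functional_star[OF f, of "star a * w"] w0[of "star a"] by (simp add: star_mult comm[of w])
    have "f (re_part w * a) = 0" "f (im_part w * a) = 0" for a
      using w0[of a] ws[of a] by (simp_all add: re_part_def im_part_def distrib_right left_diff_distrib fl mult_scaleC_left)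
    then have "x (re_part w) = 0" "x (im_part w) = 0"
      by (auto intro!: null sa_re_part sa_im_part)
    then have "x w = 0" by (subst re_im_decomp) (simp add: xl)
    then show ?thesis by (simp add: w_def xl x(3))
  qed
  moreover have "Re (f 1) * Re (x z) \<le> Re (f z) + e * Re (f 1)"
    using xu f1 by (simp add: u_def xl x(3) t_def field_simps)
  ultimately show ?thesis using that[OF ch] by blast
qed

text \<open>Each of \<open>N\<close> independent steps multiplies by \<open>b\<close> (success) or \<open>c\<close> (failure), where
  \<open>b\<^sup>2 = a\<close> and \<open>c\<^sup>2 = 1 - a\<close>; \<open>s\<close> counts the successes, and the second sum is their variance.\<close>
lemma binomial_partition:
  fixes a :: "'a::cstar"
  assumes comm: "\<And>x y::'a. x * y = y * x" and b: "sa b" "b * b = a" and c: "sa c" "c * c = 1 - a"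
  shows "\<exists>ps :: ('a \<times> real) list. (\<forall>p\<in>set ps. sa (fst p)) \<and> (\<Sum>p\<leftarrow>ps. fst p * fst p) = 1 \<and>
    (\<Sum>p\<leftarrow>ps. fst p * fst p * ((real N *\<^sub>R a - snd p *\<^sub>R 1) * (real N *\<^sub>R a - snd p *\<^sub>R 1))) = real N *\<^sub>R (a * (1 - a))"
proof (induction N)
  case 0 show ?case by (rule exI[of _ "[(1, 0)]"]) simp
next
  case (Suc N)
  then obtain ps :: "('a \<times> real) list" where ps: "\<And>p. p \<in> set ps \<Longrightarrow> sa (fst p)"
    "(\<Sum>p\<leftarrow>ps. fst p * fst p) = 1"
    "(\<Sum>p\<leftarrow>ps. fst p * fst p * ((real N *\<^sub>R a - snd p *\<^sub>R 1) * (real N *\<^sub>R a - snd p *\<^sub>R 1))) = real N *\<^sub>R (a * (1 - a))"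
    by blast
  have lcomm: "x * (y * z) = y * (x * z)" for x y z :: 'a by (metis comm mult.assoc)
  define qs where "qs = map (\<lambda>p. (b * fst p, snd p + 1)) ps @ map (\<lambda>p. (c * fst p, snd p)) ps"
  have bb: "(b * g) * (b * g) = a * (g * g)" and cc: "(c * g) * (c * g) = (1 - a) * (g * g)" for g
    using b(2) c(2) by (metis comm mult.assoc)+
  have "sa (fst q)" if "q \<in> set qs" for q
    using that ps(1) b(1) c(1) by (auto simp: qs_def intro!: sa_mult comm)
  moreover have "(\<Sum>p\<leftarrow>qs. fst p * fst p) = (\<Sum>p\<leftarrow>ps. a * (fst p * fst p) + (1 - a) * (fst p * fst p))"
    by (simp add: qs_def o_def bb cc sum_list_addf)
  then have "(\<Sum>p\<leftarrow>qs. fst p * fst p) = 1" using ps(2) by (simp add: left_diff_distrib)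
  moreover have "(\<Sum>p\<leftarrow>qs. fst p * fst p * ((real (Suc N) *\<^sub>R a - snd p *\<^sub>R 1) * (real (Suc N) *\<^sub>R a - snd p *\<^sub>R 1)))
      = (\<Sum>p\<leftarrow>ps. fst p * fst p * ((real N *\<^sub>R a - snd p *\<^sub>R 1) * (real N *\<^sub>R a - snd p *\<^sub>R 1)) + (fst p * fst p) * (a * (1 - a)))"
  proof -
    \<comment> \<open>One step changes the centred count X by a - 1 with weight a and by a with
      weight 1 - a. Its mean is zero, so the mixed terms cancel and the variance grows by a (1 -
      a).\<close>
    have id: "a * gg * ((X + a - 1) * (X + a - 1)) + (1 - a) * gg * ((X + a) * (X + a)) = gg * (X * X) + gg * (a * (1 - a))"
      for gg X :: 'a
      by (simp add: algebra_simps comm lcomm)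
    have s1: "real (Suc N) *\<^sub>R a - (s + 1) *\<^sub>R 1 = (real N *\<^sub>R a - s *\<^sub>R 1) + a - 1"
      and s2: "real (Suc N) *\<^sub>R a - s *\<^sub>R 1 = (real N *\<^sub>R a - s *\<^sub>R 1) + a" for s
      by (simp_all add: algebra_simps)
    show ?thesis
      unfolding qs_def map_append sum_list_append map_map o_def fst_conv snd_conv s1 bb cc
      unfolding s2 sum_list_addf[symmetric] id ..
  qed
  then have "(\<Sum>p\<leftarrow>qs. fst p * fst p * ((real (Suc N) *\<^sub>R a - snd p *\<^sub>R 1) * (real (Suc N) *\<^sub>R a - snd p *\<^sub>R 1)))
      = real (Suc N) *\<^sub>R (a * (1 - a))"
    by (simp only: sum_list_addf sum_list_mult_const ps(2,3) mult_1_left)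
       (simp add: scaleR_add_left add.commute)
  ultimately show ?case by blast
qed

lemma scaleR_sum_list: "r *\<^sub>R (\<Sum>p\<leftarrow>ps. h p) = (\<Sum>p\<leftarrow>ps. r *\<^sub>R (h p :: 'b::real_vector))"
  by (induction ps) (simp_all add: scaleR_add_right)

lemma sum_list_product:
  "(\<Sum>p\<leftarrow>List.product xs ys. h (fst p) (snd p)) = (\<Sum>x\<leftarrow>xs. \<Sum>y\<leftarrow>ys. h x y)"
  by (induction xs) (simp_all add: o_def)

text \<open>The product of binomial partitions, one for each list element, with counts divided by N.
  The variance per element falls to a (1 - a) / N, the estimate of the weak law of large numbers: on
  the piece p the i-th element is close, in mean square, to the number
  \<open>snd p i\<close>.\<close>

lemma joint_partition:
  fixes as :: "'a::cstar list"
  assumes comm: "\<And>x y::'a. x * y = y * x" and as: "\<And>a. a \<in> set as \<Longrightarrow> pos a \<and> pos (1 - a)" and N: "N > 0"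
  shows "\<exists>ps :: ('a \<times> (nat \<Rightarrow> real)) list. (\<forall>p\<in>set ps. sa (fst p)) \<and> (\<Sum>p\<leftarrow>ps. fst p * fst p) = 1 \<and>
    (\<forall>i<length as. (\<Sum>p\<leftarrow>ps. fst p * fst p * ((as ! i - snd p i *\<^sub>R 1) * (as ! i - snd p i *\<^sub>R 1)))
       = (1 / real N) *\<^sub>R (as ! i * (1 - as ! i)))"
  using as
proof (induction as)
  case Nil show ?case by (rule exI[of _ "[(1, \<lambda>_. 0)]"]) simp
next
  case (Cons a as)
  then obtain ps :: "('a \<times> (nat \<Rightarrow> real)) list" where ps: "\<And>p. p \<in> set ps \<Longrightarrow> sa (fst p)"
    "(\<Sum>p\<leftarrow>ps. fst p * fst p) = 1"
    "\<And>i. i < length as \<Longrightarrow> (\<Sum>p\<leftarrow>ps. fst p * fst p * ((as ! i - snd p i *\<^sub>R 1) * (as ! i - snd p i *\<^sub>R 1)))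
       = (1 / real N) *\<^sub>R (as ! i * (1 - as ! i))" by auto
  have lcomm: "x * (y * z) = y * (x * z)" for x y z :: 'a by (metis comm mult.assoc)
  obtain b c where bc: "sa b" "b * b = a" "sa c" "c * c = 1 - a"
    using Cons.prems[of a] unfolding pos_def by auto
  obtain qs :: "('a \<times> real) list" where qs: "\<And>p. p \<in> set qs \<Longrightarrow> sa (fst p)"
    "(\<Sum>p\<leftarrow>qs. fst p * fst p) = 1"
    "(\<Sum>p\<leftarrow>qs. fst p * fst p * ((real N *\<^sub>R a - snd p *\<^sub>R 1) * (real N *\<^sub>R a - snd p *\<^sub>R 1))) = real N *\<^sub>R (a * (1 - a))"
    using binomial_partition[OF comm bc, of N] by blast
  \<comment> \<open>Replacing the count s by the frequency s / N divides the squared deviation by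
    N^2, hence the variance N a (1 - a) by N^2 as well.\<close>
  have qs3: "(\<Sum>p\<leftarrow>qs. fst p * fst p * ((a - (snd p / real N) *\<^sub>R 1) * (a - (snd p / real N) *\<^sub>R 1))) = (1 / real N) *\<^sub>R (a * (1 - a))"
  proof -
    have "real N *\<^sub>R a - s *\<^sub>R 1 = real N *\<^sub>R (a - (s / real N) *\<^sub>R 1)" for s
      using N by (simp add: algebra_simps)
    then have "(real N * real N) *\<^sub>R (\<Sum>p\<leftarrow>qs. fst p * fst p * ((a - (snd p / real N) *\<^sub>R 1) * (a - (snd p / real N) *\<^sub>R 1)))
        = real N *\<^sub>R (a * (1 - a))"
      using qs(3) by (simp add: scaleR_sum_list)
    then have "(1 / (real N * real N)) *\<^sub>R (real N * real N) *\<^sub>R (\<Sum>p\<leftarrow>qs. fst p * fst p * ((a - (snd p / real N) *\<^sub>R 1) * (a - (snd p / real N) *\<^sub>R 1)))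
        = (1 / (real N * real N)) *\<^sub>R (real N *\<^sub>R (a * (1 - a)))" by (rule arg_cong)
    then show ?thesis using N by simp
  qed
  \<comment> \<open>The weights multiply. \<open>case_nat\<close> records the frequency of the new
    head at index 0 and shifts the values of the tail by one, matching the indexing of a #
    as.\<close>
  define rs where "rs = map (\<lambda>z. (fst (fst z) * fst (snd z), case_nat (snd (fst z) / real N) (snd (snd z)))) (List.product qs ps)"
  have sq: "(x * y) * (x * y) = (x * x) * (y * y)" for x y :: 'a by (metis comm mult.assoc)
  have sum: "(\<Sum>r\<leftarrow>rs. fst r * fst r * h (snd r)) =
     (\<Sum>q\<leftarrow>qs. \<Sum>p\<leftarrow>ps. ((fst q * fst q) * (fst p * fst p)) * h (case_nat (snd q / real N) (snd p)))" for h
  proof -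
    have "(\<Sum>r\<leftarrow>rs. fst r * fst r * h (snd r)) = (\<Sum>z\<leftarrow>List.product qs ps.
       ((fst (fst z) * fst (fst z)) * (fst (snd z) * fst (snd z))) * h (case_nat (snd (fst z) / real N) (snd (snd z))))"
      unfolding rs_def map_map o_def fst_conv snd_conv
      by (intro arg_cong[where f=sum_list] map_cong refl arg_cong2[where f="(*)"] sq)
    then show ?thesis
      using sum_list_product[where xs=qs and ys=ps and
          h="\<lambda>q p. ((fst q * fst q) * (fst p * fst p)) * h (case_nat (snd q / real N) (snd p))"] by simp
  qed
  have "sa (fst r)" if "r \<in> set rs" for r
    using that ps(1) qs(1) by (auto simp: rs_def intro!: sa_mult comm)
  moreover have "(\<Sum>r\<leftarrow>rs. fst r * fst r) = 1"
    using sum[of "\<lambda>_. 1"] by (simp add: sum_list_const_mult ps(2) qs(2))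
  moreover have "(\<Sum>r\<leftarrow>rs. fst r * fst r * (((a # as) ! i - snd r i *\<^sub>R 1) * ((a # as) ! i - snd r i *\<^sub>R 1)))
       = (1 / real N) *\<^sub>R ((a # as) ! i * (1 - (a # as) ! i))" if i: "i < length (a # as)" for i
  proof (cases i)
    case 0
    have "(\<Sum>q\<leftarrow>qs. \<Sum>p\<leftarrow>ps. ((fst q * fst q) * (fst p * fst p)) * Z q) = (\<Sum>q\<leftarrow>qs. (fst q * fst q) * Z q)" for Z
    proof -
      have "(\<Sum>p\<leftarrow>ps. ((fst q * fst q) * (fst p * fst p)) * Z q) = (fst q * fst q) * Z q" for q :: "'a \<times> real"
        using ps(2) by (simp add: sum_list_mult_const sum_list_const_mult)
      then show ?thesis by simp
    qed
    from this[of "\<lambda>q. (a - (snd q / real N) *\<^sub>R 1) * (a - (snd q / real N) *\<^sub>R 1)"]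
    show ?thesis using 0 qs3 sum[of "\<lambda>s. ((a - s 0 *\<^sub>R 1) * (a - s 0 *\<^sub>R 1))"] by simp
  next
    case (Suc j)
    have "(\<Sum>q\<leftarrow>qs. \<Sum>p\<leftarrow>ps. ((fst q * fst q) * (fst p * fst p)) * Z p) = (\<Sum>p\<leftarrow>ps. (fst p * fst p) * Z p)" for Z
    proof -
      have "(\<Sum>q\<leftarrow>qs. \<Sum>p\<leftarrow>ps. ((fst q * fst q) * (fst p * fst p)) * Z p) = (\<Sum>q\<leftarrow>qs. (fst q * fst q) * (\<Sum>p\<leftarrow>ps. (fst p * fst p) * Z p))"
        by (simp add: sum_list_const_mult mult.assoc)
      then show ?thesis using qs(2) by (simp add: sum_list_mult_const)
    qed
    from this[of "\<lambda>p. (as ! j - snd p j *\<^sub>R 1) * (as ! j - snd p j *\<^sub>R 1)"]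
    show ?thesis using Suc i ps(3)[of j] sum[of "\<lambda>s. ((as ! j - s (Suc j) *\<^sub>R 1) * (as ! j - s (Suc j) *\<^sub>R 1))"] by simp
  qed
  ultimately show ?case by blast
qed

lemma linear_functional_sum:
  assumes "linear_functional f" shows "f (\<Sum>i\<in>I. h i) = (\<Sum>i\<in>I. f (h i))"
  by (induction I rule: infinite_finite_induct) (simp_all add: linear_functionalD[OF assms])

lemma pos_functional_linear: "pos_functional f \<Longrightarrow> linear_functional f"
  by (simp add: pos_functional_def)

lemma pos_functional_square: "pos_functional f \<Longrightarrow> sa y \<Longrightarrow> 0 \<le> Re (f (y * y))"
  using pos_functional_pos pos_square by blast

text \<open>Parallelogram law: the squares of u + v and u - v sum to 2 u^2 + 2 v^2, and f is
  nonnegative at the square of u - v.\<close>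

lemma pos_functional_add_square:
  assumes f: "pos_functional f" and u: "sa u" and v: "sa v"
  shows "Re (f ((u + v) * (u + v))) \<le> 2 * Re (f (u * u)) + 2 * Re (f (v * v))"
proof -
  note l = linear_functionalD[OF pos_functional_linear[OF f]]
  have "0 \<le> Re (f ((u - v) * (u - v)))" using f u v by (intro pos_functional_square sa_diff)
  moreover have "(u - v) * (u - v) + (u + v) * (u + v) = (u * u + u * u) + (v * v + v * v)"
    by (simp add: algebra_simps)
  then have "f ((u - v) * (u - v)) + f ((u + v) * (u + v)) = f ((u * u + u * u) + (v * v + v * v))"
    by (simp flip: l(1))
  then have "Re (f ((u - v) * (u - v))) + Re (f ((u + v) * (u + v))) = 2 * Re (f (u * u)) + 2 * Re (f (v * v))"
    by (simp add: l(1) complex_eq_iff)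
  ultimately show ?thesis by simp
qed

section \<open>Dilation of a positive kernel to a sum of characters\<close>

text \<open>The model case is phi k l a = f (v_k^* a v_l). \<open>cs\<close> is the Cauchy-Schwarz
  inequality with the geometric mean replaced by a weighted arithmetic mean; the weight t is
  adjusted later. \<open>modular\<close> says that R acts through the scalars
  \<open>ch\<close>.\<close>

locale kernel =
  fixes n :: nat and phi :: "nat \<Rightarrow> nat \<Rightarrow> 'a::cstar \<Rightarrow> complex" and R :: "'a set" and ch :: "'a \<Rightarrow> complex"
  assumes comm: "\<And>x y::'a. x * y = y * x"
    and lin: "\<And>k l. k < n \<Longrightarrow> l < n \<Longrightarrow> linear_functional (phi k l)"
    and herm: "\<And>k l a. k < n \<Longrightarrow> l < n \<Longrightarrow> phi l k (star a) = cnj (phi k l a)"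
    and psd: "\<And>z g. 0 \<le> Re (\<Sum>k<n. \<Sum>l<n. cnj (z k) * z l * phi k l (star g * g))"
    and cs: "\<And>k l t p q. k < n \<Longrightarrow> l < n \<Longrightarrow> t > 0 \<Longrightarrow>
      cmod (phi k l (star p * q)) \<le> (t * Re (phi k k (star p * p)) + Re (phi l l (star q * q)) / t) / 2"
    and modular: "\<And>k l r a. k < n \<Longrightarrow> l < n \<Longrightarrow> r \<in> R \<Longrightarrow> phi k l (r * a) = ch r * phi k l a"
    and nontrivial: "\<exists>k<n. 0 < Re (phi k k 1)"
begin

lemma diag_pos_functional:
  assumes k: "k < n" shows "pos_functional (phi k k)"
  unfolding pos_functional_def
proof (intro conjI allI lin k)
  fix y :: 'a
  have "phi k k (star (star y * y)) = cnj (phi k k (star y * y))" by (rule herm[OF k k])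
  then show "Im (phi k k (star y * y)) = 0" by (simp add: star_mult complex_eq_iff)
  define z where "z i = (if i = k then 1 else 0 :: complex)" for i
  have "(\<Sum>i<n. \<Sum>l<n. cnj (z i) * z l * phi i l (star y * y)) = (\<Sum>i<n. if i = k then phi k k (star y * y) else 0)"
  proof (rule sum.cong[OF refl])
    fix i assume "i \<in> {..<n}"
    have "(\<Sum>l<n. cnj (z i) * z l * phi i l (star y * y)) = (\<Sum>l<n. if l = k then cnj (z i) * phi i k (star y * y) else 0)"
      by (rule sum.cong) (auto simp: z_def)
    then show "(\<Sum>l<n. cnj (z i) * z l * phi i l (star y * y)) = (if i = k then phi k k (star y * y) else 0)"
      using k by (simp add: z_def)
  qed
  then show "0 \<le> Re (phi k k (star y * y))" using psd[of z y] k by simp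
qed

text \<open>The trace of the kernel, localised at the piece g. It dominates every localised diagonal
  functional (\<open>diag_le_psi\<close>), so one character chosen for it serves all indices k and l
  at once.\<close>

definition psi :: "'a \<Rightarrow> 'a \<Rightarrow> complex" where "psi g a = (\<Sum>k<n. phi k k (star g * g * a))"

lemma shuffle: "star g * g * (star y * y) = star (g * y) * (g * (y::'a))"
  unfolding star_mult by (metis comm mult.assoc)

lemma psi_pos_functional: "pos_functional (psi g)"
  unfolding pos_functional_def linear_functional_def
proof (intro conjI allI)
  fix x y c
  show "psi g (x + y) = psi g x + psi g y"
    by (simp add: psi_def distrib_left linear_functionalD[OF lin] sum.distrib)
  show "psi g (c *\<^sub>C x) = c * psi g x"
    by (simp add: psi_def mult_scaleC_right linear_functionalD[OF lin] sum_distrib_left)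
  show "Im (psi g (star y * y)) = 0"
    unfolding psi_def shuffle Im_sum using diag_pos_functional by (intro sum.neutral) (simp add: pos_functional_def)
  show "0 \<le> Re (psi g (star y * y))"
    unfolding psi_def shuffle Re_sum using diag_pos_functional by (intro sum_nonneg) (simp add: pos_functional_def)
qed

lemma diag_le_psi: "l < n \<Longrightarrow> Re (phi l l (star (g * y) * (g * y))) \<le> Re (psi g (star y * y))"
  unfolding psi_def shuffle Re_sum
  using diag_pos_functional
  by (intro member_le_sum[where f="\<lambda>k. Re (phi k k (star (g * y) * (g * y)))"]) (auto simp: pos_functional_def)

text \<open>If \<open>psi g\<close> has no mass, both sides of the bound are harmless, but a
  character extending \<open>ch\<close> is still demanded; it is taken from some diagonal functional
  with positive mass.\<close>

lemma exists_character_psi: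
  assumes z: "pos z" and e: "e > 0"
  obtains x where "character x" "\<forall>r\<in>R. x r = ch r"
    "Re (psi g 1) * Re (x z) \<le> Re (psi g z) + e * Re (psi g 1)"
proof (cases "Re (psi g 1) > 0")
  case True
  have R: "\<forall>r\<in>R. \<forall>a. psi g (r * a) = ch r * psi g a"
  proof (intro ballI allI)
    fix r a assume r: "r \<in> R"
    have "star g * g * (r * a) = r * (star g * g * a)" by (metis comm mult.assoc)
    then show "psi g (r * a) = ch r * psi g a" by (simp add: psi_def modular[OF _ _ r] sum_distrib_left)
  qed
  show ?thesis
    by (rule exists_character[OF comm psi_pos_functional True R pos_sa[OF z] e]) (rule that)
next
  case False
  moreover have "0 \<le> Re (psi g 1)" using pos_functional_pos[OF psi_pos_functional pos_one] by blast
  ultimately have 0: "Re (psi g 1) = 0" by simp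
  obtain k where k: "k < n" "0 < Re (phi k k 1)" using nontrivial by blast
  have R: "\<forall>r\<in>R. \<forall>a. phi k k (r * a) = ch r * phi k k a" using modular[OF k(1) k(1)] by blast
  obtain x where x: "character x" "\<forall>r\<in>R. x r = ch r"
    using exists_character[OF comm diag_pos_functional[OF k(1)] k(2) R sa_zero e] by metis
  have "0 \<le> Re (psi g z)" using pos_functional_pos[OF psi_pos_functional z] by blast
  then show ?thesis using 0 by (intro that[OF x]) simp
qed

lemma kernel_factor:
  "\<exists>S. \<forall>k<n. \<forall>l<n. phi k l (star g * g) = (\<Sum>m<n. cnj (S m k) * S m l)"
proof (rule psd_kernel_factor)
  fix k l assume "k < n" "l < n"
  then show "phi l k (star g * g) = cnj (phi k l (star g * g))"
    using herm[of k l "star g * g"] by (simp add: star_mult)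
qed (rule psd)

lemma character_sa:
  assumes x: "character x" and a: "sa a" shows "x a = of_real (Re (x a))"
proof -
  have "x a = cnj (x a)" using x a unfolding character_def sa_def by metis
  then show ?thesis by (simp add: complex_eq_iff)
qed

text \<open>A piece p carries a weight G p and one character X p, and the matrix phi k l (G p G p)
  is factored into n vectors. The weights square to a partition of 1, so the Gram matrix is exact.
  For a coefficient of a, the error on p is phi k l applied to G p G p (xi p - a), where xi p is the
  value of X p at a; Cauchy-Schwarz reduces it to the mean square deviation of a from xi p,
  controlled by the variance of the partition and by the choice of X p.\<close>

lemma dilation_of_contractions:
  assumes as: "\<And>a. a \<in> set as \<Longrightarrow> pos a \<and> pos (1 - a)" and e: "e > 0"
  shows "\<exists>rs :: (('a \<Rightarrow> complex) \<times> (nat \<Rightarrow> complex)) list.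
    (\<forall>r\<in>set rs. character (fst r) \<and> (\<forall>b\<in>R. fst r b = ch b)) \<and>
    (\<forall>k<n. \<forall>l<n. (\<Sum>r\<leftarrow>rs. cnj (snd r k) * snd r l) = phi k l 1) \<and>
    (\<forall>a\<in>set as. \<forall>k<n. \<forall>l<n. cmod ((\<Sum>r\<leftarrow>rs. cnj (snd r k) * snd r l * fst r a) - phi k l a) \<le> e)"
proof -
  define D where "D = (\<Sum>k<n. Re (phi k k 1))"
  have diag1: "0 \<le> Re (phi k k 1)" if "k < n" for k
    using pos_functional_pos[OF diag_pos_functional[OF that] pos_one] by blast
  have leD: "Re (phi k k 1) \<le> D" if "k < n" for k
    unfolding D_def using diag1 that by (intro member_le_sum[where f="\<lambda>k. Re (phi k k 1)"]) auto
  have D: "D > 0" using nontrivial leD by force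
  define q where "q = length as"
  \<comment> \<open>K / N is the total variance over all list elements and diagonal indices. The
    constants are tuned to t D = e, 4 K / N \<le> t e / 2 and 2 dl D = t e / 2: then both terms of
    the Cauchy-Schwarz bound are at most e, and so is half their sum.\<close>
  define K where "K = (\<Sum>j<q. \<Sum>k<n. Re (phi k k (as ! j * (1 - as ! j))))"
  define t where "t = e / D"
  have t: "t > 0" "t * D = e" using e D by (auto simp: t_def)
  define dl where "dl = t * e / (4 * D)"
  have dl: "dl > 0" using t e D by (simp add: dl_def)
  obtain N :: nat where N: "8 * \<bar>K\<bar> / (t * e) < real N" using reals_Archimedean2 by blast
  have te: "t * e > 0" using t e by simp
  have "0 \<le> 8 * \<bar>K\<bar> / (t * e)" using te by simp
  with N have "real N > 0" by linarith
  then have N0: "N > 0" by simp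
  have "8 * \<bar>K\<bar> < real N * (t * e)" using N te by (simp add: pos_divide_less_eq)
  then have "8 * K \<le> real N * (t * e)" by linarith
  then have KN: "4 * (K / real N) \<le> t * e / 2" using \<open>real N > 0\<close> by (simp add: field_simps)
  obtain ps :: "('a \<times> (nat \<Rightarrow> real)) list" where ps: "\<And>p. p \<in> set ps \<Longrightarrow> sa (fst p)"
    "(\<Sum>p\<leftarrow>ps. fst p * fst p) = 1"
    "\<And>i. i < length as \<Longrightarrow> (\<Sum>p\<leftarrow>ps. fst p * fst p * ((as ! i - snd p i *\<^sub>R 1) * (as ! i - snd p i *\<^sub>R 1)))
       = (1 / real N) *\<^sub>R (as ! i * (1 - as ! i))"
    using joint_partition[OF comm as N0] by blast
  define P where "P = length ps"
  define G where "G p = fst (ps ! p)" for p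
  define lam where "lam p = snd (ps ! p)" for p
  define v where "v p j = (as ! j - lam p j *\<^sub>R 1)" for p j
  have saG: "sa (G p)" if "p < P" for p using ps(1) that by (simp add: G_def P_def)
  have G1: "(\<Sum>p<P. G p * G p) = 1"
    using ps(2) by (simp add: sum_list_sum_nth G_def P_def lessThan_atLeast0)
  have Gv: "(\<Sum>p<P. G p * G p * (v p j * v p j)) = (1 / real N) *\<^sub>R (as ! j * (1 - as ! j))" if "j < q" for j
    using ps(3)[of j] that by (simp add: sum_list_sum_nth G_def P_def lam_def v_def q_def lessThan_atLeast0)
  have saas: "sa (as ! j)" if "j < q" for j using as[of "as ! j"] that by (simp add: q_def pos_sa)
  have sav: "sa (v p j)" if "j < q" for p j using saas[OF that] by (simp add: v_def sa_intros)
  \<comment> \<open>The squared deviations of all list elements from their nominal values on p are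
    added, so that a single inequality for X p controls every element simultaneously.\<close>
  define z where "z p = (\<Sum>j<q. v p j * v p j)" for p
  have pos_sum: "pos (\<Sum>j\<in>I. v p j * v p j)" if "I \<subseteq> {..<q}" for p I
    using finite_subset[OF that] that
    by (induction I) (auto intro!: pos_add pos_square sav)
  have posz: "pos (z p)" for p unfolding z_def by (rule pos_sum) simp
  have "\<forall>p. \<exists>x. character x \<and> (\<forall>b\<in>R. x b = ch b) \<and>
      Re (psi (G p) 1) * Re (x (z p)) \<le> Re (psi (G p) (z p)) + dl * Re (psi (G p) 1)"
    using exists_character_psi[OF posz dl] by metis
  from choice[OF this] obtain X where X0: "\<forall>p. character (X p) \<and> (\<forall>b\<in>R. X p b = ch b) \<and>
      Re (psi (G p) 1) * Re (X p (z p)) \<le> Re (psi (G p) (z p)) + dl * Re (psi (G p) 1)" by (rule exE)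
  have X: "\<And>p. character (X p)" "\<And>p b. b \<in> R \<Longrightarrow> X p b = ch b"
    "\<And>p. Re (psi (G p) 1) * Re (X p (z p)) \<le> Re (psi (G p) (z p)) + dl * Re (psi (G p) 1)" using X0 by blast+
  have "\<forall>p. \<exists>S. \<forall>k<n. \<forall>l<n. phi k l (star (G p) * G p) = (\<Sum>m<n. cnj (S m k) * S m l)"
    using kernel_factor by (rule allI)
  from choice[OF this] obtain S where
    S0: "\<forall>p. \<forall>k<n. \<forall>l<n. phi k l (star (G p) * G p) = (\<Sum>m<n. cnj (S p m k) * S p m l)" by (rule exE)
  have S: "\<And>p k l. k < n \<Longrightarrow> l < n \<Longrightarrow> phi k l (star (G p) * G p) = (\<Sum>m<n. cnj (S p m k) * S p m l)"
    using S0 by blast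
  \<comment> \<open>Each piece contributes n one-dimensional summands with the same character; their
    vectors are the rows of its Cholesky factor.\<close>
  define rs where "rs = concat (map (\<lambda>p. map (\<lambda>m. (X p, S p m)) [0..<n]) [0..<P])"
  have rs_sum: "(\<Sum>r\<leftarrow>rs. h (fst r) (snd r)) = (\<Sum>p<P. \<Sum>m<n. h (X p) (S p m))" for h :: "('a \<Rightarrow> complex) \<Rightarrow> (nat \<Rightarrow> complex) \<Rightarrow> complex"
  proof -
    have "(\<Sum>r\<leftarrow>concat (map (\<lambda>p. map (\<lambda>m. (X p, S p m)) [0..<n]) xs). h (fst r) (snd r)) = (\<Sum>p\<leftarrow>xs. \<Sum>m<n. h (X p) (S p m))" for xs
      by (induction xs) (simp_all add: o_def interv_sum_list_conv_sum_set_nat lessThan_atLeast0)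
    from this[of "[0..<P]"] show ?thesis
      by (simp add: rs_def interv_sum_list_conv_sum_set_nat lessThan_atLeast0)
  qed
  have GG: "star (G p) * G p = G p * G p" if "p < P" for p using saG[OF that] by (simp add: sa_def)
  have gram: "(\<Sum>p<P. \<Sum>m<n. cnj (S p m k) * S p m l * c p) = (\<Sum>p<P. phi k l (G p * G p) * c p)" if kl: "k < n" "l < n" for k l c
    by (rule sum.cong) (simp_all add: S[OF kl] sum_distrib_right flip: GG)
  have 1: "(\<Sum>r\<leftarrow>rs. cnj (snd r k) * snd r l) = phi k l 1" if kl: "k < n" "l < n" for k l
    using rs_sum[of "\<lambda>x s. cnj (s k) * s l"] gram[OF kl, of "\<lambda>_. 1"] G1
    by (simp flip: linear_functional_sum[OF lin[OF kl]])
  have psi1: "(\<Sum>p<P. Re (psi (G p) 1)) = D"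
  proof -
    have "(\<Sum>p<P. Re (psi (G p) 1)) = (\<Sum>k<n. \<Sum>p<P. Re (phi k k (G p * G p)))"
      unfolding psi_def Re_sum by (subst sum.swap) (auto intro!: sum.cong simp: GG)
    also have "\<dots> = D" unfolding D_def
      by (rule sum.cong) (simp_all add: G1 flip: Re_sum linear_functional_sum[OF lin])
    finally show ?thesis .
  qed
  have psiz: "(\<Sum>p<P. Re (psi (G p) (z p))) = K / real N"
  proof -
    have "(\<Sum>p<P. Re (psi (G p) (z p))) = (\<Sum>p<P. \<Sum>j<q. \<Sum>k<n. Re (phi k k (G p * G p * (v p j * v p j))))"
    proof (rule sum.cong[OF refl])
      fix p assume "p \<in> {..<P}"
      then show "Re (psi (G p) (z p)) = (\<Sum>j<q. \<Sum>k<n. Re (phi k k (G p * G p * (v p j * v p j))))"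
        by (subst sum.swap) (simp add: psi_def z_def GG sum_distrib_left linear_functional_sum[OF lin])
    qed
    also have "\<dots> = (\<Sum>j<q. \<Sum>k<n. \<Sum>p<P. Re (phi k k (G p * G p * (v p j * v p j))))"
      by (subst sum.swap, rule sum.cong[OF refl], rule sum.swap)
    also have "\<dots> = (\<Sum>j<q. \<Sum>k<n. (1 / real N) * Re (phi k k (as ! j * (1 - as ! j))))"
    proof (intro sum.cong refl)
      fix j k assume "j \<in> {..<q}" "k \<in> {..<n}"
      then have jk: "j < q" "k < n" by auto
      have "(\<Sum>p<P. Re (phi k k (G p * G p * (v p j * v p j)))) = Re (phi k k (\<Sum>p<P. G p * G p * (v p j * v p j)))"
        by (simp add: linear_functional_sum[OF lin[OF jk(2) jk(2)]])
      also have "\<dots> = (1 / real N) * Re (phi k k (as ! j * (1 - as ! j)))"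
        unfolding Gv[OF jk(1)] linear_functionalD(6)[OF lin[OF jk(2) jk(2)]] by simp
      finally show "(\<Sum>p<P. Re (phi k k (G p * G p * (v p j * v p j)))) = (1 / real N) * Re (phi k k (as ! j * (1 - as ! j)))" .
    qed
    also have "\<dots> = K / real N" by (simp add: K_def sum_divide_distrib)
    finally show ?thesis .
  qed
  have 2: "cmod ((\<Sum>r\<leftarrow>rs. cnj (snd r k) * snd r l * fst r a) - phi k l a) \<le> e"
    if a: "a \<in> set as" and kl: "k < n" "l < n" for a k l
  proof -
    obtain i where i: "i < q" "as ! i = a" using a by (auto simp: in_set_conv_nth q_def)
    have saa: "sa a" using saas[OF i(1)] i(2) by simp
    define xi where "xi p = Re (X p a)" for p
    have Xa: "X p a = of_real (xi p)" for p using character_sa[OF X(1) saa] by (simp add: xi_def)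
    define y where "y p = xi p *\<^sub>R 1 - a" for p
    have say: "sa (y p)" for p using saa by (simp add: y_def sa_intros)
    have "(\<Sum>r\<leftarrow>rs. cnj (snd r k) * snd r l * fst r a) = (\<Sum>p<P. phi k l (G p * G p) * of_real (xi p))"
      using rs_sum[of "\<lambda>x s. cnj (s k) * s l * x a"] gram[OF kl, of "\<lambda>p. of_real (xi p)"] by (simp add: Xa)
    moreover have "phi k l a = (\<Sum>p<P. phi k l (G p * G p * a))"
      using G1 by (simp flip: linear_functional_sum[OF lin[OF kl]] sum_distrib_right)
    moreover have "phi k l (star (G p) * (G p * y p)) = phi k l (G p * G p) * of_real (xi p) - phi k l (G p * G p * a)"
      if "p < P" for p
    proof -
      have "star (G p) * (G p * y p) = (star (G p) * G p) * y p" by (simp only: mult.assoc)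
      also have "\<dots> = xi p *\<^sub>R (G p * G p) - G p * G p * a"
        unfolding GG[OF that] by (simp add: y_def right_diff_distrib)
      finally show ?thesis by (simp add: linear_functionalD[OF lin[OF kl]])
    qed
    ultimately have "(\<Sum>r\<leftarrow>rs. cnj (snd r k) * snd r l * fst r a) - phi k l a = (\<Sum>p<P. phi k l (star (G p) * (G p * y p)))"
      by (simp add: sum_subtractf)
    also have "cmod \<dots> \<le> (\<Sum>p<P. (t * Re (phi k k (G p * G p)) + (4 * Re (psi (G p) (z p)) + 2 * dl * Re (psi (G p) 1)) / t) / 2)"
    proof (rule sum_norm_le)
      fix p assume "p \<in> {..<P}"
      then have p: "p < P" by simp
      note f = psi_pos_functional[of "G p"]
      note fl = linear_functionalD[OF pos_functional_linear[OF f]]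
      note xl = X(1)[of p, unfolded character_def]
      \<comment> \<open>The deviation of a from xi p is split at the nominal value lam p i. The part
        a - lam p i is measured by the variance; the part xi p - lam p i is the value of X p at v p
        i, and its square is at most X p (z p).\<close>
      have yeq: "y p = (xi p - lam p i) *\<^sub>R 1 + (- v p i)" by (simp add: y_def v_def i(2) algebra_simps)
      have "Re (phi l l (star (G p * y p) * (G p * y p))) \<le> Re (psi (G p) (y p * y p))"
        using diag_le_psi[OF kl(2), of "G p" "y p"] say[of p] by (simp add: sa_def)
      also have "Re (psi (G p) (y p * y p)) = Re (psi (G p) (((xi p - lam p i) *\<^sub>R 1 + - v p i) * ((xi p - lam p i) *\<^sub>R 1 + - v p i)))"
        by (simp only: yeq)
      also have "Re (psi (G p) (((xi p - lam p i) *\<^sub>R 1 + - v p i) * ((xi p - lam p i) *\<^sub>R 1 + - v p i)))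
          \<le> 2 * Re (psi (G p) ((xi p - lam p i) *\<^sub>R 1 * (xi p - lam p i) *\<^sub>R 1)) + 2 * Re (psi (G p) (- v p i * - v p i))"
        by (rule pos_functional_add_square[OF f]) (auto intro: sa_intros sav[OF i(1)])
      also have "\<dots> = 2 * ((xi p - lam p i)\<^sup>2 * Re (psi (G p) 1)) + 2 * Re (psi (G p) (v p i * v p i))"
        by (simp add: fl power2_eq_square)
      finally have A: "Re (phi l l (star (G p * y p) * (G p * y p)))
          \<le> 2 * ((xi p - lam p i)\<^sup>2 * Re (psi (G p) 1)) + 2 * Re (psi (G p) (v p i * v p i))" .
      have zsplit: "z p = v p i * v p i + (\<Sum>j\<in>{..<q}-{i}. v p j * v p j)"
        unfolding z_def using i(1) by (simp add: sum.remove)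
      have rest: "pos (\<Sum>j\<in>{..<q}-{i}. v p j * v p j)" by (rule pos_sum) auto
      have B: "Re (psi (G p) (v p i * v p i)) \<le> Re (psi (G p) (z p))"
        using pos_functional_pos[OF f rest] by (simp add: zsplit fl)
      have Xv: "X p (v p i) = of_real (xi p - lam p i)"
        using xl by (simp add: v_def i(2) linear_functionalD Xa)
      have pX: "pos_functional (X p)"
        unfolding pos_functional_def using xl by simp
      have "Re (X p (z p)) \<ge> (xi p - lam p i)\<^sup>2"
        using pos_functional_pos[OF pX rest] xl by (simp add: zsplit linear_functionalD Xv power2_eq_square)
      then have "Re (psi (G p) 1) * (xi p - lam p i)\<^sup>2 \<le> Re (psi (G p) 1) * Re (X p (z p))"
        using pos_functional_pos[OF f pos_one] by (intro mult_left_mono) auto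
      with X(3)[of p] have "(xi p - lam p i)\<^sup>2 * Re (psi (G p) 1) \<le> Re (psi (G p) (z p)) + dl * Re (psi (G p) 1)"
        by (simp add: mult.commute)
      with A B have C: "Re (phi l l (star (G p * y p) * (G p * y p))) \<le> 4 * Re (psi (G p) (z p)) + 2 * dl * Re (psi (G p) 1)"
        by linarith
      have "cmod (phi k l (star (G p) * (G p * y p)))
          \<le> (t * Re (phi k k (star (G p) * G p)) + Re (phi l l (star (G p * y p) * (G p * y p))) / t) / 2"
        by (rule cs[OF kl t(1)])
      also have "\<dots> \<le> (t * Re (phi k k (G p * G p)) + (4 * Re (psi (G p) (z p)) + 2 * dl * Re (psi (G p) 1)) / t) / 2"
        using C t(1) by (simp add: GG[OF p] divide_right_mono)
      finally show "cmod (phi k l (star (G p) * (G p * y p)))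
          \<le> (t * Re (phi k k (G p * G p)) + (4 * Re (psi (G p) (z p)) + 2 * dl * Re (psi (G p) 1)) / t) / 2" .
    qed
    also have "\<dots> = (t * (\<Sum>p<P. Re (phi k k (G p * G p))) + (4 * (\<Sum>p<P. Re (psi (G p) (z p))) + 2 * dl * (\<Sum>p<P. Re (psi (G p) 1))) / t) / 2"
      by (simp add: sum.distrib sum_distrib_left flip: sum_divide_distrib)
    also have "(\<Sum>p<P. Re (phi k k (G p * G p))) = Re (phi k k 1)"
      using G1 by (simp flip: Re_sum linear_functional_sum[OF lin[OF kl(1) kl(1)]])
    also have "(t * Re (phi k k 1) + (4 * (\<Sum>p<P. Re (psi (G p) (z p))) + 2 * dl * (\<Sum>p<P. Re (psi (G p) 1))) / t) / 2 \<le> e"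
    proof -
      have "t * Re (phi k k 1) \<le> e" using mult_left_mono[OF leD[OF kl(1)], of t] t by simp
      moreover have "2 * dl * D = t * e / 2" using D by (simp add: dl_def)
      then have "4 * (K / real N) + 2 * dl * D \<le> t * e" using KN by linarith
      then have "(4 * (K / real N) + 2 * dl * D) / t \<le> e" using t(1) by (simp add: divide_le_eq mult.commute)
      ultimately show ?thesis unfolding psi1 psiz by simp
    qed
    finally show ?thesis .
  qed
  have "character (fst r) \<and> (\<forall>b\<in>R. fst r b = ch b)" if "r \<in> set rs" for r
    using that X by (auto simp: rs_def)
  with 1 2 show ?thesis by blast
qed

text \<open>The real and imaginary parts h of each element are moved into the unit interval by (c +
  h) / (2 c). Since the Gram matrix is exact, the error functional vanishes at 1, so the shift is
  free and the rescaling costs only the factor 2 c.\<close>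

theorem dilation:
  assumes F: "finite F" and e: "e > 0"
  shows "\<exists>rs :: (('a \<Rightarrow> complex) \<times> (nat \<Rightarrow> complex)) list.
    (\<forall>r\<in>set rs. character (fst r) \<and> (\<forall>b\<in>R. fst r b = ch b)) \<and>
    (\<forall>k<n. \<forall>l<n. (\<Sum>r\<leftarrow>rs. cnj (snd r k) * snd r l) = phi k l 1) \<and>
    (\<forall>a\<in>F. \<forall>k<n. \<forall>l<n. cmod ((\<Sum>r\<leftarrow>rs. cnj (snd r k) * snd r l * fst r a) - phi k l a) \<le> e)"
proof -
  obtain xs where xs: "set xs = F" using finite_list[OF F] by blast
  define al where "al a = norm a + 1" for a :: 'a
  have al: "al a > 0" for a by (simp add: al_def add_nonneg_pos)
  define pr where "pr h c = (1 / (2 * c)) *\<^sub>R (c *\<^sub>R 1 + h)" for h :: 'a and c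
  have pr: "pos (pr h c) \<and> pos (1 - pr h c)" if h: "sa h" "norm h \<le> c" "c > 0" for h c
  proof
    have "pos (c *\<^sub>R 1 - (- h))" using h by (intro pos_norm_minus sa_minus) auto
    then show "pos (pr h c)" unfolding pr_def using h by (intro pos_scaleR) auto
    have "pos ((1 / (2 * c)) *\<^sub>R (c *\<^sub>R 1 - h))" using h by (intro pos_scaleR pos_norm_minus) auto
    moreover have "1 - pr h c = (1 / (2 * c)) *\<^sub>R (c *\<^sub>R 1 - h)"
    proof -
      have "(1 / (2 * c)) *\<^sub>R (c *\<^sub>R 1 - h) + pr h c = (1 / (2 * c)) *\<^sub>R ((2 * c) *\<^sub>R 1)"
        unfolding pr_def scaleR_add_right[symmetric] by (simp add: scaleR_2 flip: scaleR_scaleR)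
      also have "\<dots> = 1" using h by simp
      finally show ?thesis by (metis eq_diff_eq)
    qed
    ultimately show "pos (1 - pr h c)" by simp
  qed
  define as where "as = concat (map (\<lambda>a. [pr (re_part a) (al a), pr (im_part a) (al a)]) xs)"
  have as: "pos a \<and> pos (1 - a)" if "a \<in> set as" for a
  proof -
    obtain b h where b: "a = pr h (al b)" "h = re_part b \<or> h = im_part b" using \<open>a \<in> set as\<close> by (auto simp: as_def)
    then have "sa h" "norm h \<le> al b"
      using sa_re_part sa_im_part norm_re_part_le[of b] norm_im_part_le[of b] by (auto simp: al_def)
    then show ?thesis unfolding b(1) using al by (rule pr)
  qed
  define A where "A = 1 + (\<Sum>a\<in>F. al a)"
  have A: "al a \<le> A" if "a \<in> F" for a
    using member_le_sum[OF that, of al] al F by (force simp: A_def intro: less_imp_le)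
  have A0: "A > 0" unfolding A_def using al by (intro add_pos_nonneg sum_nonneg) (auto intro: less_imp_le)
  \<comment> \<open>Rescaling multiplies errors by at most 2 A, so this accuracy leaves e / 2 for
    the real part and e / 2 for the imaginary part.\<close>
  have e4: "e / (4 * A) > 0" using e A0 by simp
  from dilation_of_contractions[OF as e4] obtain rs :: "(('a \<Rightarrow> complex) \<times> (nat \<Rightarrow> complex)) list" where rs0:
    "(\<forall>r\<in>set rs. character (fst r) \<and> (\<forall>b\<in>R. fst r b = ch b)) \<and>
     (\<forall>k<n. \<forall>l<n. (\<Sum>r\<leftarrow>rs. cnj (snd r k) * snd r l) = phi k l 1) \<and>
     (\<forall>a\<in>set as. \<forall>k<n. \<forall>l<n. cmod ((\<Sum>r\<leftarrow>rs. cnj (snd r k) * snd r l * fst r a) - phi k l a) \<le> e / (4 * A))"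
    by (rule exE)
  then have rs: "\<And>r. r \<in> set rs \<Longrightarrow> character (fst r) \<and> (\<forall>b\<in>R. fst r b = ch b)"
    "\<And>k l. k < n \<Longrightarrow> l < n \<Longrightarrow> (\<Sum>r\<leftarrow>rs. cnj (snd r k) * snd r l) = phi k l 1"
    "\<And>a k l. a \<in> set as \<Longrightarrow> k < n \<Longrightarrow> l < n \<Longrightarrow> cmod ((\<Sum>r\<leftarrow>rs. cnj (snd r k) * snd r l * fst r a) - phi k l a) \<le> e / (4 * A)"
    by blast+
  have "cmod ((\<Sum>r\<leftarrow>rs. cnj (snd r k) * snd r l * fst r a) - phi k l a) \<le> e"
    if a: "a \<in> F" and kl: "k < n" "l < n" for a k l
  proof -
    define E where "E b = (\<Sum>r\<leftarrow>rs. cnj (snd r k) * snd r l * fst r b) - phi k l b" for b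
    have cl: "(\<Sum>r\<leftarrow>rs. cnj (snd r k) * snd r l * fst r (b + c *\<^sub>C d)) =
       (\<Sum>r\<leftarrow>rs. cnj (snd r k) * snd r l * fst r b) + c * (\<Sum>r\<leftarrow>rs. cnj (snd r k) * snd r l * fst r d)" for b c d
    proof -
      have "map (\<lambda>r. cnj (snd r k) * snd r l * fst r (b + c *\<^sub>C d)) rs =
        map (\<lambda>r. cnj (snd r k) * snd r l * fst r b + c * (cnj (snd r k) * snd r l * fst r d)) rs"
        using rs(1) by (intro map_cong refl) (simp add: character_def linear_functionalD algebra_simps)
      then show ?thesis by (simp only: sum_list_addf sum_list_const_mult)
    qed
    have El: "E (b + c *\<^sub>C d) = E b + c * E d" for b c d
      unfolding E_def cl by (simp add: linear_functionalD[OF lin[OF kl]] algebra_simps)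
    have E0: "E 0 = 0" using El[of 0 1 0] by simp
    have E1: "E 1 = 0"
    proof -
      have m: "map (\<lambda>r. cnj (snd r k) * snd r l * fst r 1) rs = map (\<lambda>r. cnj (snd r k) * snd r l) rs"
        using rs(1) by (intro map_cong refl) (simp add: character_def)
      show ?thesis unfolding E_def m rs(2)[OF kl] by simp
    qed
    have hE: "E h = of_real (2 * c) * E (pr h c)" if "c > 0" for h c
    proof -
      have "h = 0 + (- of_real c) *\<^sub>C 1 + of_real (2 * c) *\<^sub>C pr h c"
      proof -
        have "of_real (2 * c) *\<^sub>C pr h c = (2 * c) *\<^sub>R pr h c" by (rule scaleR_scaleC[symmetric])
        also have "\<dots> = c *\<^sub>R 1 + h" using that by (simp add: pr_def del: scaleR_add_right)
        finally show ?thesis by (simp add: scaleC_minus_left flip: scaleR_scaleC)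
      qed
      then show ?thesis by (metis El E0 E1 add_0 mult_zero_right)
    qed
    have b: "cmod (E h) \<le> e / 2" if "h = re_part a \<or> h = im_part a" for h
    proof -
      have "pr h (al a) \<in> set as" using that a xs by (auto simp: as_def)
      from rs(3)[OF this kl] have "cmod (E (pr h (al a))) \<le> e / (4 * A)" by (simp add: E_def)
      then have "cmod (E h) \<le> 2 * al a * (e / (4 * A))"
        unfolding hE[OF al[of a], of h] norm_mult using al[of a] by (intro mult_mono) (auto simp: less_imp_le)
      also have "\<dots> \<le> 2 * A * (e / (4 * A))" using A[OF a] e A0 by (intro mult_right_mono) auto
      also have "\<dots> = e / 2" using A0 by simp
      finally show ?thesis .
    qed
    have "E a = E (re_part a) + \<i> * E (im_part a)" by (subst re_im_decomp[of a]) (rule El)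
    then have "cmod (E a) \<le> cmod (E (re_part a)) + cmod (E (im_part a))"
      by (metis norm_triangle_ineq norm_mult norm_ii mult_1)
    with b[of "re_part a"] b[of "im_part a"] have "cmod (E a) \<le> e" by simp
    then show ?thesis by (simp add: E_def)
  qed
  with rs(1,2) show ?thesis by blast
qed

end

section \<open>Transfer from the type class to records\<close>

lemmas cstar_alg_conj0 = cstar_alg_def[unfolded Let_def, THEN iffD1]
lemmas cstar_alg_conj1 = cstar_alg_conj0[THEN conjunct2]
lemmas cstar_alg_conj2 = cstar_alg_conj1[THEN conjunct2]
lemmas cstar_alg_conj3 = cstar_alg_conj2[THEN conjunct2]
lemmas cstar_alg_conj4 = cstar_alg_conj3[THEN conjunct2]
lemmas cstar_alg_conj5 = cstar_alg_conj4[THEN conjunct2]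
lemmas cstar_alg_conj6 = cstar_alg_conj5[THEN conjunct2]
lemmas cstar_alg_conj7 = cstar_alg_conj6[THEN conjunct2]
lemmas cstar_alg_conj8 = cstar_alg_conj7[THEN conjunct2]
lemmas cstar_alg_conj9 = cstar_alg_conj8[THEN conjunct2]
lemmas cstar_alg_conj10 = cstar_alg_conj9[THEN conjunct2]
lemmas cstar_alg_conj11 = cstar_alg_conj10[THEN conjunct2]
lemmas cstar_alg_conj12 = cstar_alg_conj11[THEN conjunct2]
lemmas cstar_alg_conj13 = cstar_alg_conj12[THEN conjunct2]
lemmas cstar_alg_conj14 = cstar_alg_conj13[THEN conjunct2]
lemmas cstar_alg_conj15 = cstar_alg_conj14[THEN conjunct2]
lemmas cstar_alg_conj16 = cstar_alg_conj15[THEN conjunct2]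
lemmas cstar_alg_conj17 = cstar_alg_conj16[THEN conjunct2]
lemmas cstar_alg_conj18 = cstar_alg_conj17[THEN conjunct2]
lemmas cstar_alg_conj19 = cstar_alg_conj18[THEN conjunct2]
lemmas cstar_alg_conj20 = cstar_alg_conj19[THEN conjunct2]
lemmas cstar_alg_conj21 = cstar_alg_conj20[THEN conjunct2]
lemmas cstar_alg_conj22 = cstar_alg_conj21[THEN conjunct2]
lemmas cstar_alg_conj23 = cstar_alg_conj22[THEN conjunct2]
lemmas cstar_alg_conj24 = cstar_alg_conj23[THEN conjunct2]
lemmas cstar_alg_conj25 = cstar_alg_conj24[THEN conjunct2]

text \<open>Items are cited by number below: 1-5 closure, 6-13 vector space, 14-18 multiplication,
  19-22 involution, 23-26 norm, 27 completeness, 28 the C*-identity.\<close>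

lemma cstar_algD:
  fixes A :: "'a cstar_alg"
  assumes "cstar_alg A"
  shows "ca_zero A \<in> ca_carrier A"
    and "\<And>x y. x \<in> ca_carrier A \<Longrightarrow> y \<in> ca_carrier A \<Longrightarrow> ca_add A x y \<in> ca_carrier A"
    and "\<And>x y. x \<in> ca_carrier A \<Longrightarrow> y \<in> ca_carrier A \<Longrightarrow> ca_mult A x y \<in> ca_carrier A"
    and "\<And>c x. x \<in> ca_carrier A \<Longrightarrow> ca_smult A c x \<in> ca_carrier A"
    and "\<And>x. x \<in> ca_carrier A \<Longrightarrow> ca_star A x \<in> ca_carrier A"
    and "\<And>x y z. x \<in> ca_carrier A \<Longrightarrow> y \<in> ca_carrier A \<Longrightarrow> z \<in> ca_carrier A \<Longrightarrow>
      ca_add A (ca_add A x y) z = ca_add A x (ca_add A y z)"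
    and "\<And>x y. x \<in> ca_carrier A \<Longrightarrow> y \<in> ca_carrier A \<Longrightarrow> ca_add A x y = ca_add A y x"
    and "\<And>x. x \<in> ca_carrier A \<Longrightarrow> ca_add A (ca_zero A) x = x"
    and "\<And>x. x \<in> ca_carrier A \<Longrightarrow> \<exists>y\<in>ca_carrier A. ca_add A x y = ca_zero A"
    and "\<And>c x y. x \<in> ca_carrier A \<Longrightarrow> y \<in> ca_carrier A \<Longrightarrow>
      ca_smult A c (ca_add A x y) = ca_add A (ca_smult A c x) (ca_smult A c y)"
    and "\<And>c d x. x \<in> ca_carrier A \<Longrightarrow> ca_smult A (c + d) x = ca_add A (ca_smult A c x) (ca_smult A d x)"
    and "\<And>c d x. x \<in> ca_carrier A \<Longrightarrow> ca_smult A (c * d) x = ca_smult A c (ca_smult A d x)"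
    and "\<And>x. x \<in> ca_carrier A \<Longrightarrow> ca_smult A 1 x = x"
    and "\<And>x y z. x \<in> ca_carrier A \<Longrightarrow> y \<in> ca_carrier A \<Longrightarrow> z \<in> ca_carrier A \<Longrightarrow>
      ca_mult A (ca_mult A x y) z = ca_mult A x (ca_mult A y z)"
    and "\<And>x y z. x \<in> ca_carrier A \<Longrightarrow> y \<in> ca_carrier A \<Longrightarrow> z \<in> ca_carrier A \<Longrightarrow>
      ca_mult A x (ca_add A y z) = ca_add A (ca_mult A x y) (ca_mult A x z)"
    and "\<And>x y z. x \<in> ca_carrier A \<Longrightarrow> y \<in> ca_carrier A \<Longrightarrow> z \<in> ca_carrier A \<Longrightarrow>
      ca_mult A (ca_add A x y) z = ca_add A (ca_mult A x z) (ca_mult A y z)"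
    and "\<And>c x y. x \<in> ca_carrier A \<Longrightarrow> y \<in> ca_carrier A \<Longrightarrow> ca_mult A (ca_smult A c x) y = ca_smult A c (ca_mult A x y)"
    and "\<And>c x y. x \<in> ca_carrier A \<Longrightarrow> y \<in> ca_carrier A \<Longrightarrow> ca_mult A x (ca_smult A c y) = ca_smult A c (ca_mult A x y)"
    and "\<And>x. x \<in> ca_carrier A \<Longrightarrow> ca_star A (ca_star A x) = x"
    and "\<And>x y. x \<in> ca_carrier A \<Longrightarrow> y \<in> ca_carrier A \<Longrightarrow> ca_star A (ca_add A x y) = ca_add A (ca_star A x) (ca_star A y)"
    and "\<And>c x. x \<in> ca_carrier A \<Longrightarrow> ca_star A (ca_smult A c x) = ca_smult A (cnj c) (ca_star A x)"
    and "\<And>x y. x \<in> ca_carrier A \<Longrightarrow> y \<in> ca_carrier A \<Longrightarrow> ca_star A (ca_mult A x y) = ca_mult A (ca_star A y) (ca_star A x)"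
    and "\<And>x. x \<in> ca_carrier A \<Longrightarrow> ca_norm A x = 0 \<longleftrightarrow> x = ca_zero A"
    and "\<And>x y. x \<in> ca_carrier A \<Longrightarrow> y \<in> ca_carrier A \<Longrightarrow> ca_norm A (ca_add A x y) \<le> ca_norm A x + ca_norm A y"
    and "\<And>c x. x \<in> ca_carrier A \<Longrightarrow> ca_norm A (ca_smult A c x) = cmod c * ca_norm A x"
    and "\<And>x y. x \<in> ca_carrier A \<Longrightarrow> y \<in> ca_carrier A \<Longrightarrow> ca_norm A (ca_mult A x y) \<le> ca_norm A x * ca_norm A y"
    and "\<And>f :: nat \<Rightarrow> 'a. (\<And>n. f n \<in> ca_carrier A) \<Longrightarrow> (\<And>e. e > 0 \<Longrightarrow> \<exists>N. \<forall>m\<ge>N. \<forall>n\<ge>N. ca_norm A (ca_diff A (f m) (f n)) < e) \<Longrightarrow>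
      \<exists>x\<in>ca_carrier A. \<forall>e>0. \<exists>N. \<forall>n\<ge>N. ca_norm A (ca_diff A (f n) x) < e"
    and "\<And>x. x \<in> ca_carrier A \<Longrightarrow> ca_norm A (ca_mult A (ca_star A x) x) = (ca_norm A x)\<^sup>2"
  subgoal using cstar_alg_conj0[OF assms, THEN conjunct1] by blast
  subgoal using cstar_alg_conj1[OF assms, THEN conjunct1] by blast
  subgoal using cstar_alg_conj1[OF assms, THEN conjunct1] by blast
  subgoal using cstar_alg_conj2[OF assms, THEN conjunct1] by blast
  subgoal using cstar_alg_conj3[OF assms, THEN conjunct1] by blast
  subgoal using cstar_alg_conj4[OF assms, THEN conjunct1] by blast
  subgoal using cstar_alg_conj5[OF assms, THEN conjunct1] by blast
  subgoal using cstar_alg_conj6[OF assms, THEN conjunct1] by blast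
  subgoal using cstar_alg_conj7[OF assms, THEN conjunct1] by blast
  subgoal using cstar_alg_conj8[OF assms, THEN conjunct1] by blast
  subgoal using cstar_alg_conj9[OF assms, THEN conjunct1] by simp
  subgoal using cstar_alg_conj10[OF assms, THEN conjunct1] by simp
  subgoal using cstar_alg_conj11[OF assms, THEN conjunct1] by blast
  subgoal using cstar_alg_conj12[OF assms, THEN conjunct1] by blast
  subgoal using cstar_alg_conj13[OF assms, THEN conjunct1] by blast
  subgoal using cstar_alg_conj14[OF assms, THEN conjunct1] by blast
  subgoal using cstar_alg_conj15[OF assms, THEN conjunct1] by metis
  subgoal using cstar_alg_conj15[OF assms, THEN conjunct1] by metis
  subgoal using cstar_alg_conj16[OF assms, THEN conjunct1] by blast
  subgoal using cstar_alg_conj17[OF assms, THEN conjunct1] by blast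
  subgoal using cstar_alg_conj18[OF assms, THEN conjunct1] by simp
  subgoal using cstar_alg_conj19[OF assms, THEN conjunct1] by blast
  subgoal using cstar_alg_conj20[OF assms, THEN conjunct1] by blast
  subgoal using cstar_alg_conj21[OF assms, THEN conjunct1] by blast
  subgoal using cstar_alg_conj22[OF assms, THEN conjunct1] by simp
  subgoal using cstar_alg_conj23[OF assms, THEN conjunct1] by blast
  subgoal for f using cstar_alg_conj24[OF assms, THEN conjunct1, rule_format, of f] by simp
  subgoal using cstar_alg_conj25[OF assms] by blast
  done

definition central_in :: "'a cstar_alg \<Rightarrow> 'a \<Rightarrow> bool" where
  "central_in A c \<longleftrightarrow> c \<in> ca_carrier A \<and> (\<forall>y\<in>ca_carrier A. ca_mult A y c = ca_mult A c y)"

definition linear_on :: "'a cstar_alg \<Rightarrow> ('a \<Rightarrow> complex) \<Rightarrow> bool" where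
  "linear_on A f \<longleftrightarrow> (\<forall>x\<in>ca_carrier A. \<forall>y\<in>ca_carrier A. f (ca_add A x y) = f x + f y) \<and>
     (\<forall>c. \<forall>x\<in>ca_carrier A. f (ca_smult A c x) = c * f x)"

definition character_on :: "'a cstar_alg \<Rightarrow> ('a \<Rightarrow> complex) \<Rightarrow> bool" where
  "character_on A x \<longleftrightarrow> linear_on A x \<and> x (ca_one A) = 1 \<and>
     (\<forall>a\<in>ca_carrier A. \<forall>b\<in>ca_carrier A. x (ca_mult A a b) = x a * x b) \<and>
     (\<forall>a\<in>ca_carrier A. x (ca_star A a) = cnj (x a))"

definition kernel_on :: "'a cstar_alg \<Rightarrow> nat \<Rightarrow> (nat \<Rightarrow> nat \<Rightarrow> 'a \<Rightarrow> complex) \<Rightarrow> 'a set \<Rightarrow> ('a \<Rightarrow> complex) \<Rightarrow> bool" where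
  "kernel_on A n phi R ch \<longleftrightarrow>
     (\<forall>k<n. \<forall>l<n. linear_on A (phi k l)) \<and>
     (\<forall>k<n. \<forall>l<n. \<forall>a\<in>ca_carrier A. phi l k (ca_star A a) = cnj (phi k l a)) \<and>
     (\<forall>z. \<forall>g\<in>ca_carrier A. 0 \<le> Re (\<Sum>k<n. \<Sum>l<n. cnj (z k) * z l * phi k l (ca_mult A (ca_star A g) g))) \<and>
     (\<forall>k<n. \<forall>l<n. \<forall>t>0. \<forall>p\<in>ca_carrier A. \<forall>q\<in>ca_carrier A. cmod (phi k l (ca_mult A (ca_star A p) q))
        \<le> (t * Re (phi k k (ca_mult A (ca_star A p) p)) + Re (phi l l (ca_mult A (ca_star A q) q)) / t) / 2) \<and>
     (\<forall>k<n. \<forall>l<n. \<forall>r\<in>R. \<forall>a\<in>ca_carrier A. phi k l (ca_mult A r a) = ch r * phi k l a) \<and>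
     (\<exists>k<n. 0 < Re (phi k k (ca_one A)))"

text \<open>One predicate collects everything to be carried over from the type class: a complement
  certifying norm at most 1, the converse of that certificate, states multiplicative on the centre
  that nearly attain the norm, and the dilation of kernels on commutative algebras. It speaks of
  record operations only.\<close>

definition good_alg :: "'a cstar_alg \<Rightarrow> bool" where
  "good_alg A \<longleftrightarrow>
     (\<forall>x\<in>ca_carrier A. ca_norm A x \<le> 1 \<longrightarrow>
        (\<exists>k\<in>ca_carrier A. ca_add A (ca_mult A (ca_star A x) x) (ca_mult A (ca_star A k) k) = ca_one A)) \<and>
     (\<forall>x\<in>ca_carrier A. \<forall>k\<in>ca_carrier A.
        ca_add A (ca_mult A (ca_star A x) x) (ca_mult A (ca_star A k) k) = ca_one A \<longrightarrow> ca_norm A x \<le> 1) \<and>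
     (\<forall>x\<in>ca_carrier A. \<forall>t\<ge>0. t < (ca_norm A x)\<^sup>2 \<longrightarrow>
        (\<exists>f. linear_on A f \<and> f (ca_one A) = 1 \<and>
           (\<forall>y\<in>ca_carrier A. Im (f (ca_mult A (ca_star A y) y)) = 0 \<and> 0 \<le> Re (f (ca_mult A (ca_star A y) y))) \<and>
           t \<le> Re (f (ca_mult A (ca_star A x) x)) \<and>
           (\<forall>c y. central_in A c \<longrightarrow> y \<in> ca_carrier A \<longrightarrow> f (ca_mult A c y) = f c * f y))) \<and>
     (ca_commutative A \<longrightarrow> (\<forall>n phi R ch F e. R \<subseteq> ca_carrier A \<longrightarrow> finite F \<longrightarrow> F \<subseteq> ca_carrier A \<longrightarrow> e > 0 \<longrightarrow>
        kernel_on A n phi R ch \<longrightarrow>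
        (\<exists>rs. (\<forall>r\<in>set rs. character_on A (fst r) \<and> (\<forall>b\<in>R. fst r b = ch b)) \<and>
           (\<forall>k<n. \<forall>l<n. (\<Sum>r\<leftarrow>rs. cnj (snd r k) * snd r l) = phi k l (ca_one A)) \<and>
           (\<forall>a\<in>F. \<forall>k<n. \<forall>l<n. cmod ((\<Sum>r\<leftarrow>rs. cnj (snd r k) * snd r l * fst r a) - phi k l a) \<le> e))))"

text \<open>The default when no counterexample exists on the given type: a single point of norm
  zero. With it, the chosen record is a unital C*-algebra in every case.\<close>

definition trivial_alg :: "'a cstar_alg" where
  "trivial_alg = \<lparr>ca_carrier = {undefined}, ca_zero = undefined, ca_one = undefined, ca_add = \<lambda>_ _. undefined,
     ca_mult = \<lambda>_ _. undefined, ca_smult = \<lambda>_ _. undefined, ca_star = \<lambda>_. undefined, ca_norm = \<lambda>_. 0\<rparr>"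

lemma unital_trivial_alg: "unital_cstar_alg trivial_alg"
  by (simp add: unital_cstar_alg_def cstar_alg_def trivial_alg_def Let_def ca_diff_def)

text \<open>Results proved for the type class \<open>cstar\<close> are transferred to records by turning a
  hypothetical counterexample into a type of class \<open>cstar\<close>.\<close>
definition chosen_alg :: "'a cstar_alg" where
  "chosen_alg = (if \<exists>A::'a cstar_alg. unital_cstar_alg A \<and> \<not> good_alg A
     then SOME A. unital_cstar_alg A \<and> \<not> good_alg A else trivial_alg)"

lemma unital_chosen_alg: "unital_cstar_alg (chosen_alg :: 'a cstar_alg)"
proof (cases "\<exists>A::'a cstar_alg. unital_cstar_alg A \<and> \<not> good_alg A")
  case True
  from someI_ex[OF this] show ?thesis using True by (simp add: chosen_alg_def)
qed (auto simp: chosen_alg_def unital_trivial_alg)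

lemma cstar_chosen_alg: "cstar_alg chosen_alg"
  by (rule unital_chosen_alg[unfolded unital_cstar_alg_def, THEN conjunct1])

lemmas chosenD = cstar_algD[OF cstar_chosen_alg]

lemma chosen_one:
  fixes x :: 'a
  shows "ca_one (chosen_alg :: 'a cstar_alg) \<in> ca_carrier chosen_alg"
  "x \<in> ca_carrier chosen_alg \<Longrightarrow> ca_mult chosen_alg (ca_one chosen_alg) x = x"
  "x \<in> ca_carrier chosen_alg \<Longrightarrow> ca_mult chosen_alg x (ca_one chosen_alg) = x"
  by (use unital_chosen_alg[where 'a='a] in \<open>simp_all add: unital_cstar_alg_def\<close>)

typedef 'a chosen = "ca_carrier (chosen_alg :: 'a cstar_alg)"
  using chosenD(1) by blast

lemma diff_in:
  assumes "cstar_alg A" "x \<in> ca_carrier A" "y \<in> ca_carrier A" shows "ca_diff A x y \<in> ca_carrier A"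
  using assms by (simp add: ca_diff_def cstar_algD(2,4))

lemma smult_0:
  assumes A: "cstar_alg A" and x: "x \<in> ca_carrier A" shows "ca_smult A 0 x = ca_zero A"
proof -
  note D = cstar_algD[OF A]
  let ?z = "ca_smult A 0 x"
  have z: "?z \<in> ca_carrier A" using D(4) x by blast
  have zz: "ca_add A ?z ?z = ?z" using D(11)[OF x, of 0 0] by simp
  obtain y where y: "y \<in> ca_carrier A" "ca_add A ?z y = ca_zero A" using D(9)[OF z] by blast
  have "?z = ca_add A (ca_zero A) ?z" using D(8)[OF z] by simp
  also have "\<dots> = ca_add A ?z (ca_zero A)" using D(7)[OF D(1) z] .
  also have "\<dots> = ca_add A (ca_add A ?z ?z) y" using D(6)[OF z z y(1)] y(2) by simp
  also have "\<dots> = ca_zero A" using zz y(2) by simp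
  finally show ?thesis .
qed

lemma diff_self:
  assumes A: "cstar_alg A" and x: "x \<in> ca_carrier A" shows "ca_diff A x x = ca_zero A"
  using cstar_algD(11)[OF A x, of 1 "-1"] cstar_algD(13)[OF A x] smult_0[OF A x] by (simp add: ca_diff_def)

instantiation chosen :: (type) "{real_normed_algebra, monoid_mult}"
begin

definition zero_chosen :: "'a chosen" where "0 = Abs_chosen (ca_zero chosen_alg)"
definition one_chosen :: "'a chosen" where "1 = Abs_chosen (ca_one chosen_alg)"
definition plus_chosen :: "'a chosen \<Rightarrow> 'a chosen \<Rightarrow> 'a chosen" where
  "x + y = Abs_chosen (ca_add chosen_alg (Rep_chosen x) (Rep_chosen y))"
definition minus_chosen :: "'a chosen \<Rightarrow> 'a chosen \<Rightarrow> 'a chosen" where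
  "x - y = Abs_chosen (ca_diff chosen_alg (Rep_chosen x) (Rep_chosen y))"
definition uminus_chosen :: "'a chosen \<Rightarrow> 'a chosen" where
  "- x = Abs_chosen (ca_smult chosen_alg (-1) (Rep_chosen x))"
definition times_chosen :: "'a chosen \<Rightarrow> 'a chosen \<Rightarrow> 'a chosen" where
  "x * y = Abs_chosen (ca_mult chosen_alg (Rep_chosen x) (Rep_chosen y))"
definition scaleR_chosen :: "real \<Rightarrow> 'a chosen \<Rightarrow> 'a chosen" where
  "r *\<^sub>R x = Abs_chosen (ca_smult chosen_alg (complex_of_real r) (Rep_chosen x))"
definition norm_chosen :: "'a chosen \<Rightarrow> real" where "norm x = ca_norm chosen_alg (Rep_chosen x)"
definition sgn_chosen :: "'a chosen \<Rightarrow> 'a chosen" where "sgn (x :: 'a chosen) = inverse (norm x) *\<^sub>R x"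
definition dist_chosen :: "'a chosen \<Rightarrow> 'a chosen \<Rightarrow> real" where "dist (x :: 'a chosen) y = norm (x - y)"
definition uniformity_chosen :: "('a chosen \<times> 'a chosen) filter" where
  "uniformity = (INF e\<in>{0<..}. principal {(x, y :: 'a chosen). dist x y < e})"
definition open_chosen :: "'a chosen set \<Rightarrow> bool" where
  "open (U :: 'a chosen set) = (\<forall>x\<in>U. \<forall>\<^sub>F (x', y) in uniformity. x' = x \<longrightarrow> y \<in> U)"

lemma Rep_mem: "Rep_chosen x \<in> ca_carrier chosen_alg" by (rule Rep_chosen)

lemma Rep_ring_ops:
  "Rep_chosen 0 = ca_zero chosen_alg" "Rep_chosen 1 = ca_one chosen_alg"
  "Rep_chosen (x + y) = ca_add chosen_alg (Rep_chosen x) (Rep_chosen y)"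
  "Rep_chosen (x - y) = ca_diff chosen_alg (Rep_chosen x) (Rep_chosen y)"
  "Rep_chosen (- x) = ca_smult chosen_alg (-1) (Rep_chosen x)"
  "Rep_chosen (x * y) = ca_mult chosen_alg (Rep_chosen x) (Rep_chosen y)"
  "Rep_chosen (r *\<^sub>R x) = ca_smult chosen_alg (complex_of_real r) (Rep_chosen x)"
  by (simp_all add: zero_chosen_def one_chosen_def plus_chosen_def minus_chosen_def uminus_chosen_def times_chosen_def
      scaleR_chosen_def Abs_chosen_inverse Rep_mem chosenD(1-5) chosen_one
      diff_in[OF cstar_chosen_alg])

instance
proof
  fix x y z :: "'a chosen" and r s :: real
  note R = Rep_chosen_inject[symmetric] Rep_ring_ops
  have inv: "ca_add chosen_alg (ca_smult chosen_alg (-1) (Rep_chosen x)) (Rep_chosen x) = ca_zero chosen_alg"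
    using diff_self[OF cstar_chosen_alg Rep_mem[of x]] chosenD(7)[OF chosenD(4)[OF Rep_mem] Rep_mem[of x]]
    by (simp add: ca_diff_def)
  show "x + y + z = x + (y + z)" by (simp add: R chosenD(6) Rep_mem)
  show "x + y = y + x" using chosenD(7)[OF Rep_mem[of x] Rep_mem[of y]] by (simp add: R)
  show "0 + x = x" by (simp add: R chosenD(8) Rep_mem)
  show "- x + x = 0" by (simp add: R inv)
  show "x - y = x + - y" by (simp add: R ca_diff_def)
  show "x * y * z = x * (y * z)" by (simp add: R chosenD(14) Rep_mem)
  show "(x + y) * z = x * z + y * z" by (simp add: R chosenD(16) Rep_mem)
  show "x * (y + z) = x * y + x * z" by (simp add: R chosenD(15) Rep_mem)
  show "1 * x = x" "x * 1 = x" by (simp_all add: R chosen_one Rep_mem)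
  show "r *\<^sub>R (x + y) = r *\<^sub>R x + r *\<^sub>R y" by (simp add: R chosenD(10) Rep_mem)
  show "(r + s) *\<^sub>R x = r *\<^sub>R x + s *\<^sub>R x" by (simp add: R chosenD(11) Rep_mem)
  show "r *\<^sub>R s *\<^sub>R x = (r * s) *\<^sub>R x" by (simp add: R chosenD(12) Rep_mem)
  show "1 *\<^sub>R x = x" by (simp add: R chosenD(13) Rep_mem)
  show "r *\<^sub>R x * y = r *\<^sub>R (x * y)" by (simp add: R chosenD(17) Rep_mem)
  show "x * r *\<^sub>R y = r *\<^sub>R (x * y)" by (simp add: R chosenD(18) Rep_mem)
  show "sgn x = inverse (norm x) *\<^sub>R x" by (rule sgn_chosen_def)
  show "dist x y = norm (x - y)" by (rule dist_chosen_def)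
  show "uniformity = (INF e\<in>{0<..}. principal {(x, y :: 'a chosen). dist x y < e})" by (rule uniformity_chosen_def)
  show "open U = (\<forall>x\<in>U. \<forall>\<^sub>F (x', y) in uniformity. x' = x \<longrightarrow> y \<in> U)" for U :: "'a chosen set"
    by (rule open_chosen_def)
  show "(norm x = 0) = (x = 0)" by (simp add: norm_chosen_def R chosenD(23) Rep_mem)
  show "norm (x + y) \<le> norm x + norm y" by (simp add: norm_chosen_def R chosenD(24) Rep_mem)
  show "norm (r *\<^sub>R x) = \<bar>r\<bar> * norm x" by (simp add: norm_chosen_def R chosenD(25) Rep_mem)
  show "norm (x * y) \<le> norm x * norm y" by (simp add: norm_chosen_def R chosenD(26) Rep_mem)
qed

end

instantiation chosen :: (type) cstar
begin

definition scaleC_chosen :: "complex \<Rightarrow> 'a chosen \<Rightarrow> 'a chosen" where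
  "c *\<^sub>C x = Abs_chosen (ca_smult chosen_alg c (Rep_chosen x))"
definition star_chosen :: "'a chosen \<Rightarrow> 'a chosen" where
  "star x = Abs_chosen (ca_star chosen_alg (Rep_chosen x))"

lemma Rep_star_ops:
  "Rep_chosen (c *\<^sub>C x) = ca_smult chosen_alg c (Rep_chosen x)"
  "Rep_chosen (star x) = ca_star chosen_alg (Rep_chosen x)"
  by (simp_all add: scaleC_chosen_def star_chosen_def Abs_chosen_inverse Rep_mem chosenD(1-5))

lemmas Rep_ops = Rep_ring_ops Rep_star_ops

instance
proof
  fix x y z :: "'a chosen" and r :: real and c d :: complex
  note R = Rep_chosen_inject[symmetric] Rep_ops
  show "c *\<^sub>C (x + y) = c *\<^sub>C x + c *\<^sub>C y" by (simp add: R chosenD(10) Rep_mem)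
  show "(c + d) *\<^sub>C x = c *\<^sub>C x + d *\<^sub>C x" by (simp add: R chosenD(11) Rep_mem)
  show "c *\<^sub>C d *\<^sub>C x = (c * d) *\<^sub>C x" by (simp add: R chosenD(12) Rep_mem)
  show "r *\<^sub>R x = complex_of_real r *\<^sub>C x" by (simp add: R)
  show "c *\<^sub>C x * y = c *\<^sub>C (x * y)" by (simp add: R chosenD(17) Rep_mem)
  show "x * c *\<^sub>C y = c *\<^sub>C (x * y)" by (simp add: R chosenD(18) Rep_mem)
  show "star (star x) = x" by (simp add: R chosenD(19) Rep_mem)
  show "star (x + y) = star x + star y" by (simp add: R chosenD(20) Rep_mem)
  show "star (c *\<^sub>C x) = cnj c *\<^sub>C star x" by (simp add: R chosenD(21) Rep_mem)
  show "star (x * y) = star y * star x" by (simp add: R chosenD(22) Rep_mem)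
  show "norm (star x * x) = (norm x)\<^sup>2" by (simp add: norm_chosen_def R chosenD(28) Rep_mem)
next
  fix X :: "nat \<Rightarrow> 'a chosen" assume "Cauchy X"
  then have c: "\<exists>M. \<forall>m\<ge>M. \<forall>n\<ge>M. dist (X m) (X n) < e" if "e > 0" for e
    using that by (simp add: Cauchy_def)
  have "\<exists>x\<in>ca_carrier chosen_alg. \<forall>e>0. \<exists>N. \<forall>n\<ge>N. ca_norm chosen_alg (ca_diff chosen_alg (Rep_chosen (X n)) x) < e"
    using c by (intro chosenD(27)) (simp_all add: Rep_mem dist_chosen_def norm_chosen_def Rep_ops)
  then obtain x where x: "x \<in> ca_carrier chosen_alg"
    "\<forall>e>0. \<exists>N. \<forall>n\<ge>N. ca_norm chosen_alg (ca_diff chosen_alg (Rep_chosen (X n)) x) < e" by blast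
  have "X \<longlonglongrightarrow> Abs_chosen x"
    unfolding LIMSEQ_def dist_chosen_def norm_chosen_def Rep_ops Abs_chosen_inverse[OF x(1)] by (rule x(2))
  then show "convergent X" by (auto simp: convergent_def)
qed

end


section \<open>The type class results, read in the chosen record\<close>

lemma Rep_Abs: "x \<in> ca_carrier chosen_alg \<Longrightarrow> Rep_chosen (Abs_chosen x) = x"
  by (rule Abs_chosen_inverse)

lemma linear_on_Rep: "linear_on chosen_alg f \<Longrightarrow> linear_functional (\<lambda>y. f (Rep_chosen y))"
  by (simp add: linear_on_def linear_functional_def Rep_ops Rep_mem)

lemma linear_on_Abs:
  assumes "linear_functional f" shows "linear_on chosen_alg (\<lambda>y. f (Abs_chosen y))"
proof -
  have "Abs_chosen (ca_add chosen_alg x y) = Abs_chosen x + Abs_chosen y"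
    if "x \<in> ca_carrier chosen_alg" "y \<in> ca_carrier chosen_alg" for x y :: 'a
    using that by (simp add: plus_chosen_def Rep_Abs)
  moreover have "Abs_chosen (ca_smult chosen_alg c x) = c *\<^sub>C Abs_chosen x"
    if "x \<in> ca_carrier chosen_alg" for c and x :: 'a
    using that by (simp add: scaleC_chosen_def Rep_Abs)
  ultimately show ?thesis by (simp add: linear_on_def linear_functionalD[OF assms])
qed

lemma Abs_ops:
  fixes x y :: 'a
  assumes "x \<in> ca_carrier chosen_alg"
  shows "y \<in> ca_carrier chosen_alg \<Longrightarrow> Abs_chosen (ca_mult chosen_alg x y) = Abs_chosen x * Abs_chosen y"
    "Abs_chosen (ca_star chosen_alg x) = star (Abs_chosen x)"
  using assms by (simp_all add: times_chosen_def star_chosen_def Rep_Abs)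

lemma character_on_Abs:
  assumes "character x" shows "character_on chosen_alg (\<lambda>y. x (Abs_chosen y))"
  using assms linear_on_Abs[of x]
  by (simp add: character_on_def character_def Abs_ops flip: one_chosen_def)

lemma chosen_sqrt:
  fixes x :: 'a
  assumes x: "x \<in> ca_carrier chosen_alg" and n: "ca_norm chosen_alg x \<le> 1"
  shows "\<exists>k\<in>ca_carrier chosen_alg. ca_add chosen_alg (ca_mult chosen_alg (ca_star chosen_alg x) x)
     (ca_mult chosen_alg (ca_star chosen_alg k) k) = ca_one chosen_alg"
proof -
  let ?x = "Abs_chosen x"
  have n1: "norm ?x \<le> 1" using n by (simp add: norm_chosen_def Rep_Abs[OF x])
  have "norm (1 - (1 - star ?x * ?x)) \<le> 1"
    using n1 by (simp add: norm_star_mult_self power_le_one)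
  moreover have "sa (1 - star ?x * ?x)" by (intro sa_intros)
  ultimately obtain k where k: "sa k" "k * k = 1 - star ?x * ?x" using sqrt_near_one by metis
  have "star ?x * ?x + star k * k = 1" using k by (simp add: sa_def)
  then have "Rep_chosen (star ?x * ?x + star k * k) = Rep_chosen 1" by simp
  then show ?thesis using Rep_mem[of k] by (auto simp: Rep_ops Rep_Abs[OF x])
qed

lemma chosen_norm:
  fixes x :: 'a
  assumes x: "x \<in> ca_carrier chosen_alg" and k: "k \<in> ca_carrier chosen_alg"
    and eq: "ca_add chosen_alg (ca_mult chosen_alg (ca_star chosen_alg x) x)
     (ca_mult chosen_alg (ca_star chosen_alg k) k) = ca_one chosen_alg"
  shows "ca_norm chosen_alg x \<le> 1"
proof -
  let ?x = "Abs_chosen x" and ?k = "Abs_chosen k"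
  have "Rep_chosen (star ?x * ?x + star ?k * ?k) = Rep_chosen 1"
    using eq by (simp add: Rep_ops Rep_Abs x k)
  then have "star ?x * ?x + star ?k * ?k = 1" by (simp add: Rep_chosen_inject)
  from norm_le_one_of_sum[OF this] show ?thesis by (simp add: norm_chosen_def Rep_Abs[OF x])
qed

lemma mcone_pos_set: "mcone {h::'b::cstar. pos h}"
proof -
  have "pos (c * c * (k * k))" if "sa c" "central c" "sa k" for c k :: 'b
  proof -
    have "c * c * (k * k) = (c * k) * (c * k)" using that(2) unfolding central_def by (metis mult.assoc)
    then show ?thesis using pos_square[OF sa_central_mult] that by metis
  qed
  then show ?thesis
    unfolding mcone_def by (auto simp: pos_add pos_star_mult pos_sa) (auto simp: pos_def[of m for m])
qed

text \<open>Take u = \<open>star x * x\<close> - t. Were -u positive, then \<open>star x * x\<close>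
  would lie below t and the squared norm of x would be at most t. So the cone of positive elements
  omits -u and a state nonnegative at u exists.\<close>

lemma exists_state:
  fixes x :: "'b::cstar"
  assumes t: "0 \<le> t" "t < (norm x)\<^sup>2"
  obtains f :: "'b \<Rightarrow> complex" where "linear_functional f" "f 1 = 1" "\<forall>y. Im (f (star y * y)) = 0 \<and> 0 \<le> Re (f (star y * y))"
    "t \<le> Re (f (star x * x))" "\<forall>c y. central c \<longrightarrow> f (c * y) = f c * f y"
proof -
  define u where "u = star x * x - t *\<^sub>R 1"
  have u: "sa u" unfolding u_def by (intro sa_intros)
  have "\<not> pos (- u)"
  proof
    assume "pos (- u)"
    then have "norm (star x * x) \<le> t" using t by (intro norm_le_of_pos pos_star_mult) (simp_all add: u_def)
    with t show False by (simp add: norm_star_mult_self)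
  qed
  then have un: "- u \<notin> {h. pos h}" by simp
  obtain f :: "'b \<Rightarrow> complex"
  where f: "\<And>x y. f (x + y) = f x + f y" "\<And>c x. f (c *\<^sub>C x) = c * f x" "f 1 = 1"
    "\<And>l. l \<in> {h. pos h} \<Longrightarrow> Im (f l) = 0 \<and> Re (f l) \<ge> 0" "Re (f u) \<ge> 0"
    "\<And>c y. central c \<Longrightarrow> f (c * y) = f c * f y"
    by (rule exists_central_state[OF mcone_pos_set u un]) (rule that)
  have l: "linear_functional f" using f(1,2) by (simp add: linear_functional_def)
  show ?thesis
  proof (rule that[OF l f(3)])
    show "\<forall>y. Im (f (star y * y)) = 0 \<and> 0 \<le> Re (f (star y * y))" using f(4) pos_star_mult by blast
    show "t \<le> Re (f (star x * x))" using f(5) by (simp add: u_def linear_functionalD[OF l] f(3))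
    show "\<forall>c y. central c \<longrightarrow> f (c * y) = f c * f y" using f(6) by blast
  qed
qed

lemma chosen_state:
  fixes x :: 'a
  assumes x: "x \<in> ca_carrier chosen_alg" and t: "0 \<le> t" "t < (ca_norm chosen_alg x)\<^sup>2"
  shows "\<exists>f. linear_on chosen_alg f \<and> f (ca_one chosen_alg) = 1 \<and>
           (\<forall>y\<in>ca_carrier chosen_alg. Im (f (ca_mult chosen_alg (ca_star chosen_alg y) y)) = 0 \<and>
              0 \<le> Re (f (ca_mult chosen_alg (ca_star chosen_alg y) y))) \<and>
           t \<le> Re (f (ca_mult chosen_alg (ca_star chosen_alg x) x)) \<and>
           (\<forall>c y. central_in chosen_alg c \<longrightarrow> y \<in> ca_carrier chosen_alg \<longrightarrow> f (ca_mult chosen_alg c y) = f c * f y)"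
proof -
  let ?x = "Abs_chosen x"
  have "t < (norm ?x)\<^sup>2" using t by (simp add: norm_chosen_def Rep_Abs[OF x])
  from exists_state[OF t(1) this] obtain f :: "'a chosen \<Rightarrow> complex" where f: "linear_functional f" "f 1 = 1"
    "\<forall>y. Im (f (star y * y)) = 0 \<and> 0 \<le> Re (f (star y * y))"
    "t \<le> Re (f (star ?x * ?x))" "\<forall>c y. central c \<longrightarrow> f (c * y) = f c * f y" by metis
  have c: "central (Abs_chosen c)" if "central_in chosen_alg c" for c :: 'a
    unfolding central_def
  proof
    fix z :: "'a chosen"
    show "z * Abs_chosen c = Abs_chosen c * z"
      using that Rep_mem[of z] unfolding central_in_def Rep_chosen_inject[symmetric] Rep_ops by (simp add: Rep_Abs)
  qed
  show ?thesis
  proof (intro exI[of _ "\<lambda>y. f (Abs_chosen y)"] conjI allI impI ballI)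
    show "linear_on chosen_alg (\<lambda>y. f (Abs_chosen y))" by (rule linear_on_Abs[OF f(1)])
    show "f (Abs_chosen (ca_one chosen_alg)) = 1" using f(2) by (simp add: one_chosen_def)
    show "t \<le> Re (f (Abs_chosen (ca_mult chosen_alg (ca_star chosen_alg x) x)))"
      using f(4) by (simp add: Abs_ops(1)[OF chosenD(5)[OF x] x] Abs_ops(2)[OF x])
  next
    fix y :: 'a assume "y \<in> ca_carrier chosen_alg"
    then show "Im (f (Abs_chosen (ca_mult chosen_alg (ca_star chosen_alg y) y))) = 0"
      "0 \<le> Re (f (Abs_chosen (ca_mult chosen_alg (ca_star chosen_alg y) y)))"
      using f(3) by (simp_all add: Abs_ops(1)[OF chosenD(5)] Abs_ops(2))
  next
    fix c y :: 'a assume cy: "central_in chosen_alg c" "y \<in> ca_carrier chosen_alg"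
    then show "f (Abs_chosen (ca_mult chosen_alg c y)) = f (Abs_chosen c) * f (Abs_chosen y)"
      using f(5) c[OF cy(1)] by (simp add: Abs_ops central_in_def)
  qed
qed

lemma chosen_dilation:
  fixes phi :: "nat \<Rightarrow> nat \<Rightarrow> 'a \<Rightarrow> complex"
  assumes comm: "ca_commutative (chosen_alg :: 'a cstar_alg)" and R: "R \<subseteq> ca_carrier chosen_alg"
    and F: "finite F" "F \<subseteq> ca_carrier chosen_alg" and e: "e > 0" and ker: "kernel_on chosen_alg n phi R ch"
  shows "\<exists>rs. (\<forall>r\<in>set rs. character_on chosen_alg (fst r) \<and> (\<forall>b\<in>R. fst r b = ch b)) \<and>
           (\<forall>k<n. \<forall>l<n. (\<Sum>r\<leftarrow>rs. cnj (snd r k) * snd r l) = phi k l (ca_one chosen_alg)) \<and>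
           (\<forall>a\<in>F. \<forall>k<n. \<forall>l<n. cmod ((\<Sum>r\<leftarrow>rs. cnj (snd r k) * snd r l * fst r a) - phi k l a) \<le> e)"
proof -
  let ?phi = "\<lambda>k l y. phi k l (Rep_chosen y)"
  note k0 = ker[unfolded kernel_on_def]
  note k1 = k0[THEN conjunct1, rule_format] and r1 = k0[THEN conjunct2]
  note k2 = r1[THEN conjunct1, rule_format] and r2 = r1[THEN conjunct2]
  note k3 = r2[THEN conjunct1, rule_format] and r3 = r2[THEN conjunct2]
  note k4 = r3[THEN conjunct1, rule_format] and r4 = r3[THEN conjunct2]
  note k5 = r4[THEN conjunct1, rule_format] and k6 = r4[THEN conjunct2]
  interpret kernel n ?phi "Abs_chosen ` R" "\<lambda>y. ch (Rep_chosen y)"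
  proof
    fix x y :: "'a chosen" show "x * y = y * x"
      using comm Rep_mem[of x] Rep_mem[of y] unfolding ca_commutative_def Rep_chosen_inject[symmetric] Rep_ops by blast
  next
    fix i l assume il: "i < n" "l < n"
    show "linear_functional (?phi i l)" by (rule linear_on_Rep[OF k1[OF il]])
    fix a show "phi l i (Rep_chosen (star a)) = cnj (phi i l (Rep_chosen a))"
      unfolding Rep_ops by (rule k2[OF il Rep_mem])
  next
    fix z g show "0 \<le> Re (\<Sum>i<n. \<Sum>l<n. cnj (z i) * z l * phi i l (Rep_chosen (star g * g)))"
      unfolding Rep_ops by (rule k3[OF Rep_mem])
  next
    fix i l :: nat and t :: real and p q :: "'a chosen" assume il: "i < n" "l < n" "t > 0"
    show "cmod (phi i l (Rep_chosen (star p * q))) \<le> (t * Re (phi i i (Rep_chosen (star p * p))) + Re (phi l l (Rep_chosen (star q * q))) / t) / 2"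
      unfolding Rep_ops by (rule k4[OF il Rep_mem Rep_mem])
  next
    fix i l r a assume il: "i < n" "l < n" "r \<in> Abs_chosen ` R"
    then obtain b where b: "b \<in> R" "r = Abs_chosen b" by blast
    have Rb: "Rep_chosen r = b" using b R by (auto intro: Rep_Abs)
    show "phi i l (Rep_chosen (r * a)) = ch (Rep_chosen r) * phi i l (Rep_chosen a)"
      unfolding Rep_ops Rb by (rule k5[OF il(1,2) b(1) Rep_mem])
  next
    show "\<exists>i<n. 0 < Re (phi i i (Rep_chosen 1))" unfolding Rep_ops by (rule k6)
  qed
  from dilation[OF finite_imageI[OF F(1), of Abs_chosen] e] obtain rs :: "(('a chosen \<Rightarrow> complex) \<times> (nat \<Rightarrow> complex)) list" where rs:
    "\<forall>r\<in>set rs. character (fst r) \<and> (\<forall>b\<in>Abs_chosen ` R. fst r b = ch (Rep_chosen b))"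
    "\<forall>k<n. \<forall>l<n. (\<Sum>r\<leftarrow>rs. cnj (snd r k) * snd r l) = phi k l (Rep_chosen 1)"
    "\<forall>a\<in>Abs_chosen ` F. \<forall>k<n. \<forall>l<n. cmod ((\<Sum>r\<leftarrow>rs. cnj (snd r k) * snd r l * fst r a) - phi k l (Rep_chosen a)) \<le> e"
    by (elim exE conjE)
  define qs where "qs = map (\<lambda>r. (\<lambda>a. fst r (Abs_chosen a), snd r)) rs"
  show ?thesis
  proof (intro exI[of _ qs] conjI)
    show "\<forall>r\<in>set qs. character_on chosen_alg (fst r) \<and> (\<forall>b\<in>R. fst r b = ch b)"
      using rs(1) R character_on_Abs by (fastforce simp: qs_def Rep_Abs subset_iff)
    show "\<forall>k<n. \<forall>l<n. (\<Sum>r\<leftarrow>qs. cnj (snd r k) * snd r l) = phi k l (ca_one chosen_alg)"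
      using rs(2) by (simp add: qs_def o_def Rep_ops)
    show "\<forall>a\<in>F. \<forall>k<n. \<forall>l<n. cmod ((\<Sum>r\<leftarrow>qs. cnj (snd r k) * snd r l * fst r a) - phi k l a) \<le> e"
      using rs(3) F(2) by (auto simp: qs_def o_def Rep_Abs subset_iff)
  qed
qed

text \<open>A bad algebra on the type would make the chosen one bad; but the chosen one carries an
  instance of the class, for which every clause has been proved.\<close>

theorem good_alg:
  fixes A :: "'a cstar_alg"
  assumes "unital_cstar_alg A" shows "good_alg A"
proof (rule ccontr)
  assume "\<not> good_alg A"
  then have ex: "\<exists>A::'a cstar_alg. unital_cstar_alg A \<and> \<not> good_alg A" using assms by blast
  from someI_ex[OF ex] ex have "\<not> good_alg (chosen_alg :: 'a cstar_alg)" by (simp add: chosen_alg_def)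
  moreover have "good_alg (chosen_alg :: 'a cstar_alg)"
    unfolding good_alg_def
  proof (intro conjI ballI allI impI)
  qed (rule chosen_sqrt chosen_norm chosen_state chosen_dilation; assumption)+
  ultimately show False by simp
qed

section \<open>Matrix algebras\<close>

definition cip :: "complex vec \<Rightarrow> complex vec \<Rightarrow> complex" where
  "cip v w = (\<Sum>i<dim_vec w. v $ i * cnj (w $ i))"

lemma cip_add_left:
  "u \<in> carrier_vec n \<Longrightarrow> v \<in> carrier_vec n \<Longrightarrow> w \<in> carrier_vec n \<Longrightarrow> cip (u + v) w = cip u w + cip v w"
  by (simp add: cip_def distrib_right sum.distrib)

lemma cip_minus_left:
  "u \<in> carrier_vec n \<Longrightarrow> v \<in> carrier_vec n \<Longrightarrow> w \<in> carrier_vec n \<Longrightarrow> cip (u - v) w = cip u w - cip v w"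
  by (simp add: cip_def left_diff_distrib sum_subtractf)

lemma cip_smult_left: "u \<in> carrier_vec n \<Longrightarrow> w \<in> carrier_vec n \<Longrightarrow> cip (c \<cdot>\<^sub>v u) w = c * cip u w"
  by (simp add: cip_def sum_distrib_left mult.assoc)

lemma cip_cnj: "u \<in> carrier_vec n \<Longrightarrow> w \<in> carrier_vec n \<Longrightarrow> cip w u = cnj (cip u w)"
  by (simp add: cip_def mult.commute)

lemma cip_minus_right:
  assumes "u \<in> carrier_vec n" "v \<in> carrier_vec n" "w \<in> carrier_vec n"
  shows "cip w (u - v) = cip w u - cip w v"
  using assms by (simp add: cip_def right_diff_distrib sum_subtractf)

lemma cip_smult_right: "u \<in> carrier_vec n \<Longrightarrow> w \<in> carrier_vec n \<Longrightarrow> cip w (c \<cdot>\<^sub>v u) = cnj c * cip w u"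
  by (simp add: cip_def sum_distrib_left mult_ac)

lemma vec_norm2_eq_L2_set: "vec_norm2 v = L2_set (\<lambda>i. cmod (v $ i)) {..<dim_vec v}"
  by (simp add: vec_norm2_def L2_set_def)

lemma vec_norm2_nonneg [simp]: "0 \<le> vec_norm2 v"
  by (simp add: vec_norm2_eq_L2_set L2_set_nonneg)

lemma cip_self: "cip v v = of_real ((vec_norm2 v)\<^sup>2)"
proof -
  have "(vec_norm2 v)\<^sup>2 = (\<Sum>i<dim_vec v. (cmod (v $ i))\<^sup>2)"
    by (simp add: vec_norm2_def sum_nonneg)
  then show ?thesis unfolding cip_def of_real_sum by (simp only: of_real_sum complex_norm_square)
qed

lemma cip_cauchy_schwarz:
  assumes "v \<in> carrier_vec n" "w \<in> carrier_vec n"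
  shows "cmod (cip v w) \<le> vec_norm2 v * vec_norm2 w"
proof -
  have "cmod (cip v w) \<le> (\<Sum>i<n. \<bar>cmod (v $ i)\<bar> * \<bar>cmod (w $ i)\<bar>)"
    using assms unfolding cip_def by (auto intro!: sum_norm_le simp: norm_mult)
  also have "\<dots> \<le> vec_norm2 v * vec_norm2 w"
    using assms L2_set_mult_ineq[of "\<lambda>i. cmod (v $ i)" "\<lambda>i. cmod (w $ i)" "{..<n}"] by (simp add: vec_norm2_eq_L2_set)
  finally show ?thesis .
qed

lemma vec_norm2_triangle:
  assumes "v \<in> carrier_vec n" "w \<in> carrier_vec n"
  shows "vec_norm2 (v + w) \<le> vec_norm2 v + vec_norm2 w"
proof -
  have "vec_norm2 (v + w) \<le> L2_set (\<lambda>i. cmod (v $ i) + cmod (w $ i)) {..<n}"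
    using assms unfolding vec_norm2_eq_L2_set by (auto intro!: L2_set_mono simp: norm_triangle_ineq)
  also have "\<dots> \<le> vec_norm2 v + vec_norm2 w"
    using assms L2_set_triangle_ineq by (simp add: vec_norm2_eq_L2_set)
  finally show ?thesis .
qed

lemma vec_norm2_smult: "vec_norm2 (c \<cdot>\<^sub>v v) = cmod c * vec_norm2 v"
  by (simp add: vec_norm2_eq_L2_set L2_set_right_distrib) (rule L2_set_cong, simp_all add: norm_mult)

lemma norm_entry_le_vec_norm2: "i < dim_vec v \<Longrightarrow> cmod (v $ i) \<le> vec_norm2 v"
  unfolding vec_norm2_eq_L2_set by (rule member_le_L2_set) auto

lemma vec_norm2_le_sum: "vec_norm2 v \<le> (\<Sum>i<dim_vec v. cmod (v $ i))"
  unfolding vec_norm2_eq_L2_set by (rule L2_set_le_sum) auto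

lemma vec_norm2_zero: "vec_norm2 (0\<^sub>v n) = 0"
  by (simp add: vec_norm2_def)

lemma vec_norm2_eq_0: "v \<in> carrier_vec n \<Longrightarrow> vec_norm2 v = 0 \<Longrightarrow> v = 0\<^sub>v n"
  by (intro eq_vecI) (use norm_entry_le_vec_norm2[of _ v] in auto)

lemma vec_norm2_unit: "j < n \<Longrightarrow> vec_norm2 (unit_vec n j) \<le> 1"
proof -
  assume j: "j < n"
  have "vec_norm2 (unit_vec n j) \<le> (\<Sum>i<n. cmod (unit_vec n j $ i))"
    using vec_norm2_le_sum[of "unit_vec n j"] by simp
  also have "\<dots> = (\<Sum>i<n. if i = j then 1 else 0)" using j by (intro sum.cong) auto
  also have "\<dots> \<le> 1" using j by simp
  finally have "vec_norm2 (unit_vec n j) \<le> 1" .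
  then show ?thesis using j by simp
qed

section \<open>Adjoints and the operator norm of complex matrices\<close>

lemma mat_adjoint_dim: "A \<in> carrier_mat n m \<Longrightarrow> mat_adjoint A \<in> carrier_mat m n"
  by (auto simp: mat_adjoint_def)

lemma mat_adjoint_index:
  fixes A :: "complex mat"
  assumes "A \<in> carrier_mat n m" "i < m" "j < n" shows "mat_adjoint A $$ (i, j) = cnj (A $$ (j, i))"
  using assms by (simp add: mat_adjoint_def mat_of_rows_def conjugate_complex_def)

lemma cip_mult_mat:
  assumes "M \<in> carrier_mat n n" "v \<in> carrier_vec n" "w \<in> carrier_vec n"
  shows "cip (M *\<^sub>v v) w = cip v (mat_adjoint M *\<^sub>v w)"
proof -
  have "cip (M *\<^sub>v v) w = (\<Sum>i<n. \<Sum>j<n. M $$ (i, j) * v $ j * cnj (w $ i))"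
    using assms by (simp add: cip_def scalar_prod_def sum_distrib_right lessThan_atLeast0)
  also have "\<dots> = (\<Sum>j<n. \<Sum>i<n. M $$ (i, j) * v $ j * cnj (w $ i))" by (rule sum.swap)
  also have "\<dots> = cip v (mat_adjoint M *\<^sub>v w)"
    using assms mat_adjoint_dim[OF assms(1)]
    by (simp add: cip_def scalar_prod_def sum_distrib_left lessThan_atLeast0 mat_adjoint_index[OF assms(1)] mult_ac)
  finally show ?thesis .
qed

lemma mat_adjoint_adjoint: "A \<in> carrier_mat n m \<Longrightarrow> mat_adjoint (mat_adjoint A) = (A :: complex mat)"
  using mat_adjoint_dim[of A n m] mat_adjoint_dim[of "mat_adjoint A" m n]
  by (intro eq_matI) (auto simp: mat_adjoint_index[of _ m n] mat_adjoint_index[of _ n m])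

lemma mat_adjoint_add:
  "A \<in> carrier_mat n m \<Longrightarrow> B \<in> carrier_mat n m \<Longrightarrow> mat_adjoint (A + B) = mat_adjoint A + (mat_adjoint B :: complex mat)"
  using mat_adjoint_dim[of A n m] mat_adjoint_dim[of B n m] mat_adjoint_dim[of "A + B" n m]
  by (intro eq_matI) (auto simp: mat_adjoint_index[of _ n m])

lemma mat_adjoint_smult:
  "A \<in> carrier_mat n m \<Longrightarrow> mat_adjoint (c \<cdot>\<^sub>m A) = cnj c \<cdot>\<^sub>m mat_adjoint A"
  using mat_adjoint_dim[of A n m] mat_adjoint_dim[of "c \<cdot>\<^sub>m A" n m]
  by (intro eq_matI) (auto simp: mat_adjoint_index[of _ n m])

lemma mat_adjoint_mult:
  fixes A B :: "complex mat"
  assumes "A \<in> carrier_mat n m" "B \<in> carrier_mat m k"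
  shows "mat_adjoint (A * B) = mat_adjoint B * mat_adjoint A"
  using assms mat_adjoint_dim[of A n m] mat_adjoint_dim[of B m k] mat_adjoint_dim[of "A * B" n k]
  by (intro eq_matI) (auto simp: mat_adjoint_index[of _ n m] mat_adjoint_index[of _ m k] mat_adjoint_index[of _ n k]
      scalar_prod_def intro!: sum.cong)

lemma mult_mat_vec_norm_bound:
  assumes "M \<in> carrier_mat n n" "v \<in> carrier_vec n"
  shows "vec_norm2 (M *\<^sub>v v) \<le> (\<Sum>i<n. \<Sum>j<n. cmod (M $$ (i, j))) * vec_norm2 v"
proof -
  have "vec_norm2 (M *\<^sub>v v) \<le> (\<Sum>i<n. cmod ((M *\<^sub>v v) $ i))"
    using vec_norm2_le_sum[of "M *\<^sub>v v"] assms by simp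
  also have "\<dots> \<le> (\<Sum>i<n. \<Sum>j<n. cmod (M $$ (i, j)) * vec_norm2 v)"
  proof (rule sum_mono)
    fix i assume "i \<in> {..<n}"
    then have "(M *\<^sub>v v) $ i = (\<Sum>j<n. M $$ (i, j) * v $ j)"
      using assms by (simp add: scalar_prod_def lessThan_atLeast0)
    also have "cmod \<dots> \<le> (\<Sum>j<n. cmod (M $$ (i, j)) * vec_norm2 v)"
      using assms by (intro sum_norm_le) (auto simp: norm_mult intro!: mult_left_mono norm_entry_le_vec_norm2)
    finally show "cmod ((M *\<^sub>v v) $ i) \<le> (\<Sum>j<n. cmod (M $$ (i, j)) * vec_norm2 v)" .
  qed
  finally show ?thesis by (simp add: sum_distrib_right)
qed

lemma opnorm_le:
  assumes M: "M \<in> carrier_mat n n" and K: "K \<ge> 0"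
    and b: "\<And>v. v \<in> carrier_vec n \<Longrightarrow> vec_norm2 (M *\<^sub>v v) \<le> K * vec_norm2 v"
  shows "mat_opnorm M \<le> K"
  unfolding mat_opnorm_def
proof (rule cSup_least)
  have "vec_norm2 (M *\<^sub>v 0\<^sub>v n) \<in> {vec_norm2 (M *\<^sub>v v) |v. v \<in> carrier_vec (dim_col M) \<and> vec_norm2 v \<le> 1}"
    using M by (intro CollectI exI[of _ "0\<^sub>v n"]) (simp add: vec_norm2_zero)
  then show "{vec_norm2 (M *\<^sub>v v) |v. v \<in> carrier_vec (dim_col M) \<and> vec_norm2 v \<le> 1} \<noteq> {}" by blast
next
  fix x assume "x \<in> {vec_norm2 (M *\<^sub>v v) |v. v \<in> carrier_vec (dim_col M) \<and> vec_norm2 v \<le> 1}"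
  then obtain v where v: "x = vec_norm2 (M *\<^sub>v v)" "v \<in> carrier_vec n" "vec_norm2 v \<le> 1" using M by auto
  have "x \<le> K * vec_norm2 v" unfolding v(1) by (rule b[OF v(2)])
  also have "\<dots> \<le> K" using v(3) K by (simp add: mult_left_le)
  finally show "x \<le> K" .
qed

lemma opnorm_upper:
  assumes M: "M \<in> carrier_mat n n" and v: "v \<in> carrier_vec n" "vec_norm2 v \<le> 1"
  shows "vec_norm2 (M *\<^sub>v v) \<le> mat_opnorm M"
  unfolding mat_opnorm_def
proof (rule cSup_upper)
  show "vec_norm2 (M *\<^sub>v v) \<in> {vec_norm2 (M *\<^sub>v v) |v. v \<in> carrier_vec (dim_col M) \<and> vec_norm2 v \<le> 1}"
    using M v by auto
  let ?K = "\<Sum>i<n. \<Sum>j<n. cmod (M $$ (i, j))"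
  have "?K \<ge> 0" by (intro sum_nonneg) auto
  have "vec_norm2 (M *\<^sub>v v) \<le> ?K" if "v \<in> carrier_vec n" "vec_norm2 v \<le> 1" for v
    using mult_mat_vec_norm_bound[OF M that(1)] mult_left_le[OF that(2) \<open>?K \<ge> 0\<close>] by linarith
  then show "bdd_above {vec_norm2 (M *\<^sub>v v) |v. v \<in> carrier_vec (dim_col M) \<and> vec_norm2 v \<le> 1}"
    using M by (auto simp: bdd_above_def)
qed

lemma opnorm_nonneg: "M \<in> carrier_mat n n \<Longrightarrow> 0 \<le> mat_opnorm M"
  using opnorm_upper[of M n "0\<^sub>v n"] vec_norm2_nonneg[of "M *\<^sub>v 0\<^sub>v n"]
  by (simp add: vec_norm2_zero del: vec_norm2_nonneg)

lemma opnorm_bound: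
  assumes M: "M \<in> carrier_mat n n" and v: "v \<in> carrier_vec n"
  shows "vec_norm2 (M *\<^sub>v v) \<le> mat_opnorm M * vec_norm2 v"
proof (cases "vec_norm2 v = 0")
  case True
  then show ?thesis using mult_mat_vec_norm_bound[OF M v] by simp
next
  case False
  then have p: "vec_norm2 v > 0" using vec_norm2_nonneg[of v] by linarith
  let ?w = "of_real (1 / vec_norm2 v) \<cdot>\<^sub>v v"
  have "vec_norm2 ?w = 1" using p by (simp only: vec_norm2_smult norm_of_real) simp
  then have "vec_norm2 (M *\<^sub>v ?w) \<le> mat_opnorm M" using v by (intro opnorm_upper[OF M]) auto
  also have "M *\<^sub>v ?w = of_real (1 / vec_norm2 v) \<cdot>\<^sub>v (M *\<^sub>v v)" using M v by (rule mult_mat_vec)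
  also have "vec_norm2 \<dots> = vec_norm2 (M *\<^sub>v v) / vec_norm2 v" using p by (simp only: vec_norm2_smult norm_of_real) simp
  finally show ?thesis using p by (simp add: divide_le_eq)
qed

lemma norm_entry_le_opnorm:
  assumes M: "M \<in> carrier_mat n n" and ij: "i < n" "j < n" shows "cmod (M $$ (i, j)) \<le> mat_opnorm M"
proof -
  have "(M *\<^sub>v unit_vec n j) $ i = M $$ (i, j)" using M ij by (simp add: mult_mat_vec_def)
  then have "cmod (M $$ (i, j)) \<le> vec_norm2 (M *\<^sub>v unit_vec n j)"
    using norm_entry_le_vec_norm2[of i "M *\<^sub>v unit_vec n j"] M ij by simp
  also have "\<dots> \<le> mat_opnorm M" using ij by (intro opnorm_upper[OF M] vec_norm2_unit) auto
  finally show ?thesis .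
qed

lemma opnorm_le_sum: "M \<in> carrier_mat n n \<Longrightarrow> mat_opnorm M \<le> (\<Sum>i<n. \<Sum>j<n. cmod (M $$ (i, j)))"
  by (rule opnorm_le) (auto intro!: sum_nonneg mult_mat_vec_norm_bound)

lemma opnorm_mult_le:
  assumes M: "M \<in> carrier_mat n n" and L: "L \<in> carrier_mat n n" shows "mat_opnorm (M * L) \<le> mat_opnorm M * mat_opnorm L"
proof (rule opnorm_le)
  fix v :: "complex vec" assume v: "v \<in> carrier_vec n"
  have "vec_norm2 (M * L *\<^sub>v v) = vec_norm2 (M *\<^sub>v (L *\<^sub>v v))" using M L v by simp
  also have "\<dots> \<le> mat_opnorm M * vec_norm2 (L *\<^sub>v v)" using L v by (intro opnorm_bound[OF M]) auto
  also have "\<dots> \<le> mat_opnorm M * (mat_opnorm L * vec_norm2 v)"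
    using opnorm_bound[OF L v] opnorm_nonneg[OF M] by (rule mult_left_mono)
  finally show "vec_norm2 (M * L *\<^sub>v v) \<le> mat_opnorm M * mat_opnorm L * vec_norm2 v" by (simp add: mult.assoc)
qed (use M L opnorm_nonneg in auto)

lemma opnorm_smult_le: "M \<in> carrier_mat n n \<Longrightarrow> mat_opnorm (c \<cdot>\<^sub>m M) \<le> cmod c * mat_opnorm M"
proof -
  assume M: "M \<in> carrier_mat n n"
  show ?thesis
  proof (rule opnorm_le)
    fix v :: "complex vec" assume v: "v \<in> carrier_vec n"
    have "(c \<cdot>\<^sub>m M) *\<^sub>v v = c \<cdot>\<^sub>v (M *\<^sub>v v)" using M v by (intro eq_vecI) auto
    then show "vec_norm2 ((c \<cdot>\<^sub>m M) *\<^sub>v v) \<le> cmod c * mat_opnorm M * vec_norm2 v"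
      using mult_left_mono[OF opnorm_bound[OF M v], of "cmod c"] by (simp add: vec_norm2_smult mult.assoc)
  qed (use M opnorm_nonneg[OF M] in auto)
qed

lemma opnorm_add_le:
  assumes M: "M \<in> carrier_mat n n" and L: "L \<in> carrier_mat n n" shows "mat_opnorm (M + L) \<le> mat_opnorm M + mat_opnorm L"
proof (rule opnorm_le)
  fix v :: "complex vec" assume v: "v \<in> carrier_vec n"
  have "(M + L) *\<^sub>v v = M *\<^sub>v v + L *\<^sub>v v" using M L v by (rule add_mult_distrib_mat_vec)
  then show "vec_norm2 ((M + L) *\<^sub>v v) \<le> (mat_opnorm M + mat_opnorm L) * vec_norm2 v"
    using vec_norm2_triangle[of "M *\<^sub>v v" n "L *\<^sub>v v"] opnorm_bound[OF M v] opnorm_bound[OF L v] M L v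
    by (auto simp: distrib_right intro: order_trans)
qed (use M L opnorm_nonneg in auto)

text \<open>The squared length of M v is the inner product of v with
  \<open>mat_adjoint M * M\<close> applied to v, and Cauchy-Schwarz bounds it. The reverse
  inequality needs only submultiplicativity once the adjoint is known to have no larger
  norm.\<close>

lemma opnorm_square_le:
  assumes M: "M \<in> carrier_mat n n" shows "(mat_opnorm M)\<^sup>2 \<le> mat_opnorm (mat_adjoint M * M)"
proof -
  let ?N = "mat_adjoint M * M"
  have N: "?N \<in> carrier_mat n n" using M mat_adjoint_dim[OF M] by auto
  have "mat_opnorm M \<le> sqrt (mat_opnorm ?N)"
  proof (rule opnorm_le[OF M])
    fix v :: "complex vec" assume v: "v \<in> carrier_vec n"
    have Mv: "M *\<^sub>v v \<in> carrier_vec n" and Nv: "?N *\<^sub>v v \<in> carrier_vec n" using M v N by auto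
    have "cip (M *\<^sub>v v) (M *\<^sub>v v) = cip v (?N *\<^sub>v v)"
      using cip_mult_mat[OF M v Mv] M v mat_adjoint_dim[OF M] by simp
    then have "(vec_norm2 (M *\<^sub>v v))\<^sup>2 = cmod (cip v (?N *\<^sub>v v))"
      by (metis cip_self norm_of_real abs_of_nonneg zero_le_power2)
    also have "\<dots> \<le> vec_norm2 v * (mat_opnorm ?N * vec_norm2 v)"
      by (rule order_trans[OF cip_cauchy_schwarz[OF v Nv]]) (intro mult_left_mono opnorm_bound[OF N v], simp)
    also have "\<dots> = (sqrt (mat_opnorm ?N) * vec_norm2 v)\<^sup>2"
      using opnorm_nonneg[OF N] by (simp add: power_mult_distrib power2_eq_square[of "vec_norm2 v"])
    finally show "vec_norm2 (M *\<^sub>v v) \<le> sqrt (mat_opnorm ?N) * vec_norm2 v"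
      by (rule power2_le_imp_le) (simp add: opnorm_nonneg[OF N])
  qed (simp add: opnorm_nonneg[OF N])
  then have "(mat_opnorm M)\<^sup>2 \<le> (sqrt (mat_opnorm ?N))\<^sup>2" by (rule power_mono) (rule opnorm_nonneg[OF M])
  then show ?thesis using opnorm_nonneg[OF N] by simp
qed

lemma opnorm_adjoint_le:
  assumes M: "M \<in> carrier_mat n n" shows "mat_opnorm M \<le> mat_opnorm (mat_adjoint M)"
proof (cases "mat_opnorm M = 0")
  case False
  then have p: "mat_opnorm M > 0" using opnorm_nonneg[OF M] by simp
  have "mat_opnorm M * mat_opnorm M \<le> mat_opnorm (mat_adjoint M) * mat_opnorm M"
    using opnorm_square_le[OF M] opnorm_mult_le[OF mat_adjoint_dim[OF M] M] by (simp add: power2_eq_square)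
  with p show ?thesis by simp
qed (use opnorm_nonneg[OF mat_adjoint_dim[OF M]] in simp)

lemma opnorm_cstar:
  assumes M: "M \<in> carrier_mat n n" shows "mat_opnorm (mat_adjoint M * M) = (mat_opnorm M)\<^sup>2"
proof (rule antisym[OF _ opnorm_square_le[OF M]])
  have "mat_opnorm (mat_adjoint M) \<le> mat_opnorm M"
    using opnorm_adjoint_le[OF mat_adjoint_dim[OF M]] mat_adjoint_adjoint[OF M] by simp
  then have "mat_opnorm (mat_adjoint M) * mat_opnorm M \<le> mat_opnorm M * mat_opnorm M"
    using opnorm_nonneg[OF M] by (rule mult_right_mono)
  then show "mat_opnorm (mat_adjoint M * M) \<le> (mat_opnorm M)\<^sup>2"
    using opnorm_mult_le[OF mat_adjoint_dim[OF M] M] by (simp add: power2_eq_square)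
qed

section \<open>Square matrices as a C*-algebra\<close>

definition mat_alg :: "nat \<Rightarrow> complex mat cstar_alg" where
  "mat_alg n = \<lparr>ca_carrier = carrier_mat n n, ca_zero = 0\<^sub>m n n, ca_one = 1\<^sub>m n, ca_add = (+), ca_mult = (*),
     ca_smult = (\<cdot>\<^sub>m), ca_star = mat_adjoint, ca_norm = mat_opnorm\<rparr>"

text \<open>The operator norm dominates each entry and is dominated by the sum of the moduli of all
  entries, so the limit can be formed entrywise.\<close>

lemma mat_complete:
  fixes f :: "nat \<Rightarrow> complex mat"
  assumes f: "\<And>k. f k \<in> carrier_mat n n"
    and c: "\<And>e. e > 0 \<Longrightarrow> \<exists>N. \<forall>m\<ge>N. \<forall>k\<ge>N. mat_opnorm (f m + (-1) \<cdot>\<^sub>m f k) < e"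
  shows "\<exists>x\<in>carrier_mat n n. \<forall>e>0. \<exists>N. \<forall>k\<ge>N. mat_opnorm (f k + (-1) \<cdot>\<^sub>m x) < e"
proof -
  have ent: "cmod (f m $$ (i, j) - f k $$ (i, j)) \<le> mat_opnorm (f m + (-1) \<cdot>\<^sub>m f k)" if "i < n" "j < n" for m k i j
    using norm_entry_le_opnorm[of "f m + (-1) \<cdot>\<^sub>m f k" n i j] f[of m] f[of k] that by simp
  have conv: "\<exists>l. (\<lambda>k. f k $$ (i, j)) \<longlonglongrightarrow> l" if ij: "i < n" "j < n" for i j
  proof -
    have "Cauchy (\<lambda>k. f k $$ (i, j))"
    proof (rule CauchyI)
      fix e :: real assume "0 < e"
      from c[OF this] obtain N where "\<forall>m\<ge>N. \<forall>k\<ge>N. mat_opnorm (f m + (-1) \<cdot>\<^sub>m f k) < e" by blast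
      then show "\<exists>M. \<forall>m\<ge>M. \<forall>k\<ge>M. cmod (f m $$ (i, j) - f k $$ (i, j)) < e"
        using ent[OF ij] by (meson le_less_trans)
    qed
    then show ?thesis by (simp add: Cauchy_convergent_iff convergent_def)
  qed
  define l where "l i j = (SOME l. (\<lambda>k. f k $$ (i, j)) \<longlonglongrightarrow> l)" for i j
  have l: "(\<lambda>k. f k $$ (i, j)) \<longlonglongrightarrow> l i j" if "i < n" "j < n" for i j
    unfolding l_def by (rule someI_ex[OF conv[OF that]])
  define x where "x = mat n n (\<lambda>(i, j). l i j)"
  have x: "x \<in> carrier_mat n n" by (simp add: x_def)
  have "(\<lambda>k. \<Sum>i<n. \<Sum>j<n. cmod (f k $$ (i, j) - l i j)) \<longlonglongrightarrow> (\<Sum>i<n. \<Sum>j<n. cmod (l i j - l i j))"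
    by (intro tendsto_sum tendsto_norm tendsto_diff l tendsto_const) auto
  then have lim: "(\<lambda>k. \<Sum>i<n. \<Sum>j<n. cmod (f k $$ (i, j) - l i j)) \<longlonglongrightarrow> 0" by simp
  have le: "mat_opnorm (f k + (-1) \<cdot>\<^sub>m x) \<le> (\<Sum>i<n. \<Sum>j<n. cmod (f k $$ (i, j) - l i j))" for k
  proof -
    have "mat_opnorm (f k + (-1) \<cdot>\<^sub>m x) \<le> (\<Sum>i<n. \<Sum>j<n. cmod ((f k + (-1) \<cdot>\<^sub>m x) $$ (i, j)))"
      using f x by (intro opnorm_le_sum) auto
    also have "\<dots> = (\<Sum>i<n. \<Sum>j<n. cmod (f k $$ (i, j) - l i j))"
      using f[of k] by (intro sum.cong refl) (simp add: x_def)
    finally show ?thesis .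
  qed
  show ?thesis
  proof (intro bexI[OF _ x] allI impI)
    fix e :: real assume "e > 0"
    from order_tendstoD(2)[OF lim this] obtain N where "\<forall>k\<ge>N. (\<Sum>i<n. \<Sum>j<n. cmod (f k $$ (i, j) - l i j)) < e"
      unfolding eventually_sequentially by blast
    then show "\<exists>N. \<forall>k\<ge>N. mat_opnorm (f k + (-1) \<cdot>\<^sub>m x) < e" using le by (meson le_less_trans)
  qed
qed

lemma cstar_mat_alg: "cstar_alg (mat_alg n)"
proof -
  have smult: "mat_opnorm (c \<cdot>\<^sub>m M) = cmod c * mat_opnorm M" if M: "M \<in> carrier_mat n n" for c M
  proof (cases "c = 0")
    case True
    then show ?thesis using opnorm_smult_le[OF M, of c] opnorm_nonneg[of "c \<cdot>\<^sub>m M" n] M by simp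
  next
    case False
    have "mat_opnorm ((1 / c) \<cdot>\<^sub>m (c \<cdot>\<^sub>m M)) \<le> cmod (1 / c) * mat_opnorm (c \<cdot>\<^sub>m M)" using M by (intro opnorm_smult_le) auto
    moreover have "(1 / c) \<cdot>\<^sub>m (c \<cdot>\<^sub>m M) = M" using False M by (intro eq_matI) auto
    ultimately have "cmod c * mat_opnorm M \<le> mat_opnorm (c \<cdot>\<^sub>m M)" using False by (simp add: norm_divide field_simps)
    then show ?thesis using opnorm_smult_le[OF M, of c] by simp
  qed
  have zero: "mat_opnorm M = 0 \<longleftrightarrow> M = 0\<^sub>m n n" if M: "M \<in> carrier_mat n n" for M
  proof
    assume "mat_opnorm M = 0"
    then show "M = 0\<^sub>m n n" using norm_entry_le_opnorm[OF M] M by (intro eq_matI) auto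
  next
    assume "M = 0\<^sub>m n n"
    then show "mat_opnorm M = 0" using opnorm_le_sum[OF M] opnorm_nonneg[OF M] by simp
  qed
  have neg: "\<exists>y\<in>carrier_mat n n. x + y = 0\<^sub>m n n" if "x \<in> carrier_mat n n" for x :: "complex mat"
    using that by (intro bexI[of _ "- x"]) auto
  show ?thesis
    unfolding cstar_alg_def mat_alg_def Let_def ca_diff_def cstar_alg.simps
  proof (intro conjI allI ballI impI)
    fix f :: "nat \<Rightarrow> complex mat" assume "\<forall>k. f k \<in> carrier_mat n n"
      "\<forall>e>0. \<exists>N. \<forall>m\<ge>N. \<forall>k\<ge>N. mat_opnorm (f m + (-1) \<cdot>\<^sub>m f k) < e"
    then show "\<exists>x\<in>carrier_mat n n. \<forall>e>0. \<exists>N. \<forall>k\<ge>N. mat_opnorm (f k + (-1) \<cdot>\<^sub>m x) < e"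
      by (intro mat_complete) auto
  next
    fix x y w :: "complex mat" and c d :: complex
    assume x: "x \<in> carrier_mat n n"
    show "(mat_opnorm x = 0) = (x = 0\<^sub>m n n)" by (rule zero[OF x])
    show "mat_opnorm (c \<cdot>\<^sub>m x) = cmod c * mat_opnorm x" by (rule smult[OF x])
    show "mat_opnorm (mat_adjoint x * x) = (mat_opnorm x)\<^sup>2" by (rule opnorm_cstar[OF x])
    show "\<exists>y\<in>carrier_mat n n. x + y = 0\<^sub>m n n" by (rule neg[OF x])
    show "mat_adjoint (mat_adjoint x) = x" by (rule mat_adjoint_adjoint[OF x])
    show "mat_adjoint (c \<cdot>\<^sub>m x) = cnj c \<cdot>\<^sub>m mat_adjoint x" by (rule mat_adjoint_smult[OF x])
    show "(c + d) \<cdot>\<^sub>m x = c \<cdot>\<^sub>m x + d \<cdot>\<^sub>m x" using x by (rule add_smult_distrib_right_mat)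
    show "c * d \<cdot>\<^sub>m x = c \<cdot>\<^sub>m (d \<cdot>\<^sub>m x)" by (intro eq_matI) auto
    show "1 \<cdot>\<^sub>m x = x" by (intro eq_matI) auto
    show "mat_adjoint x \<in> carrier_mat n n" by (rule mat_adjoint_dim[OF x])
    assume y: "y \<in> carrier_mat n n"
    show "mat_opnorm (x + y) \<le> mat_opnorm x + mat_opnorm y" by (rule opnorm_add_le[OF x y])
    show "mat_opnorm (x * y) \<le> mat_opnorm x * mat_opnorm y" by (rule opnorm_mult_le[OF x y])
    show "mat_adjoint (x + y) = mat_adjoint x + mat_adjoint y" by (rule mat_adjoint_add[OF x y])
    show "mat_adjoint (x * y) = mat_adjoint y * mat_adjoint x" by (rule mat_adjoint_mult[OF x y])
    show "x + y = y + x" using x y by (rule comm_add_mat)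
    show "c \<cdot>\<^sub>m (x + y) = c \<cdot>\<^sub>m x + c \<cdot>\<^sub>m y" using x y by (rule add_smult_distrib_left_mat)
    show "c \<cdot>\<^sub>m (x * y) = c \<cdot>\<^sub>m x * y" using mult_smult_assoc_mat[OF x y] by simp
    show "c \<cdot>\<^sub>m (x * y) = x * (c \<cdot>\<^sub>m y)" using mult_smult_distrib[OF x y] by simp
    assume w: "w \<in> carrier_mat n n"
    show "x + y + w = x + (y + w)" using x y w by (rule assoc_add_mat)
    show "x * y * w = x * (y * w)" using x y w by (rule assoc_mult_mat)
    show "x * (y + w) = x * y + x * w" using x y w by (rule mult_add_distrib_mat)
    show "(x + y) * w = x * w + y * w" using x y w by (rule add_mult_distrib_mat)
  qed auto
qed

section \<open>Unitaries between families with equal Gram matrices\<close>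

lemma isometry_unitary:
  assumes U: "U \<in> carrier_mat n n"
    and iso: "\<And>v w. v \<in> carrier_vec n \<Longrightarrow> w \<in> carrier_vec n \<Longrightarrow> cip (U *\<^sub>v v) (U *\<^sub>v w) = cip v w"
  shows "mat_adjoint U * U = 1\<^sub>m n"
proof (rule eq_matI)
  note aU = mat_adjoint_dim[OF U]
  fix i j assume "i < dim_row (1\<^sub>m n :: complex mat)" "j < dim_col (1\<^sub>m n :: complex mat)"
  then have ij: "i < n" "j < n" by auto
  let ?e = "unit_vec n :: nat \<Rightarrow> complex vec"
  have cu: "cip v (?e k) = v $ k" if "k < n" for v k
  proof -
    have "cip v (?e k) = (\<Sum>i<n. if i = k then v $ i else 0)"
      unfolding cip_def by (rule sum.cong) (auto simp: unit_vec_def)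
    then show ?thesis using that by simp
  qed
  have "(mat_adjoint U * U) $$ (i, j) = cip ((mat_adjoint U * U) *\<^sub>v ?e j) (?e i)"
    using ij U aU by (simp add: cu mult_mat_vec_def)
  also have "\<dots> = cip (mat_adjoint U *\<^sub>v (U *\<^sub>v ?e j)) (?e i)" using U aU by simp
  also have "\<dots> = cip (U *\<^sub>v ?e j) (mat_adjoint (mat_adjoint U) *\<^sub>v ?e i)" using U aU by (intro cip_mult_mat) auto
  also have "\<dots> = cip (?e j) (?e i)" unfolding mat_adjoint_adjoint[OF U] by (rule iso) auto
  finally show "(mat_adjoint U * U) $$ (i, j) = 1\<^sub>m n $$ (i, j)" using ij by (simp add: cu)
qed (use U mat_adjoint_dim[OF U] in auto)

text \<open>Induction on the number of vectors: the last one is moved by the complex Householder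
  transformation \<open>v \<mapsto> v - (\<langle>v, r\<rangle> / \<langle>P, r\<rangle>) r\<close> with \<open>r = P - q\<close>, which sends \<open>P\<close> to \<open>q\<close> and
  fixes the orthogonal complement of \<open>r\<close>.\<close>
lemma exists_isometry_of_gram:
  fixes n :: nat and p q :: "nat \<Rightarrow> complex vec"
  assumes "\<And>i. i < n \<Longrightarrow> p i \<in> carrier_vec N \<and> q i \<in> carrier_vec N"
    and "\<And>i j. i < n \<Longrightarrow> j < n \<Longrightarrow> cip (p i) (p j) = cip (q i) (q j)"
  shows "\<exists>U\<in>carrier_mat N N. (\<forall>v\<in>carrier_vec N. \<forall>w\<in>carrier_vec N. cip (U *\<^sub>v v) (U *\<^sub>v w) = cip v w) \<and>
    (\<forall>i<n. U *\<^sub>v p i = q i)"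
  using assms
proof (induction n)
  case 0
  show ?case by (rule bexI[of _ "1\<^sub>m N"]) auto
next
  case (Suc n)
  then obtain U where U: "U \<in> carrier_mat N N"
    "\<And>v w. v \<in> carrier_vec N \<Longrightarrow> w \<in> carrier_vec N \<Longrightarrow> cip (U *\<^sub>v v) (U *\<^sub>v w) = cip v w"
    "\<And>i. i < n \<Longrightarrow> U *\<^sub>v p i = q i" by (metis less_Suc_eq)
  have pc: "p i \<in> carrier_vec N" "q i \<in> carrier_vec N" if "i < Suc n" for i using Suc.prems(1)[OF that] by auto
  define P where "P = U *\<^sub>v p n"
  have P: "P \<in> carrier_vec N" and qn: "q n \<in> carrier_vec N" using U(1) pc[of n] by (auto simp: P_def)
  define r where "r = P - q n"
  have r: "r \<in> carrier_vec N" using P qn by (simp add: r_def)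
  have Pq: "cip P (q i) = cip (q n) (q i)" if "i < n" for i
    using U(2)[OF pc(1)[of n] pc(1)[of i]] U(3)[OF that] Suc.prems(2)[of n i] that by (simp add: P_def)
  have PP: "cip P P = cip (q n) (q n)" using U(2)[OF pc(1)[of n] pc(1)[of n]] Suc.prems(2)[of n n] by (simp add: P_def)
  show ?case
  proof (cases "r = 0\<^sub>v N")
    case True
    have "P = r + q n" using P qn by (auto simp: r_def)
    then have "P = q n" using True qn by simp
    then have "U *\<^sub>v p i = q i" if "i < Suc n" for i using U(3) that by (cases "i = n") (auto simp: P_def)
    with U(1,2) show ?thesis by blast
  next
    case False
    define b where "b = cip P r"
    \<comment> \<open>P and q n have equal length, so the inner product of r with itself is b + cnj
      b, twice the real part of b. Hence b is nonzero when r is. As b may be complex, dividing by b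
      gives a unitary that need not be an ordinary reflection.\<close>
    have qr: "cip (q n) r = - cnj b"
      using P qn by (simp add: b_def r_def cip_minus_right[OF P qn] PP cip_cnj[OF P qn] cip_self[of "q n"])
    have rr: "cip r r = b + cnj b"
      using qr cip_minus_left[OF P qn r] by (simp add: b_def flip: r_def)
    have "vec_norm2 r \<noteq> 0" using False vec_norm2_eq_0[OF r] by blast
    then have b0: "b \<noteq> 0" using rr by (auto simp: cip_self)
    define W where "W = mat N N (\<lambda>(i, j). (if i = j then 1 else 0) - r $ i * cnj (r $ j) / b)"
    have W: "W \<in> carrier_mat N N" by (simp add: W_def)
    have Wv: "W *\<^sub>v v = v - (cip v r / b) \<cdot>\<^sub>v r" if v: "v \<in> carrier_vec N" for v
    proof (rule eq_vecI)
      fix i assume "i < dim_vec (v - (cip v r / b) \<cdot>\<^sub>v r)"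
      then have i: "i < N" using v r by simp
      have "(W *\<^sub>v v) $ i = (\<Sum>j<N. ((if i = j then 1 else 0) - r $ i * cnj (r $ j) / b) * v $ j)"
        using i v by (simp add: W_def scalar_prod_def lessThan_atLeast0)
      also have "\<dots> = (\<Sum>j<N. (if i = j then v $ j else 0)) - (\<Sum>j<N. (v $ j * cnj (r $ j)) * (r $ i / b))"
        unfolding sum_subtractf[symmetric] by (rule sum.cong) (auto simp: left_diff_distrib)
      also have "(\<Sum>j<N. (v $ j * cnj (r $ j)) * (r $ i / b)) = cip v r * (r $ i / b)"
        using r by (simp add: cip_def sum_distrib_right sum_divide_distrib)
      finally show "(W *\<^sub>v v) $ i = (v - (cip v r / b) \<cdot>\<^sub>v r) $ i" using i v r by simp
    qed (use v r W in auto)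
    have isoW: "cip (W *\<^sub>v v) (W *\<^sub>v w) = cip v w" if v: "v \<in> carrier_vec N" and w: "w \<in> carrier_vec N" for v w
    proof -
      let ?x = "cip v r" and ?y = "cip w r"
      have sv: "(?x / b) \<cdot>\<^sub>v r \<in> carrier_vec N" "(?y / b) \<cdot>\<^sub>v r \<in> carrier_vec N" using r by auto
      have vw: "v - (?x / b) \<cdot>\<^sub>v r \<in> carrier_vec N" using v r by auto
      have "cip (W *\<^sub>v v) (W *\<^sub>v w) = cip v w - ?x / b * cnj ?y - (cnj (?y / b) * ?x - ?x / b * (cnj (?y / b) * cip r r))"
        unfolding Wv[OF v] Wv[OF w] cip_minus_right[OF w sv(2) vw] cip_minus_left[OF v sv(1) w] cip_minus_left[OF v sv(1) sv(2)]
          cip_smult_left[OF r w] cip_smult_left[OF r sv(2)] cip_smult_right[OF r v] cip_smult_right[OF r r] cip_cnj[OF w r]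
        by simp
      also have "\<dots> = cip v w" unfolding rr using b0 by (simp add: field_simps)
      finally show ?thesis .
    qed
    have Wq: "W *\<^sub>v q i = q i" if i: "i < n" for i
    proof -
      have qi: "q i \<in> carrier_vec N" using pc i by simp
      have "cip r (q i) = 0" unfolding r_def using cip_minus_left[OF P qn qi] Pq[OF i] by simp
      then have "cip (q i) r = 0" using cip_cnj[OF r qi] by simp
      then show ?thesis unfolding Wv[OF qi] using qi r by (intro eq_vecI) auto
    qed
    have one: "cip P r / b = 1" using b0 unfolding b_def by simp
    have WP: "W *\<^sub>v P = q n"
      unfolding Wv[OF P] one using P qn by (intro eq_vecI) (auto simp: r_def)
    have assoc: "(W * U) *\<^sub>v v = W *\<^sub>v (U *\<^sub>v v)" if "v \<in> carrier_vec N" for v using W U(1) that by simp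
    show ?thesis
    proof (intro bexI[of _ "W * U"] conjI ballI allI impI)
      show "W * U \<in> carrier_mat N N" using W U(1) by auto
      fix v w :: "complex vec" assume vw: "v \<in> carrier_vec N" "w \<in> carrier_vec N"
      have "U *\<^sub>v v \<in> carrier_vec N" "U *\<^sub>v w \<in> carrier_vec N" using U(1) vw by auto
      then show "cip (W * U *\<^sub>v v) (W * U *\<^sub>v w) = cip v w"
        unfolding assoc[OF vw(1)] assoc[OF vw(2)] by (simp add: isoW U(2)[OF vw])
    next
      fix i assume i: "i < Suc n"
      show "W * U *\<^sub>v p i = q i"
      proof (cases "i = n")
        case True then show ?thesis using assoc[OF pc(1)[OF i]] WP by (simp add: P_def)
      next
        case False
        then have "i < n" using i by simp
        then show ?thesis using assoc[OF pc(1)[OF i]] U(3)[of i] Wq[of i] by simp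
      qed
    qed
  qed
qed

section \<open>Transport of structure along an injection\<close>

lemma cstar_algI:
  fixes A :: "'a cstar_alg"
  assumes "ca_zero A \<in> ca_carrier A"
    and "\<And>x y. x \<in> ca_carrier A \<Longrightarrow> y \<in> ca_carrier A \<Longrightarrow> ca_add A x y \<in> ca_carrier A"
    and "\<And>x y. x \<in> ca_carrier A \<Longrightarrow> y \<in> ca_carrier A \<Longrightarrow> ca_mult A x y \<in> ca_carrier A"
    and "\<And>c x. x \<in> ca_carrier A \<Longrightarrow> ca_smult A c x \<in> ca_carrier A"
    and "\<And>x. x \<in> ca_carrier A \<Longrightarrow> ca_star A x \<in> ca_carrier A"
    and "\<And>x y z. x \<in> ca_carrier A \<Longrightarrow> y \<in> ca_carrier A \<Longrightarrow> z \<in> ca_carrier A \<Longrightarrow>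
      ca_add A (ca_add A x y) z = ca_add A x (ca_add A y z)"
    and "\<And>x y. x \<in> ca_carrier A \<Longrightarrow> y \<in> ca_carrier A \<Longrightarrow> ca_add A x y = ca_add A y x"
    and "\<And>x. x \<in> ca_carrier A \<Longrightarrow> ca_add A (ca_zero A) x = x"
    and "\<And>x. x \<in> ca_carrier A \<Longrightarrow> \<exists>y\<in>ca_carrier A. ca_add A x y = ca_zero A"
    and "\<And>c x y. x \<in> ca_carrier A \<Longrightarrow> y \<in> ca_carrier A \<Longrightarrow>
      ca_smult A c (ca_add A x y) = ca_add A (ca_smult A c x) (ca_smult A c y)"
    and "\<And>c d x. x \<in> ca_carrier A \<Longrightarrow> ca_smult A (c + d) x = ca_add A (ca_smult A c x) (ca_smult A d x)"
    and "\<And>c d x. x \<in> ca_carrier A \<Longrightarrow> ca_smult A (c * d) x = ca_smult A c (ca_smult A d x)"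
    and "\<And>x. x \<in> ca_carrier A \<Longrightarrow> ca_smult A 1 x = x"
    and "\<And>x y z. x \<in> ca_carrier A \<Longrightarrow> y \<in> ca_carrier A \<Longrightarrow> z \<in> ca_carrier A \<Longrightarrow>
      ca_mult A (ca_mult A x y) z = ca_mult A x (ca_mult A y z)"
    and "\<And>x y z. x \<in> ca_carrier A \<Longrightarrow> y \<in> ca_carrier A \<Longrightarrow> z \<in> ca_carrier A \<Longrightarrow>
      ca_mult A x (ca_add A y z) = ca_add A (ca_mult A x y) (ca_mult A x z)"
    and "\<And>x y z. x \<in> ca_carrier A \<Longrightarrow> y \<in> ca_carrier A \<Longrightarrow> z \<in> ca_carrier A \<Longrightarrow>
      ca_mult A (ca_add A x y) z = ca_add A (ca_mult A x z) (ca_mult A y z)"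
    and "\<And>c x y. x \<in> ca_carrier A \<Longrightarrow> y \<in> ca_carrier A \<Longrightarrow> ca_smult A c (ca_mult A x y) = ca_mult A (ca_smult A c x) y"
    and "\<And>c x y. x \<in> ca_carrier A \<Longrightarrow> y \<in> ca_carrier A \<Longrightarrow> ca_smult A c (ca_mult A x y) = ca_mult A x (ca_smult A c y)"
    and "\<And>x. x \<in> ca_carrier A \<Longrightarrow> ca_star A (ca_star A x) = x"
    and "\<And>x y. x \<in> ca_carrier A \<Longrightarrow> y \<in> ca_carrier A \<Longrightarrow> ca_star A (ca_add A x y) = ca_add A (ca_star A x) (ca_star A y)"
    and "\<And>c x. x \<in> ca_carrier A \<Longrightarrow> ca_star A (ca_smult A c x) = ca_smult A (cnj c) (ca_star A x)"
    and "\<And>x y. x \<in> ca_carrier A \<Longrightarrow> y \<in> ca_carrier A \<Longrightarrow> ca_star A (ca_mult A x y) = ca_mult A (ca_star A y) (ca_star A x)"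
    and "\<And>x. x \<in> ca_carrier A \<Longrightarrow> ca_norm A x = 0 \<longleftrightarrow> x = ca_zero A"
    and "\<And>x y. x \<in> ca_carrier A \<Longrightarrow> y \<in> ca_carrier A \<Longrightarrow> ca_norm A (ca_add A x y) \<le> ca_norm A x + ca_norm A y"
    and "\<And>c x. x \<in> ca_carrier A \<Longrightarrow> ca_norm A (ca_smult A c x) = cmod c * ca_norm A x"
    and "\<And>x y. x \<in> ca_carrier A \<Longrightarrow> y \<in> ca_carrier A \<Longrightarrow> ca_norm A (ca_mult A x y) \<le> ca_norm A x * ca_norm A y"
    and "\<And>f :: nat \<Rightarrow> 'a. \<forall>n. f n \<in> ca_carrier A \<Longrightarrow> \<forall>e>0. \<exists>N. \<forall>m\<ge>N. \<forall>n\<ge>N. ca_norm A (ca_diff A (f m) (f n)) < e \<Longrightarrow>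
      \<exists>x\<in>ca_carrier A. \<forall>e>0. \<exists>N. \<forall>n\<ge>N. ca_norm A (ca_diff A (f n) x) < e"
    and "\<And>x. x \<in> ca_carrier A \<Longrightarrow> ca_norm A (ca_mult A (ca_star A x) x) = (ca_norm A x)\<^sup>2"
  shows "cstar_alg A"
  unfolding cstar_alg_def Let_def
  by (intro conjI ballI allI impI) (rule assms; assumption)+

text \<open>The universal property quantifies over algebras D on the type of P alone. A matrix
  algebra becomes an admissible D after being copied into that type; \<open>d\<close> decodes a
  copied element.\<close>

definition transport_alg :: "('a \<Rightarrow> 'b) \<Rightarrow> 'a cstar_alg \<Rightarrow> 'b cstar_alg" where
  "transport_alg e A = (let d = inv_into (ca_carrier A) e in
     \<lparr>ca_carrier = e ` ca_carrier A, ca_zero = e (ca_zero A), ca_one = e (ca_one A),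
      ca_add = \<lambda>x y. e (ca_add A (d x) (d y)), ca_mult = \<lambda>x y. e (ca_mult A (d x) (d y)),
      ca_smult = \<lambda>c x. e (ca_smult A c (d x)), ca_star = \<lambda>x. e (ca_star A (d x)), ca_norm = \<lambda>x. ca_norm A (d x)\<rparr>)"

lemma transport_alg_sel:
  assumes inj: "inj_on e (ca_carrier A)"
  shows "ca_carrier (transport_alg e A) = e ` ca_carrier A" "ca_zero (transport_alg e A) = e (ca_zero A)"
    "x \<in> ca_carrier A \<Longrightarrow> y \<in> ca_carrier A \<Longrightarrow> ca_add (transport_alg e A) (e x) (e y) = e (ca_add A x y)"
    "x \<in> ca_carrier A \<Longrightarrow> y \<in> ca_carrier A \<Longrightarrow> ca_mult (transport_alg e A) (e x) (e y) = e (ca_mult A x y)"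
    "x \<in> ca_carrier A \<Longrightarrow> ca_smult (transport_alg e A) c (e x) = e (ca_smult A c x)"
    "x \<in> ca_carrier A \<Longrightarrow> ca_star (transport_alg e A) (e x) = e (ca_star A x)"
    "x \<in> ca_carrier A \<Longrightarrow> ca_norm (transport_alg e A) (e x) = ca_norm A x"
  using inj by (simp_all add: transport_alg_def Let_def)

lemma cstar_transport_alg:
  fixes A :: "'a cstar_alg" and e :: "'a \<Rightarrow> 'b"
  assumes A: "cstar_alg A" and inj: "inj_on e (ca_carrier A)"
  shows "cstar_alg (transport_alg e A)"
proof -
  note D = cstar_algD[OF A]
  note s = transport_alg_sel[OF inj]
  have diff: "ca_diff (transport_alg e A) (e x) (e y) = e (ca_diff A x y)"
    if "x \<in> ca_carrier A" "y \<in> ca_carrier A" for x y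
    using that D(4) by (simp add: ca_diff_def s)
  have ball: "Q z" if "\<And>x. x \<in> ca_carrier A \<Longrightarrow> Q (e x)" "z \<in> ca_carrier (transport_alg e A)" for Q z
    using that by (auto simp: s(1))
  have c: "e x \<in> ca_carrier (transport_alg e A)" if "x \<in> ca_carrier A" for x using that by (simp add: s(1))
  show ?thesis
  proof (rule cstar_algI)
    show "ca_zero (transport_alg e A) \<in> ca_carrier (transport_alg e A)" using D(1) by (simp add: s)
  next
    fix f :: "nat \<Rightarrow> 'b" assume f: "\<forall>n. f n \<in> ca_carrier (transport_alg e A)"
      and cau: "\<forall>r>0. \<exists>N. \<forall>m\<ge>N. \<forall>n\<ge>N. ca_norm (transport_alg e A) (ca_diff (transport_alg e A) (f m) (f n)) < r"
    define g where "g n = inv_into (ca_carrier A) e (f n)" for n :: nat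
    have g: "g n \<in> ca_carrier A" "f n = e (g n)" for n
      using f inv_into_into[of "f n" e "ca_carrier A"] f_inv_into_f[of "f n" e "ca_carrier A"] by (auto simp: g_def s(1))
    have nd: "ca_norm (transport_alg e A) (ca_diff (transport_alg e A) (f m) (e x)) = ca_norm A (ca_diff A (g m) x)"
      if "x \<in> ca_carrier A" for m x
      using that by (simp add: g diff s diff_in[OF A])
    have "\<exists>x\<in>ca_carrier A. \<forall>r>0. \<exists>N. \<forall>n\<ge>N. ca_norm A (ca_diff A (g n) x) < r"
    proof (rule D(27))
      fix r :: real assume "r > 0"
      then obtain N where "\<forall>m\<ge>N. \<forall>n\<ge>N. ca_norm (transport_alg e A) (ca_diff (transport_alg e A) (f m) (f n)) < r"
        using cau by blast
      then show "\<exists>N. \<forall>m\<ge>N. \<forall>n\<ge>N. ca_norm A (ca_diff A (g m) (g n)) < r"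
        using nd[OF g(1)] g(2) by metis
    qed (rule g(1))
    then obtain x where x: "x \<in> ca_carrier A" "\<forall>r>0. \<exists>N. \<forall>n\<ge>N. ca_norm A (ca_diff A (g n) x) < r" by blast
    show "\<exists>x\<in>ca_carrier (transport_alg e A). \<forall>r>0. \<exists>N. \<forall>n\<ge>N. ca_norm (transport_alg e A) (ca_diff (transport_alg e A) (f n) x) < r"
      by (rule bexI[OF _ c[OF x(1)]]) (use x(2) in \<open>simp add: nd[OF x(1)]\<close>)
  next
    fix x assume "x \<in> ca_carrier (transport_alg e A)"
    then obtain a where a: "a \<in> ca_carrier A" "x = e a" by (auto simp: s(1))
    obtain b where b: "b \<in> ca_carrier A" "ca_add A a b = ca_zero A" using D(9)[OF a(1)] by blast
    show "\<exists>y\<in>ca_carrier (transport_alg e A). ca_add (transport_alg e A) x y = ca_zero (transport_alg e A)"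
      by (rule bexI[OF _ c[OF b(1)]]) (simp add: s a b)
    show "(ca_norm (transport_alg e A) x = 0) = (x = ca_zero (transport_alg e A))"
      using a D(23)[OF a(1)] D(1) inj by (simp add: s inj_on_eq_iff)
    show "ca_star (transport_alg e A) (ca_star (transport_alg e A) x) = x" using a D(5)[OF a(1)] D(19)[OF a(1)] by (simp add: s)
    show "ca_norm (transport_alg e A) (ca_mult (transport_alg e A) (ca_star (transport_alg e A) x) x) = (ca_norm (transport_alg e A) x)\<^sup>2"
      using a D(5)[OF a(1)] D(3)[OF D(5)[OF a(1)] a(1)] D(28)[OF a(1)] by (simp add: s)
    show "ca_add (transport_alg e A) (ca_zero (transport_alg e A)) x = x" using a D(1) D(8)[OF a(1)] by (simp add: s)
    show "ca_smult (transport_alg e A) 1 x = x" using a D(13)[OF a(1)] by (simp add: s)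
    show "ca_star (transport_alg e A) x \<in> ca_carrier (transport_alg e A)" using a D(5)[OF a(1)] by (simp add: s)
    fix k l :: complex
    show "ca_smult (transport_alg e A) k x \<in> ca_carrier (transport_alg e A)" using a D(4)[OF a(1)] by (simp add: s)
    show "ca_smult (transport_alg e A) (k + l) x = ca_add (transport_alg e A) (ca_smult (transport_alg e A) k x) (ca_smult (transport_alg e A) l x)"
      using a D(4)[OF a(1)] D(11)[OF a(1)] by (simp add: s)
    show "ca_smult (transport_alg e A) (k * l) x = ca_smult (transport_alg e A) k (ca_smult (transport_alg e A) l x)"
      using a D(4)[OF a(1)] D(12)[OF a(1)] by (simp add: s)
    show "ca_star (transport_alg e A) (ca_smult (transport_alg e A) k x) = ca_smult (transport_alg e A) (cnj k) (ca_star (transport_alg e A) x)"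
      using a D(4,5)[OF a(1)] D(21)[OF a(1)] by (simp add: s)
    show "ca_norm (transport_alg e A) (ca_smult (transport_alg e A) k x) = cmod k * ca_norm (transport_alg e A) x"
      using a D(4)[OF a(1)] D(25)[OF a(1)] by (simp add: s)
    fix y assume "y \<in> ca_carrier (transport_alg e A)"
    then obtain b where b: "b \<in> ca_carrier A" "y = e b" by (auto simp: s(1))
    note ab = a(1) b(1) D(2)[OF a(1) b(1)] D(3)[OF a(1) b(1)] D(4)[OF a(1)] D(4)[OF b(1)] D(5)[OF a(1)] D(5)[OF b(1)]
    show "ca_add (transport_alg e A) x y \<in> ca_carrier (transport_alg e A)" "ca_mult (transport_alg e A) x y \<in> ca_carrier (transport_alg e A)"
      using ab by (simp_all add: s a b)
    show "ca_add (transport_alg e A) x y = ca_add (transport_alg e A) y x"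
      using D(7)[OF a(1) b(1)] ab by (simp add: s a(2) b(2))
    show "ca_smult (transport_alg e A) k (ca_add (transport_alg e A) x y) = ca_add (transport_alg e A) (ca_smult (transport_alg e A) k x) (ca_smult (transport_alg e A) k y)"
      using D(10)[OF a(1) b(1)] ab by (simp add: s a(2) b(2))
    show "ca_smult (transport_alg e A) k (ca_mult (transport_alg e A) x y) = ca_mult (transport_alg e A) (ca_smult (transport_alg e A) k x) y"
      using D(17)[OF a(1) b(1)] ab by (simp add: s a(2) b(2))
    show "ca_smult (transport_alg e A) k (ca_mult (transport_alg e A) x y) = ca_mult (transport_alg e A) x (ca_smult (transport_alg e A) k y)"
      using D(18)[OF a(1) b(1)] ab by (simp add: s a(2) b(2))
    show "ca_star (transport_alg e A) (ca_add (transport_alg e A) x y) = ca_add (transport_alg e A) (ca_star (transport_alg e A) x) (ca_star (transport_alg e A) y)"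
      using D(20)[OF a(1) b(1)] ab by (simp add: s a(2) b(2))
    show "ca_star (transport_alg e A) (ca_mult (transport_alg e A) x y) = ca_mult (transport_alg e A) (ca_star (transport_alg e A) y) (ca_star (transport_alg e A) x)"
      using D(22)[OF a(1) b(1)] ab by (simp add: s a(2) b(2))
    show "ca_norm (transport_alg e A) (ca_add (transport_alg e A) x y) \<le> ca_norm (transport_alg e A) x + ca_norm (transport_alg e A) y"
      using D(24)[OF a(1) b(1)] ab by (simp add: s a(2) b(2))
    show "ca_norm (transport_alg e A) (ca_mult (transport_alg e A) x y) \<le> ca_norm (transport_alg e A) x * ca_norm (transport_alg e A) y"
      using D(26)[OF a(1) b(1)] ab by (simp add: s a(2) b(2))
    fix z assume "z \<in> ca_carrier (transport_alg e A)"
    then obtain d where d: "d \<in> ca_carrier A" "z = e d" by (auto simp: s(1))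
    note abd = ab d(1) D(2)[OF b(1) d(1)] D(3)[OF b(1) d(1)] D(3)[OF a(1) d(1)]
    show "ca_add (transport_alg e A) (ca_add (transport_alg e A) x y) z = ca_add (transport_alg e A) x (ca_add (transport_alg e A) y z)"
      using D(6)[OF a(1) b(1) d(1)] abd by (simp add: s a(2) b(2) d(2))
    show "ca_mult (transport_alg e A) (ca_mult (transport_alg e A) x y) z = ca_mult (transport_alg e A) x (ca_mult (transport_alg e A) y z)"
      using D(14)[OF a(1) b(1) d(1)] abd by (simp add: s a(2) b(2) d(2))
    show "ca_mult (transport_alg e A) x (ca_add (transport_alg e A) y z) = ca_add (transport_alg e A) (ca_mult (transport_alg e A) x y) (ca_mult (transport_alg e A) x z)"
      using D(15)[OF a(1) b(1) d(1)] abd by (simp add: s a(2) b(2) d(2))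
    show "ca_mult (transport_alg e A) (ca_add (transport_alg e A) x y) z = ca_add (transport_alg e A) (ca_mult (transport_alg e A) x z) (ca_mult (transport_alg e A) y z)"
      using D(16)[OF a(1) b(1) d(1)] abd by (simp add: s a(2) b(2) d(2))
  qed
qed

lemma inj_complex_lists:
  "\<exists>h :: complex list \<Rightarrow> complex. inj_on h {xs. length xs = m}"
proof (induction m)
  case 0
  show ?case by (rule exI[of _ "\<lambda>_. 0"]) (simp add: inj_on_def)
next
  case (Suc m)
  then obtain h :: "complex list \<Rightarrow> complex" where h: "inj_on h {xs. length xs = m}" by blast
  have "infinite (UNIV :: complex set)" by (rule infinite_UNIV_char_0)
  from card_of_Times_same_infinite[OF this] obtain g :: "complex \<times> complex \<Rightarrow> complex" where "bij_betw g (UNIV \<times> UNIV) UNIV"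
    unfolding card_of_ordIso[symmetric] by blast
  then have g: "inj g" by (simp add: bij_betw_def)
  have "inj_on (\<lambda>xs. g (hd xs, h (tl xs))) {xs. length xs = Suc m}"
  proof (rule inj_onI)
    fix xs ys :: "complex list" assume xy: "xs \<in> {xs. length xs = Suc m}" "ys \<in> {xs. length xs = Suc m}"
      and eq: "g (hd xs, h (tl xs)) = g (hd ys, h (tl ys))"
    from injD[OF g eq] have he: "hd xs = hd ys" "h (tl xs) = h (tl ys)" by simp_all
    have "tl xs = tl ys" using inj_onD[OF h he(2)] xy by simp
    moreover note he(1)
    ultimately show "xs = ys" using xy by (cases xs; cases ys) auto
  qed
  then show ?case by blast
qed

text \<open>Scalar multiples of a nonzero unit form a copy of \<complex> inside the type of P, and n
  by n matrices inject into \<complex> by cardinality.\<close>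

lemma exists_inj_mat:
  fixes P :: "'p cstar_alg"
  assumes P: "unital_cstar_alg P" and ne: "ca_one P \<noteq> ca_zero P"
  shows "\<exists>e :: complex mat \<Rightarrow> 'p. inj_on e (carrier_mat n n)"
proof -
  have cP: "cstar_alg P" and one: "ca_one P \<in> ca_carrier P" using P by (auto simp: unital_cstar_alg_def)
  note D = cstar_algD[OF cP]
  have i1: "inj (\<lambda>c. ca_smult P c (ca_one P))"
  proof (rule injI)
    fix c d assume eq: "ca_smult P c (ca_one P) = ca_smult P d (ca_one P)"
    have "ca_smult P (c - d) (ca_one P) = ca_diff P (ca_smult P c (ca_one P)) (ca_smult P d (ca_one P))"
      using D(11)[OF one, of c "- d"] D(12)[OF one, of "-1" d] by (simp add: ca_diff_def)
    also have "\<dots> = ca_zero P" unfolding eq by (rule diff_self[OF cP D(4)[OF one]])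
    finally have "cmod (c - d) * ca_norm P (ca_one P) = 0"
      using D(25)[OF one, of "c - d"] D(23)[OF D(1)] by simp
    moreover have "ca_norm P (ca_one P) \<noteq> 0" using D(23)[OF one] ne by blast
    ultimately show "c = d" by simp
  qed
  obtain h :: "complex list \<Rightarrow> complex" where h: "inj_on h {xs. length xs = n * n}" using inj_complex_lists by blast
  \<comment> \<open>Row by row listing: entry (i, j) stands at position i n + j.\<close>
  define ml where "ml M = map (\<lambda>k. M $$ (k div n, k mod n)) [0..<n * n]" for M :: "complex mat"
  have "inj_on ml (carrier_mat n n)"
  proof (rule inj_onI)
    fix M L :: "complex mat" assume M: "M \<in> carrier_mat n n" and L: "L \<in> carrier_mat n n" and eq: "ml M = ml L"
    show "M = L"
    proof (rule eq_matI)
      fix i j assume "i < dim_row L" "j < dim_col L"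
      then have ij: "i < n" "j < n" using L by auto
      have "i * n + j < n * n"
      proof -
        have "i * n + j < i * n + n" using ij by simp
        also have "\<dots> = Suc i * n" by simp
        also have "\<dots> \<le> n * n" using ij by (intro mult_le_mono1) simp
        finally show ?thesis .
      qed
      then have "ml M ! (i * n + j) = M $$ (i, j)" "ml L ! (i * n + j) = L $$ (i, j)"
        using ij by (simp_all add: ml_def)
      then show "M $$ (i, j) = L $$ (i, j)" using eq by simp
    qed (use M L in auto)
  qed
  moreover have "inj_on h (ml ` carrier_mat n n)" by (rule inj_on_subset[OF h]) (auto simp: ml_def)
  ultimately have "inj_on (h \<circ> ml) (carrier_mat n n)" by (rule comp_inj_on)
  from comp_inj_on[OF this inj_on_subset[OF i1 subset_UNIV]] show ?thesis by blast
qed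

section \<open>Calculation in a unital C*-algebra given as a record\<close>

locale unital_alg =
  fixes P :: "'p cstar_alg"
  assumes unital: "unital_cstar_alg P"
begin

abbreviation "S \<equiv> ca_carrier P"
abbreviation add (infixl "\<^bold>+" 65) where "x \<^bold>+ y \<equiv> ca_add P x y"
abbreviation mul (infixl "\<^bold>*" 70) where "x \<^bold>* y \<equiv> ca_mult P x y"
abbreviation smu (infixr "\<^bold>\<cdot>" 75) where "c \<^bold>\<cdot> x \<equiv> ca_smult P c x"
abbreviation st where "st x \<equiv> ca_star P x"
abbreviation one where "one \<equiv> ca_one P"
abbreviation zero where "zero \<equiv> ca_zero P"
abbreviation nrm where "nrm x \<equiv> ca_norm P x"
abbreviation diff (infixl "\<^bold>-" 65) where "x \<^bold>- y \<equiv> ca_diff P x y"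

lemma cstar: "cstar_alg P" using unital by (simp add: unital_cstar_alg_def)

lemmas D = cstar_algD[OF cstar]

lemma one_in: "one \<in> S" using unital by (simp add: unital_cstar_alg_def)
lemma one_mul: "x \<in> S \<Longrightarrow> one \<^bold>* x = x" using unital by (simp add: unital_cstar_alg_def)
lemma mul_one: "x \<in> S \<Longrightarrow> x \<^bold>* one = x" using unital by (simp add: unital_cstar_alg_def)

lemmas closed = D(1-5) one_in diff_in[OF cstar]

lemma star_one: "st one = one"
  by (metis D(19) D(22) closed(5) one_in one_mul mul_one)

lemma add_left_comm: "x \<in> S \<Longrightarrow> y \<in> S \<Longrightarrow> z \<in> S \<Longrightarrow> x \<^bold>+ (y \<^bold>+ z) = y \<^bold>+ (x \<^bold>+ z)"
  by (metis D(6) D(7))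

lemma add_zero: "x \<in> S \<Longrightarrow> x \<^bold>+ zero = x"
  using D(7)[OF _ D(1)] D(8) by simp

lemma star_diff: "x \<in> S \<Longrightarrow> y \<in> S \<Longrightarrow> st (x \<^bold>- y) = st x \<^bold>- st y"
  by (simp add: ca_diff_def D(20,21) closed)

lemma diff_mul: "x \<in> S \<Longrightarrow> y \<in> S \<Longrightarrow> z \<in> S \<Longrightarrow> (x \<^bold>- y) \<^bold>* z = x \<^bold>* z \<^bold>- y \<^bold>* z"
  by (simp add: ca_diff_def D(16,17) closed)

lemma mul_diff: "x \<in> S \<Longrightarrow> y \<in> S \<Longrightarrow> z \<in> S \<Longrightarrow> z \<^bold>* (x \<^bold>- y) = z \<^bold>* x \<^bold>- z \<^bold>* y"
  by (simp add: ca_diff_def D(15,18) closed)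

lemma diff_add_diff: "x \<in> S \<Longrightarrow> y \<in> S \<Longrightarrow> z \<in> S \<Longrightarrow> (x \<^bold>- y) \<^bold>+ (y \<^bold>- z) = x \<^bold>- z"
proof -
  assume x: "x \<in> S" and y: "y \<in> S" and z: "z \<in> S"
  have "(x \<^bold>- y) \<^bold>+ (y \<^bold>- z) = (x \<^bold>+ (-1) \<^bold>\<cdot> z) \<^bold>+ (y \<^bold>- y)"
    using x y z by (simp add: ca_diff_def closed D(6,7) add_left_comm)
  then show ?thesis using x y z by (simp add: diff_self[OF cstar] add_zero closed) (simp add: ca_diff_def)
qed

lemma add_diff_add: "x \<in> S \<Longrightarrow> y \<in> S \<Longrightarrow> z \<in> S \<Longrightarrow> w \<in> S \<Longrightarrow> (x \<^bold>+ y) \<^bold>- (z \<^bold>+ w) = (x \<^bold>- z) \<^bold>+ (y \<^bold>- w)"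
  by (simp add: ca_diff_def closed D(6,7,10) add_left_comm)

lemma nrm_star: "x \<in> S \<Longrightarrow> nrm (st x) = nrm x"
proof -
  assume x: "x \<in> S"
  have nn: "nrm y \<ge> 0" if "y \<in> S" for y
    using D(24)[OF that D(4)[OF that, of "-1"]] D(25)[OF that, of "-1"] diff_self[OF cstar that] D(23)[OF D(1)]
    by (simp add: ca_diff_def)
  have le: "nrm y \<le> nrm (st y)" if y: "y \<in> S" for y
  proof (cases "nrm y = 0")
    case False
    have "nrm y * nrm y \<le> nrm (st y) * nrm y"
      using D(28)[OF y] D(26)[OF D(5)[OF y] y] by (simp add: power2_eq_square)
    with False nn[OF y] show ?thesis by simp
  qed (use nn[OF D(5)[OF y]] in simp)
  from le[OF x] le[OF D(5)[OF x]] D(19)[OF x] show ?thesis by simp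
qed

lemma nrm_nonneg: "y \<in> S \<Longrightarrow> nrm y \<ge> 0"
  using D(24)[of y "(-1) \<^bold>\<cdot> y"] D(25)[of y "-1"] diff_self[OF cstar, of y] D(23)[OF D(1)]
  by (simp add: ca_diff_def closed)

lemma nrm_zero: "nrm zero = 0" using D(23)[OF D(1)] by simp

lemma nrm_diff_commute: "x \<in> S \<Longrightarrow> y \<in> S \<Longrightarrow> nrm (x \<^bold>- y) = nrm (y \<^bold>- x)"
proof -
  assume x: "x \<in> S" and y: "y \<in> S"
  have "(-1) \<^bold>\<cdot> (y \<^bold>- x) = x \<^bold>- y"
    using x y D(12)[OF x, of "-1" "-1"] D(13)[OF x] by (simp add: ca_diff_def closed D(10) D(7))
  then show ?thesis using D(25)[OF closed(7)[OF y x], of "-1"] by simp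
qed

lemma nrm_diff_triangle: "x \<in> S \<Longrightarrow> y \<in> S \<Longrightarrow> z \<in> S \<Longrightarrow> nrm (x \<^bold>- z) \<le> nrm (x \<^bold>- y) + nrm (y \<^bold>- z)"
  using D(24)[of "x \<^bold>- y" "y \<^bold>- z"] diff_add_diff[of x y z] by (simp add: closed)

lemma nrm_le_diff: "x \<in> S \<Longrightarrow> y \<in> S \<Longrightarrow> nrm y \<le> nrm x + nrm (x \<^bold>- y)"
proof -
  assume x: "x \<in> S" and y: "y \<in> S"
  have "y = x \<^bold>+ (y \<^bold>- x)"
    using add_left_comm[OF x y D(4)[OF x, of "-1"]] diff_self[OF cstar x] y by (simp add: ca_diff_def add_zero)
  then have "nrm y \<le> nrm x + nrm (y \<^bold>- x)" using D(24)[OF x closed(7)[OF y x]] by simp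
  then show ?thesis using nrm_diff_commute[OF x y] by simp
qed

lemmas good = good_alg[OF unital, unfolded good_alg_def]
lemmas exists_complement = good[THEN conjunct1, rule_format]
lemmas nrm_le_one = good[THEN conjunct2, THEN conjunct1, rule_format]
lemmas exists_state_on = good[THEN conjunct2, THEN conjunct2, THEN conjunct1, rule_format]
lemmas dilation_on = good[THEN conjunct2, THEN conjunct2, THEN conjunct2, rule_format]

lemma normalize:
  assumes x: "x \<in> S" and n: "nrm x \<noteq> 0"
  shows "nrm (of_real (1 / nrm x) \<^bold>\<cdot> x) \<le> 1" "x = of_real (nrm x) \<^bold>\<cdot> of_real (1 / nrm x) \<^bold>\<cdot> x"
proof -
  show "nrm (of_real (1 / nrm x) \<^bold>\<cdot> x) \<le> 1"
    unfolding D(25)[OF x] norm_of_real using n nrm_nonneg[OF x] by simp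
  show "x = of_real (nrm x) \<^bold>\<cdot> of_real (1 / nrm x) \<^bold>\<cdot> x"
    unfolding D(12)[OF x, symmetric] of_real_mult[symmetric] using n D(13)[OF x] by simp
qed

end

text \<open>For norm at most 1 there is k with \<open>star b * b\<close> + \<open>star k * k\<close>
  = 1. A unital homomorphism preserves this equation, and the equation bounds the norm of the image;
  scaling does the rest.\<close>

lemma star_hom_contractive:
  assumes A: "unital_cstar_alg A" and P: "unital_cstar_alg P" and h: "unital_star_hom A P h" and a: "a \<in> ca_carrier A"
  shows "ca_norm P (h a) \<le> ca_norm A a"
proof -
  interpret A: unital_alg A using A by unfold_locales
  interpret P: unital_alg P using P by unfold_locales
  note hh = h[unfolded unital_star_hom_def star_hom_def]
  have c1: "ca_norm P (h b) \<le> 1" if b: "b \<in> ca_carrier A" "ca_norm A b \<le> 1" for b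
  proof -
    obtain k where k: "k \<in> ca_carrier A" "ca_add A (ca_mult A (ca_star A b) b) (ca_mult A (ca_star A k) k) = ca_one A"
      using A.exists_complement[OF b] by (rule bexE)
    have "ca_add P (ca_mult P (ca_star P (h b)) (h b)) (ca_mult P (ca_star P (h k)) (h k)) = h (ca_one A)"
      unfolding k(2)[symmetric] using hh b(1) k(1) by (simp add: A.closed)
    then show ?thesis using P.nrm_le_one[of "h b" "h k"] hh b(1) k(1) by simp
  qed
  show ?thesis
  proof (cases "ca_norm A a = 0")
    case True
    then have a0: "a = ca_smult A 0 a" using A.D(23)[OF a] smult_0[OF A.cstar a] by simp
    have "h (ca_smult A 0 a) = ca_smult P 0 (h a)" using hh a by blast
    then have "h a = ca_zero P" using a0 smult_0[OF P.cstar, of "h a"] hh a by simp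
    then show ?thesis using True P.nrm_zero by simp
  next
    case False
    let ?b = "ca_smult A (of_real (1 / ca_norm A a)) a"
    have b: "?b \<in> ca_carrier A" using a A.closed by blast
    have hb: "h ?b \<in> ca_carrier P" using hh b by blast
    have "h a = h (ca_smult A (of_real (ca_norm A a)) ?b)" using A.normalize(2)[OF a False] by simp
    also have "\<dots> = ca_smult P (of_real (ca_norm A a)) (h ?b)" using hh b by blast
    finally have "ca_norm P (h a) = ca_norm A a * ca_norm P (h ?b)"
      using P.D(25)[OF hb] A.nrm_nonneg[OF a] by simp
    also have "\<dots> \<le> ca_norm A a * 1" using c1[OF b A.normalize(1)[OF a False]] A.nrm_nonneg[OF a] by (rule mult_left_mono)
    finally show ?thesis by simp
  qed
qed

section \<open>States and finite-dimensional representations\<close>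

text \<open>No normalisation at 1 is imposed, so that vector functionals of representations fall
  under the same locale (\<open>fd_rep_contractive\<close>).\<close>

locale state = unital_alg +
  fixes f :: "'a \<Rightarrow> complex"
  assumes lin: "linear_on P f"
    and pos: "\<And>y. y \<in> S \<Longrightarrow> Im (f (st y \<^bold>* y)) = 0 \<and> 0 \<le> Re (f (st y \<^bold>* y))"
begin

lemma f_add: "x \<in> S \<Longrightarrow> y \<in> S \<Longrightarrow> f (x \<^bold>+ y) = f x + f y" using lin by (simp add: linear_on_def)
lemma f_smu: "x \<in> S \<Longrightarrow> f (c \<^bold>\<cdot> x) = c * f x" using lin by (simp add: linear_on_def)
lemma f_zero: "f zero = 0" using f_smu[OF D(1), of 0] smult_0[OF cstar D(1)] by simp
lemma f_quadratic:
  assumes p: "p \<in> S" and q: "q \<in> S"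
  shows "f (st (a \<^bold>\<cdot> p \<^bold>+ b \<^bold>\<cdot> q) \<^bold>* (a \<^bold>\<cdot> p \<^bold>+ b \<^bold>\<cdot> q)) = cnj a * a * f (st p \<^bold>* p) + cnj a * b * f (st p \<^bold>* q)
    + cnj b * a * f (st q \<^bold>* p) + cnj b * b * f (st q \<^bold>* q)"
  using p q by (simp add: D(15-18,20,21) closed f_add f_smu algebra_simps)

text \<open>f is real at the squares of p + q and of p + i q; the imaginary parts of the two
  expansions give the imaginary and the real half of the claim.\<close>

lemma f_herm:
  assumes p: "p \<in> S" and q: "q \<in> S" shows "f (st q \<^bold>* p) = cnj (f (st p \<^bold>* q))"
proof -
  have c: "1 \<^bold>\<cdot> p \<^bold>+ b \<^bold>\<cdot> q \<in> S" for b using p q by (intro closed)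
  have "Im (cnj 1 * 1 * f (st p \<^bold>* p) + cnj 1 * b * f (st p \<^bold>* q)
    + cnj b * 1 * f (st q \<^bold>* p) + cnj b * b * f (st q \<^bold>* q)) = 0" for b
    unfolding f_quadratic[OF p q, symmetric] using pos[OF c] by (rule conjunct1)
  from this[of 1] this[of \<i>] show ?thesis using pos[OF p] pos[OF q] by (simp add: complex_eq_iff)
qed

text \<open>Positivity at a p + b q with a the root of t and b = - u / a, where the phase u turns
  the number f (p^* q) into its modulus. The weight t balances the two squares.\<close>

lemma f_cauchy_schwarz:
  assumes p: "p \<in> S" and q: "q \<in> S" and t: "t > 0"
  shows "cmod (f (st p \<^bold>* q)) \<le> (t * Re (f (st p \<^bold>* p)) + Re (f (st q \<^bold>* q)) / t) / 2"
proof -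
  define w where "w = f (st p \<^bold>* q)"
  define u where "u = (if w = 0 then 1 else cnj w / of_real (cmod w))"
  have uw: "u * w = of_real (cmod w)"
    by (auto simp: u_def mult.commute complex_norm_square[symmetric] power2_eq_square)
  have uu: "cnj u * u = 1"
  proof (cases "w = 0")
    case False
    have "cnj u * u = (w * cnj w) / (of_real (cmod w) * of_real (cmod w))" using False by (simp add: u_def)
    also have "w * cnj w = of_real (cmod w) * of_real (cmod w)"
      by (simp only: complex_norm_square[symmetric] power2_eq_square of_real_mult)
    finally show ?thesis using False by simp
  qed (simp add: u_def)
  have uw': "cnj u * cnj w = of_real (cmod w)" using arg_cong[OF uw, of cnj] by simp
  define a :: complex where "a = of_real (sqrt t)"
  define b where "b = - u * of_real (1 / sqrt t)"
  have aa: "cnj a * a = of_real t" "cnj a * b = - u" "cnj b * a = - cnj u" "cnj b * b = of_real (1 / t)"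
  proof -
    have tt: "complex_of_real (sqrt t) * complex_of_real (sqrt t) = of_real t" using t by (simp flip: of_real_mult)
    then show "cnj a * a = of_real t" by (simp add: a_def)
    show "cnj a * b = - u" "cnj b * a = - cnj u" using t by (simp_all add: a_def b_def)
    have "cnj b * b = (cnj u * u) / (complex_of_real (sqrt t) * complex_of_real (sqrt t))" using t by (simp add: b_def)
    then show "cnj b * b = of_real (1 / t)" unfolding uu tt by simp
  qed
  have "0 \<le> Re (f (st (a \<^bold>\<cdot> p \<^bold>+ b \<^bold>\<cdot> q) \<^bold>* (a \<^bold>\<cdot> p \<^bold>+ b \<^bold>\<cdot> q)))"
    using pos[of "a \<^bold>\<cdot> p \<^bold>+ b \<^bold>\<cdot> q"] p q by (simp only: closed)
  also have "f (st (a \<^bold>\<cdot> p \<^bold>+ b \<^bold>\<cdot> q) \<^bold>* (a \<^bold>\<cdot> p \<^bold>+ b \<^bold>\<cdot> q))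
      = of_real t * f (st p \<^bold>* p) - u * w - cnj u * cnj w + of_real (1 / t) * f (st q \<^bold>* q)"
    unfolding f_quadratic[OF p q] f_herm[OF p q] aa by (simp add: w_def)
  finally show ?thesis unfolding uw uw' w_def[symmetric] by simp
qed

text \<open>The double sum is the value of f at \<open>star s * s\<close> for the combination s of
  the p k with coefficients z k. The combination is built by recursion on k, and f is expanded in
  each argument in turn.\<close>

lemma f_psd:
  fixes p :: "nat \<Rightarrow> 'a"
  assumes p: "\<And>k. k < n \<Longrightarrow> p k \<in> S"
  shows "0 \<le> Re (\<Sum>k<n. \<Sum>l<n. cnj (z k) * z l * f (st (p k) \<^bold>* p l))"
proof -
  define s where "s = rec_nat zero (\<lambda>k x. x \<^bold>+ z k \<^bold>\<cdot> p k)"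
  have s0: "s 0 = zero" and sS: "s (Suc k) = s k \<^bold>+ z k \<^bold>\<cdot> p k" for k by (simp_all add: s_def)
  have sm: "s m \<in> S" if "m \<le> n" for m
    using that by (induction m) (auto simp: s0 sS closed p)
  have r: "f (st y \<^bold>* s m) = (\<Sum>l<m. z l * f (st y \<^bold>* p l))" if "m \<le> n" "y \<in> S" for m y
    using that(1)
  proof (induction m)
    case 0
    have "st y \<^bold>* (0 \<^bold>\<cdot> zero) = 0 \<^bold>\<cdot> (st y \<^bold>* zero)" using that by (simp add: D(18) closed)
    then show ?case using that by (simp add: s0 smult_0[OF cstar] closed f_zero)
  next
    case (Suc m)
    then show ?case using that sm[of m] p[of m] by (simp add: sS D(15,18) closed f_add f_smu)
  qed
  have l: "f (st (s m) \<^bold>* y) = (\<Sum>k<m. cnj (z k) * f (st (p k) \<^bold>* y))" if "m \<le> n" "y \<in> S" for m y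
  proof -
    have "f (st (s m) \<^bold>* y) = cnj (f (st y \<^bold>* s m))" using that sm by (intro f_herm) auto
    also have "\<dots> = (\<Sum>k<m. cnj (z k) * f (st (p k) \<^bold>* y))"
      unfolding r[OF that] cnj_sum using that p by (intro sum.cong) (auto simp: f_herm[of y])
    finally show ?thesis .
  qed
  have "f (st (s n) \<^bold>* s n) = (\<Sum>k<n. cnj (z k) * f (st (p k) \<^bold>* s n))" by (rule l) (simp_all add: sm)
  also have "\<dots> = (\<Sum>k<n. \<Sum>l<n. cnj (z k) * z l * f (st (p k) \<^bold>* p l))"
    by (intro sum.cong refl) (simp add: r p sum_distrib_left mult.assoc)
  finally show ?thesis using pos[OF sm[OF order_refl]] by simp
qed

lemma star_mul_mul:
  assumes "x \<in> S" "y \<in> S" "p \<in> S" "q \<in> S"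
  shows "st (p \<^bold>* x) \<^bold>* (q \<^bold>* y) = st x \<^bold>* ((st p \<^bold>* q) \<^bold>* y)"
  using assms by (simp add: D(14,22) closed)

text \<open>For w of norm at most 1, inserting 1 = \<open>star w * w\<close> +
  \<open>star k * k\<close> between \<open>star y\<close> and \<open>y\<close> splits f
  (\<open>star y * y\<close>) into the term wanted and a nonnegative one. This is boundedness of
  left multiplication in the GNS construction.\<close>

lemma f_mult_bound:
  assumes x: "x \<in> S" and y: "y \<in> S"
  shows "Re (f (st (x \<^bold>* y) \<^bold>* (x \<^bold>* y))) \<le> (nrm x)\<^sup>2 * Re (f (st y \<^bold>* y))"
proof -
  have *: "Re (f (st (w \<^bold>* y) \<^bold>* (w \<^bold>* y))) \<le> Re (f (st y \<^bold>* y))" if w: "w \<in> S" "nrm w \<le> 1" for w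
  proof -
    obtain k where k: "k \<in> S" "st w \<^bold>* w \<^bold>+ st k \<^bold>* k = one" using exists_complement[OF w] by (rule bexE)
    have "st y \<^bold>* y = st y \<^bold>* ((st w \<^bold>* w \<^bold>+ st k \<^bold>* k) \<^bold>* y)" using y by (simp add: k(2) one_mul)
    also have "\<dots> = st (w \<^bold>* y) \<^bold>* (w \<^bold>* y) \<^bold>+ st (k \<^bold>* y) \<^bold>* (k \<^bold>* y)"
      using w k(1) y by (simp add: D(14-16,22) closed)
    finally have "f (st y \<^bold>* y) = f (st (w \<^bold>* y) \<^bold>* (w \<^bold>* y)) + f (st (k \<^bold>* y) \<^bold>* (k \<^bold>* y))"
      using w k(1) y by (simp add: f_add closed)
    then show ?thesis using pos[of "k \<^bold>* y"] k(1) y closed by simp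
  qed
  show ?thesis
  proof (cases "nrm x = 0")
    case True
    then have "x = zero" using D(23)[OF x] by simp
    then have "x \<^bold>* y = 0 \<^bold>\<cdot> (x \<^bold>* y)" using D(17)[OF x y, of 0] smult_0[OF cstar x] by simp
    then have "x \<^bold>* y = zero" using smult_0[OF cstar D(3)[OF x y]] by simp
    moreover have "st zero \<^bold>* zero = 0 \<^bold>\<cdot> (st zero \<^bold>* zero)"
      using D(18)[OF D(5)[OF D(1)] D(1), of 0] smult_0[OF cstar D(1)] by simp
    then have "f (st zero \<^bold>* zero) = 0" using smult_0[OF cstar] closed f_zero by metis
    ultimately show ?thesis using True by simp
  next
    case False
    let ?w = "of_real (1 / nrm x) \<^bold>\<cdot> x"
    have w: "?w \<in> S" "nrm ?w \<le> 1" using x closed normalize(1)[OF x False] by auto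
    have "x \<^bold>* y = of_real (nrm x) \<^bold>\<cdot> (?w \<^bold>* y)"
      using D(17)[OF w(1) y, of "of_real (nrm x)"] normalize(2)[OF x False] by simp
    then have "f (st (x \<^bold>* y) \<^bold>* (x \<^bold>* y)) = of_real (nrm x) * (of_real (nrm x) * f (st (?w \<^bold>* y) \<^bold>* (?w \<^bold>* y)))"
      using w(1) y by (simp add: D(17,18,21) closed f_smu)
    then have "Re (f (st (x \<^bold>* y) \<^bold>* (x \<^bold>* y))) = (nrm x)\<^sup>2 * Re (f (st (?w \<^bold>* y) \<^bold>* (?w \<^bold>* y)))"
      by (simp add: power2_eq_square)
    then show ?thesis using *[OF w] by (simp add: mult_left_mono)
  qed
qed

end

section \<open>Diagonal, conjugated and general finite-dimensional representations\<close>

definition diag_rep :: "nat \<Rightarrow> (nat \<Rightarrow> 'a \<Rightarrow> complex) \<Rightarrow> 'a \<Rightarrow> complex mat" where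
  "diag_rep N x a = mat N N (\<lambda>(i, j). if i = j then x i a else 0)"

lemma diag_rep_mult_vec:
  assumes "t \<in> carrier_vec N" shows "diag_rep N x a *\<^sub>v t = vec N (\<lambda>i. x i a * t $ i)"
proof (rule eq_vecI)
  fix i assume "i < dim_vec (vec N (\<lambda>i. x i a * t $ i))"
  then have i: "i < N" by simp
  have "(diag_rep N x a *\<^sub>v t) $ i = (\<Sum>j<N. (if i = j then x i a else 0) * t $ j)"
    using i assms by (simp add: diag_rep_def scalar_prod_def lessThan_atLeast0)
  also have "\<dots> = (\<Sum>j<N. if j = i then x i a * t $ i else 0)" by (rule sum.cong) auto
  finally show "(diag_rep N x a *\<^sub>v t) $ i = vec N (\<lambda>i. x i a * t $ i) $ i" using i by simp
qed (simp add: diag_rep_def)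

context unital_alg
begin

lemma fd_repD:
  assumes "fd_rep P n \<pi>"
  shows "x \<in> S \<Longrightarrow> \<pi> x \<in> carrier_mat n n"
    "x \<in> S \<Longrightarrow> y \<in> S \<Longrightarrow> \<pi> (x \<^bold>+ y) = \<pi> x + \<pi> y"
    "x \<in> S \<Longrightarrow> \<pi> (c \<^bold>\<cdot> x) = c \<cdot>\<^sub>m \<pi> x"
    "x \<in> S \<Longrightarrow> y \<in> S \<Longrightarrow> \<pi> (x \<^bold>* y) = \<pi> x * \<pi> y"
    "x \<in> S \<Longrightarrow> \<pi> (st x) = mat_adjoint (\<pi> x)"
  using assms by (simp_all add: fd_rep_def)

lemma fd_rep_cip:
  assumes \<pi>: "fd_rep P n \<pi>" and xy: "x \<in> S" "y \<in> S" and uw: "u \<in> carrier_vec n" "w \<in> carrier_vec n"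
  shows "cip (\<pi> x *\<^sub>v u) (\<pi> y *\<^sub>v w) = cip (\<pi> (st y \<^bold>* x) *\<^sub>v u) w"
proof -
  note R = fd_repD[OF \<pi>]
  have xu: "\<pi> x *\<^sub>v u \<in> carrier_vec n" and yw: "\<pi> y *\<^sub>v w \<in> carrier_vec n" using R(1)[OF xy(1)] R(1)[OF xy(2)] uw by auto
  have "cip (\<pi> (st y) *\<^sub>v (\<pi> x *\<^sub>v u)) w = cip (\<pi> x *\<^sub>v u) (mat_adjoint (\<pi> (st y)) *\<^sub>v w)"
    by (rule cip_mult_mat[OF R(1)[OF D(5)[OF xy(2)]] xu uw(2)])
  also have "mat_adjoint (\<pi> (st y)) = \<pi> y" using mat_adjoint_adjoint[OF R(1)[OF xy(2)]] R(5)[OF xy(2)] by simp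
  finally show ?thesis
    using xy uw R(1)[OF xy(1)] R(1)[OF D(5)[OF xy(2)]] by (simp add: R(4) closed assoc_mult_mat_vec[where n\<^sub>1=n and n\<^sub>2=n and n\<^sub>3=n])
qed

text \<open>The vector functional y \<mapsto> \<open>cip (\<pi> y *\<^sub>v u) u\<close> is
  positive, so \<open>f_mult_bound\<close> at the unit bounds the length of
  \<open>\<pi> x *\<^sub>v u\<close>.\<close>

lemma fd_rep_contractive:
  assumes \<pi>: "fd_rep P n \<pi>" and x: "x \<in> S" and u: "u \<in> carrier_vec n"
  shows "vec_norm2 (\<pi> x *\<^sub>v u) \<le> nrm x * vec_norm2 u"
proof -
  note R = fd_repD[OF \<pi>]
  define g where "g y = cip (\<pi> y *\<^sub>v u) u" for y
  have gg: "g (st y \<^bold>* y) = of_real ((vec_norm2 (\<pi> y *\<^sub>v u))\<^sup>2)" if "y \<in> S" for y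
    using fd_rep_cip[OF \<pi> that that u u] by (simp add: g_def cip_self)
  interpret g: state P g
  proof
    show "linear_on P g" unfolding linear_on_def
    proof (intro conjI ballI allI)
      fix y z assume yz: "y \<in> S" "z \<in> S"
      have "\<pi> y *\<^sub>v u \<in> carrier_vec n" "\<pi> z *\<^sub>v u \<in> carrier_vec n" using R(1)[OF yz(1)] R(1)[OF yz(2)] u by auto
      then show "g (y \<^bold>+ z) = g y + g z"
        using u by (simp add: g_def R(2) yz add_mult_distrib_mat_vec[OF R(1)[OF yz(1)] R(1)[OF yz(2)] u] cip_add_left)
    next
      fix c y assume y: "y \<in> S"
      have yu: "\<pi> y *\<^sub>v u \<in> carrier_vec n" using R(1)[OF y] u by auto
      have "(c \<cdot>\<^sub>m \<pi> y) *\<^sub>v u = c \<cdot>\<^sub>v (\<pi> y *\<^sub>v u)" using R(1)[OF y] u by (intro eq_vecI) auto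
      then show "g (c \<^bold>\<cdot> y) = c * g y" using cip_smult_left[OF yu u] by (simp add: g_def R(3) y)
    qed
  qed (simp add: gg)
  have ou: "\<pi> one *\<^sub>v u \<in> carrier_vec n" using R(1)[OF one_in] u by auto
  have "st one \<^bold>* one = one" by (simp add: star_one one_mul one_in)
  then have g1: "g one = of_real ((vec_norm2 (\<pi> one *\<^sub>v u))\<^sup>2)" using gg[OF one_in] by simp
  \<comment> \<open>\<open>fd_rep\<close> does not force \<pi> to be unital, so the image of
    \<open>one\<close> is only a projection. Cauchy-Schwarz shows that it does not lengthen
    u.\<close>
  then have "(vec_norm2 (\<pi> one *\<^sub>v u))\<^sup>2 = cmod (g one)" by (simp add: norm_power)
  also have "\<dots> \<le> vec_norm2 (\<pi> one *\<^sub>v u) * vec_norm2 u" unfolding g_def by (rule cip_cauchy_schwarz[OF ou u])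
  finally have "vec_norm2 (\<pi> one *\<^sub>v u) * vec_norm2 (\<pi> one *\<^sub>v u) \<le> vec_norm2 (\<pi> one *\<^sub>v u) * vec_norm2 u"
    by (simp add: power2_eq_square)
  then have "vec_norm2 (\<pi> one *\<^sub>v u) \<le> vec_norm2 u"
    using vec_norm2_nonneg[of u] vec_norm2_nonneg[of "\<pi> one *\<^sub>v u"] by (cases "vec_norm2 (\<pi> one *\<^sub>v u) = 0") auto
  then have "(vec_norm2 (\<pi> one *\<^sub>v u))\<^sup>2 \<le> (vec_norm2 u)\<^sup>2" by (intro power_mono) auto
  then have G1: "Re (g one) \<le> (vec_norm2 u)\<^sup>2" using g1 by simp
  have "(vec_norm2 (\<pi> x *\<^sub>v u))\<^sup>2 \<le> (nrm x)\<^sup>2 * Re (g one)"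
    using g.f_mult_bound[OF x one_in] gg[OF x] by (simp add: mul_one x star_one one_mul one_in)
  also have "\<dots> \<le> (nrm x)\<^sup>2 * (vec_norm2 u)\<^sup>2" using G1 by (rule mult_left_mono) simp
  finally have "(vec_norm2 (\<pi> x *\<^sub>v u))\<^sup>2 \<le> (nrm x * vec_norm2 u)\<^sup>2" by (simp add: power_mult_distrib)
  then show ?thesis by (rule power2_le_imp_le) (simp add: nrm_nonneg[OF x])
qed

text \<open>Beyond the original length the vectors are zero and the first character is repeated, so
  sums are unchanged and every index still carries a character extending \<open>ch\<close>. The
  freedom in N allows the two sides of the amalgam to be given the same dimension.\<close>

lemma padded_dilation:
  assumes comm: "ca_commutative P" and R: "R \<subseteq> S" and F: "finite F" "F \<subseteq> S" and e: "e > 0" and ker: "kernel_on P n phi R ch"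
  shows "\<exists>m::nat. \<forall>N\<ge>m. \<exists>x s. (\<forall>i. character_on P (x i) \<and> (\<forall>r\<in>R. x i r = ch r)) \<and>
     (\<forall>k<n. \<forall>l<n. (\<Sum>i<N. cnj (s i k) * s i l) = phi k l one) \<and>
     (\<forall>a\<in>F. \<forall>k<n. \<forall>l<n. cmod ((\<Sum>i<N. cnj (s i k) * s i l * x i a) - phi k l a) \<le> e)"
proof -
  obtain rs :: "(('p \<Rightarrow> complex) \<times> (nat \<Rightarrow> complex)) list" where rs0: "(\<forall>r\<in>set rs. character_on P (fst r) \<and> (\<forall>b\<in>R. fst r b = ch b)) \<and>
           (\<forall>k<n. \<forall>l<n. (\<Sum>r\<leftarrow>rs. cnj (snd r k) * snd r l) = phi k l one) \<and>
           (\<forall>a\<in>F. \<forall>k<n. \<forall>l<n. cmod ((\<Sum>r\<leftarrow>rs. cnj (snd r k) * snd r l * fst r a) - phi k l a) \<le> e)"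
    using dilation_on[OF comm R F e ker] by (rule exE)
  note rs = rs0[THEN conjunct1] rs0[THEN conjunct2, THEN conjunct1] rs0[THEN conjunct2, THEN conjunct2]
  have "\<exists>k<n. 0 < Re (phi k k one)" using ker unfolding kernel_on_def by (elim conjE)
  then have ne: "rs \<noteq> []" using rs(2) by force
  show ?thesis
  proof (intro exI[of _ "length rs"] allI impI)
    fix N :: nat assume N: "length rs \<le> N"
    define x where "x i = fst (rs ! (if i < length rs then i else 0))" for i
    define s where "s i k = (if i < length rs then snd (rs ! i) k else 0)" for i k
    have sum: "(\<Sum>i<N. cnj (s i k) * s i l * h (x i)) = (\<Sum>r\<leftarrow>rs. cnj (snd r k) * snd r l * h (fst r))" for k l h
    proof -
      have "(\<Sum>i<N. cnj (s i k) * s i l * h (x i)) = (\<Sum>i<length rs. cnj (s i k) * s i l * h (x i))"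
        using N by (intro sum.mono_neutral_right) (auto simp: s_def)
      also have "\<dots> = (\<Sum>r\<leftarrow>rs. cnj (snd r k) * snd r l * h (fst r))"
        by (simp add: sum_list_sum_nth lessThan_atLeast0 s_def x_def)
      finally show ?thesis .
    qed
    have "rs ! (if i < length rs then i else 0) \<in> set rs" for i using ne by auto
    then have 1: "\<forall>i. character_on P (x i) \<and> (\<forall>r\<in>R. x i r = ch r)" using rs(1) by (simp add: x_def)
    show "\<exists>x s. (\<forall>i. character_on P (x i) \<and> (\<forall>r\<in>R. x i r = ch r)) \<and>
     (\<forall>k<n. \<forall>l<n. (\<Sum>i<N. cnj (s i k) * s i l) = phi k l one) \<and>
     (\<forall>a\<in>F. \<forall>k<n. \<forall>l<n. cmod ((\<Sum>i<N. cnj (s i k) * s i l * x i a) - phi k l a) \<le> e)"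
      using 1 rs(2,3) sum[of _ _ "\<lambda>_. 1"] by (intro exI[of _ x] exI[of _ s] conjI) (simp_all add: sum[of _ _ "\<lambda>x. x a" for a])
  qed
qed

lemma fd_rep_diag:
  assumes x: "\<And>i. character_on P (x i)" shows "fd_rep P N (diag_rep N x)"
proof -
  note xs = x[unfolded character_on_def linear_on_def]
  have "diag_rep N x (a \<^bold>* b) = diag_rep N x a * diag_rep N x b" if ab: "a \<in> S" "b \<in> S" for a b
  proof (rule eq_matI)
    fix i j assume "i < dim_row (diag_rep N x a * diag_rep N x b)" "j < dim_col (diag_rep N x a * diag_rep N x b)"
    then have ij: "i < N" "j < N" by (auto simp: diag_rep_def)
    have "(diag_rep N x a * diag_rep N x b) $$ (i, j) = (\<Sum>k<N. (if i = k then x i a else 0) * (if k = j then x k b else 0))"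
      using ij by (simp add: diag_rep_def scalar_prod_def lessThan_atLeast0)
    also have "\<dots> = (\<Sum>k<N. if k = i then x i a * (if i = j then x i b else 0) else 0)"
      by (rule sum.cong) auto
    also have "\<dots> = x i a * (if i = j then x i b else 0)" using ij by simp
    finally show "diag_rep N x (a \<^bold>* b) $$ (i, j) = (diag_rep N x a * diag_rep N x b) $$ (i, j)"
      using ij xs ab by (simp add: diag_rep_def)
  qed (auto simp: diag_rep_def)
  moreover have "diag_rep N x (st a) = mat_adjoint (diag_rep N x a)" if a: "a \<in> S" for a
  proof -
    have d: "diag_rep N x a \<in> carrier_mat N N" by (simp add: diag_rep_def)
    show ?thesis using mat_adjoint_dim[OF d] xs a
      by (intro eq_matI) (auto simp: mat_adjoint_index[OF d], auto simp: diag_rep_def)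
  qed
  ultimately show ?thesis using xs unfolding fd_rep_def by (auto simp: diag_rep_def intro!: eq_matI)
qed

lemma fd_rep_conjugate:
  assumes \<pi>: "fd_rep P N \<pi>" and U: "U \<in> carrier_mat N N" "mat_adjoint U * U = 1\<^sub>m N"
  shows "fd_rep P N (\<lambda>a. U * \<pi> a * mat_adjoint U)"
proof -
  note R = fd_repD[OF \<pi>]
  note aU = mat_adjoint_dim[OF U(1)]
  have "U * (\<pi> x + \<pi> y) * mat_adjoint U = U * \<pi> x * mat_adjoint U + U * \<pi> y * mat_adjoint U" if "x \<in> S" "y \<in> S" for x y
    using that R(1)[of x] R(1)[of y] U(1) aU
    by (simp add: mult_add_distrib_mat[of _ N N _ N] add_mult_distrib_mat[of _ N N _ _ N])
  moreover have "U * (c \<cdot>\<^sub>m \<pi> x) * mat_adjoint U = c \<cdot>\<^sub>m (U * \<pi> x * mat_adjoint U)" if "x \<in> S" for c x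
    using that R(1)[of x] U(1) aU by (simp add: mult_smult_distrib[of _ N N _ N] mult_smult_assoc_mat[of _ N N _ N])
  moreover have "U * (\<pi> x * \<pi> y) * mat_adjoint U = (U * \<pi> x * mat_adjoint U) * (U * \<pi> y * mat_adjoint U)" if xy: "x \<in> S" "y \<in> S" for x y
  proof -
    note c = R(1)[OF xy(1)] R(1)[OF xy(2)] U(1) aU
    have "(U * \<pi> x * mat_adjoint U) * (U * \<pi> y * mat_adjoint U) = U * \<pi> x * (mat_adjoint U * U) * (\<pi> y * mat_adjoint U)"
      using c by (simp add: assoc_mult_mat[of _ N N _ N _ N])
    then show ?thesis unfolding U(2) using c by (simp add: assoc_mult_mat[of _ N N _ N _ N])
  qed
  moreover have "U * mat_adjoint (\<pi> x) * mat_adjoint U = mat_adjoint (U * \<pi> x * mat_adjoint U)" if x: "x \<in> S" for x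
  proof -
    note c = R(1)[OF x] U(1) aU mat_adjoint_dim[OF R(1)[OF x]]
    have "mat_adjoint (U * \<pi> x * mat_adjoint U) = mat_adjoint (mat_adjoint U) * mat_adjoint (U * \<pi> x)"
      using c by (intro mat_adjoint_mult[of _ N N _ N]) auto
    also have "mat_adjoint (U * \<pi> x) = mat_adjoint (\<pi> x) * mat_adjoint U"
      using c by (intro mat_adjoint_mult[of _ N N _ N]) auto
    finally show ?thesis using c mat_adjoint_adjoint[OF U(1)] by (simp add: assoc_mult_mat[of _ N N _ N _ N])
  qed
  moreover have "U * \<pi> x * mat_adjoint U \<in> carrier_mat N N" if "x \<in> S" for x
    using R(1)[OF that] U(1) aU by simp
  ultimately show ?thesis unfolding fd_rep_def by (simp add: R)
qed

end

text \<open>The compressions of f along h satisfy the hypotheses of the dilation theorem: positivity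
  and Cauchy-Schwarz are those of f at the vectors h g v_k. The unit among the v_k provides a
  diagonal functional of mass 1.\<close>

lemma (in state) kernel_on_hom:
  fixes A :: "'b cstar_alg"
  assumes A: "unital_cstar_alg A" and h: "unital_star_hom A P h" and R: "R \<subseteq> ca_carrier A"
    and cen: "\<And>r. r \<in> R \<Longrightarrow> central_in P (h r)"
    and fc: "\<And>c y. central_in P c \<Longrightarrow> y \<in> S \<Longrightarrow> f (c \<^bold>* y) = f c * f y" and f1: "f one = 1"
    and v: "\<And>k. k < n \<Longrightarrow> v k \<in> S" and v1: "\<exists>k<n. v k = one"
  shows "kernel_on A n (\<lambda>k l a. f (st (v k) \<^bold>* (h a \<^bold>* v l))) R (\<lambda>r. f (h r))"
proof -
  note hh = h[unfolded unital_star_hom_def star_hom_def]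
  have hin: "h a \<in> S" if "a \<in> ca_carrier A" for a using hh that by blast
  have cA: "cstar_alg A" and oneA: "ca_one A \<in> ca_carrier A" using A by (auto simp: unital_cstar_alg_def)
  note DA = cstar_algD[OF cA]
  have key: "st (v k) \<^bold>* (h (ca_mult A (ca_star A p) q) \<^bold>* v l) = st (h p \<^bold>* v k) \<^bold>* (h q \<^bold>* v l)"
    if "k < n" "l < n" "p \<in> ca_carrier A" "q \<in> ca_carrier A" for k l p q
    using that star_mul_mul[OF v v hin hin, of k l p q] hh DA(5) by simp
  show ?thesis unfolding kernel_on_def
  proof (intro conjI allI impI ballI)
    fix k l assume kl: "k < n" "l < n"
    show "linear_on A (\<lambda>a. f (st (v k) \<^bold>* (h a \<^bold>* v l)))"
      unfolding linear_on_def
    proof (intro conjI ballI allI)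
      fix x y assume xy: "x \<in> ca_carrier A" "y \<in> ca_carrier A"
      then have "h (ca_add A x y) = h x \<^bold>+ h y" using hh by blast
      then show "f (st (v k) \<^bold>* (h (ca_add A x y) \<^bold>* v l)) = f (st (v k) \<^bold>* (h x \<^bold>* v l)) + f (st (v k) \<^bold>* (h y \<^bold>* v l))"
        using xy kl v hin by (simp add: D(15,16) closed f_add)
    next
      fix c x assume x: "x \<in> ca_carrier A"
      then have "h (ca_smult A c x) = c \<^bold>\<cdot> h x" using hh by blast
      then show "f (st (v k) \<^bold>* (h (ca_smult A c x) \<^bold>* v l)) = c * f (st (v k) \<^bold>* (h x \<^bold>* v l))"
        using x kl v hin by (simp add: D(17,18) closed f_smu)
    qed
  next
    fix k l a assume kl: "k < n" "l < n" and a: "a \<in> ca_carrier A"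
    have "h (ca_star A a) = st (h a)" using hh a by blast
    then have "st (v l) \<^bold>* (h (ca_star A a) \<^bold>* v k) = st (h a \<^bold>* v l) \<^bold>* v k"
      using kl v hin[OF a] by (simp add: D(14,22) closed)
    then show "f (st (v l) \<^bold>* (h (ca_star A a) \<^bold>* v k)) = cnj (f (st (v k) \<^bold>* (h a \<^bold>* v l)))"
      using f_herm[of "v k" "h a \<^bold>* v l"] kl v hin[OF a] closed by simp
  next
    fix z g assume g: "g \<in> ca_carrier A"
    have "(\<Sum>k<n. \<Sum>l<n. cnj (z k) * z l * f (st (v k) \<^bold>* (h (ca_mult A (ca_star A g) g) \<^bold>* v l)))
      = (\<Sum>k<n. \<Sum>l<n. cnj (z k) * z l * f (st (h g \<^bold>* v k) \<^bold>* (h g \<^bold>* v l)))"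
      using g by (intro sum.cong refl) (simp add: key)
    then show "0 \<le> Re (\<Sum>k<n. \<Sum>l<n. cnj (z k) * z l * f (st (v k) \<^bold>* (h (ca_mult A (ca_star A g) g) \<^bold>* v l)))"
      using f_psd[of n "\<lambda>k. h g \<^bold>* v k" z] hin[OF g] v closed by simp
  next
    fix k l t p q assume kl: "k < n" "l < n" and t: "(t::real) > 0" and pq: "p \<in> ca_carrier A" "q \<in> ca_carrier A"
    show "cmod (f (st (v k) \<^bold>* (h (ca_mult A (ca_star A p) q) \<^bold>* v l)))
       \<le> (t * Re (f (st (v k) \<^bold>* (h (ca_mult A (ca_star A p) p) \<^bold>* v k))) + Re (f (st (v l) \<^bold>* (h (ca_mult A (ca_star A q) q) \<^bold>* v l))) / t) / 2"
      unfolding key[OF kl pq] key[OF kl(1) kl(1) pq(1) pq(1)] key[OF kl(2) kl(2) pq(2) pq(2)]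
      using hin pq v kl closed t by (intro f_cauchy_schwarz) auto
  next
    fix k l r a assume kl: "k < n" "l < n" and r: "r \<in> R" and a: "a \<in> ca_carrier A"
    have rA: "r \<in> ca_carrier A" using R r by blast
    have hra: "h (ca_mult A r a) = h r \<^bold>* h a" using hh rA a by blast
    \<comment> \<open>Centrality brings h r to the front, where f factors; so R acts by the scalars
      f (h r) in every compression.\<close>
    have c: "st (v k) \<^bold>* h r = h r \<^bold>* st (v k)" by (rule cen[OF r, unfolded central_in_def, THEN conjunct2, rule_format, OF D(5)[OF v[OF kl(1)]]])
    have "st (v k) \<^bold>* (h (ca_mult A r a) \<^bold>* v l) = (st (v k) \<^bold>* h r) \<^bold>* (h a \<^bold>* v l)"
      unfolding hra using hin[OF rA] hin[OF a] v kl by (simp add: D(14) closed)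
    also have "\<dots> = h r \<^bold>* (st (v k) \<^bold>* (h a \<^bold>* v l))"
      unfolding c using hin[OF rA] hin[OF a] v kl by (simp add: D(14) closed)
    finally show "f (st (v k) \<^bold>* (h (ca_mult A r a) \<^bold>* v l)) = f (h r) * f (st (v k) \<^bold>* (h a \<^bold>* v l))"
      using fc[OF cen[OF r]] hin[OF a] v[OF kl(1)] v[OF kl(2)] by (simp add: closed)
  next
    obtain k where k: "k < n" "v k = one" using v1 by blast
    have "h (ca_one A) = one" using hh by blast
    then have "f (st (v k) \<^bold>* (h (ca_one A) \<^bold>* v k)) = 1" using f1 by (simp add: k(2) star_one one_mul one_in)
    then show "\<exists>k<n. 0 < Re (f (st (v k) \<^bold>* (h (ca_one A) \<^bold>* v k)))" using k(1) by (intro exI[of _ k]) simp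
  qed
qed

section \<open>Amalgamated free products\<close>

locale amalgam = unital_alg P for P :: "'p cstar_alg" +
  fixes A :: "'a cstar_alg" and B :: "'b cstar_alg" and C :: "'c cstar_alg"
    and phiA :: "'c \<Rightarrow> 'a" and phiB :: "'c \<Rightarrow> 'b" and psiA :: "'a \<Rightarrow> 'p" and psiB :: "'b \<Rightarrow> 'p"
  assumes A: "unital_cstar_alg A" and B: "unital_cstar_alg B" and C: "unital_cstar_alg C"
    and commA: "ca_commutative A" and commB: "ca_commutative B"
    and homA: "unital_star_hom C A phiA" and homB: "unital_star_hom C B phiB"
    and free_product: "is_amalg_free_product A B C phiA phiB P psiA psiB"
begin

lemma psiA: "unital_star_hom A P psiA" and psiB: "unital_star_hom B P psiB"
  using free_product by (simp_all add: is_amalg_free_product_def)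

lemma psi_agree: "c \<in> ca_carrier C \<Longrightarrow> psiA (phiA c) = psiB (phiB c)"
  using free_product by (simp add: is_amalg_free_product_def)

lemmas universal = free_product[unfolded is_amalg_free_product_def, THEN conjunct2, THEN conjunct2,
  THEN conjunct2, THEN conjunct2, rule_format]

lemma psi_in: "a \<in> ca_carrier A \<Longrightarrow> psiA a \<in> S" "b \<in> ca_carrier B \<Longrightarrow> psiB b \<in> S"
  using psiA psiB by (simp_all add: unital_star_hom_def star_hom_def)

lemma psiA_simps:
  "a \<in> ca_carrier A \<Longrightarrow> a' \<in> ca_carrier A \<Longrightarrow> psiA (ca_add A a a') = psiA a \<^bold>+ psiA a'"
  "a \<in> ca_carrier A \<Longrightarrow> a' \<in> ca_carrier A \<Longrightarrow> psiA (ca_mult A a a') = psiA a \<^bold>* psiA a'"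
  "a \<in> ca_carrier A \<Longrightarrow> psiA (ca_smult A c a) = c \<^bold>\<cdot> psiA a"
  "a \<in> ca_carrier A \<Longrightarrow> psiA (ca_star A a) = st (psiA a)"
  "psiA (ca_one A) = one"
  using psiA by (simp_all add: unital_star_hom_def star_hom_def)

lemma psiB_simps:
  "b \<in> ca_carrier B \<Longrightarrow> b' \<in> ca_carrier B \<Longrightarrow> psiB (ca_add B b b') = psiB b \<^bold>+ psiB b'"
  "b \<in> ca_carrier B \<Longrightarrow> b' \<in> ca_carrier B \<Longrightarrow> psiB (ca_mult B b b') = psiB b \<^bold>* psiB b'"
  "b \<in> ca_carrier B \<Longrightarrow> psiB (ca_smult B c b) = c \<^bold>\<cdot> psiB b"
  "b \<in> ca_carrier B \<Longrightarrow> psiB (ca_star B b) = st (psiB b)"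
  "psiB (ca_one B) = one"
  using psiB by (simp_all add: unital_star_hom_def star_hom_def)

lemma phi_in: "c \<in> ca_carrier C \<Longrightarrow> phiA c \<in> ca_carrier A" "c \<in> ca_carrier C \<Longrightarrow> phiB c \<in> ca_carrier B"
  using homA homB by (simp_all add: unital_star_hom_def star_hom_def)

lemma eq_of_nrm_diff:
  assumes "x \<in> S" "y \<in> S" "nrm (x \<^bold>- y) = 0" shows "x = y"
proof -
  have "x \<^bold>- y = zero" using D(23)[OF closed(7)[OF assms(1,2)]] assms(3) by simp
  moreover have "y \<^bold>+ (x \<^bold>- y) = x"
    using add_left_comm[OF assms(2) assms(1) D(4)[OF assms(2), of "-1"]] diff_self[OF cstar assms(2)] assms(1)
    by (simp add: ca_diff_def add_zero)
  ultimately show ?thesis using add_zero[OF assms(2)] by simp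
qed

text \<open>A closed \<open>*\<close>-subalgebra \<open>S0\<close> containing both images is a competitor in the universal
  property; by uniqueness the induced map \<open>P \<rightarrow> S0 \<subseteq> P\<close> is the identity.\<close>
lemma generated:
  assumes sub: "S0 \<subseteq> S" and z: "zero \<in> S0"
    and add: "\<And>x y. x \<in> S0 \<Longrightarrow> y \<in> S0 \<Longrightarrow> x \<^bold>+ y \<in> S0"
    and mul: "\<And>x y. x \<in> S0 \<Longrightarrow> y \<in> S0 \<Longrightarrow> x \<^bold>* y \<in> S0"
    and smu: "\<And>c x. x \<in> S0 \<Longrightarrow> c \<^bold>\<cdot> x \<in> S0"
    and star: "\<And>x. x \<in> S0 \<Longrightarrow> st x \<in> S0"
    and lim: "\<And>x. x \<in> S \<Longrightarrow> (\<And>e. e > 0 \<Longrightarrow> \<exists>d\<in>S0. nrm (x \<^bold>- d) < e) \<Longrightarrow> x \<in> S0"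
    and imA: "\<And>a. a \<in> ca_carrier A \<Longrightarrow> psiA a \<in> S0" and imB: "\<And>b. b \<in> ca_carrier B \<Longrightarrow> psiB b \<in> S0"
    and x: "x \<in> S"
  shows "x \<in> S0"
proof -
  \<comment> \<open>The operations of P on a smaller carrier. Q lives on the same type as P, so it
    is an admissible target of the universal property.\<close>
  define Q where "Q = P\<lparr>ca_carrier := S0\<rparr>"
  have s: "ca_carrier Q = S0" "ca_zero Q = zero" "ca_add Q = ca_add P" "ca_mult Q = ca_mult P" "ca_smult Q = ca_smult P"
    "ca_star Q = ca_star P" "ca_norm Q = ca_norm P" "ca_diff Q = ca_diff P"
    by (simp_all add: Q_def ca_diff_def fun_eq_iff)
  have i: "y \<in> S" if "y \<in> S0" for y using that sub by blast
  have cQ: "cstar_alg Q"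
  proof (rule cstar_algI, unfold s)
    fix g :: "nat \<Rightarrow> 'p" assume g: "\<forall>n. g n \<in> S0" and cau: "\<forall>e>0. \<exists>N. \<forall>m\<ge>N. \<forall>n\<ge>N. nrm (g m \<^bold>- g n) < e"
    have "\<exists>y\<in>S. \<forall>e>0. \<exists>N. \<forall>n\<ge>N. nrm (g n \<^bold>- y) < e"
      by (rule D(27)) (use g i cau in auto)
    then obtain y where y: "y \<in> S" "\<forall>e>0. \<exists>N. \<forall>n\<ge>N. nrm (g n \<^bold>- y) < e" by blast
    have "y \<in> S0"
    proof (rule lim[OF y(1)])
      fix e :: real assume "e > 0"
      then obtain N where "\<forall>n\<ge>N. nrm (g n \<^bold>- y) < e" using y(2) by blast
      then have "nrm (g N \<^bold>- y) < e" by simp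
      then have "nrm (y \<^bold>- g N) < e" using nrm_diff_commute[OF y(1) i[of "g N"]] g by simp
      then show "\<exists>d\<in>S0. nrm (y \<^bold>- d) < e" using g by blast
    qed
    with y(2) show "\<exists>x\<in>S0. \<forall>e>0. \<exists>N. \<forall>n\<ge>N. nrm (g n \<^bold>- x) < e" by blast
  next
    fix y assume y: "y \<in> S0"
    show "\<exists>w\<in>S0. y \<^bold>+ w = zero"
      by (rule bexI[OF _ smu[OF y, of "-1"]]) (use diff_self[OF cstar i[OF y]] in \<open>simp add: ca_diff_def\<close>)
  next
    fix c x y assume "x \<in> S0" "y \<in> S0"
    then show "c \<^bold>\<cdot> (x \<^bold>* y) = (c \<^bold>\<cdot> x) \<^bold>* y" "c \<^bold>\<cdot> (x \<^bold>* y) = x \<^bold>* (c \<^bold>\<cdot> y)" using D(17,18) i by simp_all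
  qed (use z in \<open>simp\<close>, (rule add mul smu star D(6-8,10-16,19-26,28); (assumption | rule i, assumption)+)+)
  have hA: "star_hom A Q psiA" and hB: "star_hom B Q psiB"
    using psiA psiB imA imB by (simp_all add: star_hom_def unital_star_hom_def s)
  obtain F where F: "star_hom P Q F" "\<forall>a\<in>ca_carrier A. F (psiA a) = psiA a" "\<forall>b\<in>ca_carrier B. F (psiB b) = psiB b"
    using universal[OF cQ hA hB psi_agree] by blast
  have F': "star_hom P P F" using F(1) i unfolding star_hom_def s by blast
  have id: "star_hom P P (\<lambda>x. x)" by (simp add: star_hom_def)
  have hA': "star_hom A P psiA" and hB': "star_hom B P psiB"
    using psiA psiB by (simp_all add: unital_star_hom_def)
  obtain G where G: "\<forall>\<Psi>. star_hom P P \<Psi> \<and> (\<forall>a\<in>ca_carrier A. \<Psi> (psiA a) = psiA a) \<and>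
     (\<forall>b\<in>ca_carrier B. \<Psi> (psiB b) = psiB b) \<longrightarrow> (\<forall>x\<in>S. \<Psi> x = G x)"
    using universal[OF cstar hA' hB' psi_agree] by blast
  have "F x = G x" using G F' F(2,3) x by blast
  moreover have "x = G x" using G[THEN spec, of "\<lambda>x. x"] id x by simp
  ultimately have "F x = x" by simp
  moreover have "F x \<in> S0" using F(1) x by (simp add: star_hom_def s)
  ultimately show ?thesis by simp
qed

text \<open>The commutant of the image of C is a closed subalgebra, stable under the involution
  because that image is. It contains the image of A by commutativity of A, and that of B because the
  image of C can be written through B as well.\<close>

lemma central_psi:
  assumes c: "c \<in> ca_carrier C" shows "central_in P (psiA (phiA c))"
proof -
  interpret C: unital_alg C using C by unfold_locales
  define z where "z c = psiA (phiA c)" for c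
  have z: "z c \<in> S" if "c \<in> ca_carrier C" for c using that phi_in psi_in by (simp add: z_def)
  have zs: "st (z c) = z (ca_star C c)" if "c \<in> ca_carrier C" for c
    using that homA by (simp add: z_def psiA_simps phi_in unital_star_hom_def star_hom_def)
  define S0 where "S0 = {y \<in> S. \<forall>c\<in>ca_carrier C. y \<^bold>* z c = z c \<^bold>* y}"
  have "y \<in> S0" if "y \<in> S" for y
  proof (rule generated[OF _ _ _ _ _ _ _ _ _ that])
    have "zero \<^bold>* w = w \<^bold>* zero" if "w \<in> S" for w
      using D(17)[OF D(1) that, of 0] D(18)[OF that D(1), of 0] smult_0[OF cstar] D(1) D(3) that by metis
    then show "zero \<in> S0" using D(1) z by (simp add: S0_def)
    show "x \<^bold>+ y \<in> S0" if "x \<in> S0" "y \<in> S0" for x y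
      using that z by (simp add: S0_def closed D(15,16))
    show "x \<^bold>* y \<in> S0" if xy: "x \<in> S0" "y \<in> S0" for x y
    proof -
      have "x \<^bold>* y \<^bold>* z c = z c \<^bold>* (x \<^bold>* y)" if c: "c \<in> ca_carrier C" for c
      proof -
        have "x \<^bold>* y \<^bold>* z c = x \<^bold>* (z c \<^bold>* y)" using xy c z[OF c] by (simp add: S0_def D(14))
        also have "\<dots> = (x \<^bold>* z c) \<^bold>* y" using xy z[OF c] by (simp add: S0_def D(14))
        also have "\<dots> = z c \<^bold>* (x \<^bold>* y)" using xy c z[OF c] by (simp add: S0_def D(14))
        finally show ?thesis .
      qed
      then show ?thesis using xy by (simp add: S0_def closed)
    qed
    show "k \<^bold>\<cdot> x \<in> S0" if "x \<in> S0" for k x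
      using that z by (simp add: S0_def closed D(17,18))
    show "st x \<in> S0" if x: "x \<in> S0" for x
    proof -
      have "st x \<^bold>* z c = z c \<^bold>* st x" if c: "c \<in> ca_carrier C" for c
      proof -
        have c': "ca_star C c \<in> ca_carrier C" using c by (rule C.closed)
        have zc: "z c = st (z (ca_star C c))" using zs[OF c'] C.D(19)[OF c] by simp
        have "st x \<^bold>* z c = st (z (ca_star C c) \<^bold>* x)" unfolding zc using x z[OF c'] by (simp add: S0_def D(22))
        also have "\<dots> = st (x \<^bold>* z (ca_star C c))" using x c' by (simp add: S0_def)
        also have "\<dots> = z c \<^bold>* st x" unfolding zc using x z[OF c'] by (simp add: S0_def D(22))
        finally show ?thesis .
      qed
      then show ?thesis using x by (simp add: S0_def closed)
    qed
    show "x \<in> S0" if x: "x \<in> S" and app: "\<And>e. e > 0 \<Longrightarrow> \<exists>d\<in>S0. nrm (x \<^bold>- d) < e" for x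
    proof -
      have "x \<^bold>* z c = z c \<^bold>* x" if c: "c \<in> ca_carrier C" for c
      proof (rule eq_of_nrm_diff)
        have "nrm (x \<^bold>* z c \<^bold>- z c \<^bold>* x) \<le> 0 + e" if e: "e > 0" for e
        proof -
          define r where "r = e / (2 * (nrm (z c) + 1))"
          have n: "nrm (z c) + 1 > 0" using nrm_nonneg[OF z[OF c]] by simp
          have r: "r > 0" using e n by (simp add: r_def)
          obtain d where d: "d \<in> S0" "nrm (x \<^bold>- d) < r" using app[OF r] by blast
          have dS: "d \<in> S" "d \<^bold>* z c = z c \<^bold>* d" using d(1) c by (simp_all add: S0_def)
          have "nrm (x \<^bold>* z c \<^bold>- z c \<^bold>* x) \<le> nrm (x \<^bold>* z c \<^bold>- d \<^bold>* z c) + nrm (d \<^bold>* z c \<^bold>- z c \<^bold>* x)"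
            using x dS(1) z[OF c] by (intro nrm_diff_triangle closed)
          also have "x \<^bold>* z c \<^bold>- d \<^bold>* z c = (x \<^bold>- d) \<^bold>* z c" using x dS(1) z[OF c] by (simp add: diff_mul)
          also have "d \<^bold>* z c \<^bold>- z c \<^bold>* x = z c \<^bold>* (d \<^bold>- x)" unfolding dS(2) using x dS(1) z[OF c] by (simp add: mul_diff)
          also have "nrm ((x \<^bold>- d) \<^bold>* z c) + nrm (z c \<^bold>* (d \<^bold>- x)) \<le> nrm (x \<^bold>- d) * nrm (z c) + nrm (z c) * nrm (d \<^bold>- x)"
            using x dS(1) z[OF c] by (intro add_mono D(26) closed)
          also have "\<dots> = 2 * (nrm (z c) * nrm (x \<^bold>- d))" using nrm_diff_commute[OF x dS(1)] by simp
          also have "\<dots> \<le> 2 * ((nrm (z c) + 1) * r)"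
            using d(2) nrm_nonneg[OF z[OF c]] nrm_nonneg[OF closed(7)[OF x dS(1)]] by (intro mult_left_mono mult_mono) auto
          also have "\<dots> = e"
          proof -
            have "2 * (m * (e / (2 * m))) = e" if "m > 0" for m :: real using that by simp
            from this[OF n] show ?thesis by (simp only: r_def)
          qed
          finally show ?thesis by simp
        qed
        then have "nrm (x \<^bold>* z c \<^bold>- z c \<^bold>* x) \<le> 0" by (rule field_le_epsilon)
        then show "nrm (x \<^bold>* z c \<^bold>- z c \<^bold>* x) = 0" 
          using nrm_nonneg[OF closed(7)[OF closed(3)[OF x z[OF c]] closed(3)[OF z[OF c] x]]] by simp
      qed (use x z[OF c] closed in auto)
      then show ?thesis using x by (simp add: S0_def)
    qed
    show "psiA a \<in> S0" if a: "a \<in> ca_carrier A" for a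
    proof -
      have "ca_mult A a (phiA c) = ca_mult A (phiA c) a" if "c \<in> ca_carrier C" for c
        using commA a phi_in(1)[OF that] unfolding ca_commutative_def by blast
      then have "psiA a \<^bold>* z c = z c \<^bold>* psiA a" if "c \<in> ca_carrier C" for c
        using that psiA_simps(2)[OF a phi_in(1)[OF that]] psiA_simps(2)[OF phi_in(1)[OF that] a] by (simp add: z_def)
      then show ?thesis using psi_in(1)[OF a] by (simp add: S0_def)
    qed
    show "psiB b \<in> S0" if b: "b \<in> ca_carrier B" for b
    proof -
      have "ca_mult B b (phiB c) = ca_mult B (phiB c) b" if "c \<in> ca_carrier C" for c
        using commB b phi_in(2)[OF that] unfolding ca_commutative_def by blast
      then have "psiB b \<^bold>* z c = z c \<^bold>* psiB b" if "c \<in> ca_carrier C" for c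
        using that psiB_simps(2)[OF b phi_in(2)[OF that]] psiB_simps(2)[OF phi_in(2)[OF that] b]
        by (simp add: z_def psi_agree)
      then show ?thesis using psi_in(2)[OF b] by (simp add: S0_def)
    qed
  qed (auto simp: S0_def)
  then show ?thesis using z[OF c] c by (simp add: S0_def central_in_def flip: z_def)
qed

text \<open>The matrix algebra is copied into the type of P, the two representations are extended by
  the universal property, and the result is decoded. A nonzero unit is what makes room for the
  copy.\<close>

lemma extend_rep:
  assumes ne: "one \<noteq> zero" and pA: "fd_rep A N piA" and pB: "fd_rep B N piB"
    and agree: "\<And>c. c \<in> ca_carrier C \<Longrightarrow> piA (phiA c) = piB (phiB c)"
  shows "\<exists>\<pi>. fd_rep P N \<pi> \<and> (\<forall>a\<in>ca_carrier A. \<pi> (psiA a) = piA a) \<and> (\<forall>b\<in>ca_carrier B. \<pi> (psiB b) = piB b)"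
proof -
  obtain e :: "complex mat \<Rightarrow> 'p" where e: "inj_on e (carrier_mat N N)" using exists_inj_mat[OF unital ne] by blast
  define Q where "Q = transport_alg e (mat_alg N)"
  have M: "ca_carrier (mat_alg N) = carrier_mat N N" "ca_add (mat_alg N) = (+)" "ca_mult (mat_alg N) = (*)"
    "ca_smult (mat_alg N) = (\<cdot>\<^sub>m)" "ca_star (mat_alg N) = mat_adjoint" by (simp_all add: mat_alg_def)
  have inj: "inj_on e (ca_carrier (mat_alg N))" using e by (simp add: M)
  have cQ: "cstar_alg Q" unfolding Q_def by (rule cstar_transport_alg[OF cstar_mat_alg inj])
  note s = transport_alg_sel[OF inj, folded Q_def, unfolded M]
  have hA: "star_hom A Q (e \<circ> piA)" using pA by (simp add: star_hom_def fd_rep_def s)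
  have hB: "star_hom B Q (e \<circ> piB)" using pB by (simp add: star_hom_def fd_rep_def s)
  obtain F where F: "star_hom P Q F" "\<forall>a\<in>ca_carrier A. F (psiA a) = (e \<circ> piA) a" "\<forall>b\<in>ca_carrier B. F (psiB b) = (e \<circ> piB) b"
    using universal[OF cQ hA hB] agree by (metis comp_apply)
  define \<pi> where "\<pi> x = inv_into (carrier_mat N N) e (F x)" for x
  have \<pi>: "\<pi> x \<in> carrier_mat N N \<and> F x = e (\<pi> x)" if "x \<in> S" for x
  proof -
    have "F x \<in> e ` carrier_mat N N" using F(1) that by (simp add: star_hom_def s)
    then show ?thesis by (simp add: \<pi>_def inv_into_into f_inv_into_f)
  qed
  have eqI: "\<pi> x = M" if "F x = e M" "M \<in> carrier_mat N N" for x M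
    using that e by (simp add: \<pi>_def)
  have "fd_rep P N \<pi>"
    unfolding fd_rep_def
  proof (intro conjI ballI allI)
    fix x assume x: "x \<in> S"
    show "\<pi> x \<in> carrier_mat N N" using \<pi>[OF x] by blast
    show "\<pi> (st x) = mat_adjoint (\<pi> x)"
      using F(1) x \<pi>[OF x] mat_adjoint_dim by (intro eqI) (auto simp: star_hom_def s)
    show "\<pi> (c \<^bold>\<cdot> x) = c \<cdot>\<^sub>m \<pi> x" for c
      using F(1) x \<pi>[OF x] by (intro eqI) (auto simp: star_hom_def s)
    fix y assume y: "y \<in> S"
    show "\<pi> (x \<^bold>+ y) = \<pi> x + \<pi> y" "\<pi> (x \<^bold>* y) = \<pi> x * \<pi> y"
      using F(1) x y \<pi>[OF x] \<pi>[OF y] by (auto intro!: eqI simp: star_hom_def s)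
  qed
  moreover have "\<pi> (psiA a) = piA a" if "a \<in> ca_carrier A" for a
    using that F(2) pA by (intro eqI) (auto simp: fd_rep_def)
  moreover have "\<pi> (psiB b) = piB b" if "b \<in> ca_carrier B" for b
    using that F(3) pB by (intro eqI) (auto simp: fd_rep_def)
  ultimately show ?thesis by blast
qed

text \<open>Dense countable subsets of A and B generate a countable family under sums, products,
  stars and multiples by complex rationals. Its closure is a closed *-subalgebra of P, and it
  contains both images since the structure maps are contractive.\<close>

lemma separable:
  assumes sA: "ca_separable A" and sB: "ca_separable B" shows "ca_separable P"
proof -
  interpret A: unital_alg A using A by unfold_locales
  interpret B: unital_alg B using B by unfold_locales
  obtain DA where DA: "DA \<subseteq> ca_carrier A" "countable DA" "\<forall>x\<in>ca_carrier A. \<forall>e>0. \<exists>d\<in>DA. ca_norm A (ca_diff A x d) < e"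
    using sA by (auto simp: ca_separable_def)
  obtain DB where DB: "DB \<subseteq> ca_carrier B" "countable DB" "\<forall>x\<in>ca_carrier B. \<forall>e>0. \<exists>d\<in>DB. ca_norm B (ca_diff B x d) < e"
    using sB by (auto simp: ca_separable_def)
  define Q where "Q = (\<lambda>(a, b). Complex a b) ` (\<rat> \<times> \<rat>)"
  have Qc: "countable Q" unfolding Q_def by (intro countable_image countable_SIGMA countable_rat)
  have Qd: "\<exists>q\<in>Q. cmod (c - q) < e" if e: "e > 0" for c e
  proof -
    obtain a where a: "a \<in> \<rat>" "Re c < a" "a < Re c + e / 2" using Rats_dense_in_real[of "Re c" "Re c + e / 2"] e by auto
    obtain b where b: "b \<in> \<rat>" "Im c < b" "b < Im c + e / 2" using Rats_dense_in_real[of "Im c" "Im c + e / 2"] e by auto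
    have "cmod (c - Complex a b) \<le> \<bar>Re c - a\<bar> + \<bar>Im c - b\<bar>" using cmod_le[of "c - Complex a b"] by simp
    also have "\<dots> < e" using a b by linarith
    finally show ?thesis using a(1) b(1) unfolding Q_def by force
  qed
  define step where "step X = X \<union> (\<lambda>(x, y). x \<^bold>+ y) ` (X \<times> X) \<union> (\<lambda>(x, y). x \<^bold>* y) ` (X \<times> X) \<union> st ` X
    \<union> (\<lambda>(q, x). q \<^bold>\<cdot> x) ` (Q \<times> X)" for X
  define E where "E = rec_nat (insert zero (psiA ` DA \<union> psiB ` DB)) (\<lambda>_::nat. step)"
  have E0: "E 0 = insert zero (psiA ` DA \<union> psiB ` DB)" and ES: "E (Suc n) = step (E n)" for n by (simp_all add: E_def)
  have Ec: "countable (E n)" for n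
    by (induction n) (auto simp: E0 ES step_def DA(2) DB(2) Qc)
  have Ein: "E n \<subseteq> S" for n
  proof (induction n)
    case 0 show ?case using DA(1) DB(1) psi_in D(1) by (auto simp: E0)
  next
    case (Suc n) then show ?case by (auto simp: ES step_def subset_iff closed)
  qed
  have Em: "E n \<subseteq> E (n + k)" for n k
    by (induction k) (auto simp: ES step_def)
  define D0 where "D0 = (\<Union>n. E n)"
  have D0c: "countable D0" and D0in: "D0 \<subseteq> S" using Ec Ein by (auto simp: D0_def)
  have common: "\<exists>n. x \<in> E n \<and> y \<in> E n" if xy: "x \<in> D0" "y \<in> D0" for x y
  proof -
    obtain m n where "x \<in> E m" "y \<in> E n" using xy by (auto simp: D0_def)
    then have "x \<in> E (m + n)" "y \<in> E (m + n)" using Em[of m n] Em[of n m] by (auto simp: add.commute)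
    then show ?thesis by blast
  qed
  have D0add: "x \<^bold>+ y \<in> D0" and D0mul: "x \<^bold>* y \<in> D0" if xy: "x \<in> D0" "y \<in> D0" for x y
  proof -
    obtain n where n: "x \<in> E n" "y \<in> E n" using common[OF xy] by blast
    then have "x \<^bold>+ y \<in> E (Suc n)" "x \<^bold>* y \<in> E (Suc n)" unfolding ES step_def by force+
    then show "x \<^bold>+ y \<in> D0" "x \<^bold>* y \<in> D0" unfolding D0_def by blast+
  qed
  have D0st: "st x \<in> D0" and D0smu: "q \<in> Q \<Longrightarrow> q \<^bold>\<cdot> x \<in> D0" if x: "x \<in> D0" for x q
  proof -
    obtain n where n: "x \<in> E n" using x by (auto simp: D0_def)
    then have "st x \<in> E (Suc n)" unfolding ES step_def by blast
    then show "st x \<in> D0" unfolding D0_def by blast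
    assume "q \<in> Q" with n have "q \<^bold>\<cdot> x \<in> E (Suc n)" unfolding ES step_def by force
    then show "q \<^bold>\<cdot> x \<in> D0" unfolding D0_def by blast
  qed
  have D00: "E 0 \<subseteq> D0" unfolding D0_def by blast
  define S0 where "S0 = {x \<in> S. \<forall>e>0. \<exists>d\<in>D0. nrm (x \<^bold>- d) < e}"
  have S0D: "\<exists>d\<in>D0. d \<in> S \<and> nrm (x \<^bold>- d) < e" if "x \<in> S0" "e > 0" for x e
    using that D0in unfolding S0_def by blast
  have dS0: "d \<in> S0" if "d \<in> D0" for d
  proof -
    have dS: "d \<in> S" using that D0in by blast
    then have "nrm (d \<^bold>- d) = 0" using diff_self[OF cstar dS] nrm_zero by simp
    then show ?thesis using dS that unfolding S0_def by force
  qed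
  have "x \<in> S0" if "x \<in> S" for x
  proof (rule generated[OF _ _ _ _ _ _ _ _ _ that])
    show "zero \<in> S0" using dS0 D00 E0 by blast
    show "x \<^bold>+ y \<in> S0" if xy: "x \<in> S0" "y \<in> S0" for x y
    proof -
      have xyS: "x \<in> S" "y \<in> S" using xy by (simp_all add: S0_def)
      have "\<exists>d\<in>D0. nrm ((x \<^bold>+ y) \<^bold>- d) < e" if e: "e > 0" for e
      proof -
        obtain a b where ab: "a \<in> D0" "a \<in> S" "nrm (x \<^bold>- a) < e / 2" "b \<in> D0" "b \<in> S" "nrm (y \<^bold>- b) < e / 2"
          using S0D[OF xy(1), of "e / 2"] S0D[OF xy(2), of "e / 2"] e by auto
        have "nrm ((x \<^bold>+ y) \<^bold>- (a \<^bold>+ b)) \<le> nrm (x \<^bold>- a) + nrm (y \<^bold>- b)"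
          using xyS ab by (simp add: add_diff_add D(24) closed)
        then show ?thesis using ab D0add by (intro bexI[of _ "a \<^bold>+ b"]) auto
      qed
      then show ?thesis using xyS closed by (simp add: S0_def)
    qed
    show "x \<^bold>* y \<in> S0" if xy: "x \<in> S0" "y \<in> S0" for x y
    proof -
      have xyS: "x \<in> S" "y \<in> S" using xy by (simp_all add: S0_def)
      have "\<exists>d\<in>D0. nrm ((x \<^bold>* y) \<^bold>- d) < e" if e: "e > 0" for e
      proof -
        \<comment> \<open>r \<le> 1 bounds the norm of a by that of x plus 1; the error of the
          product is then below r times the second denominator, hence below e.\<close>
        define r where "r = min 1 (e / (nrm x + nrm y + 2))"
        have n: "nrm x + nrm y + 2 > 0" using nrm_nonneg[OF xyS(1)] nrm_nonneg[OF xyS(2)] by simp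
        have "r \<le> e / (nrm x + nrm y + 2)" by (simp add: r_def)
        then have r3: "r * (nrm x + nrm y + 2) \<le> e" by (simp only: pos_le_divide_eq[OF n])
        have r: "r > 0" "r \<le> 1" "r * (nrm x + nrm y + 2) \<le> e"
          using divide_pos_pos[OF e n] r3 unfolding r_def by simp_all
        obtain a b where ab: "a \<in> D0" "a \<in> S" "nrm (x \<^bold>- a) < r" "b \<in> D0" "b \<in> S" "nrm (y \<^bold>- b) < r"
          using S0D[OF xy(1) r(1)] S0D[OF xy(2) r(1)] by auto
        have na: "nrm a \<le> nrm x + 1" using nrm_le_diff[OF xyS(1) ab(2)] ab(3) r(2) by simp
        have "nrm (x \<^bold>* y \<^bold>- a \<^bold>* b) \<le> nrm (x \<^bold>* y \<^bold>- a \<^bold>* y) + nrm (a \<^bold>* y \<^bold>- a \<^bold>* b)"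
          using xyS ab by (intro nrm_diff_triangle closed)
        also have "\<dots> = nrm ((x \<^bold>- a) \<^bold>* y) + nrm (a \<^bold>* (y \<^bold>- b))" using xyS ab by (simp add: diff_mul mul_diff)
        also have "\<dots> \<le> nrm (x \<^bold>- a) * nrm y + nrm a * nrm (y \<^bold>- b)" using xyS ab by (intro add_mono D(26) closed)
        also have "\<dots> \<le> r * nrm y + (nrm x + 1) * r"
          using ab na r nrm_nonneg xyS closed(7) by (intro add_mono mult_mono) (auto simp: add_nonneg_pos less_imp_le)
        also have "\<dots> < r * (nrm x + nrm y + 2)" using r(1) by (simp add: algebra_simps)
        also have "\<dots> \<le> e" by (rule r(3))
        finally show ?thesis using ab D0mul by (intro bexI[of _ "a \<^bold>* b"]) auto
      qed
      then show ?thesis using xyS closed by (simp add: S0_def)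
    qed
    show "c \<^bold>\<cdot> x \<in> S0" if x: "x \<in> S0" for c x
    proof -
      have xS: "x \<in> S" using x by (simp add: S0_def)
      have "\<exists>d\<in>D0. nrm (c \<^bold>\<cdot> x \<^bold>- d) < e" if e: "e > 0" for e
      proof -
        have "e / (2 * (cmod c + 1)) > 0" using e by (simp add: add_nonneg_pos)
        then obtain a where a: "a \<in> D0" "a \<in> S" "nrm (x \<^bold>- a) < e / (2 * (cmod c + 1))" using S0D[OF x] by blast
        have na: "nrm a + 1 > 0" using nrm_nonneg[OF a(2)] by simp
        then have "e / (2 * (nrm a + 1)) > 0" using e by simp
        then obtain q where q: "q \<in> Q" "cmod (c - q) < e / (2 * (nrm a + 1))" using Qd by blast
        have eq1: "c \<^bold>\<cdot> x \<^bold>- c \<^bold>\<cdot> a = c \<^bold>\<cdot> (x \<^bold>- a)"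
          using xS a D(12)[OF a(2), of "-1" c] D(12)[OF a(2), of c "-1"] by (simp add: ca_diff_def D(10) closed)
        have eq2: "c \<^bold>\<cdot> a \<^bold>- q \<^bold>\<cdot> a = (c - q) \<^bold>\<cdot> a"
          using D(11)[OF a(2), of c "- q"] D(12)[OF a(2), of "-1" q] by (simp add: ca_diff_def)
        have "nrm (c \<^bold>\<cdot> x \<^bold>- q \<^bold>\<cdot> a) \<le> nrm (c \<^bold>\<cdot> x \<^bold>- c \<^bold>\<cdot> a) + nrm (c \<^bold>\<cdot> a \<^bold>- q \<^bold>\<cdot> a)"
          using xS a by (intro nrm_diff_triangle closed)
        also have "\<dots> = cmod c * nrm (x \<^bold>- a) + cmod (c - q) * nrm a"
          unfolding eq1 eq2 using D(25)[OF closed(7)[OF xS a(2)]] D(25)[OF a(2)] by simp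
        also have "\<dots> < e"
        proof -
          have half: "m * k < e / 2" if "k < e / (2 * m)" "m > 0" for m k :: real
            using that by (simp add: pos_less_divide_eq mult_ac)
          have "cmod c * nrm (x \<^bold>- a) \<le> (cmod c + 1) * nrm (x \<^bold>- a)"
            using nrm_nonneg[OF closed(7)[OF xS a(2)]] by (intro mult_right_mono) auto
          also have "\<dots> < e / 2" by (rule half[OF a(3)]) (simp add: add_nonneg_pos)
          finally have 1: "cmod c * nrm (x \<^bold>- a) < e / 2" .
          have "cmod (c - q) * nrm a \<le> cmod (c - q) * (nrm a + 1)" by (intro mult_left_mono) auto
          also have "\<dots> < e / 2" using half[OF q(2) na] by (simp only: mult.commute)
          finally show ?thesis using 1 by simp
        qed
        finally show ?thesis using a(1) q(1) D0smu by (intro bexI[of _ "q \<^bold>\<cdot> a"]) auto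
      qed
      then show ?thesis using xS closed by (simp add: S0_def)
    qed
    show "st x \<in> S0" if x: "x \<in> S0" for x
    proof -
      have xS: "x \<in> S" using x by (simp add: S0_def)
      have "\<exists>d\<in>D0. nrm (st x \<^bold>- d) < e" if e: "e > 0" for e
      proof -
        obtain a where a: "a \<in> D0" "a \<in> S" "nrm (x \<^bold>- a) < e" using S0D[OF x e] by blast
        have "nrm (st x \<^bold>- st a) < e" using a xS nrm_star[OF closed(7)[OF xS a(2)]] by (simp add: star_diff)
        then show ?thesis using a D0st by blast
      qed
      then show ?thesis using xS closed by (simp add: S0_def)
    qed
    show "x \<in> S0" if x: "x \<in> S" and app: "\<And>e. e > 0 \<Longrightarrow> \<exists>d\<in>S0. nrm (x \<^bold>- d) < e" for x
    proof -
      have "\<exists>d\<in>D0. nrm (x \<^bold>- d) < e" if e: "e > 0" for e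
      proof -
        obtain y where y: "y \<in> S0" "nrm (x \<^bold>- y) < e / 2" using app[of "e / 2"] e by auto
        obtain d where d: "d \<in> D0" "d \<in> S" "nrm (y \<^bold>- d) < e / 2" using S0D[OF y(1), of "e / 2"] e by auto
        have "y \<in> S" using y by (simp add: S0_def)
        then have "nrm (x \<^bold>- d) < e" using nrm_diff_triangle[OF x _ d(2), of y] y d by simp
        then show ?thesis using d by blast
      qed
      then show ?thesis using x by (simp add: S0_def)
    qed
    have dA: "psiA (ca_diff A a d) = psiA a \<^bold>- psiA d" if "a \<in> ca_carrier A" "d \<in> ca_carrier A" for a d
      using that by (simp add: ca_diff_def psiA_simps A.closed)
    have dB: "psiB (ca_diff B a d) = psiB a \<^bold>- psiB d" if "a \<in> ca_carrier B" "d \<in> ca_carrier B" for a d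
      using that by (simp add: ca_diff_def psiB_simps B.closed)
    show "psiA a \<in> S0" if a: "a \<in> ca_carrier A" for a
    proof -
      have "\<exists>d\<in>D0. nrm (psiA a \<^bold>- d) < e" if e: "e > 0" for e
      proof -
        obtain d where d: "d \<in> DA" "ca_norm A (ca_diff A a d) < e" using DA(3) a e by blast
        have "d \<in> ca_carrier A" using d DA by blast
        then have "nrm (psiA a \<^bold>- psiA d) < e"
          using star_hom_contractive[OF A unital psiA A.closed(7)[OF a]] dA[OF a] d(2) by fastforce
        then show ?thesis using d(1) D00 E0 by blast
      qed
      then show ?thesis using psi_in(1)[OF a] by (simp add: S0_def)
    qed
    show "psiB a \<in> S0" if a: "a \<in> ca_carrier B" for a
    proof -
      have "\<exists>d\<in>D0. nrm (psiB a \<^bold>- d) < e" if e: "e > 0" for e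
      proof -
        obtain d where d: "d \<in> DB" "ca_norm B (ca_diff B a d) < e" using DB(3) a e by blast
        have "d \<in> ca_carrier B" using d DB by blast
        then have "nrm (psiB a \<^bold>- psiB d) < e"
          using star_hom_contractive[OF B unital psiB B.closed(7)[OF a]] dB[OF a] d(2) by fastforce
        then show ?thesis using d(1) D00 E0 by blast
      qed
      then show ?thesis using psi_in(2)[OF a] by (simp add: S0_def)
    qed
  qed (auto simp: S0_def)
  then show ?thesis unfolding ca_separable_def using D0c D0in unfolding S0_def by blast
qed

end

section \<open>Finite-dimensional models of a state\<close>

locale amalgam_state = amalgam P A B C phiA phiB psiA psiB + state P f
  for P :: "'p cstar_alg" and A :: "'a cstar_alg" and B :: "'b cstar_alg" and C :: "'c cstar_alg"
    and phiA phiB psiA psiB and f :: "'p \<Rightarrow> complex" +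
  assumes f_one: "f one = 1"
    and f_central: "\<And>c y. central_in P c \<Longrightarrow> y \<in> S \<Longrightarrow> f (c \<^bold>* y) = f c * f y"
    and nontrivial: "one \<noteq> zero"
begin

text \<open>A finite-dimensional model on \<open>\<complex>\<^sup>N\<close> of the GNS representation of \<open>f\<close>, restricted to the
  vectors in \<open>V\<close>: inner products are exact, matrix coefficients of \<open>FA\<close>, \<open>FB\<close> hold up to \<open>e\<close>.\<close>
definition model :: "'p set \<Rightarrow> 'a set \<Rightarrow> 'b set \<Rightarrow> real \<Rightarrow> nat \<Rightarrow> ('p \<Rightarrow> complex mat) \<Rightarrow> ('p \<Rightarrow> complex vec) \<Rightarrow> bool" where
  "model V FA FB e N \<pi> T \<longleftrightarrow> fd_rep P N \<pi> \<and> (\<forall>v\<in>V. T v \<in> carrier_vec N) \<and>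
     (\<forall>v\<in>V. \<forall>w\<in>V. cip (T v) (T w) = f (st w \<^bold>* v)) \<and>
     (\<forall>a\<in>FA. \<forall>v\<in>V. \<forall>w\<in>V. cmod (cip (\<pi> (psiA a) *\<^sub>v T v) (T w) - f (st w \<^bold>* (psiA a \<^bold>* v))) \<le> e) \<and>
     (\<forall>b\<in>FB. \<forall>v\<in>V. \<forall>w\<in>V. cmod (cip (\<pi> (psiB b) *\<^sub>v T v) (T w) - f (st w \<^bold>* (psiB b \<^bold>* v))) \<le> e)"

lemma exists_model:
  assumes V: "finite V" "V \<subseteq> S" and FA: "finite FA" "FA \<subseteq> ca_carrier A" and FB: "finite FB" "FB \<subseteq> ca_carrier B" and e: "e > 0"
  shows "\<exists>N \<pi> T. model V FA FB e N \<pi> T"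
proof -
  interpret A: unital_alg A using A by unfold_locales
  interpret B: unital_alg B using B by unfold_locales
  \<comment> \<open>The unit is added to V so that the kernel has a diagonal entry with positive
    mass.\<close>
  obtain vs where vs: "set vs = insert one V" using finite_list[of "insert one V"] V(1) by auto
  define n where "n = length vs"
  define v where "v k = vs ! k" for k
  have v: "v k \<in> S" if "k < n" for k
    using nth_mem[of k vs] that vs V(2) one_in by (auto simp: n_def v_def)
  have v1: "\<exists>k<n. v k = one" using vs unfolding n_def v_def by (metis in_set_conv_nth insertI1)
  have vV: "\<exists>k<n. v k = w" if "w \<in> V" for w using vs that unfolding n_def v_def by (metis in_set_conv_nth insertI2)
  have RA: "phiA ` ca_carrier C \<subseteq> ca_carrier A" and RB: "phiB ` ca_carrier C \<subseteq> ca_carrier B" using phi_in by auto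
  have cenA: "central_in P (psiA r)" if "r \<in> phiA ` ca_carrier C" for r using that central_psi by auto
  have cenB: "central_in P (psiB r)" if "r \<in> phiB ` ca_carrier C" for r using that central_psi psi_agree by force
  note kerA = kernel_on_hom[OF A psiA RA cenA f_central f_one v v1]
  note kerB = kernel_on_hom[OF B psiB RB cenB f_central f_one v v1]
  obtain mA :: nat where mA: "\<forall>N\<ge>mA. \<exists>x s. (\<forall>i. character_on A (x i) \<and> (\<forall>r\<in>phiA ` ca_carrier C. x i r = f (psiA r))) \<and>
     (\<forall>k<n. \<forall>l<n. (\<Sum>i<N. cnj (s i k) * s i l) = f (st (v k) \<^bold>* (psiA (ca_one A) \<^bold>* v l))) \<and>
     (\<forall>a\<in>FA. \<forall>k<n. \<forall>l<n. cmod ((\<Sum>i<N. cnj (s i k) * s i l * x i a) - f (st (v k) \<^bold>* (psiA a \<^bold>* v l))) \<le> e)"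
    using A.padded_dilation[OF commA RA FA e kerA] by (rule exE)
  obtain mB :: nat where mB: "\<forall>N\<ge>mB. \<exists>x s. (\<forall>i. character_on B (x i) \<and> (\<forall>r\<in>phiB ` ca_carrier C. x i r = f (psiB r))) \<and>
     (\<forall>k<n. \<forall>l<n. (\<Sum>i<N. cnj (s i k) * s i l) = f (st (v k) \<^bold>* (psiB (ca_one B) \<^bold>* v l))) \<and>
     (\<forall>a\<in>FB. \<forall>k<n. \<forall>l<n. cmod ((\<Sum>i<N. cnj (s i k) * s i l * x i a) - f (st (v k) \<^bold>* (psiB a \<^bold>* v l))) \<le> e)"
    using B.padded_dilation[OF commB RB FB e kerB] by (rule exE)
  define N where "N = max mA mB"
  have NA: "N \<ge> mA" and NB: "N \<ge> mB" by (simp_all add: N_def)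
  from mA[rule_format, OF NA] obtain xA sA where A1: "\<forall>i. character_on A (xA i) \<and> (\<forall>r\<in>phiA ` ca_carrier C. xA i r = f (psiA r))"
    and A2: "\<forall>k<n. \<forall>l<n. (\<Sum>i<N. cnj (sA i k) * sA i l) = f (st (v k) \<^bold>* (psiA (ca_one A) \<^bold>* v l))"
    and A3: "\<forall>a\<in>FA. \<forall>k<n. \<forall>l<n. cmod ((\<Sum>i<N. cnj (sA i k) * sA i l * xA i a) - f (st (v k) \<^bold>* (psiA a \<^bold>* v l))) \<le> e"
    by (elim exE conjE)
  from mB[rule_format, OF NB] obtain xB sB where B1: "\<forall>i. character_on B (xB i) \<and> (\<forall>r\<in>phiB ` ca_carrier C. xB i r = f (psiB r))"
    and B2: "\<forall>k<n. \<forall>l<n. (\<Sum>i<N. cnj (sB i k) * sB i l) = f (st (v k) \<^bold>* (psiB (ca_one B) \<^bold>* v l))"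
    and B3: "\<forall>a\<in>FB. \<forall>k<n. \<forall>l<n. cmod ((\<Sum>i<N. cnj (sB i k) * sB i l * xB i a) - f (st (v k) \<^bold>* (psiB a \<^bold>* v l))) \<le> e"
    by (elim exE conjE)
  define TA where "TA k = vec N (\<lambda>i. sA i k)" for k
  define TB where "TB k = vec N (\<lambda>i. sB i k)" for k
  have Tc: "TA k \<in> carrier_vec N" "TB k \<in> carrier_vec N" for k by (simp_all add: TA_def TB_def)
  have gramA: "cip (TA l) (TA k) = f (st (v k) \<^bold>* v l)" if kl: "k < n" "l < n" for k l
    using A2[rule_format, OF kl] v[OF kl(2)] by (simp add: cip_def TA_def psiA_simps one_mul mult.commute)
  have gramB: "cip (TB l) (TB k) = f (st (v k) \<^bold>* v l)" if kl: "k < n" "l < n" for k l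
    using B2[rule_format, OF kl] v[OF kl(2)] by (simp add: cip_def TB_def psiB_simps one_mul mult.commute)
  have "\<exists>U\<in>carrier_mat N N. (\<forall>v\<in>carrier_vec N. \<forall>w\<in>carrier_vec N. cip (U *\<^sub>v v) (U *\<^sub>v w) = cip v w) \<and>
      (\<forall>i<n. U *\<^sub>v TA i = TB i)"
    by (rule exists_isometry_of_gram) (simp_all add: Tc gramA gramB)
  then obtain U where U: "U \<in> carrier_mat N N" "\<forall>v\<in>carrier_vec N. \<forall>w\<in>carrier_vec N. cip (U *\<^sub>v v) (U *\<^sub>v w) = cip v w"
    "\<forall>i<n. U *\<^sub>v TA i = TB i" by blast
  have UU: "mat_adjoint U * U = 1\<^sub>m N" using isometry_unitary[OF U(1)] U(2) by simp
  note aU = mat_adjoint_dim[OF U(1)]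
  have UU': "U * mat_adjoint U = 1\<^sub>m N" by (rule mat_mult_left_right_inverse[OF aU U(1) UU])
  let ?DA = "diag_rep N xA" and ?DB = "diag_rep N xB"
  define piA where "piA a = U * ?DA a * mat_adjoint U" for a
  have DA: "fd_rep A N ?DA" by (rule A.fd_rep_diag) (use A1 in blast)
  have DB: "fd_rep B N ?DB" by (rule B.fd_rep_diag) (use B1 in blast)
  have piA: "fd_rep A N piA" unfolding piA_def by (rule A.fd_rep_conjugate[OF DA U(1) UU])
  have agree: "piA (phiA c) = ?DB (phiB c)" if c: "c \<in> ca_carrier C" for c
  proof -
    define z where "z = f (psiA (phiA c))"
    \<comment> \<open>Every character on either side extends the one that f induces on C, so both
      diagonal matrices are the same scalar matrix, which conjugation by U fixes.\<close>
    have "?DA (phiA c) = z \<cdot>\<^sub>m 1\<^sub>m N" using A1 c by (intro eq_matI) (auto simp: diag_rep_def z_def)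
    moreover have "?DB (phiB c) = z \<cdot>\<^sub>m 1\<^sub>m N" using B1 c by (intro eq_matI) (auto simp: diag_rep_def z_def psi_agree)
    moreover have "U * (z \<cdot>\<^sub>m 1\<^sub>m N) * mat_adjoint U = z \<cdot>\<^sub>m (U * mat_adjoint U)"
      using U(1) aU by (simp add: mult_smult_distrib[of _ N N _ N] mult_smult_assoc_mat[of _ N N _ N])
    ultimately show ?thesis by (simp add: piA_def UU')
  qed
  obtain \<pi> where pi: "fd_rep P N \<pi>" "\<forall>a\<in>ca_carrier A. \<pi> (psiA a) = piA a" "\<forall>b\<in>ca_carrier B. \<pi> (psiB b) = ?DB b"
    using extend_rep[OF nontrivial piA DB agree] by blast
  \<comment> \<open>V may be listed with repetitions; one index is fixed for each vector, and any
    would do because the inner products and coefficients involve only the vector at that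
    index.\<close>
  define idx where "idx w = (SOME k. k < n \<and> v k = w)" for w
  have idx: "idx w < n \<and> v (idx w) = w" if "w \<in> V" for w
    unfolding idx_def by (rule someI_ex) (use vV[OF that] in blast)
  define T where "T w = TB (idx w)" for w
  have coefA: "cip (piA a *\<^sub>v TB l) (TB k) = (\<Sum>i<N. cnj (sA i k) * sA i l * xA i a)" if kl: "k < n" "l < n" for a k l
  proof -
    have Dc: "?DA a \<in> carrier_mat N N" by (simp add: diag_rep_def)
    have UTA: "U *\<^sub>v TA k = TB k" "U *\<^sub>v TA l = TB l" using U(3) kl by blast+
    have "mat_adjoint U *\<^sub>v TB l = (mat_adjoint U * U) *\<^sub>v TA l"
      unfolding UTA(2)[symmetric] using aU U(1) Tc by simp
    then have adjT: "mat_adjoint U *\<^sub>v TB l = TA l" using UU Tc(1)[of l] by simp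
    have "piA a *\<^sub>v TB l = U *\<^sub>v (?DA a *\<^sub>v (mat_adjoint U *\<^sub>v TB l))"
      unfolding piA_def using U(1) aU Dc Tc by (simp add: assoc_mult_mat_vec[of _ N N _ N])
    then have "piA a *\<^sub>v TB l = U *\<^sub>v (?DA a *\<^sub>v TA l)" by (simp add: adjT)
    then have "cip (piA a *\<^sub>v TB l) (TB k) = cip (U *\<^sub>v (?DA a *\<^sub>v TA l)) (U *\<^sub>v TA k)" by (simp add: UTA(1))
    also have "\<dots> = cip (?DA a *\<^sub>v TA l) (TA k)" using U(2) Dc Tc by simp
    also have "\<dots> = (\<Sum>i<N. cnj (sA i k) * sA i l * xA i a)"
      by (simp add: diag_rep_mult_vec[OF Tc(1)] cip_def) (simp add: TA_def mult_ac)
    finally show ?thesis .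
  qed
  have coefB: "cip (?DB b *\<^sub>v TB l) (TB k) = (\<Sum>i<N. cnj (sB i k) * sB i l * xB i b)" for b k l
    by (simp add: diag_rep_mult_vec[OF Tc(2)] cip_def) (simp add: TB_def mult_ac)
  have "model V FA FB e N \<pi> T"
    unfolding model_def
  proof (intro conjI ballI pi(1))
    fix x assume "x \<in> V" show "T x \<in> carrier_vec N" by (simp add: T_def Tc)
  next
    fix x w assume xw: "x \<in> V" "w \<in> V"
    show "cip (T x) (T w) = f (st w \<^bold>* x)" using gramB[of "idx w" "idx x"] idx[OF xw(1)] idx[OF xw(2)] by (simp add: T_def)
  next
    fix a x w assume a: "a \<in> FA" and xw: "x \<in> V" "w \<in> V"
    have "cip (\<pi> (psiA a) *\<^sub>v T x) (T w) = (\<Sum>i<N. cnj (sA i (idx w)) * sA i (idx x) * xA i a)"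
      unfolding T_def using pi(2) a FA(2) coefA idx[OF xw(1)] idx[OF xw(2)] by auto
    then show "cmod (cip (\<pi> (psiA a) *\<^sub>v T x) (T w) - f (st w \<^bold>* (psiA a \<^bold>* x))) \<le> e"
      using A3[rule_format, OF a, of "idx w" "idx x"] idx[OF xw(1)] idx[OF xw(2)] by simp
  next
    fix b x w assume b: "b \<in> FB" and xw: "x \<in> V" "w \<in> V"
    have "cip (\<pi> (psiB b) *\<^sub>v T x) (T w) = (\<Sum>i<N. cnj (sB i (idx w)) * sB i (idx x) * xB i b)"
      unfolding T_def using pi(3) b FB(2) coefB by auto
    then show "cmod (cip (\<pi> (psiB b) *\<^sub>v T x) (T w) - f (st w \<^bold>* (psiB b \<^bold>* x))) \<le> e"
      using B3[rule_format, OF b, of "idx w" "idx x"] idx[OF xw(1)] idx[OF xw(2)] by simp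
  qed
  then show ?thesis by blast
qed

text \<open>"Eventually" along the directed system of models, ordered by more vectors, more elements
  and smaller e. It is closed under conjunction, and existence of models makes it proper
  (\<open>ev_witness\<close>); a limit along it stands for the GNS representation of f.\<close>

definition ev :: "(nat \<Rightarrow> ('p \<Rightarrow> complex mat) \<Rightarrow> ('p \<Rightarrow> complex vec) \<Rightarrow> bool) \<Rightarrow> bool" where
  "ev \<Phi> \<longleftrightarrow> (\<exists>V FA FB e. finite V \<and> V \<subseteq> S \<and> finite FA \<and> FA \<subseteq> ca_carrier A \<and> finite FB \<and> FB \<subseteq> ca_carrier B \<and> e > 0 \<and>
     (\<forall>N \<pi> T. model V FA FB e N \<pi> T \<longrightarrow> \<Phi> N \<pi> T))"

lemma evI:
  assumes "finite V" "V \<subseteq> S" "finite FA" "FA \<subseteq> ca_carrier A" "finite FB" "FB \<subseteq> ca_carrier B" "e > 0"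
    and "\<And>N \<pi> T. model V FA FB e N \<pi> T \<Longrightarrow> \<Phi> N \<pi> T"
  shows "ev \<Phi>"
  unfolding ev_def using assms by blast

lemma ev_mono: "ev \<Phi> \<Longrightarrow> (\<And>N \<pi> T. \<Phi> N \<pi> T \<Longrightarrow> \<Psi> N \<pi> T) \<Longrightarrow> ev \<Psi>"
  unfolding ev_def by meson

lemma model_mono:
  "model V FA FB e N \<pi> T \<Longrightarrow> V' \<subseteq> V \<Longrightarrow> FA' \<subseteq> FA \<Longrightarrow> FB' \<subseteq> FB \<Longrightarrow> e \<le> e' \<Longrightarrow> model V' FA' FB' e' N \<pi> T"
  unfolding model_def by (meson order_trans subsetD)

lemma ev_conj:
  assumes "ev \<Phi>" "ev \<Psi>" shows "ev (\<lambda>N \<pi> T. \<Phi> N \<pi> T \<and> \<Psi> N \<pi> T)"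
proof -
  obtain V FA FB e where 1: "finite V" "V \<subseteq> S" "finite FA" "FA \<subseteq> ca_carrier A" "finite FB" "FB \<subseteq> ca_carrier B" "e > 0"
    "\<forall>N \<pi> T. model V FA FB e N \<pi> T \<longrightarrow> \<Phi> N \<pi> T" using assms(1) unfolding ev_def by (elim exE conjE)
  obtain V' FA' FB' e' where 2: "finite V'" "V' \<subseteq> S" "finite FA'" "FA' \<subseteq> ca_carrier A" "finite FB'" "FB' \<subseteq> ca_carrier B" "e' > 0"
    "\<forall>N \<pi> T. model V' FA' FB' e' N \<pi> T \<longrightarrow> \<Psi> N \<pi> T" using assms(2) unfolding ev_def by (elim exE conjE)
  show ?thesis
  proof (rule evI[of "V \<union> V'" "FA \<union> FA'" "FB \<union> FB'" "min e e'"])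
    fix N \<pi> T assume m: "model (V \<union> V') (FA \<union> FA') (FB \<union> FB') (min e e') N \<pi> T"
    have "model V FA FB e N \<pi> T" by (rule model_mono[OF m]) auto
    moreover have "model V' FA' FB' e' N \<pi> T" by (rule model_mono[OF m]) auto
    ultimately show "\<Phi> N \<pi> T \<and> \<Psi> N \<pi> T" using 1(8) 2(8) by blast
  qed (use 1(1-7) 2(1-7) in auto)
qed

lemma ev_witness: "ev \<Phi> \<Longrightarrow> \<exists>N \<pi> T. \<Phi> N \<pi> T"
  using exists_model unfolding ev_def by metis

lemma ev_basic:
  assumes V: "finite V" "V \<subseteq> S"
  shows "ev (\<lambda>N \<pi> T. fd_rep P N \<pi> \<and> (\<forall>v\<in>V. T v \<in> carrier_vec N) \<and> (\<forall>v\<in>V. \<forall>w\<in>V. cip (T v) (T w) = f (st w \<^bold>* v)))"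
  by (rule evI[of V "{}" "{}" 1]) (use V in \<open>auto simp: model_def\<close>)

lemma vec_eq_0_of_cip:
  assumes "r \<in> carrier_vec N" "cip r r = 0" shows "r = 0\<^sub>v N"
  using assms vec_norm2_eq_0[OF assms(1)] by (simp add: cip_self)

text \<open>Exact inner products make T linear: the defect of linearity is orthogonal to the three
  vectors of which it is a combination, hence to itself.\<close>

lemma ev_lincomb:
  assumes x: "x \<in> S" and y: "y \<in> S"
  shows "ev (\<lambda>N \<pi> T. fd_rep P N \<pi> \<and> T x \<in> carrier_vec N \<and> T y \<in> carrier_vec N \<and> T (x \<^bold>+ c \<^bold>\<cdot> y) \<in> carrier_vec N \<and>
     T (x \<^bold>+ c \<^bold>\<cdot> y) = T x + c \<cdot>\<^sub>v T y)"
proof -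
  let ?s = "x \<^bold>+ c \<^bold>\<cdot> y"
  have s: "?s \<in> S" using x y by (intro closed)
  show ?thesis
  proof (rule ev_mono[OF ev_basic[of "{x, y, ?s}"]])
    show "finite {x, y, ?s}" "{x, y, ?s} \<subseteq> S" using x y s by auto
    fix N \<pi> T assume a: "fd_rep P N \<pi> \<and> (\<forall>v\<in>{x, y, ?s}. T v \<in> carrier_vec N) \<and>
      (\<forall>v\<in>{x, y, ?s}. \<forall>w\<in>{x, y, ?s}. cip (T v) (T w) = f (st w \<^bold>* v))"
    then have T: "T x \<in> carrier_vec N" "T y \<in> carrier_vec N" "T ?s \<in> carrier_vec N"
      and g: "\<And>v w. v \<in> {x, y, ?s} \<Longrightarrow> w \<in> {x, y, ?s} \<Longrightarrow> cip (T v) (T w) = f (st w \<^bold>* v)" by blast+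
    have cT: "c \<cdot>\<^sub>v T y \<in> carrier_vec N" using T by simp
    define r where "r = T ?s - (T x + c \<cdot>\<^sub>v T y)"
    have r: "r \<in> carrier_vec N" using T by (simp add: r_def)
    have z: "cip r (T w) = 0" if w: "w \<in> {x, y, ?s}" for w
    proof -
      have wS: "w \<in> S" using w x y s by blast
      have Tw: "T w \<in> carrier_vec N" using w T by blast
      have "cip r (T w) = cip (T ?s) (T w) - (cip (T x) (T w) + c * cip (T y) (T w))"
        unfolding r_def using cip_minus_left[OF T(3) _ Tw, of "T x + c \<cdot>\<^sub>v T y"] cip_add_left[OF T(1) cT Tw] cip_smult_left[OF T(2) Tw] T cT by simp
      also have "\<dots> = f (st w \<^bold>* ?s) - (f (st w \<^bold>* x) + c * f (st w \<^bold>* y))" using g w by simp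
      also have "\<dots> = 0" using wS x y by (simp add: D(15,18) closed f_add f_smu)
      finally show ?thesis .
    qed
    have zr: "cip (T w) r = 0" if "w \<in> {x, y, ?s}" for w
      using z[OF that] cip_cnj[OF r, of "T w"] that T by auto
    have "cip (T x + c \<cdot>\<^sub>v T y) r = 0" using cip_add_left[OF T(1) cT r] cip_smult_left[OF T(2) r] zr by simp
    then have "cip r r = 0" using cip_minus_left[OF T(3) _ r, of "T x + c \<cdot>\<^sub>v T y"] zr[of ?s] T by (simp add: r_def)
    from vec_eq_0_of_cip[OF r this] have r0: "r = 0\<^sub>v N" .
    have "T ?s = r + (T x + c \<cdot>\<^sub>v T y)" unfolding r_def using T by (intro eq_vecI) auto
    then have "T ?s = T x + c \<cdot>\<^sub>v T y" unfolding r0 using T by simp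
    then show "fd_rep P N \<pi> \<and> T x \<in> carrier_vec N \<and> T y \<in> carrier_vec N \<and> T ?s \<in> carrier_vec N \<and> T ?s = T x + c \<cdot>\<^sub>v T y"
      using a T by blast
  qed
qed

text \<open>Elements whose representing matrices converge strongly to left multiplication on the GNS
  vectors: for each v, the matrix of x nearly sends T v to T (x v) in all sufficiently fine
  models.\<close>

definition approximable :: "'p set" where
  "approximable = {x \<in> S. \<forall>v\<in>S. \<forall>d>0. ev (\<lambda>N \<pi> T. fd_rep P N \<pi> \<and> T v \<in> carrier_vec N \<and> T (x \<^bold>* v) \<in> carrier_vec N \<and>
     vec_norm2 (\<pi> x *\<^sub>v T v - T (x \<^bold>* v)) < d)}"

lemma approximableD:
  assumes "x \<in> approximable" "v \<in> S" "d > 0"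
  shows "ev (\<lambda>N \<pi> T. fd_rep P N \<pi> \<and> T v \<in> carrier_vec N \<and> T (x \<^bold>* v) \<in> carrier_vec N \<and> vec_norm2 (\<pi> x *\<^sub>v T v - T (x \<^bold>* v)) < d)"
  using assms by (simp add: approximable_def)

lemma vec_norm2_diff_triangle:
  assumes "u \<in> carrier_vec n" "v \<in> carrier_vec n" "w \<in> carrier_vec n"
  shows "vec_norm2 (u - w) \<le> vec_norm2 (u - v) + vec_norm2 (v - w)"
proof -
  have "u - w = (u - v) + (v - w)" using assms by (intro eq_vecI) auto
  then show ?thesis using vec_norm2_triangle[of "u - v" n "v - w"] assms by simp
qed

lemma approximable_of_coefficients:
  assumes a: "x \<in> S"
    and co: "\<And>v w d. v \<in> S \<Longrightarrow> w \<in> S \<Longrightarrow> d > 0 \<Longrightarrow> ev (\<lambda>N \<pi> T. cmod (cip (\<pi> x *\<^sub>v T v) (T w) - f (st w \<^bold>* (x \<^bold>* v))) \<le> d)"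
    and co2: "\<And>v w d. v \<in> S \<Longrightarrow> w \<in> S \<Longrightarrow> d > 0 \<Longrightarrow>
      ev (\<lambda>N \<pi> T. cmod (cip (\<pi> (st x \<^bold>* x) *\<^sub>v T v) (T w) - f (st w \<^bold>* ((st x \<^bold>* x) \<^bold>* v))) \<le> d)"
  shows "x \<in> approximable"
  unfolding approximable_def
proof (intro CollectI conjI ballI allI impI a)
  fix v and d :: real assume v: "v \<in> S" and d: "d > 0"
  let ?w = "x \<^bold>* v"
  have w: "?w \<in> S" using a v by (intro closed)
  define e where "e = d\<^sup>2 / 4"
  have e: "e > 0" using d by (simp add: e_def)
  show "ev (\<lambda>N \<pi> T. fd_rep P N \<pi> \<and> T v \<in> carrier_vec N \<and> T ?w \<in> carrier_vec N \<and> vec_norm2 (\<pi> x *\<^sub>v T v - T ?w) < d)"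
  proof (rule ev_mono[OF ev_conj[OF ev_basic[of "{v, ?w}"] ev_conj[OF co[OF v w e] co2[OF v v e]]]])
    show "finite {v, ?w}" "{v, ?w} \<subseteq> S" using v w by auto
    fix N \<pi> T
    assume h: "(fd_rep P N \<pi> \<and> (\<forall>y\<in>{v, ?w}. T y \<in> carrier_vec N) \<and> (\<forall>y\<in>{v, ?w}. \<forall>z\<in>{v, ?w}. cip (T y) (T z) = f (st z \<^bold>* y))) \<and>
      cmod (cip (\<pi> x *\<^sub>v T v) (T ?w) - f (st ?w \<^bold>* (x \<^bold>* v))) \<le> e \<and>
      cmod (cip (\<pi> (st x \<^bold>* x) *\<^sub>v T v) (T v) - f (st v \<^bold>* ((st x \<^bold>* x) \<^bold>* v))) \<le> e"
    then have pi: "fd_rep P N \<pi>" and T: "T v \<in> carrier_vec N" "T ?w \<in> carrier_vec N" and ww: "cip (T ?w) (T ?w) = f (st ?w \<^bold>* ?w)"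
      by blast+
    define s where "s = f (st ?w \<^bold>* ?w)"
    have sv: "f (st v \<^bold>* ((st x \<^bold>* x) \<^bold>* v)) = s" using star_mul_mul[OF v v a a] by (simp add: s_def)
    have u: "\<pi> x *\<^sub>v T v \<in> carrier_vec N" using fd_repD(1)[OF pi a] T by simp
    define p where "p = cip (\<pi> x *\<^sub>v T v) (T ?w)"
    define q where "q = cip (\<pi> x *\<^sub>v T v) (\<pi> x *\<^sub>v T v)"
    have hp: "cmod (p - s) \<le> e" using h by (simp add: p_def s_def)
    have hq: "cmod (q - s) \<le> e" using h fd_rep_cip[OF pi a a T(1) T(1)] by (simp add: q_def sv)
    let ?r = "\<pi> x *\<^sub>v T v - T ?w"
    have r: "?r \<in> carrier_vec N" using u T by simp
    have s_real: "cnj s = s" using pos[OF w] by (simp add: s_def complex_eq_iff)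
    have "cip ?r ?r = q - cnj p - (p - s)"
      unfolding cip_minus_left[OF u T(2) r] cip_minus_right[OF u T(2) u] cip_minus_right[OF u T(2) T(2)]
      using cip_cnj[OF u T(2)] ww by (simp add: p_def q_def s_def)
    also have "\<dots> = (q - s) - cnj (p - s) - (p - s)" by (simp add: s_real)
    finally have "cip ?r ?r = (q - s) - cnj (p - s) - (p - s)" .
    then have "cmod (cip ?r ?r) \<le> cmod (q - s) + cmod (cnj (p - s)) + cmod (p - s)"
      by (metis norm_triangle_ineq4 norm_triangle_le_diff add_right_mono order_trans)
    also have "\<dots> \<le> 3 * e" using hp hq by (simp only: complex_mod_cnj)
    also have "\<dots> < d\<^sup>2" using d by (simp add: e_def)
    finally have "(vec_norm2 ?r)\<^sup>2 < d\<^sup>2" by (simp add: cip_self norm_power)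
    then have "vec_norm2 ?r < d" using d by (intro power2_less_imp_less[of _ d]) auto
    then show "fd_rep P N \<pi> \<and> T v \<in> carrier_vec N \<and> T ?w \<in> carrier_vec N \<and> vec_norm2 ?r < d"
      using pi T by blast
  qed
qed

text \<open>For a in A the product of its star with a is again in A, so models can be asked to
  approximate the coefficients of both.\<close>

lemma approximable_psiA:
  assumes a: "a \<in> ca_carrier A" shows "psiA a \<in> approximable"
proof (rule approximable_of_coefficients)
  have co: "ev (\<lambda>N \<pi> T. cmod (cip (\<pi> (psiA b) *\<^sub>v T v) (T w) - f (st w \<^bold>* (psiA b \<^bold>* v))) \<le> d)"
    if "b \<in> ca_carrier A" "v \<in> S" "w \<in> S" "d > 0" for b v w d
    by (rule evI[of "{v, w}" "{b}" "{}" d]) (use that in \<open>auto simp: model_def\<close>)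
  have aa: "ca_mult A (ca_star A a) a \<in> ca_carrier A" "psiA (ca_mult A (ca_star A a) a) = st (psiA a) \<^bold>* psiA a"
  proof -
    interpret A: unital_alg A using A by unfold_locales
    show "ca_mult A (ca_star A a) a \<in> ca_carrier A" using a by (intro A.closed)
    show "psiA (ca_mult A (ca_star A a) a) = st (psiA a) \<^bold>* psiA a" using a by (simp add: psiA_simps A.closed)
  qed
  show "psiA a \<in> S" by (rule psi_in(1)[OF a])
  fix v w and d :: real assume vw: "v \<in> S" "w \<in> S" "d > 0"
  show "ev (\<lambda>N \<pi> T. cmod (cip (\<pi> (psiA a) *\<^sub>v T v) (T w) - f (st w \<^bold>* (psiA a \<^bold>* v))) \<le> d)" by (rule co[OF a vw])
  show "ev (\<lambda>N \<pi> T. cmod (cip (\<pi> (st (psiA a) \<^bold>* psiA a) *\<^sub>v T v) (T w) - f (st w \<^bold>* (st (psiA a) \<^bold>* psiA a \<^bold>* v))) \<le> d)"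
    using co[OF aa(1) vw] by (simp only: aa(2))
qed

lemma approximable_psiB:
  assumes b: "b \<in> ca_carrier B" shows "psiB b \<in> approximable"
proof (rule approximable_of_coefficients)
  have co: "ev (\<lambda>N \<pi> T. cmod (cip (\<pi> (psiB b) *\<^sub>v T v) (T w) - f (st w \<^bold>* (psiB b \<^bold>* v))) \<le> d)"
    if "b \<in> ca_carrier B" "v \<in> S" "w \<in> S" "d > 0" for b v w d
    by (rule evI[of "{v, w}" "{}" "{b}" d]) (use that in \<open>auto simp: model_def\<close>)
  have bb: "ca_mult B (ca_star B b) b \<in> ca_carrier B" "psiB (ca_mult B (ca_star B b) b) = st (psiB b) \<^bold>* psiB b"
  proof -
    interpret B: unital_alg B using B by unfold_locales
    show "ca_mult B (ca_star B b) b \<in> ca_carrier B" using b by (intro B.closed)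
    show "psiB (ca_mult B (ca_star B b) b) = st (psiB b) \<^bold>* psiB b" using b by (simp add: psiB_simps B.closed)
  qed
  show "psiB b \<in> S" by (rule psi_in(2)[OF b])
  fix v w and d :: real assume vw: "v \<in> S" "w \<in> S" "d > 0"
  show "ev (\<lambda>N \<pi> T. cmod (cip (\<pi> (psiB b) *\<^sub>v T v) (T w) - f (st w \<^bold>* (psiB b \<^bold>* v))) \<le> d)" by (rule co[OF b vw])
  show "ev (\<lambda>N \<pi> T. cmod (cip (\<pi> (st (psiB b) \<^bold>* psiB b) *\<^sub>v T v) (T w) - f (st w \<^bold>* (st (psiB b) \<^bold>* psiB b \<^bold>* v))) \<le> d)"
    using co[OF bb(1) vw] by (simp only: bb(2))
qed

lemma approximable_lincomb:
  assumes x: "x \<in> approximable" and y: "y \<in> approximable" shows "x \<^bold>+ c \<^bold>\<cdot> y \<in> approximable"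
proof -
  have xS: "x \<in> S" and yS: "y \<in> S" using x y by (simp_all add: approximable_def)
  let ?s = "x \<^bold>+ c \<^bold>\<cdot> y"
  have cy: "c \<^bold>\<cdot> y \<in> S" and s: "?s \<in> S" using xS yS by (auto intro!: closed)
  show ?thesis unfolding approximable_def
  proof (intro CollectI conjI ballI allI impI s)
    fix v and d :: real assume v: "v \<in> S" and d: "d > 0"
    have xv: "x \<^bold>* v \<in> S" and yv: "y \<^bold>* v \<in> S" using xS yS v by (auto intro!: closed)
    define e where "e = d / (2 * (cmod c + 1))"
    have c1: "cmod c + 1 > 0" by (simp add: add_nonneg_pos)
    have e: "e > 0" using d c1 by (simp add: e_def)
    have d2: "d / 2 > 0" using d by simp
    have sv: "?s \<^bold>* v = x \<^bold>* v \<^bold>+ c \<^bold>\<cdot> (y \<^bold>* v)" using D(16)[OF xS cy v] D(17)[OF yS v] by simp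
    show "ev (\<lambda>N \<pi> T. fd_rep P N \<pi> \<and> T v \<in> carrier_vec N \<and> T (?s \<^bold>* v) \<in> carrier_vec N \<and> vec_norm2 (\<pi> ?s *\<^sub>v T v - T (?s \<^bold>* v)) < d)"
    proof (rule ev_mono[OF ev_conj[OF ev_lincomb[OF xv yv, of c] ev_conj[OF approximableD[OF x v d2] approximableD[OF y v e]]]], elim conjE)
      fix N \<pi> T
      assume pi: "fd_rep P N \<pi>" and T: "T v \<in> carrier_vec N" "T (x \<^bold>* v) \<in> carrier_vec N" "T (y \<^bold>* v) \<in> carrier_vec N"
          "T (x \<^bold>* v \<^bold>+ c \<^bold>\<cdot> (y \<^bold>* v)) \<in> carrier_vec N"
        and eq: "T (x \<^bold>* v \<^bold>+ c \<^bold>\<cdot> (y \<^bold>* v)) = T (x \<^bold>* v) + c \<cdot>\<^sub>v T (y \<^bold>* v)"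
        and dx: "vec_norm2 (\<pi> x *\<^sub>v T v - T (x \<^bold>* v)) < d / 2" and dy: "vec_norm2 (\<pi> y *\<^sub>v T v - T (y \<^bold>* v)) < e"
      note R = fd_repD[OF pi]
      have px: "\<pi> x \<in> carrier_mat N N" and py: "\<pi> y \<in> carrier_mat N N" using R(1) xS yS by auto
      have "\<pi> ?s = \<pi> x + c \<cdot>\<^sub>m \<pi> y" using R(2)[OF xS cy] R(3)[OF yS] by simp
      then have "\<pi> ?s *\<^sub>v T v - T (?s \<^bold>* v) = (\<pi> x *\<^sub>v T v - T (x \<^bold>* v)) + c \<cdot>\<^sub>v (\<pi> y *\<^sub>v T v - T (y \<^bold>* v))"
        unfolding sv eq using px py T
        by (intro eq_vecI) (auto simp: add_scalar_prod_distrib[of _ N] algebra_simps)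
      then have "vec_norm2 (\<pi> ?s *\<^sub>v T v - T (?s \<^bold>* v)) \<le> vec_norm2 (\<pi> x *\<^sub>v T v - T (x \<^bold>* v)) + cmod c * vec_norm2 (\<pi> y *\<^sub>v T v - T (y \<^bold>* v))"
        using vec_norm2_triangle[of "\<pi> x *\<^sub>v T v - T (x \<^bold>* v)" N "c \<cdot>\<^sub>v (\<pi> y *\<^sub>v T v - T (y \<^bold>* v))"] px py T
        by (simp add: vec_norm2_smult)
      also have "\<dots> < d / 2 + d / 2"
      proof (rule add_less_le_mono[OF dx])
        have "cmod c * vec_norm2 (\<pi> y *\<^sub>v T v - T (y \<^bold>* v)) \<le> (cmod c + 1) * e"
          using dy by (intro mult_mono) auto
        also have "\<dots> = d / 2"
        proof -
          have "m * (d / (2 * m)) = d / 2" if "m > 0" for m :: real using that by simp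
          from this[OF c1] show ?thesis by (simp only: e_def)
        qed
        finally show "cmod c * vec_norm2 (\<pi> y *\<^sub>v T v - T (y \<^bold>* v)) \<le> d / 2" .
      qed
      finally have "vec_norm2 (\<pi> ?s *\<^sub>v T v - T (?s \<^bold>* v)) < d" by simp
      then show "fd_rep P N \<pi> \<and> T v \<in> carrier_vec N \<and> T (?s \<^bold>* v) \<in> carrier_vec N \<and> vec_norm2 (\<pi> ?s *\<^sub>v T v - T (?s \<^bold>* v)) < d"
        using pi T sv by simp
    qed
  qed
qed

text \<open>The error of y at v is transported by the matrix of x, which is contractive up to the
  norm of x, uniformly over all models; the error of x is then taken at the vector y v.\<close>

lemma approximable_mult:
  assumes x: "x \<in> approximable" and y: "y \<in> approximable" shows "x \<^bold>* y \<in> approximable"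
proof -
  have xS: "x \<in> S" and yS: "y \<in> S" using x y by (simp_all add: approximable_def)
  have xy: "x \<^bold>* y \<in> S" using xS yS by (intro closed)
  show ?thesis unfolding approximable_def
  proof (intro CollectI conjI ballI allI impI xy)
    fix v and d :: real assume v: "v \<in> S" and d: "d > 0"
    have yv: "y \<^bold>* v \<in> S" using yS v by (intro closed)
    define e where "e = d / (2 * (nrm x + 1))"
    have n1: "nrm x + 1 > 0" using nrm_nonneg[OF xS] by simp
    have e: "e > 0" using d n1 by (simp add: e_def)
    have d2: "d / 2 > 0" using d by simp
    have as: "x \<^bold>* y \<^bold>* v = x \<^bold>* (y \<^bold>* v)" by (rule D(14)[OF xS yS v])
    show "ev (\<lambda>N \<pi> T. fd_rep P N \<pi> \<and> T v \<in> carrier_vec N \<and> T (x \<^bold>* y \<^bold>* v) \<in> carrier_vec N \<and> vec_norm2 (\<pi> (x \<^bold>* y) *\<^sub>v T v - T (x \<^bold>* y \<^bold>* v)) < d)"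
    proof (rule ev_mono[OF ev_conj[OF approximableD[OF x yv d2] approximableD[OF y v e]]], elim conjE)
      fix N \<pi> T
      assume pi: "fd_rep P N \<pi>" and T: "T v \<in> carrier_vec N" "T (y \<^bold>* v) \<in> carrier_vec N" "T (x \<^bold>* (y \<^bold>* v)) \<in> carrier_vec N"
        and dx: "vec_norm2 (\<pi> x *\<^sub>v T (y \<^bold>* v) - T (x \<^bold>* (y \<^bold>* v))) < d / 2" and dy: "vec_norm2 (\<pi> y *\<^sub>v T v - T (y \<^bold>* v)) < e"
      note R = fd_repD[OF pi]
      have px: "\<pi> x \<in> carrier_mat N N" and py: "\<pi> y \<in> carrier_mat N N" using R(1) xS yS by auto
      have u: "\<pi> y *\<^sub>v T v \<in> carrier_vec N" using py T by simp
      have c: "\<pi> (x \<^bold>* y) *\<^sub>v T v \<in> carrier_vec N" "\<pi> x *\<^sub>v T (y \<^bold>* v) \<in> carrier_vec N" using R(1)[OF xy] px T by auto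
      have "\<pi> (x \<^bold>* y) *\<^sub>v T v - \<pi> x *\<^sub>v T (y \<^bold>* v) = \<pi> x *\<^sub>v (\<pi> y *\<^sub>v T v - T (y \<^bold>* v))"
        using px py T u by (simp add: R(4)[OF xS yS] mult_minus_distrib_mat_vec[of _ N N])
      then have "vec_norm2 (\<pi> (x \<^bold>* y) *\<^sub>v T v - \<pi> x *\<^sub>v T (y \<^bold>* v)) \<le> nrm x * vec_norm2 (\<pi> y *\<^sub>v T v - T (y \<^bold>* v))"
        using fd_rep_contractive[OF pi xS, of "\<pi> y *\<^sub>v T v - T (y \<^bold>* v)"] u T by simp
      also have "\<dots> \<le> (nrm x + 1) * e" using dy nrm_nonneg[OF xS] by (intro mult_mono) auto
      also have "\<dots> = d / 2"
      proof -
        have "m * (d / (2 * m)) = d / 2" if "m > 0" for m :: real using that by simp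
        from this[OF n1] show ?thesis by (simp only: e_def)
      qed
      finally have "vec_norm2 (\<pi> (x \<^bold>* y) *\<^sub>v T v - T (x \<^bold>* (y \<^bold>* v))) < d"
        using vec_norm2_diff_triangle[OF c T(3)] dx by simp
      then show "fd_rep P N \<pi> \<and> T v \<in> carrier_vec N \<and> T (x \<^bold>* y \<^bold>* v) \<in> carrier_vec N \<and> vec_norm2 (\<pi> (x \<^bold>* y) *\<^sub>v T v - T (x \<^bold>* y \<^bold>* v)) < d"
        using pi T as by simp
    qed
  qed
qed

text \<open>The norm of x - y bounds two defects uniformly in the model: that of the matrices, by
  \<open>fd_rep_contractive\<close>, and that of the vectors T (x v) and T (y v), by
  \<open>f_mult_bound\<close>. Together with the error of y these are the three shares d /
  3.\<close>

lemma approximable_closed: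
  assumes x: "x \<in> S" and app: "\<And>e. e > 0 \<Longrightarrow> \<exists>y\<in>approximable. nrm (x \<^bold>- y) < e" shows "x \<in> approximable"
  unfolding approximable_def
proof (intro CollectI conjI ballI allI impI x)
  fix v and d :: real assume v: "v \<in> S" and d: "d > 0"
  \<comment> \<open>A bound for the length of T v, valid in every model; the added 1 keeps K
    positive when that length is 0.\<close>
  define K where "K = sqrt (Re (f (st v \<^bold>* v))) + 1"
  have fv: "Im (f (st v \<^bold>* v)) = 0" "0 \<le> Re (f (st v \<^bold>* v))" using pos[OF v] by auto
  have K: "K > 0" using fv(2) by (simp add: K_def add_nonneg_pos)
  define e where "e = d / (3 * K)"
  have e: "e > 0" using d K by (simp add: e_def)
  obtain y where y: "y \<in> approximable" "nrm (x \<^bold>- y) < e" using app[OF e] by blast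
  have yS: "y \<in> S" using y by (simp add: approximable_def)
  let ?z = "x \<^bold>- y"
  have z: "?z \<in> S" using x yS by (intro closed)
  have xv: "x \<^bold>* v \<in> S" and yv: "y \<^bold>* v \<in> S" and zv: "?z \<^bold>* v \<in> S" using x yS v z by (auto intro!: closed)
  have zvd: "?z \<^bold>* v = x \<^bold>* v \<^bold>+ (-1) \<^bold>\<cdot> (y \<^bold>* v)" using diff_mul[OF x yS v] by (simp add: ca_diff_def)
  have d3: "d / 3 > 0" using d by simp
  have fin: "finite {v, ?z \<^bold>* v}" and sub: "{v, ?z \<^bold>* v} \<subseteq> S" using v zv by auto
  show "ev (\<lambda>N \<pi> T. fd_rep P N \<pi> \<and> T v \<in> carrier_vec N \<and> T (x \<^bold>* v) \<in> carrier_vec N \<and> vec_norm2 (\<pi> x *\<^sub>v T v - T (x \<^bold>* v)) < d)"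
  proof (rule ev_mono[OF ev_conj[OF ev_basic[OF fin sub] ev_conj[OF ev_lincomb[OF xv yv, of "-1", folded zvd] approximableD[OF y(1) v d3]]]], elim conjE)
    fix N \<pi> T
    assume pi: "fd_rep P N \<pi>" and T: "T v \<in> carrier_vec N" "T (x \<^bold>* v) \<in> carrier_vec N" "T (y \<^bold>* v) \<in> carrier_vec N"
      and g: "\<forall>u\<in>{v, ?z \<^bold>* v}. \<forall>w\<in>{v, ?z \<^bold>* v}. cip (T u) (T w) = f (st w \<^bold>* u)"
      and eq: "T (?z \<^bold>* v) = T (x \<^bold>* v) + (-1) \<cdot>\<^sub>v T (y \<^bold>* v)"
      and dy: "vec_norm2 (\<pi> y *\<^sub>v T v - T (y \<^bold>* v)) < d / 3"
    note R = fd_repD[OF pi]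
    have px: "\<pi> x \<in> carrier_mat N N" and py: "\<pi> y \<in> carrier_mat N N" using R(1) x yS by auto
    have c: "\<pi> x *\<^sub>v T v \<in> carrier_vec N" "\<pi> y *\<^sub>v T v \<in> carrier_vec N" using px py T by auto
    have g1: "cip (T v) (T v) = f (st v \<^bold>* v)" and g2: "cip (T (?z \<^bold>* v)) (T (?z \<^bold>* v)) = f (st (?z \<^bold>* v) \<^bold>* (?z \<^bold>* v))" using g by auto
    have Tv: "vec_norm2 (T v) \<le> K"
    proof -
      have "(vec_norm2 (T v))\<^sup>2 = Re (f (st v \<^bold>* v))" using g1 unfolding cip_self by (metis Re_complex_of_real)
      then have "vec_norm2 (T v) = sqrt (Re (f (st v \<^bold>* v)))" by (metis real_sqrt_unique vec_norm2_nonneg)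
      then show ?thesis by (simp add: K_def)
    qed
    have small: "nrm ?z * K \<le> d / 3"
    proof -
      have "nrm ?z * K \<le> e * K" using y(2) K by (intro mult_right_mono) auto
      also have "\<dots> = d / 3" using K by (simp add: e_def)
      finally show ?thesis .
    qed
    have "\<pi> ?z = \<pi> x + (-1) \<cdot>\<^sub>m \<pi> y" using R(2)[OF x D(4)[OF yS]] R(3)[OF yS] by (simp add: ca_diff_def)
    then have "\<pi> x *\<^sub>v T v - \<pi> y *\<^sub>v T v = \<pi> ?z *\<^sub>v T v"
      using px py T by (intro eq_vecI) (auto simp: add_scalar_prod_distrib[of _ N])
    then have "vec_norm2 (\<pi> x *\<^sub>v T v - \<pi> y *\<^sub>v T v) \<le> nrm ?z * vec_norm2 (T v)" using fd_rep_contractive[OF pi z T(1)] by simp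
    also have "\<dots> \<le> nrm ?z * K" using Tv nrm_nonneg[OF z] by (rule mult_left_mono)
    finally have 1: "vec_norm2 (\<pi> x *\<^sub>v T v - \<pi> y *\<^sub>v T v) \<le> d / 3" using small by simp
    have "(vec_norm2 (T (?z \<^bold>* v)))\<^sup>2 = Re (f (st (?z \<^bold>* v) \<^bold>* (?z \<^bold>* v)))" using g2 unfolding cip_self by (metis Re_complex_of_real)
    also have "\<dots> \<le> (nrm ?z)\<^sup>2 * Re (f (st v \<^bold>* v))" by (rule f_mult_bound[OF z v])
    also have "\<dots> = (nrm ?z)\<^sup>2 * (vec_norm2 (T v))\<^sup>2" using g1 unfolding cip_self by (metis Re_complex_of_real)
    also have "\<dots> \<le> (nrm ?z * K)\<^sup>2" unfolding power_mult_distrib using Tv by (intro mult_left_mono power_mono) auto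
    finally have "vec_norm2 (T (?z \<^bold>* v)) \<le> nrm ?z * K"
      by (rule power2_le_imp_le) (use nrm_nonneg[OF z] K in simp)
    moreover have "T (y \<^bold>* v) - T (x \<^bold>* v) = (-1) \<cdot>\<^sub>v T (?z \<^bold>* v)" unfolding eq using T by (intro eq_vecI) auto
    ultimately have 2: "vec_norm2 (T (y \<^bold>* v) - T (x \<^bold>* v)) \<le> d / 3" using small by (simp add: vec_norm2_smult)
    have "vec_norm2 (\<pi> x *\<^sub>v T v - T (x \<^bold>* v)) < d"
      using vec_norm2_diff_triangle[OF c(1,2) T(2)] vec_norm2_diff_triangle[OF c(2) T(3,2)] 1 2 dy by simp
    then show "fd_rep P N \<pi> \<and> T v \<in> carrier_vec N \<and> T (x \<^bold>* v) \<in> carrier_vec N \<and> vec_norm2 (\<pi> x *\<^sub>v T v - T (x \<^bold>* v)) < d"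
      using pi T by blast
  qed
qed

lemma zero_approximable: "zero \<in> approximable"
proof -
  interpret A: unital_alg A using A by unfold_locales
  have "psiA (ca_zero A) = ca_smult P 0 (psiA (ca_zero A))"
    using psiA_simps(3)[OF A.D(1), of 0] smult_0[OF A.cstar A.D(1)] by simp
  then have "psiA (ca_zero A) = zero" using smult_0[OF cstar psi_in(1)[OF A.D(1)]] by simp
  then show ?thesis using approximable_psiA[OF A.D(1)] by simp
qed

text \<open>Strong convergence is not visibly stable under the involution, so the generation
  argument is run for elements that are approximable together with their stars. The images of A and
  B qualify because A and B are closed under the involution.\<close>

lemma all_approximable:
  assumes x: "x \<in> S" shows "x \<in> approximable"
proof -
  have aS: "y \<in> S" if "y \<in> approximable" for y using that by (simp add: approximable_def)
  have add: "y \<^bold>+ z \<in> approximable" if "y \<in> approximable" "z \<in> approximable" for y z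
    using approximable_lincomb[OF that, of 1] D(13)[OF aS[OF that(2)]] by simp
  have smu: "c \<^bold>\<cdot> y \<in> approximable" if "y \<in> approximable" for y c
    using approximable_lincomb[OF zero_approximable that, of c] D(8)[OF D(4)[OF aS[OF that]]] by simp
  define S0 where "S0 = {y \<in> approximable. st y \<in> approximable}"
  have "x \<in> S0"
  proof (rule generated[OF _ _ _ _ _ _ _ _ _ x])
    show "S0 \<subseteq> S" using aS by (auto simp: S0_def)
    have "st zero = zero" using D(21)[OF D(1), of 0] smult_0[OF cstar] D(1,5) by simp
    then show "zero \<in> S0" using zero_approximable by (simp add: S0_def)
    show "y \<^bold>+ z \<in> S0" if "y \<in> S0" "z \<in> S0" for y z
      using that aS by (simp add: S0_def add D(20))
    show "y \<^bold>* z \<in> S0" if "y \<in> S0" "z \<in> S0" for y z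
      using that aS by (simp add: S0_def approximable_mult D(22))
    show "c \<^bold>\<cdot> y \<in> S0" if "y \<in> S0" for c y
      using that aS by (simp add: S0_def smu D(21))
    show "st y \<in> S0" if "y \<in> S0" for y using that aS by (simp add: S0_def D(19))
    show "y \<in> S0" if y: "y \<in> S" and app: "\<And>e. e > 0 \<Longrightarrow> \<exists>d\<in>S0. nrm (y \<^bold>- d) < e" for y
    proof -
      have "\<exists>d\<in>approximable. nrm (y \<^bold>- d) < e" if "e > 0" for e using app[OF that] by (auto simp: S0_def)
      moreover have "\<exists>d\<in>approximable. nrm (st y \<^bold>- d) < e" if e: "e > 0" for e
      proof -
        obtain d where d: "d \<in> S0" "nrm (y \<^bold>- d) < e" using app[OF e] by blast
        have dS: "d \<in> S" using d aS by (simp add: S0_def)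
        have "nrm (st y \<^bold>- st d) < e" using d(2) nrm_star[OF closed(7)[OF y dS]] star_diff[OF y dS] by simp
        then show ?thesis using d(1) by (auto simp: S0_def)
      qed
      ultimately show ?thesis using approximable_closed[OF y] approximable_closed[OF D(5)[OF y]] by (simp add: S0_def)
    qed
    interpret A: unital_alg A using A by unfold_locales
    interpret B: unital_alg B using B by unfold_locales
    show "psiA a \<in> S0" if "a \<in> ca_carrier A" for a
      using approximable_psiA[OF that] approximable_psiA[OF A.D(5)[OF that]] that by (simp add: S0_def psiA_simps)
    show "psiB b \<in> S0" if "b \<in> ca_carrier B" for b
      using approximable_psiB[OF that] approximable_psiB[OF B.D(5)[OF that]] that by (simp add: S0_def psiB_simps)
  qed
  then show ?thesis by (simp add: S0_def)
qed

text \<open>T one is a unit vector, and the matrix of x sends it close to T x, whose squared length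
  is exactly f (x^* x). The tolerance is the gap between that length and y.\<close>

lemma exists_rep_norm_gt:
  assumes x: "x \<in> S" and y: "0 \<le> y" "y\<^sup>2 < Re (f (st x \<^bold>* x))"
  shows "\<exists>N \<pi>. fd_rep P N \<pi> \<and> y < mat_opnorm (\<pi> x)"
proof -
  define t where "t = sqrt (Re (f (st x \<^bold>* x)))"
  have "y < t" unfolding t_def using y by (metis real_less_rsqrt)
  then have d: "t - y > 0" by simp
  have xo: "x \<^bold>* one = x" by (rule mul_one[OF x])
  have fin: "finite {one, x}" "{one, x} \<subseteq> S" using x one_in by auto
  obtain N \<pi> T where h: "(fd_rep P N \<pi> \<and> (\<forall>v\<in>{one, x}. T v \<in> carrier_vec N) \<and> (\<forall>v\<in>{one, x}. \<forall>w\<in>{one, x}. cip (T v) (T w) = f (st w \<^bold>* v))) \<and>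
     (fd_rep P N \<pi> \<and> T one \<in> carrier_vec N \<and> T (x \<^bold>* one) \<in> carrier_vec N \<and> vec_norm2 (\<pi> x *\<^sub>v T one - T (x \<^bold>* one)) < t - y)"
    using ev_witness[OF ev_conj[OF ev_basic[OF fin] approximableD[OF all_approximable[OF x] one_in d]]] by (elim exE)
  then have pi: "fd_rep P N \<pi>" and T: "T one \<in> carrier_vec N" "T x \<in> carrier_vec N"
    and g: "cip (T one) (T one) = f (st one \<^bold>* one)" "cip (T x) (T x) = f (st x \<^bold>* x)"
    and dist: "vec_norm2 (\<pi> x *\<^sub>v T one - T x) < t - y" by (auto simp: xo)
  have "(vec_norm2 (T one))\<^sup>2 = 1" using g(1) unfolding cip_self by (simp add: star_one one_mul one_in f_one flip: of_real_power)
  then have T1: "vec_norm2 (T one) = 1" using vec_norm2_nonneg[of "T one"] by (simp add: power2_eq_1_iff)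
  have "(vec_norm2 (T x))\<^sup>2 = Re (f (st x \<^bold>* x))" using g(2) unfolding cip_self by (metis Re_complex_of_real)
  then have Tx: "vec_norm2 (T x) = t" unfolding t_def by (metis real_sqrt_unique vec_norm2_nonneg)
  have px: "\<pi> x \<in> carrier_mat N N" using fd_repD(1)[OF pi x] .
  have u: "\<pi> x *\<^sub>v T one \<in> carrier_vec N" using px T by simp
  have "T x = (T x - \<pi> x *\<^sub>v T one) + \<pi> x *\<^sub>v T one" using T u px by (intro eq_vecI) auto
  then have "t \<le> vec_norm2 (T x - \<pi> x *\<^sub>v T one) + vec_norm2 (\<pi> x *\<^sub>v T one)"
    using vec_norm2_triangle[of "T x - \<pi> x *\<^sub>v T one" N "\<pi> x *\<^sub>v T one"] T u Tx by simp
  moreover have "T x - \<pi> x *\<^sub>v T one = (-1) \<cdot>\<^sub>v (\<pi> x *\<^sub>v T one - T x)" using T u px by (intro eq_vecI) auto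
  then have "vec_norm2 (T x - \<pi> x *\<^sub>v T one) < t - y" using dist by (simp add: vec_norm2_smult)
  moreover have "vec_norm2 (\<pi> x *\<^sub>v T one) \<le> mat_opnorm (\<pi> x)" using opnorm_upper[OF px T(1)] T1 by simp
  ultimately have "y < mat_opnorm (\<pi> x)" by simp
  then show ?thesis using pi by blast
qed

end

section \<open>Recovering the norm from finite-dimensional representations\<close>

context amalgam
begin

lemma exists_rep_norm_above:
  assumes x: "x \<in> S" and y: "0 \<le> y" "y < nrm x"
  shows "\<exists>N \<pi>. fd_rep P N \<pi> \<and> y < mat_opnorm (\<pi> x)"
proof -
  \<comment> \<open>A value strictly between y^2 and the squared norm of x; the state is asked for
    at least t, which still exceeds y^2.\<close>
  define t where "t = (y\<^sup>2 + (nrm x)\<^sup>2) / 2"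
  have "y\<^sup>2 < (nrm x)\<^sup>2" using y by (simp add: power_strict_mono)
  then have t: "0 \<le> t" "y\<^sup>2 < t" "t < (nrm x)\<^sup>2" by (simp_all add: t_def)
  obtain f where lin: "linear_on P f" and f1: "f one = 1"
    and fp: "\<forall>y\<in>S. Im (f (st y \<^bold>* y)) = 0 \<and> 0 \<le> Re (f (st y \<^bold>* y))" and ft: "t \<le> Re (f (st x \<^bold>* x))"
    and fc: "\<forall>c y. central_in P c \<longrightarrow> y \<in> S \<longrightarrow> f (c \<^bold>* y) = f c * f y"
    using exists_state_on[OF x t(1) t(3)] by (elim exE conjE)
  have ne: "one \<noteq> zero"
  proof
    assume "one = zero"
    then have "one = 0 \<^bold>\<cdot> one" using smult_0[OF cstar one_in] by simp
    then have "f one = 0 * f one" using lin one_in unfolding linear_on_def by metis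
    then show False using f1 by simp
  qed
  interpret amalgam_state P A B C phiA phiB psiA psiB f
    by unfold_locales (use lin f1 fp fc ne in auto)
  show ?thesis by (rule exists_rep_norm_gt[OF x y(1)]) (use t ft in simp)
qed

theorem residually_finite_dimensional:
  assumes "ca_separable A" "ca_separable B" shows "RFD P"
  unfolding RFD_def
proof (intro conjI ballI)
  show "ca_separable P" by (rule separable[OF assms])
  fix a assume a: "a \<in> S"
  let ?X = "{mat_opnorm (\<pi> a) |\<pi> n. fd_rep P n \<pi>}"
  \<comment> \<open>The zero-dimensional representation keeps the set of norms nonempty and its
    upper bounds nonnegative. This covers elements of norm 0, in particular the zero
    algebra.\<close>
  have z: "fd_rep P 0 (\<lambda>_. 0\<^sub>m 0 0)"
    unfolding fd_rep_def using mat_adjoint_dim[of "0\<^sub>m 0 0 :: complex mat" 0 0] by (auto intro!: eq_matI)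
  have up: "r \<le> nrm a" if r: "r \<in> ?X" for r
  proof -
    obtain \<pi> n where p: "r = mat_opnorm (\<pi> a)" "fd_rep P n \<pi>" using r by blast
    show ?thesis unfolding p(1)
      by (rule opnorm_le[OF fd_repD(1)[OF p(2) a] nrm_nonneg[OF a]]) (rule fd_rep_contractive[OF p(2) a])
  qed
  show "nrm a = Sup ?X"
  proof (rule cSup_eq_non_empty[symmetric])
    show "?X \<noteq> {}" using z by blast
    fix y assume y: "\<And>r. r \<in> ?X \<Longrightarrow> r \<le> y"
    have "mat_opnorm (0\<^sub>m 0 0 :: complex mat) \<in> ?X"
      by (intro CollectI exI[of _ "\<lambda>_. 0\<^sub>m 0 0"] exI[of _ 0] conjI refl z)
    then have y0: "0 \<le> y" using y opnorm_nonneg[of "0\<^sub>m 0 0 :: complex mat" 0] by fastforce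
    show "nrm a \<le> y"
    proof (rule ccontr)
      assume "\<not> nrm a \<le> y"
      then obtain N \<pi> where p: "fd_rep P N \<pi>" "y < mat_opnorm (\<pi> a)" using exists_rep_norm_above[OF a y0] by auto
      then have "mat_opnorm (\<pi> a) \<le> y" by (intro y) blast
      with p(2) show False by simp
    qed
  qed (rule up)
qed

end

theorem mainTheorem1:
  fixes A :: "'a cstar_alg" and B :: "'b cstar_alg" and C :: "'c cstar_alg"
    and phiA :: "'c \<Rightarrow> 'a" and phiB :: "'c \<Rightarrow> 'b"
    and P :: "'p cstar_alg" and psiA :: "'a \<Rightarrow> 'p" and psiB :: "'b \<Rightarrow> 'p"
  assumes "unital_cstar_alg A" "unital_cstar_alg B" "unital_cstar_alg C"
    and "ca_separable A" "ca_separable B" "ca_separable C"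
    and "ca_commutative A" "ca_commutative B" "ca_commutative C"
    and "unital_star_hom C A phiA" "inj_on phiA (ca_carrier C)"
    and "unital_star_hom C B phiB" "inj_on phiB (ca_carrier C)"
    and "is_amalg_free_product A B C phiA phiB P psiA psiB"
  shows "RFD P"
proof -
  have "unital_cstar_alg P" using assms(14) by (simp add: is_amalg_free_product_def)
  then interpret amalgam P A B C phiA phiB psiA psiB
    using assms by unfold_locales
  show ?thesis using assms(4,5) by (rule residually_finite_dimensional)
qed



end
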